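(* Let $\mathcal{S}$ be a symmetric free domain in $\mathbb{M}^2$. Assume that for all $w_1,w_2\in\mathcal{S}$: if $\pi(w_1)$ is similar to $\pi(w_2)$ (i.e. $\pi(w_1)=s^{-1}\pi(w_2)s$ for some invertible matrix $s$), then $w_1\oplus w_2\in\mathcal{S}$. Let $\mathcal{S}_o$, $\mathcal{S}_{oo}$, the Zariski-free manifold $\mathfrak{G}_{oo}$ and $\mathfrak{G}_o=\pi(\mathcal{S}_o)$ be as defined in the context. Then there are canonical bijections between the following five sets of graded functions: (i) symmetric conditionally nc functions $f$ that are freely holomorphic on $\mathcal{S}$; (ii) symmetric conditionally nc functions $f_o$ on $\mathcal{S}_o$ that are freely locally bounded on $\mathcal{S}$; (iii) symmetric Zariski-freely holomorphic functions $f_{oo}$ on $\mathcal{S}_{oo}$ that are conditionally nc and freely locally bounded on $\mathcal{S}$; (iv) holomorphic functions $F_{oo}$ on the Zariski-free manifold $\mathfrak{G}_{oo}$ that are conditionally nc and have the property that for every $w\in\mathcal{S}$ there is a free neighborhood $U$ of $w$ such that $F_{oo}$ is bounded on $\pi(U)\cap\mathfrak{G}_{oo}$; (v) graded functions $F_o$ on $\mathfrak{G}_o$ that are conditionally nc and have the property that for every $w\in\mathcal{S}$ there is a free neighborhood $U$ of $w$ such that $F_o$ is bounded on $\pi(U)\cap\mathfrak{G}_o$. Moreover, if $f,f_o,f_{oo},F_o,F_{oo}$ correspond under these bijections, then $f_o=f|_{\mathcal{S}_o}$, $f_{oo}=f_o|_{\mathcal{S}_{oo}}$, $F_{oo}=F_o|_{\mathfrak{G}_{oo}}$,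 $f_o=F_o\circ\pi$ on $\mathcal{S}_o$ and $f_{oo}=F_{oo}\circ\pi$ on $\mathcal{S}_{oo}$.
   Context: **Basics.** $\mathbb{M}_n$ is the algebra of $n\times n$ complex matrices, $\mathbb{M}^d=\bigcup_{n\ge1}\mathbb{M}_n^d$ (disjoint union), with points $x=(x^1,\dots,x^d)$. Direct sums $x\oplus y$ and similarities $s^{-1}xs$ are taken componentwise. An *nc-set* is a subset of $\mathbb{M}^d$ closed under direct sums. A function $f:D\to\mathbb{M}^1$, $D\subseteq\mathbb{M}^d$, is *graded* if $f(x)\in\mathbb{M}_n$ whenever $x\in D\cap\mathbb{M}_n^d$. An *nc-function* is a graded function $f$ on an nc-set $D$ such that $f(x\oplus y)=f(x)\oplus f(y)$ for $x,y\in D$, and $f(s^{-1}xs)=s^{-1}f(x)s$ whenever $x\in D\cap\mathbb{M}_n^d$, $s\in\mathbb{M}_n$ is invertible and $s^{-1}xs\in D$. Boundedness refers to operator norms of values, uniformly over all levels $n$. For $w=(w^1,w^2)\in\mathbb{M}^2$, $w^f=(w^2,w^1)$; a set is *symmetric* if it is invariant under $w\mapsto w^f$, and a function $f$ on a symmetric set is *symmetric* if $f(w^f)=f(w)$. **Topologies.** A set $D\subseteq\mathbb{M}^d$ is finitely open if $D\cap\mathbb{M}_n^d$ is open in $\mathbb{M}_n^d$ for every $n$. A topology on $\mathbb{M}^d$ is *admissible* if it has a basis of finitely open nc-sets. The *free topology* has as base the sets $B_\delta=\{x:\|[\delta_{ij}(x)]\|<1\}$, $\delta$ a (rectangular) matrix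 of free polynomials (polynomials over $\mathbb{C}$ in non-commuting variables); freely open sets are free domains. For an admissible topology $\tau$, a graded function $f$ on $D$ is *$\tau$-holomorphic* if $D\in\tau$, every $x\in D$ has a neighborhood $U\in\tau$, $U\subseteq D$, that is an nc-set on which $f$ is an nc-function, and every $x\in D$ has a $\tau$-neighborhood on which $f$ is bounded. One says freely (resp. Zariski-freely) holomorphic when $\tau$ is the free (resp. Zariski-free) topology. A *free variety* in a free domain $D$ is a set $\{x\in D: g(x)=0\ \forall g\in E\}$, $E$ a set of freely holomorphic functions on $D$. The *Zariski-free topology* has as base the sets $D\setminus T$, $D$ a free domain and $T$ a finite union of free varieties in $D$; it is admissible. A function $\phi$ defined on a subset $A\subseteq\mathcal{S}$ is *freely locally bounded on $\mathcal{S}$* if every $z\in\mathcal{S}$ (not only $z\in A$) has a free neighborhood $V$ such that $\phi$ is bounded on $V\cap A$. **Constructions.** $\pi:\mathbb{M}^2\to\mathbb{M}^3$ is $\pi(w^1,w^2)=(\tfrac12(w^1+w^2),\tfrac14(w^1-w^2)^2,\tfrac18(w^1-w^2)(w^1+w^2)(w^1-w^2))$. Let $\Gamma$ be the set of finite subsets of $\mathbb{C}\setminus\{0\}$. For each $\gamma\in\Gamma$ fix $r_\gamma>0$ with $r_\gamma<\min\{\min_{c\in\gamma}|c|,\ \tfrac14\min_{c\ne d\in\gamma}|c-d|\}$, let $\Delta_\gamma=\bigcup_{c\in\gamma}\{z:|z-c|<r_\gamma\}$, and fix a holomorphic branch $s_\gamma$ of $\sqrt z$ on $\Delta_\gamma$.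 For $\tau\in\{-1,1\}^\gamma$ let $\iota_{\gamma\tau}(z)=\tau(c)$ if $|z-c|<r_\gamma$, $c\in\gamma$. Let $D_\gamma=\{x\in\mathbb{M}^1:\sigma(x)\subseteq\Delta_\gamma\}$ and, via the holomorphic functional calculus, $I_{\gamma\tau}(x)=\iota_{\gamma\tau}(x)$ and $S_{\gamma\tau}(x)=s_\gamma(x)\iota_{\gamma\tau}(x)$ for $x\in D_\gamma$. Let $\mathcal{W}_\gamma=\{(u,x)\in\mathbb{M}^2:x\in D_\gamma\}$ and $\mathcal{U}_\gamma=\{(u,x)\in\mathcal{W}_\gamma:\ uI_{\gamma\tau}(x)\ne I_{\gamma\tau}(x)u$ for every nonconstant $\tau\in\{-1,1\}^\gamma\}$. Put $\omega_{\gamma\tau}(u,x)=(u+S_{\gamma\tau}(x),u-S_{\gamma\tau}(x))$ on $\mathcal{W}_\gamma$ and $\Phi_{\gamma\tau}(u,x)=(u,x,S_{\gamma\tau}(x)uS_{\gamma\tau}(x))$ on $\mathcal{U}_\gamma$. Unions below are over $\gamma\in\Gamma$, $\tau\in\{-1,1\}^\gamma$: $\mathcal{S}_o=\bigcup_{\gamma,\tau}(\omega_{\gamma\tau}(\mathcal{W}_\gamma)\cap\mathcal{S})$; $\mathcal{S}_{oo}=\bigcup_{\gamma,\tau}(\omega_{\gamma\tau}(\mathcal{U}_\gamma)\cap\mathcal{S})\subseteq\mathcal{S}_o$; $\mathcal{U}_{\gamma\tau}(\mathcal{S})=\{(u,x)\in\mathcal{U}_\gamma:\omega_{\gamma\tau}(u,x)\in\mathcal{S}\}$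 (Zariski-freely open); $\mathfrak{G}_{oo}=\bigcup_{\gamma,\tau}\Phi_{\gamma\tau}(\mathcal{U}_{\gamma\tau}(\mathcal{S}))=\pi(\mathcal{S}_{oo})\subseteq\mathbb{M}^3$. $\mathfrak{G}_{oo}$ is a Zariski-free manifold: its topology has as base the sets $\Phi_{\gamma\tau}(U)$, $U\subseteq\mathcal{U}_{\gamma\tau}(\mathcal{S})$ Zariski-freely open, and its charts are $\Phi_{\gamma\tau}^{-1}:\Phi_{\gamma\tau}(\mathcal{U}_{\gamma\tau}(\mathcal{S}))\to\mathcal{U}_{\gamma\tau}(\mathcal{S})$. A function $F:\mathfrak{G}_{oo}\to\mathbb{M}^1$ is *holomorphic* if $F\circ\Phi_{\gamma\tau}$ is Zariski-freely holomorphic on $\mathcal{U}_{\gamma\tau}(\mathcal{S})$ for all $\gamma,\tau$. **Conditionally nc.** A graded function $f$ on an arbitrary set $D\subseteq\mathbb{M}^d$ is *conditionally nc* if (i) $f(s^{-1}xs)=s^{-1}f(x)s$ whenever $x,s^{-1}xs\in D$, and (ii) there is a graded function $\hat f$ on $\hat D=\{y:\exists x\in D,\ x\oplus y\in D\}$ such that $f(x\oplus y)=f(x)\oplus\hat f(y)$ whenever $x\in D$ and $x\oplus y\in D$. *)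

theory Defs
  imports
    "HOL-Complex_Analysis.Complex_Residues"
    "HOL-Library.Poly_Mapping"
    "HOL-Library.FuncSet"
    "Jordan_Normal_Form.Spectral_Radius"
begin

section \<open>Matrices and tuples of matrices\<close>

text \<open>
  A point of the \<open>d\<close>-dimensional nc universe is a list of \<open>d\<close> square complex matrices of one
  common size, its level. Values of functions, i.e. points of the one-dimensional universe,
  are plain matrices.
\<close>

type_synonym nc_point = "complex mat list"

definition mat_inv :: "complex mat \<Rightarrow> complex mat" where
  "mat_inv A = (THE B. inverts_mat A B \<and> inverts_mat B A)"

definition mat_dsum :: "complex mat \<Rightarrow> complex mat \<Rightarrow> complex mat" where
  "mat_dsum A B =
     four_block_mat A (0\<^sub>m (dim_row A) (dim_col B)) (0\<^sub>m (dim_row B) (dim_col A)) B"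

definition euclid_norm :: "complex Matrix.vec \<Rightarrow> real" where
  "euclid_norm v = L2_set (\<lambda>i. cmod (vec_index v i)) {..<dim_vec v}"

definition op_norm :: "complex mat \<Rightarrow> real" where
  "op_norm A = (SUP v \<in> {v \<in> carrier_vec (dim_col A). euclid_norm v \<le> 1}. euclid_norm (A *\<^sub>v v))"

definition nc_space :: "nat \<Rightarrow> nc_point set" where
  "nc_space d = {x. length x = d \<and> (\<exists>n\<ge>1. set x \<subseteq> carrier_mat n n)}"

definition mlevel :: "nc_point \<Rightarrow> nat" where
  "mlevel x = dim_row (hd x)"

definition point_dsum :: "nc_point \<Rightarrow> nc_point \<Rightarrow> nc_point" where
  "point_dsum x y = map2 mat_dsum x y"

definition conj_mat :: "complex mat \<Rightarrow> complex mat \<Rightarrow> complex mat" where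
  "conj_mat s a = mat_inv s * a * s"

definition conj_point :: "complex mat \<Rightarrow> nc_point \<Rightarrow> nc_point" where
  "conj_point s x = map (conj_mat s) x"

definition GL :: "nat \<Rightarrow> complex mat set" where
  "GL n = {s \<in> carrier_mat n n. invertible_mat s}"

definition similar_points :: "nc_point \<Rightarrow> nc_point \<Rightarrow> bool" where
  "similar_points x y \<longleftrightarrow> (\<exists>s \<in> GL (mlevel y). x = conj_point s y)"

section \<open>Nc-functions\<close>

definition nc_set :: "nat \<Rightarrow> nc_point set \<Rightarrow> bool" where
  "nc_set d D \<longleftrightarrow> D \<subseteq> nc_space d \<and> (\<forall>x\<in>D. \<forall>y\<in>D. point_dsum x y \<in> D)"

definition graded :: "nc_point set \<Rightarrow> (nc_point \<Rightarrow> complex mat) \<Rightarrow> bool" where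
  "graded D f \<longleftrightarrow> (\<forall>x\<in>D. f x \<in> carrier_mat (mlevel x) (mlevel x))"

definition preserves_similarity :: "nc_point set \<Rightarrow> (nc_point \<Rightarrow> complex mat) \<Rightarrow> bool" where
  "preserves_similarity D f \<longleftrightarrow>
     (\<forall>x\<in>D. \<forall>s \<in> GL (mlevel x). conj_point s x \<in> D \<longrightarrow> f (conj_point s x) = conj_mat s (f x))"

definition nc_function :: "nat \<Rightarrow> nc_point set \<Rightarrow> (nc_point \<Rightarrow> complex mat) \<Rightarrow> bool" where
  "nc_function d D f \<longleftrightarrow>
     nc_set d D \<and> graded D f \<and>
     (\<forall>x\<in>D. \<forall>y\<in>D. f (point_dsum x y) = mat_dsum (f x) (f y)) \<and>
     preserves_similarity D f"

definition conditionally_nc :: "nat \<Rightarrow> nc_point set \<Rightarrow> (nc_point \<Rightarrow> complex mat) \<Rightarrow> bool" where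
  "conditionally_nc d D f \<longleftrightarrow>
     D \<subseteq> nc_space d \<and> graded D f \<and> preserves_similarity D f \<and>
     (\<exists>f'. graded {y \<in> nc_space d. \<exists>x\<in>D. point_dsum x y \<in> D} f' \<and>
        (\<forall>x\<in>D. \<forall>y \<in> nc_space d. point_dsum x y \<in> D \<longrightarrow> f (point_dsum x y) = mat_dsum (f x) (f' y)))"

definition bounded_values_on :: "nc_point set \<Rightarrow> (nc_point \<Rightarrow> complex mat) \<Rightarrow> bool" where
  "bounded_values_on A f \<longleftrightarrow> (\<exists>C. \<forall>x\<in>A. op_norm (f x) \<le> C)"

definition flip :: "nc_point \<Rightarrow> nc_point" where
  "flip w = [w ! 1, w ! 0]"

definition symmetric_set :: "nc_point set \<Rightarrow> bool" where
  "symmetric_set D \<longleftrightarrow> (\<forall>w\<in>D. flip w \<in> D)"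

definition symmetric_fun :: "nc_point set \<Rightarrow> (nc_point \<Rightarrow> complex mat) \<Rightarrow> bool" where
  "symmetric_fun D f \<longleftrightarrow> symmetric_set D \<and> (\<forall>w\<in>D. f (flip w) = f w)"

section \<open>The free topology\<close>

text \<open>
  A free polynomial is a finitely supported family of complex coefficients indexed by words;
  the variables are numbered from 0.
\<close>

type_synonym free_poly = "nat list \<Rightarrow>\<^sub>0 complex"

definition free_poly_in :: "nat \<Rightarrow> free_poly \<Rightarrow> bool" where
  "free_poly_in d p \<longleftrightarrow> (\<forall>w \<in> Poly_Mapping.keys p. set w \<subseteq> {..<d})"

definition eval_word :: "nat list \<Rightarrow> nc_point \<Rightarrow> complex mat" where
  "eval_word w x = foldr (\<lambda>i a. x ! i * a) w (1\<^sub>m (mlevel x))"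

definition eval_poly :: "free_poly \<Rightarrow> nc_point \<Rightarrow> complex mat" where
  "eval_poly p x = Matrix.mat (mlevel x) (mlevel x)
     (\<lambda>ij. \<Sum>w\<in>Poly_Mapping.keys p. Poly_Mapping.lookup p w * eval_word w x $$ ij)"

text \<open>The block matrix whose block in position \<open>(i, j)\<close> is \<open>\<delta>\<^sub>i\<^sub>j(x)\<close>.\<close>

definition eval_poly_mat :: "free_poly mat \<Rightarrow> nc_point \<Rightarrow> complex mat" where
  "eval_poly_mat \<delta> x = (let n = mlevel x in
     Matrix.mat (dim_row \<delta> * n) (dim_col \<delta> * n)
       (\<lambda>(i, j). eval_poly (\<delta> $$ (i div n, j div n)) x $$ (i mod n, j mod n)))"

definition basic_free_set :: "nat \<Rightarrow> free_poly mat \<Rightarrow> nc_point set" where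
  "basic_free_set d \<delta> = {x \<in> nc_space d. op_norm (eval_poly_mat \<delta> x) < 1}"

text \<open>
  The generating families of this topology and of the Zariski-free topology below are closed
  under finite intersections and cover the space, so they are bases of the generated topologies.
\<close>

definition free_topology :: "nat \<Rightarrow> nc_point topology" where
  "free_topology d =
     topology_generated_by (basic_free_set d ` {\<delta>. \<forall>p \<in> elements_mat \<delta>. free_poly_in d p})"

text \<open>The clauses of \<open>\<tau>\<close>-holomorphy for an admissible topology \<open>\<tau>\<close> on \<open>nc_space d\<close>.\<close>

definition tau_holomorphic ::
    "nc_point topology \<Rightarrow> nat \<Rightarrow> nc_point set \<Rightarrow> (nc_point \<Rightarrow> complex mat) \<Rightarrow> bool" where
  "tau_holomorphic \<tau> d D f \<longleftrightarrow>
     openin \<tau> D \<and> graded D f \<and>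
     (\<forall>x\<in>D. \<exists>U. openin \<tau> U \<and> x \<in> U \<and> U \<subseteq> D \<and> nc_function d U f) \<and>
     (\<forall>x\<in>D. \<exists>U. openin \<tau> U \<and> x \<in> U \<and> U \<subseteq> D \<and> bounded_values_on U f)"

definition free_domain :: "nat \<Rightarrow> nc_point set \<Rightarrow> bool" where
  "free_domain d D \<longleftrightarrow> openin (free_topology d) D"

definition freely_holomorphic ::
    "nat \<Rightarrow> nc_point set \<Rightarrow> (nc_point \<Rightarrow> complex mat) \<Rightarrow> bool" where
  "freely_holomorphic d D f \<longleftrightarrow> tau_holomorphic (free_topology d) d D f"

definition freely_locally_bounded_on ::
    "nat \<Rightarrow> nc_point set \<Rightarrow> nc_point set \<Rightarrow> (nc_point \<Rightarrow> complex mat) \<Rightarrow> bool" where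
  "freely_locally_bounded_on d S A f \<longleftrightarrow>
     (\<forall>z\<in>S. \<exists>V. openin (free_topology d) V \<and> z \<in> V \<and> bounded_values_on (V \<inter> A) f)"

section \<open>The Zariski-free topology\<close>

definition free_variety :: "nat \<Rightarrow> nc_point set \<Rightarrow> nc_point set \<Rightarrow> bool" where
  "free_variety d D T \<longleftrightarrow>
     (\<exists>E. (\<forall>g\<in>E. freely_holomorphic d D g) \<and>
          T = {x \<in> D. \<forall>g\<in>E. g x = 0\<^sub>m (mlevel x) (mlevel x)})"

definition zariski_free_topology :: "nat \<Rightarrow> nc_point topology" where
  "zariski_free_topology d = topology_generated_by
     {D - \<Union>\<T> | D \<T>. free_domain d D \<and> finite \<T> \<and> (\<forall>T\<in>\<T>. free_variety d D T)}"

definition zariski_freely_holomorphic ::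
    "nat \<Rightarrow> nc_point set \<Rightarrow> (nc_point \<Rightarrow> complex mat) \<Rightarrow> bool" where
  "zariski_freely_holomorphic d D f \<longleftrightarrow> tau_holomorphic (zariski_free_topology d) d D f"

section \<open>Holomorphic functional calculus\<close>

text \<open>
  The Riesz-Dunford integral of \<open>f(z) (z - x)\<inverse> / (2 \<pi> \<i>)\<close>, taken entrywise. The contour
  consists of sufficiently small circles about the eigenvalues of \<open>x\<close>, and \<open>residue\<close> is
  by definition the integral over one such circle divided by \<open>2 \<pi> \<i>\<close>. It is meaningful if
  \<open>f\<close> is holomorphic on a neighbourhood of the spectrum.
\<close>

definition hol_calculus :: "(complex \<Rightarrow> complex) \<Rightarrow> complex mat \<Rightarrow> complex mat" where
  "hol_calculus f x = Matrix.mat (dim_row x) (dim_row x)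
     (\<lambda>ij. \<Sum>e\<in>spectrum x.
        residue (\<lambda>z. f z * mat_inv (z \<cdot>\<^sub>m 1\<^sub>m (dim_row x) - x) $$ ij) e)"

section \<open>The map \<open>\<pi>\<close> and its local inverses\<close>

definition pi_map :: "nc_point \<Rightarrow> nc_point" where
  "pi_map w = (let a = w ! 0; b = w ! 1 in
     [(1/2) \<cdot>\<^sub>m (a + b),
      (1/4) \<cdot>\<^sub>m ((a - b) * (a - b)),
      (1/8) \<cdot>\<^sub>m ((a - b) * (a + b) * (a - b))])"

definition Gamma :: "complex set set" where
  "Gamma = {\<gamma>. finite \<gamma> \<and> \<gamma> \<subseteq> - {0}}"

definition Delta :: "(complex set \<Rightarrow> real) \<Rightarrow> complex set \<Rightarrow> complex set" where
  "Delta r \<gamma> = (\<Union>c\<in>\<gamma>. {z. cmod (z - c) < r \<gamma>})"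

text \<open>
  A choice of radii \<open>r \<gamma>\<close> and of branches \<open>q \<gamma>\<close> of the square root. The bounds on the radius
  are stated elementwise, so that they are vacuous where the corresponding minimum is over the
  empty set.
\<close>

definition sqrt_choice ::
    "(complex set \<Rightarrow> real) \<Rightarrow> (complex set \<Rightarrow> complex \<Rightarrow> complex) \<Rightarrow> bool" where
  "sqrt_choice r q \<longleftrightarrow> (\<forall>\<gamma>\<in>Gamma.
     r \<gamma> > 0 \<and> (\<forall>c\<in>\<gamma>. r \<gamma> < cmod c) \<and>
     (\<forall>c\<in>\<gamma>. \<forall>d\<in>\<gamma>. c \<noteq> d \<longrightarrow> r \<gamma> < (1/4) * cmod (c - d)) \<and>
     q \<gamma> holomorphic_on Delta r \<gamma> \<and> (\<forall>z \<in> Delta r \<gamma>. (q \<gamma> z)\<^sup>2 = z))"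

definition signs :: "complex set \<Rightarrow> (complex \<Rightarrow> complex) set" where
  "signs \<gamma> = \<gamma> \<rightarrow>\<^sub>E {-1, 1}"

definition iota ::
    "(complex set \<Rightarrow> real) \<Rightarrow> complex set \<Rightarrow> (complex \<Rightarrow> complex) \<Rightarrow> complex \<Rightarrow> complex" where
  "iota r \<gamma> \<tau> z = \<tau> (THE c. c \<in> \<gamma> \<and> cmod (z - c) < r \<gamma>)"

definition D_dom :: "(complex set \<Rightarrow> real) \<Rightarrow> complex set \<Rightarrow> complex mat set" where
  "D_dom r \<gamma> = {x. (\<exists>n\<ge>1. x \<in> carrier_mat n n) \<and> spectrum x \<subseteq> Delta r \<gamma>}"

definition I_fun ::
    "(complex set \<Rightarrow> real) \<Rightarrow> complex set \<Rightarrow> (complex \<Rightarrow> complex) \<Rightarrow> complex mat \<Rightarrow> complex mat" where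
  "I_fun r \<gamma> \<tau> x = hol_calculus (iota r \<gamma> \<tau>) x"

definition S_fun ::
    "(complex set \<Rightarrow> real) \<Rightarrow> (complex set \<Rightarrow> complex \<Rightarrow> complex) \<Rightarrow>
     complex set \<Rightarrow> (complex \<Rightarrow> complex) \<Rightarrow> complex mat \<Rightarrow> complex mat" where
  "S_fun r q \<gamma> \<tau> x = hol_calculus (\<lambda>z. q \<gamma> z * iota r \<gamma> \<tau> z) x"

definition W_dom :: "(complex set \<Rightarrow> real) \<Rightarrow> complex set \<Rightarrow> nc_point set" where
  "W_dom r \<gamma> = {p \<in> nc_space 2. p ! 1 \<in> D_dom r \<gamma>}"

definition U_dom :: "(complex set \<Rightarrow> real) \<Rightarrow> complex set \<Rightarrow> nc_point set" where
  "U_dom r \<gamma> = {p \<in> W_dom r \<gamma>. \<forall>\<tau> \<in> signs \<gamma>. \<not> \<tau> constant_on \<gamma> \<longrightarrow>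
     p ! 0 * I_fun r \<gamma> \<tau> (p ! 1) \<noteq> I_fun r \<gamma> \<tau> (p ! 1) * p ! 0}"

definition omega ::
    "(complex set \<Rightarrow> real) \<Rightarrow> (complex set \<Rightarrow> complex \<Rightarrow> complex) \<Rightarrow>
     complex set \<Rightarrow> (complex \<Rightarrow> complex) \<Rightarrow> nc_point \<Rightarrow> nc_point" where
  "omega r q \<gamma> \<tau> p = (let u = p ! 0; x = p ! 1 in
     [u + S_fun r q \<gamma> \<tau> x, u - S_fun r q \<gamma> \<tau> x])"

definition Phi ::
    "(complex set \<Rightarrow> real) \<Rightarrow> (complex set \<Rightarrow> complex \<Rightarrow> complex) \<Rightarrow>
     complex set \<Rightarrow> (complex \<Rightarrow> complex) \<Rightarrow> nc_point \<Rightarrow> nc_point" where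
  "Phi r q \<gamma> \<tau> p = (let u = p ! 0; x = p ! 1 in
     [u, x, S_fun r q \<gamma> \<tau> x * u * S_fun r q \<gamma> \<tau> x])"

definition S_o ::
    "(complex set \<Rightarrow> real) \<Rightarrow> (complex set \<Rightarrow> complex \<Rightarrow> complex) \<Rightarrow>
     nc_point set \<Rightarrow> nc_point set" where
  "S_o r q S = (\<Union>\<gamma>\<in>Gamma. \<Union>\<tau>\<in>signs \<gamma>. omega r q \<gamma> \<tau> ` W_dom r \<gamma> \<inter> S)"

definition S_oo ::
    "(complex set \<Rightarrow> real) \<Rightarrow> (complex set \<Rightarrow> complex \<Rightarrow> complex) \<Rightarrow>
     nc_point set \<Rightarrow> nc_point set" where
  "S_oo r q S = (\<Union>\<gamma>\<in>Gamma. \<Union>\<tau>\<in>signs \<gamma>. omega r q \<gamma> \<tau> ` U_dom r \<gamma> \<inter> S)"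

definition U_chart ::
    "(complex set \<Rightarrow> real) \<Rightarrow> (complex set \<Rightarrow> complex \<Rightarrow> complex) \<Rightarrow>
     nc_point set \<Rightarrow> complex set \<Rightarrow> (complex \<Rightarrow> complex) \<Rightarrow> nc_point set" where
  "U_chart r q S \<gamma> \<tau> = {p \<in> U_dom r \<gamma>. omega r q \<gamma> \<tau> p \<in> S}"

definition G_oo ::
    "(complex set \<Rightarrow> real) \<Rightarrow> (complex set \<Rightarrow> complex \<Rightarrow> complex) \<Rightarrow>
     nc_point set \<Rightarrow> nc_point set" where
  "G_oo r q S = (\<Union>\<gamma>\<in>Gamma. \<Union>\<tau>\<in>signs \<gamma>. Phi r q \<gamma> \<tau> ` U_chart r q S \<gamma> \<tau>)"

definition G_o ::
    "(complex set \<Rightarrow> real) \<Rightarrow> (complex set \<Rightarrow> complex \<Rightarrow> complex) \<Rightarrow>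
     nc_point set \<Rightarrow> nc_point set" where
  "G_o r q S = pi_map ` S_o r q S"

text \<open>
  Holomorphy on the manifold \<open>G_oo\<close> is tested in the charts, the inverses of the maps \<open>Phi\<close>;
  the topology of \<open>G_oo\<close>, which has as base the images under \<open>Phi\<close> of the Zariski-freely open
  subsets of \<open>U_chart\<close>, does not enter otherwise.
\<close>

definition holomorphic_on_G_oo ::
    "(complex set \<Rightarrow> real) \<Rightarrow> (complex set \<Rightarrow> complex \<Rightarrow> complex) \<Rightarrow>
     nc_point set \<Rightarrow> (nc_point \<Rightarrow> complex mat) \<Rightarrow> bool" where
  "holomorphic_on_G_oo r q S F \<longleftrightarrow> (\<forall>\<gamma>\<in>Gamma. \<forall>\<tau>\<in>signs \<gamma>.
     zariski_freely_holomorphic 2 (U_chart r q S \<gamma> \<tau>) (F \<circ> Phi r q \<gamma> \<tau>))"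

definition bounded_along_pi ::
    "nc_point set \<Rightarrow> nc_point set \<Rightarrow> (nc_point \<Rightarrow> complex mat) \<Rightarrow> bool" where
  "bounded_along_pi S G F \<longleftrightarrow>
     (\<forall>w\<in>S. \<exists>U. openin (free_topology 2) U \<and> w \<in> U \<and> bounded_values_on (pi_map ` U \<inter> G) F)"

section \<open>The five sets of graded functions\<close>

text \<open>
  A function on \<open>D\<close> is represented by its unique extension in \<open>extensional D\<close>, so that equality
  of representatives is equality of functions on \<open>D\<close>.
\<close>

definition sym_functions_S :: "nc_point set \<Rightarrow> (nc_point \<Rightarrow> complex mat) set" where
  "sym_functions_S S = {f \<in> extensional S.
     symmetric_fun S f \<and> conditionally_nc 2 S f \<and> freely_holomorphic 2 S f}"

definition sym_functions_S_o ::
    "(complex set \<Rightarrow> real) \<Rightarrow> (complex set \<Rightarrow> complex \<Rightarrow> complex) \<Rightarrow>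
     nc_point set \<Rightarrow> (nc_point \<Rightarrow> complex mat) set" where
  "sym_functions_S_o r q S = {f \<in> extensional (S_o r q S).
     symmetric_fun (S_o r q S) f \<and> conditionally_nc 2 (S_o r q S) f \<and>
     freely_locally_bounded_on 2 S (S_o r q S) f}"

definition sym_functions_S_oo ::
    "(complex set \<Rightarrow> real) \<Rightarrow> (complex set \<Rightarrow> complex \<Rightarrow> complex) \<Rightarrow>
     nc_point set \<Rightarrow> (nc_point \<Rightarrow> complex mat) set" where
  "sym_functions_S_oo r q S = {f \<in> extensional (S_oo r q S).
     symmetric_fun (S_oo r q S) f \<and> zariski_freely_holomorphic 2 (S_oo r q S) f \<and>
     conditionally_nc 2 (S_oo r q S) f \<and> freely_locally_bounded_on 2 S (S_oo r q S) f}"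

definition functions_G_oo ::
    "(complex set \<Rightarrow> real) \<Rightarrow> (complex set \<Rightarrow> complex \<Rightarrow> complex) \<Rightarrow>
     nc_point set \<Rightarrow> (nc_point \<Rightarrow> complex mat) set" where
  "functions_G_oo r q S = {F \<in> extensional (G_oo r q S).
     holomorphic_on_G_oo r q S F \<and> conditionally_nc 3 (G_oo r q S) F \<and>
     bounded_along_pi S (G_oo r q S) F}"

definition functions_G_o ::
    "(complex set \<Rightarrow> real) \<Rightarrow> (complex set \<Rightarrow> complex \<Rightarrow> complex) \<Rightarrow>
     nc_point set \<Rightarrow> (nc_point \<Rightarrow> complex mat) set" where
  "functions_G_o r q S = {F \<in> extensional (G_o r q S).
     conditionally_nc 3 (G_o r q S) F \<and> bounded_along_pi S (G_o r q S) F}"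

end

(*
  Write w = (u + v, u - v), so that pi(w) = (u, v^2, v u v). By uniqueness of square roots
  without opposite eigenvalues, S_o consists of the w in S for which no two eigenvalues of v
  (equal ones included) are opposite.

  A locally bounded conditionally nc function is Lipschitz at each level: conjugating a (+) b by
  [[1, c], [0, 1]] puts c (a - b) into the corner of the argument and c (f(a) - f(b)) into the
  corner of the value. So values on S are limits along w + t (1, -1) of values on S_o, and values
  on S_o are limits along w + t (k, k) of values on S_oo, with k not commuting with any
  nonscalar I_tau(v^2). The limits again define conditionally nc functions, which gives the
  bijections between (i), (ii) and (iii); the Zariski-holomorphy in (iii) is not needed for that,
  it is a consequence.

  For (iv) and (v) one has to show that f descends along pi. If pi(w) = s^-1 pi(w') s with w' in
  S_o, then V = s^-1 v' s is a polynomial in v^2, hence commutes with v, and J = V^-1 v satisfies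
  J^2 = 1 and J u = u J. Then (1 + J)/2 and (1 - J)/2 intertwine w with the conjugates of w' and
  of the flip of w', at which the symmetric function f takes the same value, so
  f(w) = s^-1 f(w') s.
*)
theory Submission
  imports Defs "HOL-Complex_Analysis.Residue_Theorem"
begin

text \<open>The Lipschitz bound for a and b comes from a conjugate of a (+) b, so every limit needs
  direct sums of its approximating points inside the domain of the function. This dictates the
  approximations: the shifts t are small and positive, so that v + t and v + t' have no opposite
  eigenvalues, and perturbed points are compared in mixed pairs.

  In the step from S_oo to S_o direct sums are the obstacle. If v^2 has disjoint spectra at x and y,
  no direction k (+) l is admissible: the sign function separating the spectra gives I_tau = 1 (+)
  -1, which commutes with it. Additivity on S_o is therefore recovered from invariance under
  similarities.

  Holomorphy needs bounds at all levels at once, whereas the calculus is defined by entrywise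
  residues. Its algebra is derived from division by the characteristic polynomial, its norm from
  scalar contour integrals, and spectra are localised by the condition ||p(x)|| < 1, which is freely
  open.

  The assumption on similar images enters in the descent: it puts w (+) w' and the sum of w with the
  flip of w' into S, where the intertwining takes place.\<close>

declare minus_carrier_mat [simp]

section \<open>Invertible matrices and direct sums\<close>

abbreviation Mat :: "nat => complex mat set" where
 "Mat n \<equiv> carrier_mat n n"

lemma mat_inv_eqI:
 assumes A: "A \<in> Mat n" and B: "B \<in> Mat n" and AB: "A * B = 1\<^sub>m n" and BA: "B * A = 1\<^sub>m n"
 shows "mat_inv A = B"
 unfolding mat_inv_def
proof (rule the_equality)
 show "inverts_mat A B \<and> inverts_mat B A"
  using assms by (auto simp: inverts_mat_def)
next
 fix C assume "inverts_mat A C \<and> inverts_mat C A"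
 then have c1: "A * C = 1\<^sub>m n" and c2: "C * A = 1\<^sub>m (dim_row C)"
  using A by (auto simp: inverts_mat_def)
 \<comment> \<open>\<open>inverts_mat\<close> says nothing about the format of \<open>C\<close>; it
   has to be read off from the dimensions of the two products.\<close>
 have "dim_col C = n" using c1 by (metis index_mult_mat(3) index_one_mat(3))
 moreover have "dim_row C = n" using c2 A by (metis carrier_matD(2) index_mult_mat(3) index_one_mat(3))
 ultimately have C: "C \<in> Mat n" by auto
 have "C = (B * A) * C" using BA C by simp
 also have "\<dots> = B * (A * C)" using A B C by (simp add: assoc_mult_mat[of _ n n _ n _ n])
 also have "\<dots> = B" using c1 B by simp
 finally show "C = B" .
qed

lemma GL_I:
 assumes "A \<in> Mat n" "B \<in> Mat n" "A * B = 1\<^sub>m n" "B * A = 1\<^sub>m n"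
 shows "A \<in> GL n"
 using assms by (auto simp: GL_def invertible_mat_def inverts_mat_def)

lemma GL_D:
 assumes "s \<in> GL n"
 shows "s \<in> Mat n" "mat_inv s \<in> Mat n" "s * mat_inv s = 1\<^sub>m n"
  "mat_inv s * s = 1\<^sub>m n" "mat_inv s \<in> GL n"
proof -
 show s: "s \<in> Mat n" using assms by (auto simp: GL_def)
 obtain B where "inverts_mat s B" "inverts_mat B s"
  using assms by (auto simp: GL_def invertible_mat_def)
 then have c1: "s * B = 1\<^sub>m n" and c2: "B * s = 1\<^sub>m (dim_row B)"
  using s by (auto simp: inverts_mat_def)
 have "dim_col B = n" using c1 by (metis index_mult_mat(3) index_one_mat(3))
 moreover have "dim_row B = n" using c2 s by (metis carrier_matD(2) index_mult_mat(3) index_one_mat(3))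
 ultimately have B: "B \<in> Mat n" by auto
 have i: "mat_inv s = B" using mat_inv_eqI[OF s B c1] c2 B by simp
 show "mat_inv s \<in> Mat n" "s * mat_inv s = 1\<^sub>m n" "mat_inv s * s = 1\<^sub>m n"
  using i B c1 c2 by auto
 show "mat_inv s \<in> GL n" using GL_I[of B n s] i B c1 c2 s by auto
qed

lemma GL_one: "1\<^sub>m n \<in> GL n" "mat_inv (1\<^sub>m n) = 1\<^sub>m n"
 using GL_I[of "1\<^sub>m n" n "1\<^sub>m n"] mat_inv_eqI[of "1\<^sub>m n" n "1\<^sub>m n"] by auto

lemma conj_mat_carrier [simp]: "s \<in> GL n ==> a \<in> Mat n ==> conj_mat s a \<in> Mat n"
 unfolding conj_mat_def using GL_D by (metis mult_carrier_mat)

lemma conj_mat_mult: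
 assumes "s \<in> GL n" "a \<in> Mat n" "b \<in> Mat n"
 shows "conj_mat s (a * b) = conj_mat s a * conj_mat s b"
proof -
 note s = GL_D[OF assms(1)]
 have "conj_mat s a * conj_mat s b = mat_inv s * (a * ((s * mat_inv s) * (b * s)))"
  unfolding conj_mat_def using s(1,2) assms(2,3) by (simp add: assoc_mult_mat[of _ n n _ n _ n])
 then show ?thesis unfolding conj_mat_def using s assms(2,3)
  by (simp add: assoc_mult_mat[of _ n n _ n _ n] left_mult_one_mat[of _ n n])
qed

lemma conj_mat_add:
 assumes "s \<in> GL n" "a \<in> Mat n" "b \<in> Mat n"
 shows "conj_mat s (a + b) = conj_mat s a + conj_mat s b"
 using GL_D[OF assms(1)] assms(2,3) unfolding conj_mat_def
 by (simp add: mult_add_distrib_mat[of _ n n _ n] add_mult_distrib_mat[of _ n n _ _ n])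

lemma conj_mat_minus:
 assumes "s \<in> GL n" "a \<in> Mat n" "b \<in> Mat n"
 shows "conj_mat s (a - b) = conj_mat s a - conj_mat s b"
 using GL_D[OF assms(1)] assms(2,3) unfolding conj_mat_def
 by (simp add: mult_minus_distrib_mat[of _ n n _ n] minus_mult_distrib_mat[of _ n n _ _ n])

lemma conj_mat_smult:
 assumes "s \<in> GL n" "a \<in> Mat n"
 shows "conj_mat s (c \<cdot>\<^sub>m a) = c \<cdot>\<^sub>m conj_mat s a"
 using GL_D[OF assms(1)] assms(2) unfolding conj_mat_def
 by (simp add: mult_smult_distrib[of _ n n _ n] mult_smult_assoc_mat[of _ n n _ n])

lemma conj_mat_one: "s \<in> GL n ==> conj_mat s (1\<^sub>m n) = 1\<^sub>m n"
 using GL_D[of s n] unfolding conj_mat_def by (simp add: right_mult_one_mat[of _ n n])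

lemma conj_mat_zero: "s \<in> GL n ==> conj_mat s (0\<^sub>m n n) = 0\<^sub>m n n"
 using GL_D[of s n] unfolding conj_mat_def by simp

lemma conj_mat_by_one: "a \<in> Mat n ==> conj_mat (1\<^sub>m n) a = a"
 unfolding conj_mat_def GL_one by simp

lemma conj_mat_inverse:
 assumes "s \<in> GL n" "a \<in> Mat n"
 shows "conj_mat (mat_inv s) (conj_mat s a) = a"
proof -
 note s = GL_D[OF assms(1)]
 have i: "mat_inv (mat_inv s) = s" using mat_inv_eqI[of "mat_inv s" n s] s by auto
 have "conj_mat (mat_inv s) (conj_mat s a) = (s * mat_inv s) * a * (s * mat_inv s)"
  unfolding conj_mat_def i using s(1,2) assms(2) by (simp add: assoc_mult_mat[of _ n n _ n _ n])
 then show ?thesis using s assms(2) by simp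
qed

lemma conj_mat_inj:
 assumes "s \<in> GL n" "a \<in> Mat n" "b \<in> Mat n" "conj_mat s a = conj_mat s b"
 shows "a = b"
 using conj_mat_inverse[OF assms(1,2)] conj_mat_inverse[OF assms(1,3)] assms(4) by metis

lemma mat_dsum_carrier [simp]:
 "A \<in> carrier_mat n n' ==> B \<in> carrier_mat m m' ==> mat_dsum A B \<in> carrier_mat (n + m) (n' + m')"
 unfolding mat_dsum_def by auto

lemma mat_dsum_eq:
 "A \<in> Mat n ==> B \<in> Mat m ==>
  mat_dsum A B = four_block_mat A (0\<^sub>m n m) (0\<^sub>m m n) B"
 unfolding mat_dsum_def by auto

lemma mat_dsum_mult:
 assumes "A \<in> Mat n" "B \<in> Mat m" "C \<in> Mat n" "D \<in> Mat m"
 shows "mat_dsum A B * mat_dsum C D = mat_dsum (A * C) (B * D)"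
 using assms by (simp add: mat_dsum_eq[of _ n _ m] mult_four_block_mat[of _ n n _ m _ m _ _ n _ m])

lemma mat_dsum_add:
 assumes "A \<in> Mat n" "B \<in> Mat m" "C \<in> Mat n" "D \<in> Mat m"
 shows "mat_dsum A B + mat_dsum C D = mat_dsum (A + C) (B + D)"
 using assms by (simp add: mat_dsum_eq[of _ n _ m] add_four_block_mat[of _ n n _ m _ m])

lemma mat_dsum_smult:
 assumes "A \<in> Mat n" "B \<in> Mat m"
 shows "c \<cdot>\<^sub>m mat_dsum A B = mat_dsum (c \<cdot>\<^sub>m A) (c \<cdot>\<^sub>m B)"
 using assms by (intro eq_matI) (auto simp: mat_dsum_eq[of _ n _ m])

lemma mat_dsum_minus:
 assumes "A \<in> Mat n" "B \<in> Mat m" "C \<in> Mat n" "D \<in> Mat m"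
 shows "mat_dsum A B - mat_dsum C D = mat_dsum (A - C) (B - D)"
 using assms by (intro eq_matI) (auto simp: mat_dsum_def)

lemma mat_dsum_one: "mat_dsum (1\<^sub>m n) (1\<^sub>m m) = 1\<^sub>m (n + m)"
 by (simp add: mat_dsum_def)

lemma mat_dsum_zero: "mat_dsum (0\<^sub>m n n) (0\<^sub>m m m) = 0\<^sub>m (n + m) (n + m)"
 by (simp add: mat_dsum_def)

lemma four_block_inj:
 assumes "four_block_mat A B C D = four_block_mat A' B' C' D'"
  "A \<in> carrier_mat n1 n2" "A' \<in> carrier_mat n1 n2" "B \<in> carrier_mat n1 m2" "B' \<in> carrier_mat n1 m2"
  "C \<in> carrier_mat m1 n2" "C' \<in> carrier_mat m1 n2" "D \<in> carrier_mat m1 m2" "D' \<in> carrier_mat m1 m2"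
 shows "A = A' \<and> B = B' \<and> C = C' \<and> D = D'"
proof (intro conjI)
 have e: "four_block_mat A B C D $$ (i, j) = four_block_mat A' B' C' D' $$ (i, j)" for i j
  using assms(1) by simp
 show "A = A'"
 proof (rule eq_matI)
  fix i j assume "i < dim_row A'" "j < dim_col A'" then show "A $$ (i, j) = A' $$ (i, j)"
   using e[of i j] assms(2-) by auto
 qed (use assms in auto)
 show "B = B'"
 proof (rule eq_matI)
  fix i j assume "i < dim_row B'" "j < dim_col B'" then show "B $$ (i, j) = B' $$ (i, j)"
   using e[of i "j + n2"] assms(2-) by auto
 qed (use assms in auto)
 show "C = C'"
 proof (rule eq_matI)
  fix i j assume "i < dim_row C'" "j < dim_col C'" then show "C $$ (i, j) = C' $$ (i, j)"
   using e[of "i + n1" j] assms(2-) by auto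
 qed (use assms in auto)
 show "D = D'"
 proof (rule eq_matI)
  fix i j assume "i < dim_row D'" "j < dim_col D'" then show "D $$ (i, j) = D' $$ (i, j)"
   using e[of "i + n1" "j + n2"] assms(2-) by auto
 qed (use assms in auto)
qed

lemma mat_dsum_inj:
 assumes "mat_dsum A B = mat_dsum C D"
  "A \<in> Mat n" "B \<in> Mat m" "C \<in> Mat n" "D \<in> Mat m"
 shows "A = C" "B = D"
 using four_block_inj[of A "0\<^sub>m n m" "0\<^sub>m m n" B C "0\<^sub>m n m" "0\<^sub>m m n" D n n m m] assms
 by (simp_all add: mat_dsum_eq[of _ n _ m])

lemma mat_dsum_assoc: "mat_dsum (mat_dsum A B) C = mat_dsum A (mat_dsum B C)"
 unfolding mat_dsum_def by (rule assoc_four_block_mat[symmetric])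

lemma GL_dsum:
 assumes "s \<in> GL n" "t \<in> GL m"
 shows "mat_dsum s t \<in> GL (n + m)" "mat_inv (mat_dsum s t) = mat_dsum (mat_inv s) (mat_inv t)"
proof -
 note s = GL_D[OF assms(1)] and t = GL_D[OF assms(2)]
 have "mat_dsum s t * mat_dsum (mat_inv s) (mat_inv t) = 1\<^sub>m (n + m)"
  "mat_dsum (mat_inv s) (mat_inv t) * mat_dsum s t = 1\<^sub>m (n + m)"
  using s t by (simp_all add: mat_dsum_mult[of _ n _ m] mat_dsum_one)
 moreover have "mat_dsum s t \<in> carrier_mat (n + m) (n + m)"
  "mat_dsum (mat_inv s) (mat_inv t) \<in> carrier_mat (n + m) (n + m)"
  using s t by auto
 ultimately show "mat_dsum s t \<in> GL (n + m)" "mat_inv (mat_dsum s t) = mat_dsum (mat_inv s) (mat_inv t)"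
  using GL_I mat_inv_eqI by blast+
qed

lemma uminus_zero: "- (0\<^sub>m n m :: complex mat) = 0\<^sub>m n m"
 by (intro eq_matI) auto

definition shear :: "nat => nat => complex mat => complex mat" where
 "shear n m T = four_block_mat (1\<^sub>m n) T (0\<^sub>m m n) (1\<^sub>m m)"

lemma shear_GL:
 assumes T: "T \<in> carrier_mat n m"
 shows "shear n m T \<in> GL (n + m)" "mat_inv (shear n m T) = shear n m (- T)"
proof -
 have "shear n m T * shear n m (- T) = 1\<^sub>m (n + m)" "shear n m (- T) * shear n m T = 1\<^sub>m (n + m)"
  using T by (simp_all add: shear_def mult_four_block_mat[of _ n n _ m _ m _ _ n _ m] 
    uminus_l_inv_mat[of _ n m] comm_add_mat[of _ n m "- T"] uminus_zero)
 moreover have "shear n m T \<in> carrier_mat (n + m) (n + m)" "shear n m (- T) \<in> carrier_mat (n + m) (n + m)"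
  using T by (auto simp: shear_def)
 ultimately show "shear n m T \<in> GL (n + m)" "mat_inv (shear n m T) = shear n m (- T)"
  using GL_I mat_inv_eqI by blast+
qed

text \<open>The corner measures how far \<open>T\<close> is from intertwining \<open>a\<close> and
  \<open>b\<close>. With \<open>T\<close> a multiple of the identity it is a multiple of
  \<open>a - b\<close>, which yields Lipschitz bounds; with \<open>T\<close> an intertwiner it
  vanishes, so that the direct sum is fixed and relations between values can be read off.\<close>

lemma conj_shear:
 assumes "T \<in> carrier_mat n m" "a \<in> Mat n" "b \<in> Mat m"
 shows "conj_mat (shear n m T) (mat_dsum a b) = four_block_mat a (a * T - T * b) (0\<^sub>m m n) b"
proof -
 have "- (T * b) + a * T = a * T - T * b"
  using assms by (intro eq_matI) auto
 moreover have "a * T + - T * b = a * T - T * b"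
  using assms by (intro eq_matI) auto
 ultimately show ?thesis
  using assms unfolding conj_mat_def shear_GL(2)[OF assms(1)]
  by (simp add: shear_def mat_dsum_eq[of _ n _ m] mult_four_block_mat[of _ n n _ m _ m _ _ n _ m])
qed

text \<open>The permutation matrix that exchanges two summands. A conditionally nc function is
  controlled directly only on the first summand; conjugation by this matrix carries the information
  over to the second.\<close>

definition block_swap :: "nat => nat => complex mat" where
 "block_swap n m = four_block_mat (0\<^sub>m n m) (1\<^sub>m n) (1\<^sub>m m) (0\<^sub>m m n)"

lemma block_swap_GL: "block_swap n m \<in> GL (n + m)" "mat_inv (block_swap n m) = block_swap m n"
proof -
 have "block_swap n m * block_swap m n = 1\<^sub>m (n + m)" for n m
  by (simp add: block_swap_def mult_four_block_mat[of _ n m _ n _ m _ _ n _ m])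
 from this[of n m] this[of m n]
 have "block_swap n m * block_swap m n = 1\<^sub>m (n + m)" "block_swap m n * block_swap n m = 1\<^sub>m (n + m)"
  by (auto simp: add.commute)
 moreover have "block_swap n m \<in> carrier_mat (n + m) (n + m)" "block_swap m n \<in> carrier_mat (n + m) (n + m)"
  by (auto simp: block_swap_def)
 ultimately show "block_swap n m \<in> GL (n + m)" "mat_inv (block_swap n m) = block_swap m n"
  using GL_I mat_inv_eqI by blast+
qed

lemma conj_block_swap:
 assumes "a \<in> Mat n" "b \<in> Mat m"
 shows "conj_mat (block_swap n m) (mat_dsum a b) = mat_dsum b a"
proof -
 have "block_swap m n * mat_dsum a b = four_block_mat (0\<^sub>m m n) b a (0\<^sub>m n m)"
  using assms by (simp add: block_swap_def mat_dsum_eq[of _ n _ m] mult_four_block_mat[of _ m n _ m _ n _ _ n _ m])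
 then show ?thesis
  using assms unfolding conj_mat_def block_swap_GL(2)
  by (simp add: block_swap_def mat_dsum_eq[of b m a n] mult_four_block_mat[of _ m n _ m _ n _ _ m _ n])
qed

section \<open>Operator norms\<close>

text \<open>The inequality ||a v|| <= C ||v|| for a matrix given as a function on arbitrary index
  sets. Submatrices, padding by zeros and shuffles of blocks then become injections between index
  sets.\<close>

definition opb :: "'i set => 'j set => ('i => 'j => complex) => real => bool" where
 "opb I J a C \<longleftrightarrow>
   (\<forall>v. L2_set (\<lambda>i. cmod (\<Sum>j\<in>J. a i j * v j)) I \<le> C * L2_set (\<lambda>j. cmod (v j)) J)"

lemma opb_sum_entries:
 assumes "finite I" "finite J"
 shows "opb I J a (\<Sum>i\<in>I. \<Sum>j\<in>J. cmod (a i j))"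
 unfolding opb_def
proof
 fix v :: "'b => complex"
 let ?n = "L2_set (\<lambda>j. cmod (v j)) J"
 have "L2_set (\<lambda>i. cmod (\<Sum>j\<in>J. a i j * v j)) I \<le> (\<Sum>i\<in>I. cmod (\<Sum>j\<in>J. a i j * v j))"
  by (rule L2_set_le_sum) auto
 also have "\<dots> \<le> (\<Sum>i\<in>I. \<Sum>j\<in>J. cmod (a i j) * ?n)"
 proof (rule sum_mono)
  fix i
  have "cmod (\<Sum>j\<in>J. a i j * v j) \<le> (\<Sum>j\<in>J. cmod (a i j) * cmod (v j))"
   by (rule order.trans[OF norm_sum]) (simp add: norm_mult)
  also have "\<dots> \<le> (\<Sum>j\<in>J. cmod (a i j) * ?n)"
   using member_le_L2_set[OF assms(2), of _ "\<lambda>j. cmod (v j)"] by (intro sum_mono mult_left_mono) auto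
  finally show "cmod (\<Sum>j\<in>J. a i j * v j) \<le> (\<Sum>j\<in>J. cmod (a i j) * ?n)" .
 qed
 finally show "L2_set (\<lambda>i. cmod (\<Sum>j\<in>J. a i j * v j)) I \<le> (\<Sum>i\<in>I. \<Sum>j\<in>J. cmod (a i j)) * ?n"
  by (simp add: sum_distrib_right)
qed

lemma opb_mono: "opb I J a C ==> C \<le> D ==> opb I J a D"
 unfolding opb_def by (meson L2_set_nonneg mult_right_mono order.trans)

lemma opb_cong: "(\<And>i j. i \<in> I ==> j \<in> J ==> a i j = b i j) ==> opb I J a C = opb I J b C"
proof -
 assume "\<And>i j. i \<in> I ==> j \<in> J ==> a i j = b i j"
 then have "L2_set (\<lambda>i. cmod (\<Sum>j\<in>J. a i j * v j)) I = L2_set (\<lambda>i. cmod (\<Sum>j\<in>J. b i j * v j)) I" for v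
  by (intro L2_set_cong refl arg_cong[of _ _ cmod] sum.cong) auto
 then show ?thesis unfolding opb_def by simp
qed

lemma opb_add:
 assumes "opb I J a C" "opb I J b D"
 shows "opb I J (\<lambda>i j. a i j + b i j) (C + D)"
 unfolding opb_def
proof
 fix v :: "'b => complex"
 let ?A = "\<lambda>i. \<Sum>j\<in>J. a i j * v j" and ?B = "\<lambda>i. \<Sum>j\<in>J. b i j * v j"
 have "L2_set (\<lambda>i. cmod (\<Sum>j\<in>J. (a i j + b i j) * v j)) I \<le> L2_set (\<lambda>i. cmod (?A i) + cmod (?B i)) I"
  by (intro L2_set_mono) (auto simp: distrib_right sum.distrib norm_triangle_ineq)
 also have "\<dots> \<le> L2_set (\<lambda>i. cmod (?A i)) I + L2_set (\<lambda>i. cmod (?B i)) I"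
  by (rule L2_set_triangle_ineq)
 finally show "L2_set (\<lambda>i. cmod (\<Sum>j\<in>J. (a i j + b i j) * v j)) I \<le> (C + D) * L2_set (\<lambda>j. cmod (v j)) J"
  using assms[unfolded opb_def, rule_format, of v] by (simp add: distrib_right)
qed

lemma opb_zero: "opb I J (\<lambda>i j. 0) 0"
 unfolding opb_def by (simp add: L2_set_0')

lemma opb_sum:
 assumes "finite K" "\<And>k. k \<in> K ==> opb I J (a k) (C k)"
 shows "opb I J (\<lambda>i j. \<Sum>k\<in>K. a k i j) (\<Sum>k\<in>K. C k)"
 using assms by (induction K rule: finite_induct) (auto simp: opb_zero opb_add)

lemma opb_comp:
 assumes "opb I J a C" "opb J K b D" "C \<ge> 0"
 shows "opb I K (\<lambda>i k. \<Sum>j\<in>J. a i j * b j k) (C * D)"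
 unfolding opb_def
proof
 fix v :: "'c => complex"
 let ?w = "\<lambda>j. \<Sum>k\<in>K. b j k * v k"
 have eq: "(\<Sum>k\<in>K. (\<Sum>j\<in>J. a i j * b j k) * v k) = (\<Sum>j\<in>J. a i j * ?w j)" for i
  unfolding sum_distrib_left sum_distrib_right by (subst sum.swap) (simp add: mult.assoc)
 have "L2_set (\<lambda>i. cmod (\<Sum>j\<in>J. a i j * ?w j)) I \<le> C * L2_set (\<lambda>j. cmod (?w j)) J"
  using assms(1)[unfolded opb_def, rule_format, of ?w] .
 also have "\<dots> \<le> C * (D * L2_set (\<lambda>k. cmod (v k)) K)"
  using assms(2)[unfolded opb_def, rule_format, of v] assms(3) by (intro mult_left_mono) auto
 finally show "L2_set (\<lambda>i. cmod (\<Sum>k\<in>K. (\<Sum>j\<in>J. a i j * b j k) * v k)) I \<le> C * D * L2_set (\<lambda>k. cmod (v k)) K"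
  unfolding eq by (simp add: mult.assoc)
qed

lemma opb_scale: 
 assumes "opb I J a C" shows "opb I J (\<lambda>i j. c * a i j) (cmod c * C)"
 unfolding opb_def
proof
 fix v :: "'b => complex"
 have "L2_set (\<lambda>i. cmod (\<Sum>j\<in>J. c * a i j * v j)) I = L2_set (\<lambda>i. cmod c * cmod (\<Sum>j\<in>J. a i j * v j)) I"
  by (intro L2_set_cong) (auto simp: norm_mult[symmetric] sum_distrib_left mult.assoc)
 also have "\<dots> = cmod c * L2_set (\<lambda>i. cmod (\<Sum>j\<in>J. a i j * v j)) I"
  by (simp add: L2_set_right_distrib)
 also have "\<dots> \<le> cmod c * (C * L2_set (\<lambda>j. cmod (v j)) J)"
  using assms[unfolded opb_def, rule_format, of v] by (intro mult_left_mono) auto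
 finally show "L2_set (\<lambda>i. cmod (\<Sum>j\<in>J. c * a i j * v j)) I \<le> cmod c * C * L2_set (\<lambda>j. cmod (v j)) J"
  by (simp add: mult.assoc)
qed

lemma L2_set_image: "inj_on f I ==> L2_set g (f ` I) = L2_set (\<lambda>i. g (f i)) I"
 unfolding L2_set_def by (simp add: sum.reindex)

lemma L2_set_subset_mono: "finite B ==> A \<subseteq> B ==> L2_set g A \<le> L2_set g B"
 unfolding L2_set_def by (auto intro!: sum_mono2)

lemma L2_set_mono_neutral: "finite B ==> A \<subseteq> B ==> (\<And>i. i \<in> B - A ==> g i = 0) ==> L2_set g A = L2_set g B"
 unfolding L2_set_def by (intro arg_cong[of _ _ sqrt] sum.mono_neutral_left) auto

text \<open>Padding \<open>v\<close> with zeros makes the small matrix act as a part of the large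
  one, and dropping rows does not increase a norm.\<close>

lemma opb_submatrix:
 assumes "opb I J a C" "finite I" "finite J" "inj_on f I0" "inj_on g J0" "f ` I0 \<subseteq> I" "g ` J0 \<subseteq> J"
 shows "opb I0 J0 (\<lambda>i j. a (f i) (g j)) C"
 unfolding opb_def
proof
 fix v :: "'d => complex"
 define w where "w j = (if j \<in> g ` J0 then v (the_inv_into J0 g j) else 0)" for j
 have wg: "w (g j) = v j" if "j \<in> J0" for j
  using that assms(5) by (simp add: w_def the_inv_into_f_f)
 have s: "(\<Sum>j\<in>J. b j * w j) = (\<Sum>j\<in>J0. b (g j) * v j)" for b
 proof -
  have "(\<Sum>j\<in>J. b j * w j) = (\<Sum>j\<in>g ` J0. b j * w j)"
   using assms(3,7) by (intro sum.mono_neutral_right) (auto simp: w_def)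
  also have "\<dots> = (\<Sum>j\<in>J0. b (g j) * v j)"
   using assms(5) wg by (simp add: sum.reindex)
  finally show ?thesis .
 qed
 have "L2_set (\<lambda>i. cmod (\<Sum>j\<in>J0. a (f i) (g j) * v j)) I0 = L2_set (\<lambda>i. cmod (\<Sum>j\<in>J. a i j * w j)) (f ` I0)"
  using assms(4) s by (simp add: L2_set_image)
 also have "\<dots> \<le> L2_set (\<lambda>i. cmod (\<Sum>j\<in>J. a i j * w j)) I"
  using assms(2,6) by (rule L2_set_subset_mono)
 also have "\<dots> \<le> C * L2_set (\<lambda>j. cmod (w j)) J" using assms(1) unfolding opb_def by blast
 also have "L2_set (\<lambda>j. cmod (w j)) J = L2_set (\<lambda>j. cmod (w j)) (g ` J0)"
  using assms(3,7) by (intro L2_set_mono_neutral[symmetric]) (auto simp: w_def)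
 also have "\<dots> = L2_set (\<lambda>j. cmod (v j)) J0"
  using assms(5) wg by (auto simp: L2_set_image intro: L2_set_cong)
 finally show "L2_set (\<lambda>i. cmod (\<Sum>j\<in>J0. a (f i) (g j) * v j)) I0 \<le> C * L2_set (\<lambda>j. cmod (v j)) J0" .
qed

text \<open>Off the embedded block the matrix vanishes, so discarding the other coordinates of the
  argument leaves the image unchanged and can only shrink the norm of the argument.\<close>

lemma opb_embed:
 assumes "opb I0 J0 (\<lambda>i j. a (f i) (g j)) C" "C \<ge> 0" "finite I" "finite J" "inj_on f I0" "inj_on g J0"
  "f ` I0 \<subseteq> I" "g ` J0 \<subseteq> J"
  "\<And>i j. i \<in> I ==> j \<in> J ==> \<not> (i \<in> f ` I0 \<and> j \<in> g ` J0) ==> a i j = 0"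
 shows "opb I J a C"
 unfolding opb_def
proof
 fix v :: "'d => complex"
 have s: "(\<Sum>j\<in>J. a i j * v j) = (\<Sum>j\<in>J0. a i (g j) * v (g j))" if "i \<in> I" for i
 proof -
  have "(\<Sum>j\<in>J. a i j * v j) = (\<Sum>j\<in>g ` J0. a i j * v j)"
   using assms(4,8,9) that by (intro sum.mono_neutral_right) auto
  then show ?thesis using assms(6) by (simp add: sum.reindex)
 qed
 have "L2_set (\<lambda>i. cmod (\<Sum>j\<in>J. a i j * v j)) I = L2_set (\<lambda>i. cmod (\<Sum>j\<in>J. a i j * v j)) (f ` I0)"
  using assms(3,7,9) by (intro L2_set_mono_neutral[symmetric]) auto
 also have "\<dots> = L2_set (\<lambda>i. cmod (\<Sum>j\<in>J0. a (f i) (g j) * v (g j))) I0"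
  using assms(5,7) s by (auto simp: L2_set_image intro!: L2_set_cong)
 also have "\<dots> \<le> C * L2_set (\<lambda>j. cmod (v (g j))) J0"
  using assms(1)[unfolded opb_def, rule_format, of "\<lambda>j. v (g j)"] .
 also have "\<dots> = C * L2_set (\<lambda>j. cmod (v j)) (g ` J0)" using assms(6) by (simp add: L2_set_image)
 also have "\<dots> \<le> C * L2_set (\<lambda>j. cmod (v j)) J"
  using assms(2,4,8) by (intro mult_left_mono L2_set_subset_mono) auto
 finally show "L2_set (\<lambda>i. cmod (\<Sum>j\<in>J. a i j * v j)) I \<le> C * L2_set (\<lambda>j. cmod (v j)) J" .
qed

lemma opb_square:
 assumes "opb I J a C"
 shows "(\<Sum>i\<in>I. (cmod (\<Sum>j\<in>J. a i j * v j))\<^sup>2) \<le> C\<^sup>2 * (\<Sum>j\<in>J. (cmod (v j))\<^sup>2)"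
proof -
 have "(L2_set (\<lambda>i. cmod (\<Sum>j\<in>J. a i j * v j)) I)\<^sup>2 \<le> (C * L2_set (\<lambda>j. cmod (v j)) J)\<^sup>2"
  using assms unfolding opb_def by (intro power_mono) auto
 then show ?thesis unfolding L2_set_def by (simp add: power_mult_distrib sum_nonneg)
qed

text \<open>Orthogonality: the two blocks act on disjoint coordinates, so squared norms of arguments
  and of images add up and the common constant survives. The triangle inequality would give the sum
  of two constants instead.\<close>

lemma opb_block_diag:
 assumes b1: "opb I1 J1 (\<lambda>i j. a (f1 i) (g1 j)) C" and b2: "opb I2 J2 (\<lambda>i j. a (f2 i) (g2 j)) C" and C: "C \<ge> 0"
  and fin: "finite I1" "finite J1" "finite I2" "finite J2"
  and inj: "inj_on f1 I1" "inj_on g1 J1" "inj_on f2 I2" "inj_on g2 J2"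
  and I: "I = f1 ` I1 \<union> f2 ` I2" "f1 ` I1 \<inter> f2 ` I2 = {}" and J: "J = g1 ` J1 \<union> g2 ` J2" "g1 ` J1 \<inter> g2 ` J2 = {}"
  and z: "\<And>i j. i \<in> I1 ==> j \<in> J2 ==> a (f1 i) (g2 j) = 0" "\<And>i j. i \<in> I2 ==> j \<in> J1 ==> a (f2 i) (g1 j) = 0"
 shows "opb I J a C"
 unfolding opb_def
proof
 fix v :: "'d => complex"
 have sJ: "(\<Sum>j\<in>J. b j) = (\<Sum>j\<in>J1. b (g1 j)) + (\<Sum>j\<in>J2. b (g2 j))" for b :: "'d => complex"
  using J inj fin by (simp add: sum.union_disjoint sum.reindex)
 have sJ': "(\<Sum>j\<in>J. b j) = (\<Sum>j\<in>J1. b (g1 j)) + (\<Sum>j\<in>J2. b (g2 j))" for b :: "'d => real"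
  using J inj fin by (simp add: sum.union_disjoint sum.reindex)
 have sI: "(\<Sum>j\<in>I. b j) = (\<Sum>j\<in>I1. b (f1 j)) + (\<Sum>j\<in>I2. b (f2 j))" for b :: "'c => real"
  using I inj fin by (simp add: sum.union_disjoint sum.reindex)
 have e1: "(\<Sum>j\<in>J. a (f1 i) j * v j) = (\<Sum>j\<in>J1. a (f1 i) (g1 j) * v (g1 j))" if "i \<in> I1" for i
  using that z by (simp add: sJ)
 have e2: "(\<Sum>j\<in>J. a (f2 i) j * v j) = (\<Sum>j\<in>J2. a (f2 i) (g2 j) * v (g2 j))" if "i \<in> I2" for i
  using that z by (simp add: sJ)
 note sq1 = opb_square[OF b1, of "\<lambda>j. v (g1 j)"] and sq2 = opb_square[OF b2, of "\<lambda>j. v (g2 j)"]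
 have "(\<Sum>i\<in>I. (cmod (\<Sum>j\<in>J. a i j * v j))\<^sup>2) \<le> C\<^sup>2 * (\<Sum>j\<in>J. (cmod (v j))\<^sup>2)"
  unfolding sI sJ'[of "\<lambda>j. (cmod (v j))\<^sup>2"] using sq1 sq2 by (simp add: e1 e2 distrib_left)
 then have "L2_set (\<lambda>i. cmod (\<Sum>j\<in>J. a i j * v j)) I \<le> sqrt (C\<^sup>2 * (\<Sum>j\<in>J. (cmod (v j))\<^sup>2))"
  unfolding L2_set_def by simp
 also have "\<dots> = C * L2_set (\<lambda>j. cmod (v j)) J"
  using C by (simp add: L2_set_def real_sqrt_mult)
 finally show "L2_set (\<lambda>i. cmod (\<Sum>j\<in>J. a i j * v j)) I \<le> C * L2_set (\<lambda>j. cmod (v j)) J" .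
qed

lemma opb_entry:
 assumes "opb I J a C" "finite I" "finite J" "i \<in> I" "j \<in> J"
 shows "cmod (a i j) \<le> C"
proof -
 let ?v = "\<lambda>k. if k = j then 1 else 0 :: complex"
 have s: "(\<Sum>k\<in>J. a i k * ?v k) = a i j" for i
  using assms(3,5) by (simp add: if_distrib[of "\<lambda>x. _ * x"] sum.delta cong: if_cong)
 have "cmod (a i j) \<le> L2_set (\<lambda>i. cmod (\<Sum>k\<in>J. a i k * ?v k)) I"
  unfolding s using member_le_L2_set[OF assms(2,4), of "\<lambda>i. cmod (a i j)"] .
 also have "\<dots> \<le> C * L2_set (\<lambda>k. cmod (?v k)) J"
  using assms(1)[unfolded opb_def, rule_format, of ?v] .
 also have "L2_set (\<lambda>k. cmod (?v k)) J = L2_set (\<lambda>k. cmod (?v k)) {j}"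
  using assms(3,5) by (intro L2_set_mono_neutral[symmetric]) auto
 finally show ?thesis by simp
qed

abbreviation ent :: "complex mat => nat => nat => complex" where
 "ent A \<equiv> \<lambda>i j. A $$ (i, j)"

lemma euclid_norm_mult_vec:
 assumes "A \<in> carrier_mat n m" "v \<in> carrier_vec m"
 shows "euclid_norm (A *\<^sub>v v) = L2_set (\<lambda>i. cmod (\<Sum>j<m. A $$ (i, j) * vec_index v j)) {..<n}"
 unfolding euclid_norm_def using assms
 by (auto simp: scalar_prod_def atLeast0LessThan intro!: L2_set_cong arg_cong[of _ _ cmod] sum.cong)

lemma op_norm_aux:
 assumes A: "A \<in> carrier_mat n m"
 shows "opb {..<n} {..<m} (ent A) (op_norm A)" "op_norm A \<ge> 0"
  "opb {..<n} {..<m} (ent A) C ==> C \<ge> 0 ==> op_norm A \<le> C"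
proof -
 let ?V = "{v \<in> carrier_vec m. euclid_norm v \<le> 1}"
 have on: "op_norm A = (SUP v\<in>?V. euclid_norm (A *\<^sub>v v))" using A by (simp add: op_norm_def)
 have z: "0\<^sub>v m \<in> ?V" by (simp add: euclid_norm_def L2_set_0')
 have bd: "euclid_norm (A *\<^sub>v v) \<le> C" if "opb {..<n} {..<m} (ent A) C" "C \<ge> 0" "v \<in> ?V" for C v
 proof -
  have "euclid_norm (A *\<^sub>v v) \<le> C * L2_set (\<lambda>j. cmod (vec_index v j)) {..<m}"
   using that(1,3) unfolding opb_def by (simp add: euclid_norm_mult_vec[OF A])
  also have "\<dots> \<le> C * 1" using that by (intro mult_left_mono) (auto simp: euclid_norm_def)
  finally show ?thesis by simp
 qed
 \<comment> \<open>A crude bound whose purpose is to make the set under the supremum in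
   \<open>op_norm\<close> bounded above; without that, \<open>SUP\<close> would be an unspecified
   real.\<close>
 let ?C = "\<Sum>i<n. \<Sum>j<m. cmod (A $$ (i, j))"
 have C0: "opb {..<n} {..<m} (ent A) ?C" "?C \<ge> 0"
  by (auto intro!: opb_sum_entries sum_nonneg)
 have bdd: "bdd_above ((\<lambda>v. euclid_norm (A *\<^sub>v v)) ` ?V)"
  using bd[OF C0] by (auto intro!: bdd_aboveI)
 have up: "euclid_norm (A *\<^sub>v v) \<le> op_norm A" if "v \<in> ?V" for v
  unfolding on using bdd that by (rule cSUP_upper2[where x=v]) auto
 show nn: "op_norm A \<ge> 0" using up[OF z] unfolding euclid_norm_def by (rule order.trans[rotated]) auto
 show "op_norm A \<le> C" if "opb {..<n} {..<m} (ent A) C" "C \<ge> 0"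
  unfolding on using z bd[OF that] by (intro cSUP_least) blast+
 show "opb {..<n} {..<m} (ent A) (op_norm A)"
  unfolding opb_def
 proof
  fix v :: "nat => complex"
  let ?n = "L2_set (\<lambda>j. cmod (v j)) {..<m}"
  show "L2_set (\<lambda>i. cmod (\<Sum>j<m. A $$ (i, j) * v j)) {..<n} \<le> op_norm A * ?n"
  proof (cases "?n = 0")
   case True
   then have "v j = 0" if "j < m" for j using that by (auto simp: L2_set_eq_0_iff)
   then show ?thesis using True by (simp add: L2_set_0')
  next
   case False
   then have pos: "?n > 0" by (metis L2_set_nonneg less_eq_real_def)
   define w where "w = Matrix.vec m (\<lambda>j. v j / of_real ?n)"
   have "euclid_norm w = L2_set (\<lambda>j. cmod (v j) * (1 / ?n)) {..<m}"
    unfolding euclid_norm_def w_def using pos by (intro L2_set_cong) (auto simp: norm_divide)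
   also have "\<dots> = ?n * (1 / ?n)" using pos by (subst L2_set_left_distrib) auto
   also have "\<dots> = 1" using pos by simp
   finally have "w \<in> ?V" by (simp add: w_def)
   then have "euclid_norm (A *\<^sub>v w) \<le> op_norm A" by (rule up)
   moreover have "euclid_norm (A *\<^sub>v w) = L2_set (\<lambda>i. cmod (\<Sum>j<m. A $$ (i, j) * v j) * (1 / ?n)) {..<n}"
   proof -
    have "w \<in> carrier_vec m" by (simp add: w_def)
    moreover have "cmod (\<Sum>j<m. A $$ (i, j) * vec_index w j) = cmod (\<Sum>j<m. A $$ (i, j) * v j) * (1 / ?n)" for i
    proof -
     have "(\<Sum>j<m. A $$ (i, j) * vec_index w j) = (\<Sum>j<m. A $$ (i, j) * v j) / of_real ?n"
      by (simp add: w_def sum_divide_distrib)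
     then show ?thesis using pos by (simp add: norm_divide)
    qed
    ultimately show ?thesis by (simp add: euclid_norm_mult_vec[OF A])
   qed
   moreover have "\<dots> = L2_set (\<lambda>i. cmod (\<Sum>j<m. A $$ (i, j) * v j)) {..<n} / ?n"
    using pos by (subst L2_set_left_distrib[symmetric]) auto
   ultimately show ?thesis using pos by (simp add: divide_le_eq)
  qed
 qed
qed

lemmas op_norm_opb = op_norm_aux(1) and op_norm_nonneg = op_norm_aux(2) and op_norm_leI = op_norm_aux(3)

lemma op_norm_add:
 assumes "A \<in> carrier_mat n m" "B \<in> carrier_mat n m"
 shows "op_norm (A + B) \<le> op_norm A + op_norm B"
proof (rule op_norm_leI[of _ n m])
 have "opb {..<n} {..<m} (ent (A + B)) C = opb {..<n} {..<m} (\<lambda>i j. ent A i j + ent B i j) C" for C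
  using assms by (intro opb_cong) auto
 then show "opb {..<n} {..<m} (ent (A + B)) (op_norm A + op_norm B)"
  using opb_add[OF op_norm_opb[OF assms(1)] op_norm_opb[OF assms(2)]] by simp
qed (use assms op_norm_nonneg in auto)

lemma op_norm_smult_le:
 assumes "A \<in> carrier_mat n m"
 shows "op_norm (c \<cdot>\<^sub>m A) \<le> cmod c * op_norm A"
proof (rule op_norm_leI[of _ n m])
 have "opb {..<n} {..<m} (ent (c \<cdot>\<^sub>m A)) C = opb {..<n} {..<m} (\<lambda>i j. c * ent A i j) C" for C
  using assms by (intro opb_cong) auto
 then show "opb {..<n} {..<m} (ent (c \<cdot>\<^sub>m A)) (cmod c * op_norm A)"
  using opb_scale[OF op_norm_opb[OF assms(1)]] by simp
qed (use assms op_norm_nonneg in auto)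

lemma op_norm_zero [simp]: "op_norm (0\<^sub>m n m) = 0"
proof -
 have "op_norm (0\<^sub>m n m) \<le> 0"
 proof (rule op_norm_leI[of _ n m])
  have "opb {..<n} {..<m} (ent (0\<^sub>m n m)) C = opb {..<n} {..<m} (\<lambda>i j. 0) C" for C
   by (intro opb_cong) auto
  then show "opb {..<n} {..<m} (ent (0\<^sub>m n m)) 0" using opb_zero by simp
 qed auto
 then show ?thesis using op_norm_nonneg[of "0\<^sub>m n m" n m] by simp
qed

lemma op_norm_smult:
 assumes A: "A \<in> carrier_mat n m"
 shows "op_norm (c \<cdot>\<^sub>m A) = cmod c * op_norm A"
proof (cases "c = 0")
 case True
 then have "c \<cdot>\<^sub>m A = 0\<^sub>m n m" using A by (intro eq_matI) auto
 then show ?thesis using True by simp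
next
 case False
 have "A = inverse c \<cdot>\<^sub>m (c \<cdot>\<^sub>m A)" using A False by (intro eq_matI) auto
 then have "op_norm A \<le> cmod (inverse c) * op_norm (c \<cdot>\<^sub>m A)"
  using op_norm_smult_le[of "c \<cdot>\<^sub>m A" n m "inverse c"] A by auto
 then have "cmod c * op_norm A \<le> cmod c * (cmod (inverse c) * op_norm (c \<cdot>\<^sub>m A))"
  by (intro mult_left_mono) auto
 also have "\<dots> = op_norm (c \<cdot>\<^sub>m A)" using False by (simp add: norm_inverse)
 finally have "cmod c * op_norm A \<le> op_norm (c \<cdot>\<^sub>m A)" .
 then show ?thesis using op_norm_smult_le[OF A, of c] by linarith
qed

lemma op_norm_minus:
 assumes "A \<in> carrier_mat n m" "B \<in> carrier_mat n m"
 shows "op_norm (A - B) \<le> op_norm A + op_norm B"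
proof -
 have "A - B = A + (-1) \<cdot>\<^sub>m B" using assms by (intro eq_matI) auto
 then show ?thesis using op_norm_add[of A n m "(-1) \<cdot>\<^sub>m B"] op_norm_smult[of B n m "-1"] assms by auto
qed

lemma op_norm_minus_commute:
 assumes "A \<in> carrier_mat n m" "B \<in> carrier_mat n m"
 shows "op_norm (A - B) = op_norm (B - A)"
proof -
 have "A - B = (-1) \<cdot>\<^sub>m (B - A)" using assms by (intro eq_matI) auto
 then show ?thesis using op_norm_smult[of "B - A" n m "-1"] assms by auto
qed

lemma op_norm_triangle:
 assumes "A \<in> carrier_mat n m" "B \<in> carrier_mat n m" "C \<in> carrier_mat n m"
 shows "op_norm (A - C) \<le> op_norm (A - B) + op_norm (B - C)"
proof -
 have "A - C = (A - B) + (B - C)" using assms by (intro eq_matI) auto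
 then show ?thesis using op_norm_add[of "A - B" n m "B - C"] assms by auto
qed

lemma op_norm_le_add_diff:
 assumes "A \<in> carrier_mat n m" "B \<in> carrier_mat n m"
 shows "op_norm A \<le> op_norm B + op_norm (A - B)"
proof -
 have "A = B + (A - B)" using assms by (intro eq_matI) auto
 then show ?thesis using op_norm_add[of B n m "A - B"] assms by auto
qed

lemma op_norm_mult:
 assumes "A \<in> carrier_mat n k" "B \<in> carrier_mat k m"
 shows "op_norm (A * B) \<le> op_norm A * op_norm B"
proof (rule op_norm_leI[of _ n m])
 have "opb {..<n} {..<m} (ent (A * B)) C = opb {..<n} {..<m} (\<lambda>i j. \<Sum>l<k. ent A i l * ent B l j) C" for C
  using assms by (intro opb_cong) (auto simp: scalar_prod_def atLeast0LessThan intro!: sum.cong)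
 then show "opb {..<n} {..<m} (ent (A * B)) (op_norm A * op_norm B)"
  using opb_comp[OF op_norm_opb[OF assms(1)] op_norm_opb[OF assms(2)] op_norm_nonneg[OF assms(1)]] by simp
qed (use assms op_norm_nonneg in auto)

lemma op_norm_one_le: "op_norm (1\<^sub>m n) \<le> 1"
proof (rule op_norm_leI[of _ n n])
 have "opb {..<n} {..<n} (ent (1\<^sub>m n)) 1 = opb {..<n} {..<n} (\<lambda>i j. if i = j then 1 else 0) 1"
  by (intro opb_cong) auto
 also have "\<dots>" unfolding opb_def by (auto simp: if_distrib[of "\<lambda>x. x * _"] sum.delta' cong: if_cong intro!: L2_set_mono)
 finally show "opb {..<n} {..<n} (ent (1\<^sub>m n)) 1" .
qed auto

lemma entry_le_op_norm:
 assumes "A \<in> carrier_mat n m" "i < n" "j < m"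
 shows "cmod (A $$ (i, j)) \<le> op_norm A"
 using opb_entry[OF op_norm_opb[OF assms(1)], of i j] assms by auto

text \<open>The corner is a compression of the whole matrix. In this way a bound for the value at a
  sheared direct sum becomes a bound for a difference of values.\<close>

lemma op_norm_four_block_corner:
 assumes "A \<in> carrier_mat n n'" "B \<in> carrier_mat n m'" "C \<in> carrier_mat m n'" "D \<in> carrier_mat m m'"
 shows "op_norm B \<le> op_norm (four_block_mat A B C D)"
proof (rule op_norm_leI[of _ n m'])
 let ?F = "four_block_mat A B C D"
 have F: "?F \<in> carrier_mat (n + m) (n' + m')" using assms by auto
 have "opb {..<n} {..<m'} (\<lambda>i j. ent ?F (id i) (j + n')) (op_norm ?F)"
  by (rule opb_submatrix[OF op_norm_opb[OF F]]) (auto simp: inj_on_def)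
 moreover have "opb {..<n} {..<m'} (\<lambda>i j. ent ?F (id i) (j + n')) c = opb {..<n} {..<m'} (ent B) c" for c
  using assms by (intro opb_cong) auto
 ultimately show "opb {..<n} {..<m'} (ent B) (op_norm ?F)" by simp
 show "0 \<le> op_norm ?F" using op_norm_nonneg[OF F] .
qed (use assms in auto)

lemma op_norm_upper_triangular_le:
 assumes "A \<in> Mat n" "B \<in> carrier_mat n m" "D \<in> Mat m"
 shows "op_norm (four_block_mat A B (0\<^sub>m m n) D) \<le> op_norm A + op_norm B + op_norm D"
proof -
 \<comment> \<open>\<open>?E X k l p q\<close> is the zero matrix with the p x q matrix
   \<open>X\<close> inserted at row \<open>k\<close> and column \<open>l\<close>.\<close>
 let ?E = "\<lambda>X k l p q. Matrix.mat (n + m) (n + m) (\<lambda>(i, j). if i \<in> {k..<k + p} \<and> j \<in> {l..<l + q} then X $$ (i - k, j - l) else 0)"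
 have le: "op_norm (?E X k l p q) \<le> op_norm X" if X: "X \<in> carrier_mat p q" and pq: "k + p \<le> n + m" "l + q \<le> n + m" for X k l p q
 proof (rule op_norm_leI[OF _ _ op_norm_nonneg[OF X]])
  have im: "i \<in> (\<lambda>i. i + k) ` {..<p} \<longleftrightarrow> i \<in> {k..<k + p}" for i k p :: nat
   by (auto simp: image_iff) (metis add.commute le_add_diff_inverse lessThan_iff less_diff_conv2)
  show "opb {..<n + m} {..<n + m} (ent (?E X k l p q)) (op_norm X)"
  proof (rule opb_embed[of "{..<p}" "{..<q}" _ "\<lambda>i. i + k" "\<lambda>j. j + l"])
   show "opb {..<p} {..<q} (\<lambda>i j. ent (?E X k l p q) (i + k) (j + l)) (op_norm X)"
    by (rule opb_cong[THEN iffD1, OF _ op_norm_opb[OF X]]) (use pq in auto)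
  qed (use pq op_norm_nonneg[OF X] in \<open>auto simp: im inj_on_def\<close>)
 qed simp
 let ?A = "?E A 0 0 n n" and ?B = "?E B 0 n n m" and ?D = "?E D n n m m"
 have "four_block_mat A B (0\<^sub>m m n) D = ?A + ?B + ?D" using assms by (intro eq_matI) auto
 moreover have "op_norm (?A + ?B + ?D) \<le> op_norm ?A + op_norm ?B + op_norm ?D"
  using op_norm_add[of "?A + ?B" "n + m" "n + m" ?D] op_norm_add[of ?A "n + m" "n + m" ?B] by simp
 ultimately show ?thesis using le[OF assms(1), of 0 0] le[OF assms(2), of 0 n] le[OF assms(3), of n n] by simp
qed

section \<open>The holomorphic functional calculus\<close>

definition resolvent :: "complex mat => complex => complex mat" where
 "resolvent x z = mat_inv (z \<cdot>\<^sub>m 1\<^sub>m (dim_row x) - x)"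

lemma index_mult_mat_sum:
 fixes A B :: "complex mat"
 assumes "A \<in> carrier_mat n m" "B \<in> carrier_mat m k" "i < n" "j < k"
 shows "(A * B) $$ (i, j) = (\<Sum>l<m. A $$ (i, l) * B $$ (l, j))"
 using assms by (auto simp: scalar_prod_def atLeast0LessThan intro!: sum.cong)

lemma poly_char_poly:
 fixes x :: "complex mat"
 assumes "x \<in> Mat n"
 shows "poly (char_poly x) z = Determinant.det (z \<cdot>\<^sub>m 1\<^sub>m n - x)"
 unfolding char_poly_def
 by (rule poly_det_cong[of _ n]) (use assms in \<open>auto simp: char_poly_matrix_def\<close>)

lemma spectrum_root:
 fixes x :: "complex mat"
 assumes "x \<in> Mat n"
 shows "e \<in> spectrum x \<longleftrightarrow> poly (char_poly x) e = 0"
 using spectrum_root_char_poly[OF assms] by auto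

text \<open>Cramer's rule. It exhibits the entries as polynomials in \<open>z\<close> divided by the
  characteristic polynomial, whence holomorphy off the spectrum and later the theorem of Cayley and
  Hamilton.\<close>

lemma resolvent:
 assumes x: "x \<in> Mat n" and z: "z \<notin> spectrum x"
 shows "resolvent x z = inverse (poly (char_poly x) z) \<cdot>\<^sub>m adj_mat (z \<cdot>\<^sub>m 1\<^sub>m n - x)"
  "resolvent x z \<in> Mat n"
  "(z \<cdot>\<^sub>m 1\<^sub>m n - x) * resolvent x z = 1\<^sub>m n" "resolvent x z * (z \<cdot>\<^sub>m 1\<^sub>m n - x) = 1\<^sub>m n"
proof -
 let ?A = "z \<cdot>\<^sub>m 1\<^sub>m n - x" and ?d = "poly (char_poly x) z"
 have A: "?A \<in> Mat n" using x by auto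
 have d: "?d \<noteq> 0" "?d = Determinant.det ?A"
  using z spectrum_root[OF x] poly_char_poly[OF x] by auto
 note adj = adj_mat[OF A]
 define B where "B = inverse ?d \<cdot>\<^sub>m adj_mat ?A"
 have B: "B \<in> Mat n" using adj by (simp add: B_def)
 have AB: "?A * B = 1\<^sub>m n" "B * ?A = 1\<^sub>m n"
  using d adj A unfolding B_def
  by (auto simp: mult_smult_distrib[OF A adj(1)] mult_smult_assoc_mat[OF adj(1) A] intro!: eq_matI)
 have "mat_inv ?A = B" by (rule mat_inv_eqI[OF A B AB])
 moreover have "dim_row x = n" using x by auto
 ultimately show "resolvent x z = inverse ?d \<cdot>\<^sub>m adj_mat ?A" "resolvent x z \<in> Mat n"
  "?A * resolvent x z = 1\<^sub>m n" "resolvent x z * ?A = 1\<^sub>m n"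
  using AB B unfolding B_def resolvent_def by auto
qed

lemma holomorphic_on_det:
 assumes "\<And>z. M z \<in> Mat n" "\<And>i j. i < n ==> j < n ==> (\<lambda>z. M z $$ (i, j)) holomorphic_on X"
 shows "(\<lambda>z. Determinant.det (M z)) holomorphic_on X"
proof -
 have "(\<lambda>z. \<Sum>p | p permutes {0..<n}. signof p * (\<Prod>i = 0..<n. M z $$ (i, p i))) holomorphic_on X"
  by (intro holomorphic_intros assms) (auto simp: permutes_in_image dest: permutes_in_image)
 then show ?thesis by (simp add: det_def'[OF assms(1)])
qed

lemma holomorphic_on_adj:
 assumes x: "x \<in> Mat n" and ij: "i < n" "j < n"
 shows "(\<lambda>z. adj_mat (z \<cdot>\<^sub>m 1\<^sub>m n - x) $$ (i, j)) holomorphic_on X"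
proof -
 let ?M = "\<lambda>z. mat_delete (z \<cdot>\<^sub>m 1\<^sub>m n - x) j i"
 have "(\<lambda>z. Determinant.det (?M z)) holomorphic_on X"
 proof (rule holomorphic_on_det)
  show "?M z \<in> carrier_mat (n - 1) (n - 1)" for z using x by (auto simp: mat_delete_def)
  fix k l assume kl: "k < n - 1" "l < n - 1"
  let ?k = "if k < j then k else Suc k" and ?l = "if l < i then l else Suc l"
  have "?M z $$ (k, l) = z * 1\<^sub>m n $$ (?k, ?l) - x $$ (?k, ?l)" for z
   using kl x by (auto simp: mat_delete_def)
  then show "(\<lambda>z. ?M z $$ (k, l)) holomorphic_on X" by (simp only:) (intro holomorphic_intros)
 qed
 then have "(\<lambda>z. (- 1) ^ (j + i) * Determinant.det (?M z)) holomorphic_on X" by (intro holomorphic_intros)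
 moreover have "adj_mat (z \<cdot>\<^sub>m 1\<^sub>m n - x) $$ (i, j) = (- 1) ^ (j + i) * Determinant.det (?M z)" for z
  using x ij by (simp add: adj_mat_def cofactor_def)
 ultimately show ?thesis by simp
qed

lemma holomorphic_on_resolvent:
 assumes x: "x \<in> Mat n" and ij: "i < n" "j < n"
 shows "(\<lambda>z. resolvent x z $$ (i, j)) holomorphic_on - spectrum x"
proof -
 have "(\<lambda>z. inverse (poly (char_poly x) z) * adj_mat (z \<cdot>\<^sub>m 1\<^sub>m n - x) $$ (i, j)) holomorphic_on - spectrum x"
  using spectrum_root[OF x] by (intro holomorphic_intros holomorphic_on_adj[OF x ij]) auto
 then show ?thesis
 proof (rule holomorphic_transform)
  fix z assume "z \<in> - spectrum x"
  then have z: "z \<notin> spectrum x" by simp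
  then show "inverse (poly (char_poly x) z) * adj_mat (z \<cdot>\<^sub>m 1\<^sub>m n - x) $$ (i, j) = resolvent x z $$ (i, j)"
   using adj_mat(1)[of "z \<cdot>\<^sub>m 1\<^sub>m n - x" n] x ij by (simp add: resolvent(1)[OF x z])
 qed
qed

lemma residue_sum:
 fixes s :: "complex set"
 assumes "finite K" "open s" "z \<in> s" "\<And>k. k \<in> K ==> f k holomorphic_on s - {z}"
 shows "residue (\<lambda>w. \<Sum>k\<in>K. f k w) z = (\<Sum>k\<in>K. residue (f k) z)"
 using assms
proof (induction K rule: finite_induct)
 case empty
 then show ?case by (simp add: residue_const)
next
 case (insert k K)
 have "residue (\<lambda>w. f k w + (\<Sum>k\<in>K. f k w)) z = residue (f k) z + residue (\<lambda>w. \<Sum>k\<in>K. f k w) z"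
  using insert by (intro residue_add[of s]) (auto intro!: holomorphic_intros)
 then show ?case using insert by simp
qed

lemma hc_carrier [simp]: "x \<in> Mat n ==> hol_calculus f x \<in> Mat n"
 unfolding hol_calculus_def by auto

lemma hc_entry:
 assumes "x \<in> Mat n" "i < n" "j < n"
 shows "hol_calculus f x $$ (i, j) = (\<Sum>e\<in>spectrum x. residue (\<lambda>z. f z * resolvent x z $$ (i, j)) e)"
 using assms by (simp add: hol_calculus_def resolvent_def)

text \<open>The open set is a parameter of the setting and not of the calculus:
  \<open>hol_calculus f x\<close> sees \<open>f\<close> only near the eigenvalues, so different sets
  around the spectrum can be used for the same value.\<close>

locale hc_setting =
 fixes x :: "complex mat" and n :: nat and \<Omega> :: "complex set"
 assumes x [simp]: "x \<in> Mat n" and op: "open \<Omega>" and sub: "spectrum x \<subseteq> \<Omega>"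
begin

lemma finite_spec: "finite (spectrum x)"
 using card_finite_spectrum[OF x] by simp

text \<open>The other eigenvalues are removed, so that \<open>e\<close> is the only singularity of
  the resolvent in an open set, as the rules for residues require.\<close>

definition nb :: "complex => complex set" where "nb e = \<Omega> - (spectrum x - {e})"

lemma nb: "e \<in> spectrum x ==> open (nb e)" "e \<in> spectrum x ==> e \<in> nb e"
 "e \<in> spectrum x ==> nb e - {e} = \<Omega> - spectrum x"
 using op sub finite_spec by (auto simp: nb_def intro!: open_Diff finite_imp_closed)

lemma holo_R:
 assumes "f holomorphic_on \<Omega>" "i < n" "j < n" "e \<in> spectrum x"
 shows "(\<lambda>z. f z * resolvent x z $$ (i, j)) holomorphic_on nb e - {e}"
 unfolding nb(3)[OF assms(4)]
 by (intro holomorphic_intros holomorphic_on_subset[OF assms(1)]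
   holomorphic_on_subset[OF holomorphic_on_resolvent[OF x assms(2,3)]]) auto

lemma residue_eqI:
 assumes "e \<in> spectrum x" "\<And>z. z \<in> \<Omega> - spectrum x ==> f z = g z"
 shows "residue f e = residue g e"
proof (rule residue_cong[OF _ refl])
 have "eventually (\<lambda>z. z \<in> nb e - {e}) (at e)"
  using nb[OF assms(1)] by (intro eventually_at_in_open)
 then show "\<forall>\<^sub>F z in at e. f z = g z"
  by eventually_elim (use assms nb(3) in auto)
qed

lemma hc_cong:
 assumes "\<And>z. z \<in> \<Omega> ==> f z = g z"
 shows "hol_calculus f x = hol_calculus g x"
proof (rule eq_matI)
 fix i j assume "i < dim_row (hol_calculus g x)" "j < dim_col (hol_calculus g x)"
 then have ij: "i < n" "j < n" using x by (auto simp: hol_calculus_def)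
 show "hol_calculus f x $$ (i, j) = hol_calculus g x $$ (i, j)"
  unfolding hc_entry[OF x ij] using assms by (intro sum.cong refl residue_eqI) auto
qed (auto simp: hol_calculus_def)

lemma hc_add:
 assumes f: "f holomorphic_on \<Omega>" and g: "g holomorphic_on \<Omega>"
 shows "hol_calculus (\<lambda>z. f z + g z) x = hol_calculus f x + hol_calculus g x"
proof (rule eq_matI)
 fix i j assume "i < dim_row (hol_calculus f x + hol_calculus g x)" "j < dim_col (hol_calculus f x + hol_calculus g x)"
 then have ij: "i < n" "j < n" using x by (auto simp: hol_calculus_def)
 have "residue (\<lambda>z. (f z + g z) * resolvent x z $$ (i, j)) e =
  residue (\<lambda>z. f z * resolvent x z $$ (i, j)) e + residue (\<lambda>z. g z * resolvent x z $$ (i, j)) e"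
  if e: "e \<in> spectrum x" for e
  unfolding distrib_right
  by (rule residue_add[of "nb e"]) (use nb e holo_R[OF f ij e] holo_R[OF g ij e] in auto)
 then show "hol_calculus (\<lambda>z. f z + g z) x $$ (i, j) = (hol_calculus f x + hol_calculus g x) $$ (i, j)"
  using ij by (subst index_add_mat) (auto simp: hc_entry[OF x ij] sum.distrib carrier_matD[OF hc_carrier[OF x]])
qed (auto simp: hol_calculus_def)

lemma hc_scale:
 assumes f: "f holomorphic_on \<Omega>"
 shows "hol_calculus (\<lambda>z. c * f z) x = c \<cdot>\<^sub>m hol_calculus f x"
proof (rule eq_matI)
 fix i j assume "i < dim_row (c \<cdot>\<^sub>m hol_calculus f x)" "j < dim_col (c \<cdot>\<^sub>m hol_calculus f x)"
 then have ij: "i < n" "j < n" using x by (auto simp: hol_calculus_def)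
 have "residue (\<lambda>z. (c * f z) * resolvent x z $$ (i, j)) e =
  c * residue (\<lambda>z. f z * resolvent x z $$ (i, j)) e"
  if e: "e \<in> spectrum x" for e
  unfolding mult.assoc
  by (rule residue_lmul[of "nb e"]) (use nb e holo_R[OF f ij e] in auto)
 then show "hol_calculus (\<lambda>z. c * f z) x $$ (i, j) = (c \<cdot>\<^sub>m hol_calculus f x) $$ (i, j)"
  using ij by (subst index_smult_mat) (auto simp: hc_entry[OF x ij] sum_distrib_left carrier_matD[OF hc_carrier[OF x]])
qed (auto simp: hol_calculus_def)

text \<open>z R(z) = x R(z) + 1 for the resolvent R, and the summand f(z) * 1 is holomorphic at the
  eigenvalues, so it has no residue. Together with linearity this one case generates the calculus of
  polynomials.\<close>

lemma hc_times:
 assumes f: "f holomorphic_on \<Omega>"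
 shows "hol_calculus (\<lambda>z. z * f z) x = x * hol_calculus f x"
proof (rule eq_matI)
 fix i j assume "i < dim_row (x * hol_calculus f x)" "j < dim_col (x * hol_calculus f x)"
 then have ij: "i < n" "j < n" using x by (auto simp: hol_calculus_def)
 let ?R = "\<lambda>k z. resolvent x z $$ (k, j)"
 have "residue (\<lambda>z. (z * f z) * ?R i z) e = (\<Sum>k<n. x $$ (i, k) * residue (\<lambda>z. f z * ?R k z) e)"
  if e: "e \<in> spectrum x" for e
 proof -
  have eq: "z * ?R i z = (\<Sum>k<n. x $$ (i, k) * ?R k z) + 1\<^sub>m n $$ (i, j)" if z: "z \<notin> spectrum x" for z
  proof -
   note R = resolvent[OF x z]
   have "(z \<cdot>\<^sub>m 1\<^sub>m n - x) * resolvent x z = z \<cdot>\<^sub>m resolvent x z - x * resolvent x z"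
    using R(2) by (simp add: minus_mult_distrib_mat[of _ n n] mult_smult_assoc_mat[of _ n n _ n])
   then have "(z \<cdot>\<^sub>m resolvent x z - x * resolvent x z) $$ (i, j) = 1\<^sub>m n $$ (i, j)" using R(3) by simp
   moreover have "(x * resolvent x z) $$ (i, j) = (\<Sum>k<n. x $$ (i, k) * ?R k z)"
    by (rule index_mult_mat_sum[OF x R(2) ij])
   moreover have "(z \<cdot>\<^sub>m resolvent x z - x * resolvent x z) $$ (i, j) = z * ?R i z - (x * resolvent x z) $$ (i, j)"
    using R(2) ij carrier_matD[OF x] by auto
   ultimately show ?thesis by (simp add: algebra_simps)
  qed
  have hr: "(\<lambda>z. x $$ (i, k) * (f z * ?R k z)) holomorphic_on nb e - {e}" if "k < n" for k
   by (rule holomorphic_on_mult[OF holomorphic_on_const holo_R[OF f that ij(2) e]])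
  have "residue (\<lambda>z. (z * f z) * ?R i z) e =
   residue (\<lambda>z. (\<Sum>k<n. x $$ (i, k) * (f z * ?R k z)) + f z * 1\<^sub>m n $$ (i, j)) e"
  proof (rule residue_eqI[OF e])
   fix z assume "z \<in> \<Omega> - spectrum x"
   then have "(z * f z) * ?R i z = f z * ((\<Sum>k<n. x $$ (i, k) * ?R k z) + 1\<^sub>m n $$ (i, j))"
    using eq[of z] by (simp add: mult.left_commute mult.assoc)
   then show "(z * f z) * ?R i z = (\<Sum>k<n. x $$ (i, k) * (f z * ?R k z)) + f z * 1\<^sub>m n $$ (i, j)"
    by (simp add: distrib_left sum_distrib_left mult.left_commute)
  qed
  also have "\<dots> = residue (\<lambda>z. \<Sum>k<n. x $$ (i, k) * (f z * ?R k z)) e + residue (\<lambda>z. f z * 1\<^sub>m n $$ (i, j)) e"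
  proof (rule residue_add[of "nb e"])
   show "(\<lambda>z. \<Sum>k<n. x $$ (i, k) * (f z * ?R k z)) holomorphic_on nb e - {e}"
    using hr by (intro holomorphic_on_sum) auto
   show "(\<lambda>z. f z * 1\<^sub>m n $$ (i, j)) holomorphic_on nb e - {e}"
    unfolding nb(3)[OF e] using f by (intro holomorphic_on_mult holomorphic_on_const) (auto intro: holomorphic_on_subset)
  qed (use nb e in auto)
  also have "residue (\<lambda>z. f z * 1\<^sub>m n $$ (i, j)) e = 0"
   by (rule residue_holo[of \<Omega>]) (use op sub e f in \<open>auto intro!: holomorphic_on_mult holomorphic_on_const\<close>)
  also have "residue (\<lambda>z. \<Sum>k<n. x $$ (i, k) * (f z * ?R k z)) e = (\<Sum>k<n. residue (\<lambda>z. x $$ (i, k) * (f z * ?R k z)) e)"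
   using hr nb e by (intro residue_sum[of _ "nb e"]) auto
  also have "\<dots> = (\<Sum>k<n. x $$ (i, k) * residue (\<lambda>z. f z * ?R k z) e)"
   using nb(1,2) e ij f by (intro sum.cong refl residue_lmul[of "nb e"] holo_R) auto
  finally show ?thesis by simp
 qed
 then have "hol_calculus (\<lambda>z. z * f z) x $$ (i, j) =
   (\<Sum>e\<in>spectrum x. \<Sum>k<n. x $$ (i, k) * residue (\<lambda>z. f z * ?R k z) e)"
  by (simp add: hc_entry[OF x ij])
 also have "\<dots> = (\<Sum>k<n. x $$ (i, k) * hol_calculus f x $$ (k, j))"
  by (subst sum.swap) (auto simp: hc_entry[OF x _ ij(2)] sum_distrib_left)
 also have "\<dots> = (x * hol_calculus f x) $$ (i, j)"
  by (rule index_mult_mat_sum[OF x hc_carrier[OF x] ij, symmetric])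
 finally show "hol_calculus (\<lambda>z. z * f z) x $$ (i, j) = (x * hol_calculus f x) $$ (i, j)" .
qed (use x in \<open>auto simp: hol_calculus_def\<close>)

end

lemma eigenvalue_le_op_norm:
 assumes A: "A \<in> Mat n" and y: "y \<in> carrier_vec n" "y \<noteq> 0\<^sub>v n" and e: "A *\<^sub>v y = c \<cdot>\<^sub>v y"
 shows "cmod c \<le> op_norm A"
proof -
 let ?N = "L2_set (\<lambda>j. cmod (vec_index y j)) {..<n}"
 have "L2_set (\<lambda>i. cmod (\<Sum>j<n. A $$ (i, j) * vec_index y j)) {..<n} \<le> op_norm A * ?N"
  using op_norm_opb[OF A] unfolding opb_def by (rule spec)
 moreover have "L2_set (\<lambda>i. cmod (\<Sum>j<n. A $$ (i, j) * vec_index y j)) {..<n} = cmod c * ?N"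
 proof -
  have "(\<Sum>j<n. A $$ (i, j) * vec_index y j) = c * vec_index y i" if "i < n" for i
  proof -
   have "vec_index (A *\<^sub>v y) i = (\<Sum>j<n. A $$ (i, j) * vec_index y j)"
    using that A y by (auto simp: scalar_prod_def atLeast0LessThan intro!: sum.cong)
   then show ?thesis using e that y by simp
  qed
  then have "L2_set (\<lambda>i. cmod (\<Sum>j<n. A $$ (i, j) * vec_index y j)) {..<n} = L2_set (\<lambda>i. cmod c * cmod (vec_index y i)) {..<n}"
   by (intro L2_set_cong) (auto simp: norm_mult)
  then show ?thesis by (simp add: L2_set_right_distrib)
 qed
 moreover have "?N > 0"
 proof -
  have "?N \<noteq> 0"
  proof
   assume "?N = 0"
   then have "y = 0\<^sub>v n" using y(1) by (intro eq_vecI) (auto simp: L2_set_eq_0_iff)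
   then show False using y by simp
  qed
  then show ?thesis by (metis L2_set_nonneg less_eq_real_def)
 qed
 ultimately show ?thesis by simp
qed

lemma spectrum_eigenvector:
 assumes "x \<in> Mat n" "c \<in> spectrum x"
 obtains y where "y \<in> carrier_vec n" "y \<noteq> 0\<^sub>v n" "x *\<^sub>v y = c \<cdot>\<^sub>v y"
 using assms unfolding spectrum_def eigenvalue_def eigenvector_def by auto

text \<open>The larger disc is the domain for the residue theorem. No singularity lies in it outside
  the smaller disc, so the circle picks up all of them with winding number 1.\<close>

lemma residue_circle:
 assumes fin: "finite \<sigma>" and rho: "0 < \<rho>" "\<rho> < \<rho>'" and sub: "\<sigma> \<inter> ball c \<rho>' \<subseteq> ball c \<rho>"
  and holo: "g holomorphic_on ball c \<rho>' - \<sigma>"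
 shows "contour_integral (circlepath c \<rho>) g = 2 * pi * \<i> * (\<Sum>p\<in>\<sigma> \<inter> ball c \<rho>. residue g p)"
proof -
 let ?P = "\<sigma> \<inter> ball c \<rho>"
 have P: "ball c \<rho>' - ?P = ball c \<rho>' - \<sigma>" using sub by auto
 have "contour_integral (circlepath c \<rho>) g = 2 * pi * \<i> * (\<Sum>p\<in>?P. winding_number (circlepath c \<rho>) p * residue g p)"
 proof (rule Residue_theorem[of "ball c \<rho>'"])
  show "g holomorphic_on ball c \<rho>' - ?P" using holo P by simp
  show "path_image (circlepath c \<rho>) \<subseteq> ball c \<rho>' - ?P"
   using rho by (auto simp: dist_norm norm_minus_commute)
  show "\<forall>z. z \<notin> ball c \<rho>' --> winding_number (circlepath c \<rho>) z = 0"
   using rho by (auto intro!: winding_number_zero_outside[of _ "cball c \<rho>"])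
 qed (use fin in auto)
 also have "\<dots> = 2 * pi * \<i> * (\<Sum>p\<in>?P. residue g p)"
  using rho by (intro arg_cong[of _ _ "\<lambda>s. _ * s"] sum.cong) (auto simp: winding_number_circlepath dist_norm norm_minus_commute)
 finally show ?thesis .
qed

text \<open>The resolvent is \<open>1/z + O(1/z\<^sup>2)\<close> at infinity, which normalises the calculus.\<close>

lemma sum_residues_resolvent:
 assumes x: "x \<in> Mat n" and ij: "i < n" "j < n"
 shows "(\<Sum>e\<in>spectrum x. residue (\<lambda>z. resolvent x z $$ (i, j)) e) = 1\<^sub>m n $$ (i, j)"
proof -
 let ?R = "\<lambda>z. resolvent x z $$ (i, j)" and ?\<sigma> = "spectrum x" and ?d = "1\<^sub>m n $$ (i, j) :: complex"
 define a where "a = op_norm x"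
 define s where "s = (\<Sum>e\<in>?\<sigma>. residue ?R e)"
 have fin: "finite ?\<sigma>" using card_finite_spectrum[OF x] by simp
 have a0: "a \<ge> 0" unfolding a_def by (rule op_norm_nonneg[OF x])
 have sig: "cmod e \<le> a" if "e \<in> ?\<sigma>" for e
  unfolding a_def by (rule spectrum_eigenvector[OF x that]) (rule eigenvalue_le_op_norm[OF x])
 have eq: "z \<cdot>\<^sub>m resolvent x z - x * resolvent x z = 1\<^sub>m n" and Rc: "resolvent x z \<in> Mat n" "x * resolvent x z \<in> Mat n"
  if z: "z \<notin> ?\<sigma>" for z
 proof -
  note R = resolvent[OF x z]
  show "resolvent x z \<in> Mat n" "x * resolvent x z \<in> Mat n" using mult_carrier_mat[OF x R(2)] R(2) by auto
  have "(z \<cdot>\<^sub>m 1\<^sub>m n - x) * resolvent x z = z \<cdot>\<^sub>m resolvent x z - x * resolvent x z"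
   using R(2) x by (simp add: minus_mult_distrib_mat[of _ n n] mult_smult_assoc_mat[of _ n n _ n])
  then show "z \<cdot>\<^sub>m resolvent x z - x * resolvent x z = 1\<^sub>m n" using R(3) by simp
 qed
 \<comment> \<open>From z R - x R = 1: once |z| > 2 ||x||, the term x R is at most half of z R, so
   ||z R|| <= 2 and x R is of order 1/|z|.\<close>
 have xR: "cmod z * op_norm (x * resolvent x z) \<le> 2 * a" if z: "cmod z > 2 * a" for z
 proof -
  have z': "z \<notin> ?\<sigma>" using sig[of z] z a0 by auto
  note c = Rc[OF z']
  let ?r = "op_norm (resolvent x z)"
  have "cmod z * ?r = op_norm (z \<cdot>\<^sub>m resolvent x z)" using op_norm_smult[OF c(1)] by simp
  also have "\<dots> \<le> op_norm (x * resolvent x z) + op_norm (z \<cdot>\<^sub>m resolvent x z - x * resolvent x z)"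
   using c by (intro op_norm_le_add_diff[of _ n n]) auto
  also have "\<dots> \<le> a * ?r + 1" unfolding eq[OF z'] a_def by (intro add_mono op_norm_mult[OF x c(1)] op_norm_one_le)
  finally have 1: "cmod z * ?r \<le> a * ?r + 1" .
  have "2 * a * ?r \<le> cmod z * ?r" using z op_norm_nonneg[OF c(1)] by (intro mult_right_mono) auto
  then have "cmod z * ?r \<le> 2" using 1 by linarith
  then have 2: "a * (cmod z * ?r) \<le> a * 2" by (rule mult_left_mono[OF _ a0])
  have "cmod z * op_norm (x * resolvent x z) \<le> cmod z * (a * ?r)"
   unfolding a_def by (rule mult_left_mono[OF op_norm_mult[OF x c(1)] norm_ge_zero])
  then show ?thesis using 2 by (simp add: mult_ac)
 qed
 have bound: "cmod (2 * pi * \<i> * (s - ?d)) \<le> (2 * a / \<rho>^2) * (2 * pi * \<rho>)" if rho: "\<rho> > 2 * a" "\<rho> > 0" for \<rho>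
 proof -
  have hol: "?R holomorphic_on - ?\<sigma>" using holomorphic_on_resolvent[OF x ij] .
  have sig': "cmod e < \<rho>" if "e \<in> ?\<sigma>" for e using sig[OF that] rho by linarith
  have sb: "?\<sigma> \<inter> ball 0 \<rho> = ?\<sigma>" using sig' by (force simp: dist_norm)
  have "contour_integral (circlepath 0 \<rho>) ?R = 2 * pi * \<i> * (\<Sum>p\<in>?\<sigma> \<inter> ball 0 \<rho>. residue ?R p)"
   using rho sb by (intro residue_circle[OF fin, of _ "\<rho> + 1"] holomorphic_on_subset[OF hol]) auto
  then have ci: "contour_integral (circlepath 0 \<rho>) ?R = 2 * pi * \<i> * s" using sb s_def by simp
  have "?R contour_integrable_on (circlepath 0 \<rho>)"
  proof (rule contour_integrable_holomorphic_simple[of _ "- ?\<sigma>"])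
   show "path_image (circlepath 0 \<rho>) \<subseteq> - ?\<sigma>" using sig' rho by force
  qed (use hol fin in \<open>auto intro: finite_imp_closed\<close>)
  then have h1: "(?R has_contour_integral (2 * pi * \<i> * s)) (circlepath 0 \<rho>)"
   using ci has_contour_integral_integral by metis
  have h2: "((\<lambda>z. ?d / z) has_contour_integral (2 * pi * \<i> * ?d)) (circlepath 0 \<rho>)"
   using Cauchy_integral_circlepath_simple[of "\<lambda>_. ?d" 0 \<rho> 0] rho by simp
  have h: "((\<lambda>z. ?R z - ?d / z) has_contour_integral (2 * pi * \<i> * (s - ?d))) (circlepath 0 \<rho>)"
   using has_contour_integral_diff[OF h1 h2] by (simp add: algebra_simps)
  show ?thesis
  proof (rule has_contour_integral_bound_circlepath[OF h])
   fix z assume "cmod (z - 0) = \<rho>"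
   then have zr: "cmod z = \<rho>" by simp
   have z: "z \<notin> ?\<sigma>" "z \<noteq> 0" using sig' zr rho by force+
   have "(z \<cdot>\<^sub>m resolvent x z - x * resolvent x z) $$ (i, j) = z * ?R z - (x * resolvent x z) $$ (i, j)"
    using Rc[OF z(1)] ij carrier_matD[OF x] by auto
   then have "?R z - ?d / z = (x * resolvent x z) $$ (i, j) / z" unfolding eq[OF z(1)] using z(2) by (simp add: field_simps)
   then have "cmod (?R z - ?d / z) = cmod ((x * resolvent x z) $$ (i, j)) / \<rho>" using zr by (simp add: norm_divide)
   also have "\<dots> \<le> op_norm (x * resolvent x z) / \<rho>"
    using entry_le_op_norm[OF Rc(2)[OF z(1)] ij] rho by (intro divide_right_mono) auto
   also have "\<dots> \<le> 2 * a / \<rho>^2" using xR[of z] zr rho by (simp add: power2_eq_square field_simps)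
   finally show "cmod (?R z - ?d / z) \<le> 2 * a / \<rho>^2" .
  qed (use rho a0 in auto)
 qed
 have "s - ?d = 0"
 proof (rule ccontr)
  assume "s - ?d \<noteq> 0"
  define d where "d = cmod (s - ?d)"
  have d: "d > 0" using \<open>s - ?d \<noteq> 0\<close> by (simp add: d_def)
  \<comment> \<open>The bound amounts to \<open>d * \<rho> \<le> 2 * a\<close> for every admissible
    radius; this one exceeds both \<open>2 * a\<close> and \<open>2 * a / d\<close>.\<close>
  define \<rho> where "\<rho> = 2 * a + 2 * a / d + 1"
  have q: "2 * a / d \<ge> 0" using a0 d by simp
  then have rp: "\<rho> > 2 * a" "\<rho> > 0" unfolding \<rho>_def using a0 by linarith+
  have "2 * pi * d \<le> (2 * a / \<rho>^2) * (2 * pi * \<rho>)" using bound[OF rp] by (simp add: d_def norm_mult)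
  then have "d * \<rho> \<le> 2 * a" using rp by (simp add: power2_eq_square field_simps)
  then have "\<rho> \<le> 2 * a / d" using d by (simp add: field_simps)
  then show False using a0 by (simp add: \<rho>_def)
 qed
 then show ?thesis by (simp add: s_def)
qed

section \<open>Polynomials of a matrix and the polynomial form of the calculus\<close>

definition pm :: "complex poly => complex mat => complex mat" where
 "pm p x = fold_coeffs (\<lambda>a M. a \<cdot>\<^sub>m 1\<^sub>m (dim_row x) + x * M) p (0\<^sub>m (dim_row x) (dim_row x))"

lemma pm_0: "pm 0 x = 0\<^sub>m (dim_row x) (dim_row x)"
 by (simp add: pm_def)

lemma pm_pCons:
 assumes "x \<in> Mat n"
 shows "pm (pCons a p) x = a \<cdot>\<^sub>m 1\<^sub>m n + x * pm p x"
proof (cases "a = 0 \<and> p = 0")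
 case True
 have "0 \<cdot>\<^sub>m 1\<^sub>m n + x * 0\<^sub>m n n = 0\<^sub>m n n"
  using assms by (intro eq_matI) auto
 then show ?thesis using assms True by (simp add: pm_0)
next
 case False
 then show ?thesis using assms by (auto simp: pm_def)
qed

lemma pm_carrier [simp]: "x \<in> Mat n ==> pm p x \<in> Mat n"
 by (induction p) (auto simp: pm_0 pm_pCons)

lemma pm_dsum:
 assumes "x \<in> Mat n" "y \<in> Mat m"
 shows "pm p (mat_dsum x y) = mat_dsum (pm p x) (pm p y)"
proof (induction p)
 case 0
 then show ?case using assms by (simp add: pm_0 mat_dsum_zero mat_dsum_def)
next
 case (pCons a p)
 have "pm (pCons a p) (mat_dsum x y) = a \<cdot>\<^sub>m mat_dsum (1\<^sub>m n) (1\<^sub>m m) + mat_dsum x y * mat_dsum (pm p x) (pm p y)"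
  using assms pCons by (simp add: pm_pCons[of _ "n + m"] mat_dsum_one)
 also have "\<dots> = mat_dsum (pm (pCons a p) x) (pm (pCons a p) y)"
  using assms by (simp add: mat_dsum_mult[of _ n _ m] mat_dsum_add[of _ n _ m] mat_dsum_smult[of _ n _ m] pm_pCons)
 finally show ?case .
qed

lemma pm_conj:
 assumes "s \<in> GL n" "x \<in> Mat n"
 shows "pm p (conj_mat s x) = conj_mat s (pm p x)"
proof (induction p)
 case 0
 then show ?case using carrier_matD[OF assms(2)] carrier_matD[OF conj_mat_carrier[OF assms]] conj_mat_zero[OF assms(1)] by (simp add: pm_0)
next
 case (pCons a p)
 then show ?case using assms
  by (simp add: pm_pCons[of _ n] conj_mat_add[OF assms(1)] conj_mat_mult[OF assms(1)] conj_mat_smult[OF assms(1)] conj_mat_one[OF assms(1)])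
qed

lemma pm_commute:
 assumes x: "x \<in> Mat n" and y: "y \<in> Mat n" and xy: "x * y = y * x"
 shows "pm p x * y = y * pm p x"
proof (induction p)
 case 0
 then show ?case using assms by (simp add: pm_0)
next
 case (pCons a p)
 have "x * pm p x * y = x * (y * pm p x)" using x y pCons by (simp add: assoc_mult_mat[of _ n n _ n _ n])
 also have "\<dots> = y * (x * pm p x)"
  unfolding assoc_mult_mat[OF x y pm_carrier[OF x], symmetric] xy by (rule assoc_mult_mat[OF y x pm_carrier[OF x]])
 finally have e: "x * pm p x * y = y * (x * pm p x)" .
 have c: "a \<cdot>\<^sub>m 1\<^sub>m n \<in> Mat n" "x * pm p x \<in> Mat n" using x by auto
 have "pm (pCons a p) x * y = (a \<cdot>\<^sub>m 1\<^sub>m n) * y + x * pm p x * y"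
  unfolding pm_pCons[OF x] by (rule add_mult_distrib_mat[OF c y])
 also have "(a \<cdot>\<^sub>m 1\<^sub>m n) * y = y * (a \<cdot>\<^sub>m 1\<^sub>m n)"
  using y by (simp add: mult_smult_distrib[of _ n n _ n] mult_smult_assoc_mat[of _ n n _ n])
 also have "y * (a \<cdot>\<^sub>m 1\<^sub>m n) + x * pm p x * y = y * pm (pCons a p) x"
  unfolding e pm_pCons[OF x] by (rule mult_add_distrib_mat[OF y c, symmetric])
 finally show ?case .
qed

lemma smult_mat_mult_vec:
 fixes A :: "complex mat"
 assumes "A \<in> carrier_mat n m" "y \<in> carrier_vec m"
 shows "(a \<cdot>\<^sub>m A) *\<^sub>v y = a \<cdot>\<^sub>v (A *\<^sub>v y)"
 using assms by (intro eq_vecI) auto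

lemma pm_eigvec:
 assumes x: "x \<in> Mat n" and y: "y \<in> carrier_vec n" and xy: "x *\<^sub>v y = c \<cdot>\<^sub>v y"
 shows "pm p x *\<^sub>v y = poly p c \<cdot>\<^sub>v y"
proof (induction p)
 case 0
 then show ?case using x y by (simp add: pm_0) (intro eq_vecI, auto)
next
 case (pCons a p)
 have "x *\<^sub>v (pm p x *\<^sub>v y) = poly p c \<cdot>\<^sub>v (c \<cdot>\<^sub>v y)"
  using x y pCons xy by (simp add: mult_mat_vec[of _ n n])
 then have "pm (pCons a p) x *\<^sub>v y = a \<cdot>\<^sub>v y + poly p c \<cdot>\<^sub>v (c \<cdot>\<^sub>v y)"
  using x y by (simp add: pm_pCons add_mult_distrib_mat_vec[of _ n n] assoc_mult_mat_vec[of _ n n _ n] smult_mat_mult_vec[of _ n n])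
 then show ?case using y by (auto intro!: eq_vecI simp: algebra_simps)
qed

context hc_setting
begin

lemma calculus_dims [simp]:
 "dim_row x = n" "dim_col x = n" "dim_row (hol_calculus f x) = n" "dim_col (hol_calculus f x) = n"
 "dim_row (pm p x) = n" "dim_col (pm p x) = n" "x * 1\<^sub>m n = x" "pm p x * 1\<^sub>m n = pm p x"
 "0\<^sub>m n n * hol_calculus f x = 0\<^sub>m n n" "pm p x + 0\<^sub>m n n = pm p x"
 "pm p x * hol_calculus f x + 0\<^sub>m n n = pm p x * hol_calculus f x"
 using carrier_matD[OF x] carrier_matD[OF hc_carrier[OF x, of f]] carrier_matD[OF pm_carrier[OF x, of p]]
  right_mult_one_mat[OF x] right_mult_one_mat[OF pm_carrier[OF x, of p]] left_mult_zero_mat[OF hc_carrier[OF x, of f]]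
  right_add_zero_mat[OF pm_carrier[OF x, of p]]
  right_add_zero_mat[OF mult_carrier_mat[OF pm_carrier[OF x, of p] hc_carrier[OF x, of f]]] by auto

text \<open>Horner's recursion reduces this to \<open>hc_add\<close>, \<open>hc_scale\<close> and
  \<open>hc_times\<close>. The factor \<open>h\<close> is carried along because remainders Q h of a
  division have to be evaluated before the calculus is known to be multiplicative.\<close>

lemma hc_poly_mult:
 assumes h: "h holomorphic_on \<Omega>"
 shows "hol_calculus (\<lambda>z. poly p z * h z) x = pm p x * hol_calculus h x"
proof (induction p)
 case 0
 have "hol_calculus (\<lambda>z. 0 * h z) x = 0 \<cdot>\<^sub>m hol_calculus h x" using h by (rule hc_scale)
 also have "\<dots> = 0\<^sub>m n n" by (intro eq_matI) auto
 finally show ?case by (simp add: pm_0)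
next
 case (pCons a p)
 have ph: "(\<lambda>z. poly p z * h z) holomorphic_on \<Omega>" using h by (intro holomorphic_intros)
 have "hol_calculus (\<lambda>z. poly (pCons a p) z * h z) x = hol_calculus (\<lambda>z. a * h z + z * (poly p z * h z)) x"
  by (intro arg_cong[of _ _ "\<lambda>f. hol_calculus f x"]) (auto simp: algebra_simps)
 also have "\<dots> = a \<cdot>\<^sub>m hol_calculus h x + x * (pm p x * hol_calculus h x)"
  using h ph pCons by (subst hc_add) (auto intro!: holomorphic_intros simp: hc_scale hc_times)
 also have "\<dots> = pm (pCons a p) x * hol_calculus h x"
 proof -
  let ?H = "hol_calculus h x"
  have H: "?H \<in> Mat n" by (rule hc_carrier[OF x])
  have c: "a \<cdot>\<^sub>m 1\<^sub>m n \<in> Mat n" "x * pm p x \<in> Mat n"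
   using mult_carrier_mat[OF x pm_carrier[OF x]] by auto
  have "pm (pCons a p) x * ?H = (a \<cdot>\<^sub>m 1\<^sub>m n) * ?H + x * pm p x * ?H"
   unfolding pm_pCons[OF x] by (rule add_mult_distrib_mat[OF c H])
  also have "x * pm p x * ?H = x * (pm p x * ?H)" by (rule assoc_mult_mat[OF x pm_carrier[OF x] H])
  also have "(a \<cdot>\<^sub>m 1\<^sub>m n) * ?H = a \<cdot>\<^sub>m ?H"
   using mult_smult_assoc_mat[OF one_carrier_mat H, of a] left_mult_one_mat[OF H] by simp
  finally show ?thesis by simp
 qed
 finally show ?case .
qed

lemma hc_one: "hol_calculus (\<lambda>z. 1) x = 1\<^sub>m n"
 using hc_entry[OF x, of _ _ "\<lambda>z. 1"] sum_residues_resolvent[OF x] hc_carrier[OF x, of "\<lambda>z. 1"]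
 by (intro eq_matI) auto

lemma hc_poly: "hol_calculus (poly p) x = pm p x"
 using hc_poly_mult[of "\<lambda>z. 1" p] hc_one by simp

text \<open>Read off from the calculus instead of an induction: evaluation of a polynomial is the
  calculus of its polynomial function, for which products are already available.\<close>

lemma pm_mult: "pm (p * q) x = pm p x * pm q x"
proof -
 have "(\<lambda>z. poly p z * poly q z) = poly (p * q)" by auto
 then show ?thesis using hc_poly_mult[of "poly q" p] by (simp add: hc_poly holomorphic_intros)
qed

lemma pm_add: "pm (p + q) x = pm p x + pm q x"
proof -
 have "(\<lambda>z. poly p z + poly q z) = poly (p + q)" by auto
 then show ?thesis using hc_add[of "poly p" "poly q"] by (simp add: hc_poly holomorphic_intros)
qed

text \<open>The characteristic polynomial cancels the denominator of the resolvent. What remains is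
  an entry of the adjugate, which is entire in \<open>z\<close> and has no residues.\<close>

lemma cayley_hamilton_pm: "pm (char_poly x) x = 0\<^sub>m n n"
proof (rule eq_matI)
 fix i j assume "i < dim_row (0\<^sub>m n n :: complex mat)" "j < dim_col (0\<^sub>m n n :: complex mat)"
 then have ij: "i < n" "j < n" by auto
 have "residue (\<lambda>z. poly (char_poly x) z * resolvent x z $$ (i, j)) e = 0" if e: "e \<in> spectrum x" for e
 proof -
  have "residue (\<lambda>z. poly (char_poly x) z * resolvent x z $$ (i, j)) e = residue (\<lambda>z. adj_mat (z \<cdot>\<^sub>m 1\<^sub>m n - x) $$ (i, j)) e"
  proof (rule residue_eqI[OF e])
   fix z assume "z \<in> \<Omega> - spectrum x"
   then have z: "z \<notin> spectrum x" by simp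
   then have "poly (char_poly x) z \<noteq> 0" using spectrum_root[OF x] by auto
   moreover have "resolvent x z $$ (i, j) = inverse (poly (char_poly x) z) * adj_mat (z \<cdot>\<^sub>m 1\<^sub>m n - x) $$ (i, j)"
    using adj_mat(1)[of "z \<cdot>\<^sub>m 1\<^sub>m n - x" n] ij by (simp add: resolvent(1)[OF x z])
   ultimately show "poly (char_poly x) z * resolvent x z $$ (i, j) = adj_mat (z \<cdot>\<^sub>m 1\<^sub>m n - x) $$ (i, j)" by simp
  qed
  also have "\<dots> = 0" using holomorphic_on_adj[OF x ij, of UNIV] by (intro residue_holo[of UNIV]) auto
  finally show ?thesis .
 qed
 then show "pm (char_poly x) x $$ (i, j) = 0\<^sub>m n n $$ (i, j)"
  using ij by (simp add: hc_poly[symmetric] hc_entry[OF x ij])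
qed (use carrier_matD[OF pm_carrier[OF x]] in auto)

text \<open>\<open>Q\<close> may be any polynomial that annihilates \<open>x\<close>, not only its
  characteristic polynomial. A single division can thus serve several matrices, such as the summands
  of a direct sum.\<close>

lemma hc_eq_pm:
 assumes f: "\<And>z. z \<in> \<Omega> ==> f z = poly p z + poly Q z * h z" and Q: "pm Q x = 0\<^sub>m n n" and h: "h holomorphic_on \<Omega>"
 shows "hol_calculus f x = pm p x"
proof -
 have "hol_calculus f x = hol_calculus (\<lambda>z. poly p z + poly Q z * h z) x"
  using f by (rule hc_cong)
 also have "\<dots> = pm p x + pm Q x * hol_calculus h x"
  using h by (subst hc_add) (auto intro!: holomorphic_intros simp: hc_poly hc_poly_mult)
 also have "\<dots> = pm p x" using Q by simp
 finally show ?thesis .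
qed

text \<open>Newton's divided differences: splitting off a node \<open>e\<close> replaces the
  holomorphic remainder \<open>h\<close> by its difference quotient at \<open>e\<close>, which is
  holomorphic again. Repeated nodes are allowed and account for multiplicities.\<close>

lemma newton_interpolation:
 assumes "f holomorphic_on \<Omega>" "set es \<subseteq> \<Omega>"
 shows "\<exists>p h. h holomorphic_on \<Omega> \<and> (\<forall>z\<in>\<Omega>. f z = poly p z + poly (\<Prod>e\<leftarrow>es. [:- e, 1:]) z * h z)"
 using assms(2)
proof (induction es)
 case Nil
 then show ?case using assms(1) by (intro exI[of _ 0] exI[of _ f]) auto
next
 case (Cons e es)
 let ?Q = "\<Prod>e\<leftarrow>es. [:- e, 1:]"
 obtain p h where h: "h holomorphic_on \<Omega>" and eq: "\<And>z. z \<in> \<Omega> ==> f z = poly p z + poly ?Q z * h z"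
  using Cons by auto
 define h' where "h' = (\<lambda>z. if z = e then deriv h e else (h z - h e) / (z - e))"
 have h': "h' holomorphic_on \<Omega>" unfolding h'_def using h op by (rule pole_lemma_open)
 have "h z = h e + (z - e) * h' z" for z by (simp add: h'_def)
 then have "f z = poly (p + Polynomial.smult (h e) ?Q) z + poly (\<Prod>e\<leftarrow>e # es. [:- e, 1:]) z * h' z"
  if "z \<in> \<Omega>" for z
 proof -
  have "f z = poly p z + poly ?Q z * (h e + (z - e) * h' z)"
   using eq[OF that] \<open>\<And>z. h z = h e + (z - e) * h' z\<close> by metis
  then show ?thesis by (simp add: algebra_simps)
 qed
 then show ?case using h' by blast
qed

lemma char_poly_division:
 assumes f: "f holomorphic_on \<Omega>"
 obtains p h where "h holomorphic_on \<Omega>" "\<And>z. z \<in> \<Omega> ==> f z = poly p z + poly (char_poly x) z * h z"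
proof -
 obtain es where es: "char_poly x = (\<Prod>e\<leftarrow>es. [:- e, 1:])" using char_poly_factorized[OF x] by auto
 have "set es \<subseteq> spectrum x" using spectrum_root[OF x] es by (auto simp: poly_prod_list prod_list_zero_iff image_iff)
 then have "set es \<subseteq> \<Omega>" using sub by auto
 from newton_interpolation[OF f this] show ?thesis using that es by auto
qed

lemma hc_pm:
 assumes f: "f holomorphic_on \<Omega>"
 obtains p where "hol_calculus f x = pm p x"
 using char_poly_division[OF f] hc_eq_pm[OF _ cayley_hamilton_pm] by metis

text \<open>It suffices to divide \<open>f\<close> by the characteristic polynomial: the remainder,
  also after multiplication by \<open>g\<close>, is killed by the theorem of Cayley and Hamilton,
  and for a polynomial factor the claim is \<open>hc_poly_mult\<close>.\<close>

lemma hc_mult: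
 assumes f: "f holomorphic_on \<Omega>" and g: "g holomorphic_on \<Omega>"
 shows "hol_calculus (\<lambda>z. f z * g z) x = hol_calculus f x * hol_calculus g x"
proof -
 let ?Q = "char_poly x"
 obtain p h where h: "h holomorphic_on \<Omega>" and eq: "\<And>z. z \<in> \<Omega> ==> f z = poly p z + poly ?Q z * h z"
  using char_poly_division[OF f] by blast
 have "hol_calculus (\<lambda>z. f z * g z) x = hol_calculus (\<lambda>z. poly p z * g z + poly ?Q z * (h z * g z)) x"
  using eq by (intro hc_cong) (simp add: algebra_simps)
 also have "\<dots> = pm p x * hol_calculus g x + pm ?Q x * hol_calculus (\<lambda>z. h z * g z) x"
  using g h holomorphic_on_mult[OF h g] by (subst hc_add) (auto intro!: holomorphic_intros simp: hc_poly_mult)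
 also have "\<dots> = pm p x * hol_calculus g x"
  by (simp add: cayley_hamilton_pm)
 also have "pm p x = hol_calculus f x" using hc_eq_pm[OF eq cayley_hamilton_pm h] by simp
 finally show ?thesis .
qed

lemma hc_id: "hol_calculus (\<lambda>z. z) x = x"
 using hc_times[of "\<lambda>z. 1"] hc_one by simp

text \<open>The characteristic polynomial vanishes at the eigenvalue \<open>c\<close>, so
  \<open>f\<close> and its interpolation polynomial have the same value there.\<close>

lemma hc_eigvec:
 assumes f: "f holomorphic_on \<Omega>" and y: "y \<in> carrier_vec n" "y \<noteq> 0\<^sub>v n" and xy: "x *\<^sub>v y = c \<cdot>\<^sub>v y"
 shows "hol_calculus f x *\<^sub>v y = f c \<cdot>\<^sub>v y"
proof -
 have c: "c \<in> spectrum x" using y xy carrier_matD[OF x] unfolding spectrum_def eigenvalue_def eigenvector_def by auto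
 obtain p h where h: "h holomorphic_on \<Omega>" and eq: "\<And>z. z \<in> \<Omega> ==> f z = poly p z + poly (char_poly x) z * h z"
  using char_poly_division[OF f] by blast
 have "f c = poly p c" using eq[of c] c sub spectrum_root[OF x, of c] by auto
 then show ?thesis using hc_eq_pm[OF eq cayley_hamilton_pm h] pm_eigvec[OF x y(1) xy] by simp
qed

end

section \<open>Spectra and the calculus under direct sums, similarities and squares\<close>

lemma spectrum_four_block:
 fixes A B D :: "complex mat"
 assumes A: "A \<in> Mat n" and B: "B \<in> carrier_mat n m" and D: "D \<in> Mat m"
 shows "spectrum (four_block_mat A B (0\<^sub>m m n) D) = spectrum A \<union> spectrum D"
proof -
 let ?F = "four_block_mat A B (0\<^sub>m m n) D"
 have F: "?F \<in> carrier_mat (n + m) (n + m)" using assms by auto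
 have "poly (char_poly ?F) z = poly (char_poly A) z * poly (char_poly D) z" for z
 proof -
  have "z \<cdot>\<^sub>m 1\<^sub>m (n + m) - ?F = four_block_mat (z \<cdot>\<^sub>m 1\<^sub>m n - A) (- B) (0\<^sub>m m n) (z \<cdot>\<^sub>m 1\<^sub>m m - D)"
   using assms by (intro eq_matI) auto
  then show ?thesis unfolding poly_char_poly[OF F] poly_char_poly[OF A] poly_char_poly[OF D]
   using assms by (simp add: det_four_block_mat_lower_left_zero[of _ n _ m])
 qed
 then show ?thesis using spectrum_root[OF F] spectrum_root[OF A] spectrum_root[OF D] by auto
qed

lemma spectrum_dsum:
 assumes "A \<in> Mat n" "D \<in> Mat m"
 shows "spectrum (mat_dsum A D) = spectrum A \<union> spectrum D"
 using spectrum_four_block[OF assms(1) zero_carrier_mat assms(2)] assms by (simp add: mat_dsum_eq[of _ n _ m])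

lemma spectrum_conj:
 assumes "s \<in> GL n" "x \<in> Mat n"
 shows "spectrum (conj_mat s x) = spectrum x"
proof -
 note s = GL_D[OF assms(1)]
 have "similar_mat_wit (conj_mat s x) x (mat_inv s) s"
  using s assms unfolding similar_mat_wit_def Let_def conj_mat_def by auto
 then have "similar_mat (conj_mat s x) x" unfolding similar_mat_def by blast
 then have "char_poly (conj_mat s x) = char_poly x" by (rule char_poly_similar)
 then show ?thesis using spectrum_root[OF assms(2)] spectrum_root[OF conj_mat_carrier[OF assms]] by auto
qed

text \<open>One division by the characteristic polynomial of the direct sum serves all three
  matrices, since that polynomial annihilates each summand. The claim is thereby reduced to one
  interpolation polynomial.\<close>

lemma hc_dsum:
 assumes x: "x \<in> Mat n" and y: "y \<in> Mat m" and op: "open \<Omega>"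
  and sub: "spectrum x \<subseteq> \<Omega>" "spectrum y \<subseteq> \<Omega>" and f: "f holomorphic_on \<Omega>"
 shows "hol_calculus f (mat_dsum x y) = mat_dsum (hol_calculus f x) (hol_calculus f y)"
proof -
 let ?w = "mat_dsum x y"
 interpret x: hc_setting x n \<Omega> using assms by unfold_locales auto
 interpret y: hc_setting y m \<Omega> using assms by unfold_locales auto
 interpret w: hc_setting ?w "n + m" \<Omega> using assms spectrum_dsum[OF x y] by unfold_locales auto
 obtain p h where h: "h holomorphic_on \<Omega>" and eq: "\<And>z. z \<in> \<Omega> ==> f z = poly p z + poly (char_poly ?w) z * h z"
  using w.char_poly_division[OF f] by blast
 have "mat_dsum (pm (char_poly ?w) x) (pm (char_poly ?w) y) = mat_dsum (0\<^sub>m n n) (0\<^sub>m m m)"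
  using w.cayley_hamilton_pm by (simp add: pm_dsum[OF x y] mat_dsum_zero)
 from mat_dsum_inj[OF this, of n m] have z: "pm (char_poly ?w) x = 0\<^sub>m n n" "pm (char_poly ?w) y = 0\<^sub>m m m"
  using x y by auto
 show ?thesis using w.hc_eq_pm[OF eq w.cayley_hamilton_pm h] x.hc_eq_pm[OF eq z(1) h] y.hc_eq_pm[OF eq z(2) h]
  by (simp add: pm_dsum[OF x y])
qed

lemma hc_conj:
 assumes x: "x \<in> Mat n" and s: "s \<in> GL n" and op: "open \<Omega>" and sub: "spectrum x \<subseteq> \<Omega>" and f: "f holomorphic_on \<Omega>"
 shows "hol_calculus f (conj_mat s x) = conj_mat s (hol_calculus f x)"
proof -
 interpret x: hc_setting x n \<Omega> using assms by unfold_locales auto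
 interpret y: hc_setting "conj_mat s x" n \<Omega> using assms spectrum_conj[OF s x] by unfold_locales auto
 obtain p h where h: "h holomorphic_on \<Omega>" and eq: "\<And>z. z \<in> \<Omega> ==> f z = poly p z + poly (char_poly x) z * h z"
  using x.char_poly_division[OF f] by blast
 have "pm (char_poly x) (conj_mat s x) = 0\<^sub>m n n"
  using x.cayley_hamilton_pm pm_conj[OF s x] conj_mat_zero[OF s] by simp
 from y.hc_eq_pm[OF eq this h] x.hc_eq_pm[OF eq x.cayley_hamilton_pm h] show ?thesis
  by (simp add: pm_conj[OF s x])
qed

lemma pm_square:
 assumes v: "v \<in> Mat n"
 shows "pm (pcompose p [:0, 0, 1:]) v = pm p (v * v)"
proof -
 interpret hc_setting v n UNIV using v by unfold_locales auto
 have v2: "v * v \<in> Mat n" by (rule mult_carrier_mat[OF v v])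
 show ?thesis
 proof (induction p)
  case 0
  then show ?case using carrier_matD[OF v] by (simp add: pm_0)
 next
  case (pCons a p)
  have "pm [:0, 0, 1:] v = v * v"
  proof -
   have z: "0 \<cdot>\<^sub>m 1\<^sub>m n + A = A" if "A \<in> Mat n" for A :: "complex mat"
    using that by (intro eq_matI) auto
   have o: "1 \<cdot>\<^sub>m 1\<^sub>m n = (1\<^sub>m n :: complex mat)" by (intro eq_matI) auto
   have "pm [:1:] v = 1\<^sub>m n" using v o by (simp add: pm_pCons[OF v] pm_0)
   then have "pm [:0, 1:] v = v" using z[OF v] v by (simp add: pm_pCons[OF v])
   then show ?thesis using z[OF v2] by (simp add: pm_pCons[OF v])
  qed
  moreover have "pm [:a:] v = a \<cdot>\<^sub>m 1\<^sub>m n"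
   using right_mult_zero_mat[OF v, of n] right_add_zero_mat[OF smult_carrier_mat[OF one_carrier_mat], of a n] v
   by (simp add: pm_pCons[OF v] pm_0)
  ultimately show ?case by (simp only: pcompose_pCons pm_add pm_mult pm_pCons[OF v2] pCons)
 qed
qed

text \<open>Divide f = p + Q h by the characteristic polynomial Q of v^2 and substitute z^2: on
  \<open>N\<close> the identity function becomes p(z^2) + Q(z^2) h(z^2). As Q(z^2) annihilates
  \<open>v\<close>, this gives v = p(v^2), and p(v^2) is the value of the calculus.\<close>

lemma hc_sqrt:
 assumes v: "v \<in> Mat n" and \<Omega>: "open \<Omega>" "spectrum (v * v) \<subseteq> \<Omega>" and f: "f holomorphic_on \<Omega>"
  and N: "open N" "spectrum v \<subseteq> N" "\<And>z. z \<in> N ==> z\<^sup>2 \<in> \<Omega> \<and> f (z\<^sup>2) = z"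
 shows "hol_calculus f (v * v) = v"
proof -
 interpret x: hc_setting "v * v" n \<Omega> using v \<Omega> by unfold_locales auto
 interpret v: hc_setting v n N using v N by unfold_locales auto
 let ?Q = "char_poly (v * v)"
 obtain p h where h: "h holomorphic_on \<Omega>" and eq: "\<And>z. z \<in> \<Omega> ==> f z = poly p z + poly ?Q z * h z"
  using x.char_poly_division[OF f] by blast
 have "(\<lambda>z. h (z\<^sup>2)) holomorphic_on N"
  using N(3) by (intro holomorphic_on_compose_gen[of "\<lambda>z. z\<^sup>2" N h \<Omega>, unfolded o_def] h holomorphic_intros) auto
 moreover have "z = poly (pcompose p [:0, 0, 1:]) z + poly (pcompose ?Q [:0, 0, 1:]) z * h (z\<^sup>2)" if "z \<in> N" for z
  using eq[of "z\<^sup>2"] N(3)[OF that] by (simp add: poly_pcompose power2_eq_square)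
 ultimately have "hol_calculus (\<lambda>z. z) v = pm (pcompose p [:0, 0, 1:]) v"
  using x.cayley_hamilton_pm pm_square[OF v, of ?Q] by (intro v.hc_eq_pm[where Q = "pcompose ?Q [:0, 0, 1:]"]) auto
 then have "v = pm p (v * v)" using v.hc_id pm_square[OF v] by simp
 also have "\<dots> = hol_calculus f (v * v)" using x.hc_eq_pm[OF eq x.cayley_hamilton_pm h] by simp
 finally show ?thesis by simp
qed

section \<open>Points, free polynomials and the free topology\<close>

definition pts :: "nat => nat => nc_point set" where
 "pts d n = {x. length x = d \<and> set x \<subseteq> Mat n}"

lemma nc_space_pts: "nc_space d = (\<Union>n\<in>{1..}. pts d n)"
 by (auto simp: nc_space_def pts_def)

lemma ptsD: "x \<in> pts d n ==> length x = d" "x \<in> pts d n ==> i < d ==> x ! i \<in> Mat n"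
 by (auto simp: pts_def)

lemma ptsI: "length x = d ==> (\<And>i. i < d ==> x ! i \<in> Mat n) ==> x \<in> pts d n"
 by (auto simp: pts_def in_set_conv_nth)

lemma pts_mlevel: "x \<in> pts d n ==> d > 0 ==> mlevel x = n"
 by (cases x) (auto simp: pts_def mlevel_def)

lemma nc_space_iff: "d > 0 ==> x \<in> nc_space d \<longleftrightarrow> x \<in> pts d (mlevel x) \<and> mlevel x \<ge> 1"
 by (auto simp: nc_space_pts pts_mlevel)

lemma pts_nc_space: "x \<in> pts d n ==> n \<ge> 1 ==> x \<in> nc_space d"
 by (auto simp: nc_space_pts)

lemma length_dsum: "length x = d ==> length y = d ==> length (point_dsum x y) = d"
 by (simp add: point_dsum_def)

lemma nth_dsum: "length x = d ==> length y = d ==> i < d ==> point_dsum x y ! i = mat_dsum (x ! i) (y ! i)"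
 by (simp add: point_dsum_def)

lemma pts_dsum [simp]: "x \<in> pts d n ==> y \<in> pts d m ==> point_dsum x y \<in> pts d (n + m)"
 by (intro ptsI) (auto simp: length_dsum nth_dsum ptsD)

lemma pts_conj [simp]: "x \<in> pts d n ==> s \<in> GL n ==> conj_point s x \<in> pts d n"
 by (intro ptsI) (auto simp: conj_point_def ptsD)

lemma nth_conj: "length x = d ==> i < d ==> conj_point s x ! i = conj_mat s (x ! i)"
 by (simp add: conj_point_def)

lemma point_eqI: "x \<in> pts d n ==> y \<in> pts d m ==> (\<And>i. i < d ==> x ! i = y ! i) ==> x = y"
 by (rule nth_equalityI) (auto simp: ptsD)

lemma nc_space_dsum: "d > 0 ==> x \<in> nc_space d ==> y \<in> nc_space d ==> point_dsum x y \<in> nc_space d"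
 using pts_dsum pts_nc_space by (metis (no_types, lifting) nc_space_iff trans_le_add1)

lemma eval_word_simps [simp]:
 "eval_word [] x = 1\<^sub>m (mlevel x)" "eval_word (i # w) x = x ! i * eval_word w x"
 by (simp_all add: eval_word_def)

lemma eval_word_carrier:
 assumes "x \<in> pts d n" "d > 0" "set w \<subseteq> {..<d}"
 shows "eval_word w x \<in> Mat n"
 using assms(3) by (induction w) (auto simp: pts_mlevel[OF assms(1,2)] intro!: mult_carrier_mat[of _ n n] ptsD(2)[OF assms(1)])

text \<open>By \<open>pf_eval_poly\<close> and \<open>pf_poly\<close> these are exactly the
  functions that agree on \<open>nc_space d\<close> with a free polynomial. Products and
  substitutions can be treated pointwise in this form, without a convolution of coefficient
  families; the last clause leaves the values elsewhere arbitrary.\<close>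

inductive pf :: "nat => (nc_point => complex mat) => bool" for d where
 word: "set w \<subseteq> {..<d} ==> pf d (\<lambda>x. c \<cdot>\<^sub>m eval_word w x)"
| add: "pf d g ==> pf d h ==> pf d (\<lambda>x. g x + h x)"
| cong: "pf d g ==> (\<And>x. x \<in> nc_space d ==> h x = g x) ==> pf d h"

lemma pf_carrier:
 assumes "pf d g" "x \<in> pts d n" "d > 0" "n \<ge> 1"
 shows "g x \<in> Mat n"
 using assms(1)
proof induction
 case (word w c)
 then show ?case using eval_word_carrier[OF assms(2,3)] by simp
next
 case (cong g h)
 then show ?case using pts_nc_space[OF assms(2,4)] by simp
qed auto

lemma pf_eval_poly:
 assumes d: "d > 0" and p: "free_poly_in d p"
 shows "pf d (eval_poly p)"
proof -
 have "pf d (\<lambda>x. Matrix.mat (mlevel x) (mlevel x) (\<lambda>ij. \<Sum>w\<in>K. Poly_Mapping.lookup p w * eval_word w x $$ ij))"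
  if "finite K" "\<forall>w\<in>K. set w \<subseteq> {..<d}" for K
  using that
 proof (induction K rule: finite_induct)
  case empty
  show ?case
  proof (rule pf.cong[OF pf.word[of "[]" d 0]])
   fix x assume "x \<in> nc_space d"
   show "Matrix.mat (mlevel x) (mlevel x) (\<lambda>ij. \<Sum>w\<in>{}. Poly_Mapping.lookup p w * eval_word w x $$ ij) = 0 \<cdot>\<^sub>m eval_word [] x"
    by (intro eq_matI) auto
  qed auto
 next
  case (insert w K)
  then have *: "pf d (\<lambda>x. Matrix.mat (mlevel x) (mlevel x) (\<lambda>ij. \<Sum>w\<in>K. Poly_Mapping.lookup p w * eval_word w x $$ ij))" by simp
  show ?case
  proof (rule pf.cong[OF pf.add[OF pf.word[of w d "Poly_Mapping.lookup p w"] *]])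
   fix x assume "x \<in> nc_space d"
   then have x: "x \<in> pts d (mlevel x)" using d by (simp add: nc_space_iff)
   have e: "eval_word w x \<in> carrier_mat (mlevel x) (mlevel x)" using eval_word_carrier[OF x d] insert by simp
   show "Matrix.mat (mlevel x) (mlevel x) (\<lambda>ij. \<Sum>w\<in>insert w K. Poly_Mapping.lookup p w * eval_word w x $$ ij) =
    Poly_Mapping.lookup p w \<cdot>\<^sub>m eval_word w x +
    Matrix.mat (mlevel x) (mlevel x) (\<lambda>ij. \<Sum>w\<in>K. Poly_Mapping.lookup p w * eval_word w x $$ ij)"
    using insert(1,2) e by (intro eq_matI) auto
  qed (use insert in auto)
 qed
 from this[of "Poly_Mapping.keys p"] show ?thesis
  using p unfolding free_poly_in_def by (simp add: eval_poly_def[abs_def])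
qed

lemma eval_poly_superset:
 assumes "finite K" "Poly_Mapping.keys p \<subseteq> K" "i < mlevel x" "j < mlevel x"
 shows "eval_poly p x $$ (i, j) = (\<Sum>w\<in>K. Poly_Mapping.lookup p w * eval_word w x $$ (i, j))"
 using assms by (simp add: eval_poly_def) (intro sum.mono_neutral_left, auto simp: in_keys_iff)

lemma pf_poly:
 assumes "pf d g" and d: "d > 0"
 shows "\<exists>p. free_poly_in d p \<and> (\<forall>x\<in>nc_space d. eval_poly p x = g x)"
 using assms(1)
proof induction
 case (word w c)
 show ?case
 proof (intro exI[of _ "Poly_Mapping.single w c"] conjI ballI)
  show "free_poly_in d (Poly_Mapping.single w c)" using word by (auto simp: free_poly_in_def)
  fix x assume "x \<in> nc_space d"
  then have x: "x \<in> pts d (mlevel x)" using d by (simp add: nc_space_iff)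
  have e: "eval_word w x \<in> carrier_mat (mlevel x) (mlevel x)" using eval_word_carrier[OF x d word] .
  show "eval_poly (Poly_Mapping.single w c) x = c \<cdot>\<^sub>m eval_word w x"
  proof (rule eq_matI)
   fix i j assume "i < dim_row (c \<cdot>\<^sub>m eval_word w x)" "j < dim_col (c \<cdot>\<^sub>m eval_word w x)"
   then have ij: "i < mlevel x" "j < mlevel x" using e by auto
   show "eval_poly (Poly_Mapping.single w c) x $$ (i, j) = (c \<cdot>\<^sub>m eval_word w x) $$ (i, j)"
    using ij e by (subst eval_poly_superset[of "{w}"]) auto
  qed (use e in \<open>auto simp: eval_poly_def\<close>)
 qed
next
 case (add g h)
 then obtain p q where p: "free_poly_in d p" "\<And>x. x \<in> nc_space d ==> eval_poly p x = g x"
  and q: "free_poly_in d q" "\<And>x. x \<in> nc_space d ==> eval_poly q x = h x" by auto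
 show ?case
 proof (intro exI[of _ "p + q"] conjI ballI)
  show "free_poly_in d (p + q)" using p(1) q(1) Poly_Mapping.keys_add[of p q] by (auto simp: free_poly_in_def)
  fix x assume x: "x \<in> nc_space d"
  let ?K = "Poly_Mapping.keys p \<union> Poly_Mapping.keys q"
  have "eval_poly (p + q) x = eval_poly p x + eval_poly q x"
  proof (rule eq_matI)
   fix i j assume "i < dim_row (eval_poly p x + eval_poly q x)" "j < dim_col (eval_poly p x + eval_poly q x)"
   then have ij: "i < mlevel x" "j < mlevel x" by (auto simp: eval_poly_def)
   have "eval_poly (p + q) x $$ (i, j) = eval_poly p x $$ (i, j) + eval_poly q x $$ (i, j)"
    using ij Poly_Mapping.keys_add[of p q]
    by (simp add: eval_poly_superset[of ?K] lookup_add distrib_right sum.distrib)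
   also have "\<dots> = (eval_poly p x + eval_poly q x) $$ (i, j)" using ij by (simp add: eval_poly_def)
   finally show "eval_poly (p + q) x $$ (i, j) = (eval_poly p x + eval_poly q x) $$ (i, j)" .
  qed (auto simp: eval_poly_def)
  then show "eval_poly (p + q) x = g x + h x" using p q x by simp
 qed
next
 case (cong g h)
 then show ?case by auto
qed

lemma pf_scale:
 assumes "pf d g" "d > 0"
 shows "pf d (\<lambda>x. c \<cdot>\<^sub>m g x)"
 using assms(1)
proof induction
 case (word w b)
 show ?case by (rule pf.cong[OF pf.word[OF word, of "c * b"]]) (auto intro!: eq_matI)
next
 case (add g h)
 have "pf d (\<lambda>x. c \<cdot>\<^sub>m g x + c \<cdot>\<^sub>m h x)" using add by (intro pf.add)
 then show ?case
 proof (rule pf.cong)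
  fix x assume "x \<in> nc_space d"
  then have x: "x \<in> pts d (mlevel x)" "mlevel x \<ge> 1" using assms(2) by (auto simp: nc_space_iff)
  show "c \<cdot>\<^sub>m (g x + h x) = c \<cdot>\<^sub>m g x + c \<cdot>\<^sub>m h x"
   using pf_carrier[OF add(1) x(1) assms(2) x(2)] pf_carrier[OF add(2) x(1) assms(2) x(2)]
   by (intro eq_matI) (auto simp: algebra_simps)
 qed
next
 case (cong g h)
 show ?case by (rule pf.cong[OF cong(3)]) (use cong in auto)
qed

lemma pf_const: "pf d (\<lambda>x. c \<cdot>\<^sub>m 1\<^sub>m (mlevel x))"
 using pf.word[of "[]" d c] by simp

lemma pf_var_mult:
 assumes "pf d g" "i < d"
 shows "pf d (\<lambda>x. x ! i * g x)"
 using assms(1)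
proof induction
 case (word w c)
 have "pf d (\<lambda>x. c \<cdot>\<^sub>m eval_word (i # w) x)" using word assms by (intro pf.word) auto
 then show ?case
 proof (rule pf.cong)
  fix x assume "x \<in> nc_space d"
  then have x: "x \<in> pts d (mlevel x)" using assms(2) by (auto simp: nc_space_iff)
  show "x ! i * (c \<cdot>\<^sub>m eval_word w x) = c \<cdot>\<^sub>m eval_word (i # w) x"
   using eval_word_carrier[OF x _ word] ptsD(2)[OF x assms(2)] assms(2)
   by (simp add: mult_smult_distrib[of _ "mlevel x" "mlevel x" _ "mlevel x"])
 qed
next
 case (add g h)
 have "pf d (\<lambda>x. x ! i * g x + x ! i * h x)" using add by (intro pf.add)
 then show ?case
 proof (rule pf.cong)
  fix x assume "x \<in> nc_space d"
  then have x: "x \<in> pts d (mlevel x)" "mlevel x \<ge> 1" "d > 0" using assms(2) by (auto simp: nc_space_iff)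
  show "x ! i * (g x + h x) = x ! i * g x + x ! i * h x"
   by (rule mult_add_distrib_mat[OF ptsD(2)[OF x(1) assms(2)] pf_carrier[OF add(1) x(1,3,2)] pf_carrier[OF add(2) x(1,3,2)]])
 qed
next
 case (cong g h)
 show ?case by (rule pf.cong[OF cong(3)]) (use cong in auto)
qed

lemma pf_word_mult:
 assumes "pf d g" "d > 0" "set w \<subseteq> {..<d}"
 shows "pf d (\<lambda>x. eval_word w x * g x)"
 using assms(3)
proof (induction w)
 case Nil
 show ?case
 proof (rule pf.cong[OF assms(1)])
  fix x assume "x \<in> nc_space d"
  then have x: "x \<in> pts d (mlevel x)" "mlevel x \<ge> 1" using assms(2) by (auto simp: nc_space_iff)
  show "eval_word [] x * g x = g x" using pf_carrier[OF assms(1) x(1) assms(2) x(2)] by simp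
 qed
next
 case (Cons i w)
 then have "pf d (\<lambda>x. x ! i * (eval_word w x * g x))" by (intro pf_var_mult) auto
 then show ?case
 proof (rule pf.cong)
  fix x assume "x \<in> nc_space d"
  then have x: "x \<in> pts d (mlevel x)" "mlevel x \<ge> 1" using assms(2) by (auto simp: nc_space_iff)
  show "eval_word (i # w) x * g x = x ! i * (eval_word w x * g x)"
   using assoc_mult_mat[OF ptsD(2)[OF x(1)] eval_word_carrier[OF x(1) assms(2)] pf_carrier[OF assms(1) x(1) assms(2) x(2)]]
    Cons by simp
 qed
qed

lemma pf_mult:
 assumes "pf d g" "pf d h" "d > 0"
 shows "pf d (\<lambda>x. g x * h x)"
 using assms(1)
proof induction
 case (word w c)
 have "pf d (\<lambda>x. c \<cdot>\<^sub>m (eval_word w x * h x))" using pf_scale[OF pf_word_mult[OF assms(2,3) word] assms(3)] .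
 then show ?case
 proof (rule pf.cong)
  fix x assume "x \<in> nc_space d"
  then have x: "x \<in> pts d (mlevel x)" "mlevel x \<ge> 1" using assms(3) by (auto simp: nc_space_iff)
  show "c \<cdot>\<^sub>m eval_word w x * h x = c \<cdot>\<^sub>m (eval_word w x * h x)"
   by (rule mult_smult_assoc_mat[OF eval_word_carrier[OF x(1) assms(3) word] pf_carrier[OF assms(2) x(1) assms(3) x(2)]])
 qed
next
 case (add g1 g2)
 have "pf d (\<lambda>x. g1 x * h x + g2 x * h x)" using add by (intro pf.add)
 then show ?case
 proof (rule pf.cong)
  fix x assume "x \<in> nc_space d"
  then have x: "x \<in> pts d (mlevel x)" "mlevel x \<ge> 1" using assms(3) by (auto simp: nc_space_iff)
  note c = pf_carrier[OF _ x(1) assms(3) x(2)]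
  show "(g1 x + g2 x) * h x = g1 x * h x + g2 x * h x"
   by (rule add_mult_distrib_mat[OF c[OF add(1)] c[OF add(2)] c[OF assms(2)]])
 qed
next
 case (cong g h')
 show ?case by (rule pf.cong[OF cong(3)]) (use cong in auto)
qed

lemma pf_var: 
 assumes "i < d" shows "pf d (\<lambda>x. x ! i)"
proof (rule pf.cong[OF pf_var_mult[OF pf_const[of d 1] assms]])
 fix x assume "x \<in> nc_space d"
 then have x: "x \<in> pts d (mlevel x)" using assms by (auto simp: nc_space_iff)
 have "1 \<cdot>\<^sub>m 1\<^sub>m (mlevel x) = (1\<^sub>m (mlevel x) :: complex mat)" by (intro eq_matI) auto
 then show "x ! i = x ! i * (1 \<cdot>\<^sub>m 1\<^sub>m (mlevel x))" using ptsD(2)[OF x assms] by simp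
qed

lemma pf_minus:
 assumes "pf d g" "pf d h" "d > 0"
 shows "pf d (\<lambda>x. g x - h x)"
proof (rule pf.cong[OF pf.add[OF assms(1) pf_scale[OF assms(2,3), of "-1"]]])
 fix x assume "x \<in> nc_space d"
 then have x: "x \<in> pts d (mlevel x)" "mlevel x \<ge> 1" using assms(3) by (auto simp: nc_space_iff)
 note c = pf_carrier[OF _ x(1) assms(3) x(2)]
 show "g x - h x = g x + - 1 \<cdot>\<^sub>m h x" using c[OF assms(1)] c[OF assms(2)] by (intro eq_matI) auto
qed

lemma pf_pm:
 assumes "pf d g" "d > 0"
 shows "pf d (\<lambda>x. pm p (g x))"
proof (induction p)
 case 0
 show ?case
 proof (rule pf.cong[OF pf_const[of d 0]])
  fix x assume "x \<in> nc_space d"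
  then have x: "x \<in> pts d (mlevel x)" "mlevel x \<ge> 1" using assms(2) by (auto simp: nc_space_iff)
  show "pm 0 (g x) = 0 \<cdot>\<^sub>m 1\<^sub>m (mlevel x)" using pf_carrier[OF assms(1) x(1) assms(2) x(2)]
   by (intro eq_matI) (auto simp: pm_0)
 qed
next
 case (pCons a p)
 show ?case
 proof (rule pf.cong[OF pf.add[OF pf_const[of d a] pf_mult[OF assms(1) pCons(2) assms(2)]]])
  fix x assume "x \<in> nc_space d"
  then have x: "x \<in> pts d (mlevel x)" "mlevel x \<ge> 1" using assms(2) by (auto simp: nc_space_iff)
  show "pm (pCons a p) (g x) = a \<cdot>\<^sub>m 1\<^sub>m (mlevel x) + g x * pm p (g x)"
   by (rule pm_pCons[OF pf_carrier[OF assms(1) x(1) assms(2) x(2)]])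
 qed
qed

lemma pf_comp:
 assumes g: "pf d g" and d: "d > 0" "e > 0" and \<psi>: "\<And>i. i < d ==> pf e (\<psi> i)"
 shows "pf e (\<lambda>x. g (map (\<lambda>i. \<psi> i x) [0..<d]))"
proof -
 let ?\<psi> = "\<lambda>x. map (\<lambda>i. \<psi> i x) [0..<d]"
 have lv: "?\<psi> x \<in> pts d (mlevel x)" "mlevel (?\<psi> x) = mlevel x" "mlevel x \<ge> 1" if "x \<in> nc_space e" for x
 proof -
  have x: "x \<in> pts e (mlevel x)" "mlevel x \<ge> 1" using that d by (auto simp: nc_space_iff)
  show "?\<psi> x \<in> pts d (mlevel x)" using pf_carrier[OF \<psi> x(1) d(2) x(2)] by (intro ptsI) auto
  then show "mlevel (?\<psi> x) = mlevel x" by (rule pts_mlevel[OF _ d(1)])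
  show "mlevel x \<ge> 1" by fact
 qed
 have comp_word: "pf e (\<lambda>x. eval_word w (?\<psi> x))" if "set w \<subseteq> {..<d}" for w
  using that
 proof (induction w)
  case Nil
  show ?case
  proof (rule pf.cong[OF pf_const[of e 1]])
   fix x assume "x \<in> nc_space e"
   then show "eval_word [] (?\<psi> x) = 1 \<cdot>\<^sub>m 1\<^sub>m (mlevel x)" using lv by (intro eq_matI) auto
  qed
 next
  case (Cons i w)
  show ?case
   by (rule pf.cong[OF pf_mult[OF \<psi>[of i] Cons(1) d(2)]]) (use Cons in auto)
 qed
 show ?thesis
  using g
 proof induction
  case (word w c)
  show ?case by (rule pf_scale[OF comp_word[OF word] d(2)])
 next
  case (add g h)
  then show ?case by (intro pf.add)
 next
  case (cong g h)
  show ?case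
  proof (rule pf.cong[OF cong(3)])
   fix x assume "x \<in> nc_space e"
   then have "?\<psi> x \<in> nc_space d" using lv pts_nc_space by blast
   then show "h (?\<psi> x) = g (?\<psi> x)" using cong by auto
  qed
 qed
qed

section \<open>Distances and level-independent Lipschitz constants\<close>

definition pdist :: "nc_point => nc_point => real" where
 "pdist x y = (\<Sum>i<length x. op_norm (x ! i - y ! i))"

definition pbound :: "real => nc_point => bool" where
 "pbound M x \<longleftrightarrow> (\<forall>i<length x. op_norm (x ! i) \<le> M)"

lemma pdist_nonneg:
 assumes "x \<in> pts d n" "y \<in> pts d n" shows "pdist x y \<ge> 0"
 unfolding pdist_def using ptsD[OF assms(1)] ptsD[OF assms(2)] 
 by (intro sum_nonneg) (auto intro: op_norm_nonneg[of _ n n])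

lemma pdist_coord:
 assumes "x \<in> pts d n" "y \<in> pts d n" "i < d" shows "op_norm (x ! i - y ! i) \<le> pdist x y"
 unfolding pdist_def using ptsD[OF assms(1)] ptsD[OF assms(2)] assms(3)
 by (intro member_le_sum[of i _ "\<lambda>i. op_norm (x ! i - y ! i)"]) (auto intro: op_norm_nonneg[of _ n n])

lemma mat_diff_split:
 fixes A :: "complex mat"
 assumes "A \<in> carrier_mat n m" "B \<in> carrier_mat n m" "C \<in> carrier_mat n m"
 shows "A - C = (A - B) + (B - C)"
 using assms by (intro eq_matI) auto

text \<open>The product rule a b - a' b' = a (b - b') + (a - a') b' uses only the
  submultiplicativity of the operator norm, so the constant depends on the polynomial and on
  \<open>M\<close> but not on the level \<open>n\<close>.\<close>

lemma pf_lip: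
 assumes "pf d g" and d: "d > 0" and M: "M \<ge> 0"
 shows "\<exists>L\<ge>0. \<forall>n\<ge>1. \<forall>x\<in>pts d n. \<forall>y\<in>pts d n. pbound M x --> pbound M y -->
  op_norm (g x) \<le> L \<and> op_norm (g x - g y) \<le> L * pdist x y"
 using assms(1)
proof induction
 case (word w c)
 have "\<exists>L\<ge>0. \<forall>n\<ge>1. \<forall>x\<in>pts d n. \<forall>y\<in>pts d n. pbound M x --> pbound M y -->
  op_norm (eval_word w x) \<le> L \<and> op_norm (eval_word w x - eval_word w y) \<le> L * pdist x y"
  using word
 proof (induction w)
  case Nil
  show ?case
  proof (intro exI[of _ 1] conjI allI impI ballI)
   fix n x y assume "x \<in> pts d n" "y \<in> pts d n"
   then have "eval_word [] x - eval_word [] y = 0\<^sub>m n n" using d by (simp add: pts_mlevel)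
   then show "op_norm (eval_word [] x - eval_word [] y) \<le> 1 * pdist x y"
    using \<open>x \<in> pts d n\<close> \<open>y \<in> pts d n\<close> by (simp add: pdist_nonneg del: eval_word_simps)
  qed (auto simp: op_norm_one_le)
 next
  case (Cons i w)
  then obtain L where L: "L \<ge> 0" and *: "\<And>n x y. n \<ge> 1 ==> x \<in> pts d n ==> y \<in> pts d n ==> pbound M x ==> pbound M y ==>
   op_norm (eval_word w x) \<le> L \<and> op_norm (eval_word w x - eval_word w y) \<le> L * pdist x y" by auto
  have i: "i < d" and w: "set w \<subseteq> {..<d}" using Cons by auto
  \<comment> \<open>\<open>M * L\<close> accounts for a change in the rest of the word behind a head
    of norm at most \<open>M\<close>, and \<open>L\<close> for a change of the head in front of a
    rest of norm at most \<open>L\<close>.\<close>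
  show ?case
  proof (intro exI[of _ "M * L + L"] allI impI ballI)
   show "0 \<le> M * L + L \<and> (\<forall>n\<ge>1. \<forall>x\<in>pts d n. \<forall>y\<in>pts d n. pbound M x --> pbound M y -->
    op_norm (eval_word (i # w) x) \<le> M * L + L \<and> op_norm (eval_word (i # w) x - eval_word (i # w) y) \<le> (M * L + L) * pdist x y)"
   proof (intro conjI allI impI ballI)
    show "0 \<le> M * L + L" using M L by simp
    fix n x y assume n: "1 \<le> n" and x: "x \<in> pts d n" and y: "y \<in> pts d n" and b: "pbound M x" "pbound M y"
    note IH = *[OF n x y b]
    have X: "x ! i \<in> Mat n" "eval_word w x \<in> Mat n" and Y: "y ! i \<in> Mat n" "eval_word w y \<in> Mat n"
     using ptsD(2)[OF x i] ptsD(2)[OF y i] eval_word_carrier[OF x d w] eval_word_carrier[OF y d w] by auto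
    have xM: "op_norm (x ! i) \<le> M" using b i ptsD[OF x] by (auto simp: pbound_def)
    have "op_norm (x ! i * eval_word w x) \<le> op_norm (x ! i) * op_norm (eval_word w x)" by (rule op_norm_mult[OF X])
    also have "\<dots> \<le> M * L" using xM IH M op_norm_nonneg[OF X(2)] by (intro mult_mono) auto
    finally show "op_norm (eval_word (i # w) x) \<le> M * L + L" using L by simp
    have "eval_word (i # w) x - eval_word (i # w) y = x ! i * (eval_word w x - eval_word w y) + (x ! i - y ! i) * eval_word w y"
    proof -
     have "x ! i * (eval_word w x - eval_word w y) = x ! i * eval_word w x - x ! i * eval_word w y"
      by (rule mult_minus_distrib_mat[OF X Y(2)])
     moreover have "(x ! i - y ! i) * eval_word w y = x ! i * eval_word w y - y ! i * eval_word w y"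
      by (rule minus_mult_distrib_mat[OF X(1) Y])
     moreover have "x ! i * eval_word w x - y ! i * eval_word w y =
      (x ! i * eval_word w x - x ! i * eval_word w y) + (x ! i * eval_word w y - y ! i * eval_word w y)"
      by (rule mat_diff_split[of _ n n]) (use X Y in \<open>auto intro: mult_carrier_mat\<close>)
     ultimately show ?thesis by simp
    qed
    then have "op_norm (eval_word (i # w) x - eval_word (i # w) y) \<le>
      op_norm (x ! i * (eval_word w x - eval_word w y)) + op_norm ((x ! i - y ! i) * eval_word w y)"
     using op_norm_add[OF mult_carrier_mat[OF X(1) minus_carrier_mat[OF Y(2)]] mult_carrier_mat[OF minus_carrier_mat[OF Y(1)] Y(2)]]
     by (simp only:)
    also have "\<dots> \<le> op_norm (x ! i) * op_norm (eval_word w x - eval_word w y) + op_norm (x ! i - y ! i) * op_norm (eval_word w y)"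
     using X Y by (intro add_mono op_norm_mult[of _ n n _ n]) auto
    also have "\<dots> \<le> M * (L * pdist x y) + pdist x y * L"
     using xM IH M *[OF n y x b(2,1)] pdist_coord[OF x y i] X Y pdist_nonneg[OF x y]
     by (intro add_mono mult_mono) (auto intro: op_norm_nonneg[of _ n n])
    finally show "op_norm (eval_word (i # w) x - eval_word (i # w) y) \<le> (M * L + L) * pdist x y"
     by (simp add: algebra_simps)
   qed
  qed
 qed
 then obtain L where L: "L \<ge> 0" and *: "\<And>n x y. n \<ge> 1 ==> x \<in> pts d n ==> y \<in> pts d n ==> pbound M x ==> pbound M y ==>
   op_norm (eval_word w x) \<le> L \<and> op_norm (eval_word w x - eval_word w y) \<le> L * pdist x y" by auto
 show ?case
 proof (intro exI[of _ "cmod c * L"] conjI allI impI ballI)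
  show "0 \<le> cmod c * L" using L by simp
  fix n x y assume n: "1 \<le> n" and x: "x \<in> pts d n" and y: "y \<in> pts d n" and b: "pbound M x" "pbound M y"
  have X: "eval_word w x \<in> Mat n" and Y: "eval_word w y \<in> Mat n"
   using eval_word_carrier[OF x d word] eval_word_carrier[OF y d word] by auto
  show "op_norm (c \<cdot>\<^sub>m eval_word w x) \<le> cmod c * L" using *[OF n x y b] by (simp add: op_norm_smult[OF X] mult_left_mono)
  have "c \<cdot>\<^sub>m eval_word w x - c \<cdot>\<^sub>m eval_word w y = c \<cdot>\<^sub>m (eval_word w x - eval_word w y)"
   using X Y by (intro eq_matI) (auto simp: algebra_simps)
  then show "op_norm (c \<cdot>\<^sub>m eval_word w x - c \<cdot>\<^sub>m eval_word w y) \<le> cmod c * L * pdist x y"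
   using *[OF n x y b] op_norm_smult[of "eval_word w x - eval_word w y" n n c] Y
   by (simp add: mult_left_mono mult.assoc)
 qed
next
 case (add g h)
 let ?P = "\<lambda>g L. \<forall>n\<ge>1. \<forall>x\<in>pts d n. \<forall>y\<in>pts d n. pbound M x --> pbound M y -->
  op_norm (g x) \<le> L \<and> op_norm (g x - g y) \<le> L * pdist x y"
 from add.IH(1) obtain L where L1: "L \<ge> 0" and P1: "?P g L" by (elim exE conjE)
 from add.IH(2) obtain L' where L2: "L' \<ge> 0" and P2: "?P h L'" by (elim exE conjE)
 note L = L1 L2
 note * = P1[rule_format] and ** = P2[rule_format]
 show ?case
 proof (intro exI[of _ "L + L'"] conjI allI impI ballI)
  show "0 \<le> L + L'" using L by simp
  fix n x y assume n: "1 \<le> n" and x: "x \<in> pts d n" and y: "y \<in> pts d n" and b: "pbound M x" "pbound M y"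
  note c = pf_carrier[OF _ _ d n]
  note gx = c[OF add(1) x] and gy = c[OF add(1) y] and hx = c[OF add(2) x] and hy = c[OF add(2) y]
  show "op_norm (g x + h x) \<le> L + L'" using op_norm_add[OF gx hx] *[OF n x y b] **[OF n x y b] by linarith
  have "g x + h x - (g y + h y) = (g x - g y) + (h x - h y)" using gx gy hx hy by (intro eq_matI) auto
  then show "op_norm (g x + h x - (g y + h y)) \<le> (L + L') * pdist x y"
   using op_norm_add[of "g x - g y" n n "h x - h y"] gy hy *[OF n x y b] **[OF n x y b] by (auto simp: distrib_right)
 qed
next
 case (cong g h)
 then show ?case using pts_nc_space by metis
qed

section \<open>Norms of block matrices\<close>

definition blockmat :: "nat => nat => nat => (nat => nat => complex mat) => complex mat" where
 "blockmat p q n G = Matrix.mat (p * n) (q * n) (\<lambda>(i, j). G (i div n) (j div n) $$ (i mod n, j mod n))"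

lemma eval_poly_mat_blockmat:
 "eval_poly_mat \<delta> x = blockmat (dim_row \<delta>) (dim_col \<delta>) (mlevel x) (\<lambda>k l. eval_poly (\<delta> $$ (k, l)) x)"
 by (simp add: eval_poly_mat_def blockmat_def Let_def)

lemma blockmat_carrier [simp]: "blockmat p q n G \<in> carrier_mat (p * n) (q * n)"
 by (simp add: blockmat_def)

text \<open>Translates a row or column number of a matrix with blocks of size \<open>n\<close> into
  one with blocks of size \<open>N\<close>: the block number is kept and the position inside the
  block is moved by \<open>a\<close>.\<close>

definition block_shift :: "nat => nat => nat => nat => nat" where
 "block_shift n N a i = i div n * N + (a + i mod n)"

lemma block_shift:
 assumes "n > 0" "a + n \<le> N"
 shows "block_shift n N a i div N = i div n" "block_shift n N a i mod N = a + i mod n"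
  "i < p * n ==> block_shift n N a i < p * N" "inj_on (block_shift n N a) X"
proof -
 have lt: "a + i mod n < N" for i
  using assms mod_less_divisor[OF assms(1), of i] by linarith
 show d: "block_shift n N a i div N = i div n" and m: "block_shift n N a i mod N = a + i mod n" for i
  using lt[of i] by (simp_all add: block_shift_def)
 show "block_shift n N a i < p * N" if "i < p * n"
 proof -
  have "i div n < p" using that assms(1) by (simp add: less_mult_imp_div_less)
  then have "i div n * N + N \<le> p * N" by (metis Suc_leI add.commute mult_Suc mult_le_mono1)
  then show ?thesis using lt[of i] by (simp add: block_shift_def)
 qed
 show "inj_on (block_shift n N a) X"
 proof (rule inj_onI)
  fix i j assume "block_shift n N a i = block_shift n N a j"
  then have "i div n = j div n" "a + i mod n = a + j mod n" using d m by metis+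
  then show "i = j" by (metis add_left_cancel div_mult_mod_eq)
 qed
qed

lemma block_shift_cover:
 assumes "n > 0" "m > 0"
 shows "{..<p * (n + m)} = block_shift n (n + m) 0 ` {..<p * n} \<union> block_shift m (n + m) n ` {..<p * m}"
  "block_shift n (n + m) 0 ` {..<p * n} \<inter> block_shift m (n + m) n ` {..<p * m} = {}"
proof -
 note b1 = block_shift[OF assms(1), of 0 "n + m"] and b2 = block_shift[OF assms(2), of n "n + m"]
 have "j \<in> block_shift n (n + m) 0 ` {..<p * n} \<union> block_shift m (n + m) n ` {..<p * m}" if j: "j < p * (n + m)" for j
 proof -
  let ?N = "n + m"
  have q: "j div ?N < p" using j assms by (simp add: less_mult_imp_div_less)
  show ?thesis
  proof (cases "j mod ?N < n")
   case True
   let ?i = "j div ?N * n + j mod ?N"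
   have "block_shift n ?N 0 ?i = j div ?N * ?N + j mod ?N" using True by (simp add: block_shift_def)
   then have "block_shift n ?N 0 ?i = j" unfolding div_mult_mod_eq .
   moreover have "?i < p * n"
   proof -
    have "?i < j div ?N * n + n" using True by simp
    also have "\<dots> \<le> p * n" using q by (metis Suc_leI add.commute mult_Suc mult_le_mono1)
    finally show ?thesis .
   qed
   ultimately show ?thesis by (metis UnI1 imageI lessThan_iff)
  next
   case False
   define t where "t = j mod ?N - n"
   let ?i = "j div ?N * m + t"
   have lt: "t < m" using False assms mod_less_divisor[of ?N j] unfolding t_def by linarith
   have "n + t = j mod ?N" using False by (simp add: t_def)
   moreover have "block_shift m ?N n ?i = j div ?N * ?N + (n + t)" using lt by (simp add: block_shift_def)
   ultimately have "block_shift m ?N n ?i = j div ?N * ?N + j mod ?N" by (simp only:)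
   then have "block_shift m ?N n ?i = j" unfolding div_mult_mod_eq .
   moreover have "?i < p * m"
   proof -
    have "?i < j div ?N * m + m" using lt by simp
    also have "\<dots> \<le> p * m" using q by (metis Suc_leI add.commute mult_Suc mult_le_mono1)
    finally show ?thesis .
   qed
   ultimately show ?thesis by (metis UnI2 imageI lessThan_iff)
  qed
 qed
 then show "{..<p * (n + m)} = block_shift n (n + m) 0 ` {..<p * n} \<union> block_shift m (n + m) n ` {..<p * m}"
  using b1(3) b2(3) by auto
 have "block_shift n (n + m) 0 i \<noteq> block_shift m (n + m) n j" for i j
 proof
  assume "block_shift n (n + m) 0 i = block_shift m (n + m) n j"
  then have "0 + i mod n = n + j mod m" using b1(2) b2(2) by (metis le_add1 add_0 order_refl)
  then show False using mod_less_divisor[OF assms(1), of i] by linarith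
 qed
 then show "block_shift n (n + m) 0 ` {..<p * n} \<inter> block_shift m (n + m) n ` {..<p * m} = {}" by auto
qed

lemma mat_dsum_index:
 assumes "A \<in> Mat n" "B \<in> Mat m"
 shows "i < n ==> j < n ==> mat_dsum A B $$ (0 + i, 0 + j) = A $$ (i, j)"
  "i < m ==> j < m ==> mat_dsum A B $$ (n + i, n + j) = B $$ (i, j)"
  "i < n ==> j < m ==> mat_dsum A B $$ (0 + i, n + j) = 0"
  "i < m ==> j < n ==> mat_dsum A B $$ (n + i, 0 + j) = 0"
 using assms by (auto simp: mat_dsum_def)

text \<open>Sorting the coordinates by summand turns a block matrix of direct sums into the direct
  sum of two block matrices, whose norm is the larger of the two. This is what makes basic free sets
  closed under direct sums and under passing to summands.\<close>

lemma blockmat_dsum_norm: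
 assumes nm: "n > 0" "m > 0" and C: "C \<ge> 0"
  and G: "\<And>k l. k < p ==> l < q ==> G k l \<in> Mat n" and H: "\<And>k l. k < p ==> l < q ==> H k l \<in> Mat m"
 shows "op_norm (blockmat p q (n + m) (\<lambda>k l. mat_dsum (G k l) (H k l))) \<le> C \<longleftrightarrow>
  op_norm (blockmat p q n G) \<le> C \<and> op_norm (blockmat p q m H) \<le> C"
proof -
 let ?N = "n + m" and ?B = "blockmat p q (n + m) (\<lambda>k l. mat_dsum (G k l) (H k l))"
 let ?f = "block_shift n ?N 0" and ?g = "block_shift m ?N n"
 have b1: "0 + n \<le> n + m" and b2: "n + m \<le> n + m" by auto
 note f = block_shift[OF nm(1) b1] and g = block_shift[OF nm(2) b2]
 have dv: "i div n < k" if "i < k * n" for i k using that by (simp add: less_mult_imp_div_less)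
 have dv': "i div m < k" if "i < k * m" for i k using that by (simp add: less_mult_imp_div_less)
 have mn: "i mod n < n" "i mod m < m" for i using nm by auto
 have e: "?B $$ (i, j) = mat_dsum (G (i div ?N) (j div ?N)) (H (i div ?N) (j div ?N)) $$ (i mod ?N, j mod ?N)"
  if "i < p * ?N" "j < q * ?N" for i j using that by (simp add: blockmat_def)
 have "?B $$ (?f i, ?f j) = mat_dsum (G (i div n) (j div n)) (H (i div n) (j div n)) $$ (0 + i mod n, 0 + j mod n)" if "i < p * n" "j < q * n" for i j
  using e[OF f(3)[OF that(1)] f(3)[OF that(2)]] by (simp only: f(1,2))
 then have e11: "?B $$ (?f i, ?f j) = blockmat p q n G $$ (i, j)" if "i < p * n" "j < q * n" for i j
  using mat_dsum_index(1)[OF G[OF dv dv, OF that] H[OF dv dv, OF that] mn(1) mn(1)] that by (simp add: blockmat_def)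
 have "?B $$ (?g i, ?g j) = mat_dsum (G (i div m) (j div m)) (H (i div m) (j div m)) $$ (n + i mod m, n + j mod m)" if "i < p * m" "j < q * m" for i j
  using e[OF g(3)[OF that(1)] g(3)[OF that(2)]] by (simp only: g(1,2))
 then have e22: "?B $$ (?g i, ?g j) = blockmat p q m H $$ (i, j)" if "i < p * m" "j < q * m" for i j
  using mat_dsum_index(2)[OF G[OF dv' dv', OF that] H[OF dv' dv', OF that] mn(2) mn(2)] that by (simp add: blockmat_def)
 have "?B $$ (?f i, ?g j) = mat_dsum (G (i div n) (j div m)) (H (i div n) (j div m)) $$ (0 + i mod n, n + j mod m)" if "i < p * n" "j < q * m" for i j
  using e[OF f(3)[OF that(1)] g(3)[OF that(2)]] by (simp only: f(1,2) g(1,2))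
 then have e12: "?B $$ (?f i, ?g j) = 0" if "i < p * n" "j < q * m" for i j
  using mat_dsum_index(3)[OF G[OF dv dv', OF that] H[OF dv dv', OF that] mn] that by simp
 have "?B $$ (?g i, ?f j) = mat_dsum (G (i div m) (j div n)) (H (i div m) (j div n)) $$ (n + i mod m, 0 + j mod n)" if "i < p * m" "j < q * n" for i j
  using e[OF g(3)[OF that(1)] f(3)[OF that(2)]] by (simp only: f(1,2) g(1,2))
 then have e21: "?B $$ (?g i, ?f j) = 0" if "i < p * m" "j < q * n" for i j
  using mat_dsum_index(4)[OF G[OF dv' dv, OF that] H[OF dv' dv, OF that] mn(2,1)] that by simp
 have B: "?B \<in> carrier_mat (p * ?N) (q * ?N)" by simp
 show ?thesis
 proof (intro iffI conjI)
  assume le: "op_norm ?B \<le> C"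
  have ob: "opb {..<p * ?N} {..<q * ?N} (ent ?B) C" using opb_mono[OF op_norm_opb[OF B] le] .
  show "op_norm (blockmat p q n G) \<le> C"
  proof (rule op_norm_leI[OF blockmat_carrier _ C])
   have "opb {..<p * n} {..<q * n} (\<lambda>i j. ent ?B (?f i) (?f j)) C"
    by (rule opb_submatrix[OF ob]) (use f in auto)
   then show "opb {..<p * n} {..<q * n} (ent (blockmat p q n G)) C"
    by (rule opb_cong[THEN iffD1, rotated]) (use e11 in auto)
  qed
  show "op_norm (blockmat p q m H) \<le> C"
  proof (rule op_norm_leI[OF blockmat_carrier _ C])
   have "opb {..<p * m} {..<q * m} (\<lambda>i j. ent ?B (?g i) (?g j)) C"
    by (rule opb_submatrix[OF ob]) (use g in auto)
   then show "opb {..<p * m} {..<q * m} (ent (blockmat p q m H)) C"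
    by (rule opb_cong[THEN iffD1, rotated]) (use e22 in auto)
  qed
 next
  assume le: "op_norm (blockmat p q n G) \<le> C \<and> op_norm (blockmat p q m H) \<le> C"
  show "op_norm ?B \<le> C"
  proof (rule op_norm_leI[OF B _ C])
   show "opb {..<p * ?N} {..<q * ?N} (ent ?B) C"
   proof (rule opb_block_diag[of "{..<p * n}" "{..<q * n}" _ ?f ?f _ "{..<p * m}" "{..<q * m}" ?g ?g])
    have "opb {..<p * n} {..<q * n} (ent (blockmat p q n G)) C"
     using opb_mono[OF op_norm_opb[OF blockmat_carrier]] le by blast
    then show "opb {..<p * n} {..<q * n} (\<lambda>i j. ent ?B (?f i) (?f j)) C"
     by (rule opb_cong[THEN iffD1, rotated]) (use e11 in auto)
    have "opb {..<p * m} {..<q * m} (ent (blockmat p q m H)) C"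
     using opb_mono[OF op_norm_opb[OF blockmat_carrier]] le by blast
    then show "opb {..<p * m} {..<q * m} (\<lambda>i j. ent ?B (?g i) (?g j)) C"
     by (rule opb_cong[THEN iffD1, rotated]) (use e22 in auto)
   qed (use C f(4) g(4) block_shift_cover[OF nm] e12 e21 in auto)
  qed
 qed
qed

lemma blockmat_diff_norm:
 assumes n: "n > 0"
  and G: "\<And>k l. k < p ==> l < q ==> G k l \<in> Mat n" and H: "\<And>k l. k < p ==> l < q ==> H k l \<in> Mat n"
 shows "op_norm (blockmat p q n G - blockmat p q n H) \<le> (\<Sum>k<p. \<Sum>l<q. op_norm (G k l - H k l))"
proof (rule op_norm_leI)
 let ?D = "\<lambda>k l. G k l - H k l"
 have D: "?D k l \<in> Mat n" if "k < p" "l < q" for k l using G[OF that] H[OF that] by simp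
 \<comment> \<open>The difference with all blocks but the one at \<open>(k, l)\<close> replaced by
   zero. Each such matrix has the norm of its block, and their sum is the whole difference.\<close>
 define a where "a k l i j = (if i div n = k \<and> j div n = l then ?D k l $$ (i mod n, j mod n) else 0)" for k l i j
 have dv: "i div n < k" if "i < k * n" for i k using that by (simp add: less_mult_imp_div_less)
 have lt: "k * n + i < p * n" if "k < p" "i < n" for k i p
 proof -
  have "k * n + i < k * n + n" using that by simp
  also have "\<dots> \<le> p * n" using that by (metis Suc_leI add.commute mult_Suc mult_le_mono1)
  finally show ?thesis .
 qed
 have im: "i \<in> (\<lambda>i. k * n + i) ` {..<n}" if "i div n = k" for i k
  using that n by (intro image_eqI[of _ _ "i mod n"]) auto
 have "opb {..<p * n} {..<q * n} (a k l) (op_norm (?D k l))" if "k < p" "l < q" for k l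
 proof (rule opb_embed[of "{..<n}" "{..<n}" _ "\<lambda>i. k * n + i" "\<lambda>j. l * n + j"])
  show "opb {..<n} {..<n} (\<lambda>i j. a k l (k * n + i) (l * n + j)) (op_norm (?D k l))"
   by (rule opb_cong[THEN iffD1, OF _ op_norm_opb[OF D[OF that]]]) (auto simp: a_def)
  show "0 \<le> op_norm (?D k l)" using op_norm_nonneg[OF D[OF that]] .
 qed (use lt that im in \<open>auto simp: a_def\<close>)
 then have "opb {..<p * n} {..<q * n} (\<lambda>i j. \<Sum>k<p. \<Sum>l<q. a k l i j) (\<Sum>k<p. \<Sum>l<q. op_norm (?D k l))"
  by (intro opb_sum) auto
 then show "opb {..<p * n} {..<q * n} (ent (blockmat p q n G - blockmat p q n H)) (\<Sum>k<p. \<Sum>l<q. op_norm (?D k l))"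
 proof (rule opb_cong[THEN iffD1, rotated])
  fix i j assume ij: "i \<in> {..<p * n}" "j \<in> {..<q * n}"
  have "(\<Sum>k<p. \<Sum>l<q. a k l i j) = (\<Sum>k<p. if i div n = k then (\<Sum>l<q. if j div n = l then ?D k l $$ (i mod n, j mod n) else 0) else 0)"
   by (intro sum.cong refl) (auto simp: a_def)
  also have "\<dots> = ?D (i div n) (j div n) $$ (i mod n, j mod n)"
   using ij dv by (simp add: sum.delta')
  also have "\<dots> = ent (blockmat p q n G - blockmat p q n H) i j"
   using ij n G[OF dv dv, of i j] H[OF dv dv, of i j] by (simp add: blockmat_def)
  finally show "(\<Sum>k<p. \<Sum>l<q. a k l i j) = ent (blockmat p q n G - blockmat p q n H) i j" .
 qed
 show "0 \<le> (\<Sum>k<p. \<Sum>l<q. op_norm (?D k l))"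
  using op_norm_nonneg[OF D] by (intro sum_nonneg) auto
qed simp

section \<open>A base of the free topology\<close>

definition valid_polys :: "nat => free_poly mat set => bool" where
 "valid_polys d F \<longleftrightarrow> finite F \<and> (\<forall>\<delta>\<in>F. \<forall>p\<in>elements_mat \<delta>. free_poly_in d p)"

text \<open>Finite intersections of basic sets, kept as finite families of polynomial matrices; this
  avoids merging them into one block-diagonal matrix.\<close>

definition fnb :: "nat => free_poly mat set => nc_point set" where
 "fnb d F = {x \<in> nc_space d. \<forall>\<delta>\<in>F. op_norm (eval_poly_mat \<delta> x) < 1}"

lemma valid_polysD: "valid_polys d F ==> \<delta> \<in> F ==> k < dim_row \<delta> ==> l < dim_col \<delta> ==> free_poly_in d (\<delta> $$ (k, l))"
 unfolding valid_polys_def elements_mat_def by force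

lemma eval_poly_dsum:
 assumes x: "x \<in> pts d n" and y: "y \<in> pts d m" and d: "d > 0" and nm: "n \<ge> 1" "m \<ge> 1" and p: "free_poly_in d p"
 shows "eval_poly p (point_dsum x y) = mat_dsum (eval_poly p x) (eval_poly p y)"
proof -
 have "g (point_dsum x y) = mat_dsum (g x) (g y)" if "pf d g" for g
  using that
 proof induction
  case (word w c)
  have "eval_word w (point_dsum x y) = mat_dsum (eval_word w x) (eval_word w y)"
   using word
  proof (induction w)
   case Nil
   show ?case using pts_mlevel[OF x d] pts_mlevel[OF y d] pts_mlevel[OF pts_dsum[OF x y] d] by (simp add: mat_dsum_one)
  next
   case (Cons i w)
   then have i: "i < d" and w: "set w \<subseteq> {..<d}" by auto
   show ?case using Cons(1)[OF w] nth_dsum[OF ptsD(1)[OF x] ptsD(1)[OF y] i] ptsD(2)[OF x i] ptsD(2)[OF y i]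
    eval_word_carrier[OF x d w] eval_word_carrier[OF y d w] by (simp add: mat_dsum_mult[of _ n _ m])
  qed
  then show ?case using eval_word_carrier[OF x d word] eval_word_carrier[OF y d word]
   by (simp add: mat_dsum_smult[of _ n _ m])
 next
  case (add g h)
  then show ?case using pf_carrier[OF _ x d nm(1)] pf_carrier[OF _ y d nm(2)] by (simp add: mat_dsum_add[of _ n _ m])
 next
  case (cong g h)
  then show ?case using pts_nc_space[OF x nm(1)] pts_nc_space[OF y nm(2)] pts_nc_space[OF pts_dsum[OF x y]] nm by simp
 qed
 from this[OF pf_eval_poly[OF d p]] show ?thesis .
qed

lemma eval_poly_carrier: "x \<in> pts d n ==> d > 0 ==> eval_poly p x \<in> Mat n"
 by (simp add: eval_poly_def pts_mlevel)

lemma fnb_dsum: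
 assumes F: "valid_polys d F" and x: "x \<in> nc_space d" and y: "y \<in> nc_space d" and d: "d > 0"
 shows "point_dsum x y \<in> fnb d F \<longleftrightarrow> x \<in> fnb d F \<and> y \<in> fnb d F"
proof -
 define n m where "n = mlevel x" and "m = mlevel y"
 have X: "x \<in> pts d n" "n \<ge> 1" and Y: "y \<in> pts d m" "m \<ge> 1" using x y d by (auto simp: nc_space_iff n_def m_def)
 have D: "point_dsum x y \<in> nc_space d" using nc_space_dsum[OF d x y] .
 have lv: "mlevel (point_dsum x y) = n + m" using pts_mlevel[OF pts_dsum[OF X(1) Y(1)] d] .
 have "op_norm (eval_poly_mat \<delta> (point_dsum x y)) < 1 \<longleftrightarrow> op_norm (eval_poly_mat \<delta> x) < 1 \<and> op_norm (eval_poly_mat \<delta> y) < 1"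
  if "\<delta> \<in> F" for \<delta>
 proof -
  let ?p = "dim_row \<delta>" and ?q = "dim_col \<delta>"
  let ?G = "\<lambda>k l. eval_poly (\<delta> $$ (k, l)) x" and ?H = "\<lambda>k l. eval_poly (\<delta> $$ (k, l)) y"
  have "eval_poly_mat \<delta> (point_dsum x y) = blockmat ?p ?q (n + m) (\<lambda>k l. mat_dsum (?G k l) (?H k l))"
   unfolding eval_poly_mat_blockmat lv blockmat_def
   using eval_poly_dsum[OF X(1) Y(1) d X(2) Y(2) valid_polysD[OF F that]] X(2) Y(2)
   by (intro eq_matI) (auto simp: less_mult_imp_div_less)
  \<comment> \<open>The block criterion concerns non-strict bounds. The strict ones follow by
    inserting for \<open>C\<close> the norm of the sum and the maximum of the norms of the
    summands.\<close>
  then have iff: "op_norm (eval_poly_mat \<delta> (point_dsum x y)) \<le> C \<longleftrightarrow>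
   op_norm (eval_poly_mat \<delta> x) \<le> C \<and> op_norm (eval_poly_mat \<delta> y) \<le> C" if "C \<ge> 0" for C
   using blockmat_dsum_norm[of n m C ?p ?q ?G ?H] X Y that eval_poly_carrier[OF X(1) d] eval_poly_carrier[OF Y(1) d]
   by (simp add: eval_poly_mat_blockmat n_def[symmetric] m_def[symmetric])
  have nn: "op_norm (eval_poly_mat \<delta> z) \<ge> 0" for z
   unfolding eval_poly_mat_blockmat by (rule op_norm_nonneg[OF blockmat_carrier])
  show ?thesis
  proof
   assume "op_norm (eval_poly_mat \<delta> (point_dsum x y)) < 1"
   then show "op_norm (eval_poly_mat \<delta> x) < 1 \<and> op_norm (eval_poly_mat \<delta> y) < 1"
    using iff[OF nn, of "point_dsum x y"] by auto
  next
   assume "op_norm (eval_poly_mat \<delta> x) < 1 \<and> op_norm (eval_poly_mat \<delta> y) < 1"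
   moreover have "op_norm (eval_poly_mat \<delta> (point_dsum x y)) \<le> max (op_norm (eval_poly_mat \<delta> x)) (op_norm (eval_poly_mat \<delta> y))"
    using iff[of "max (op_norm (eval_poly_mat \<delta> x)) (op_norm (eval_poly_mat \<delta> y))"] nn[of x] by (simp add: le_max_iff_disj)
   ultimately show "op_norm (eval_poly_mat \<delta> (point_dsum x y)) < 1" by linarith
  qed
 qed
 then show ?thesis using x y D by (auto simp: fnb_def)
qed

lemma pbound_exists:
 assumes "x \<in> pts d n" shows "\<exists>M\<ge>0. pbound M x"
proof (intro exI[of _ "\<Sum>i<d. op_norm (x ! i)"] conjI)
 show "0 \<le> (\<Sum>i<d. op_norm (x ! i))" using op_norm_nonneg[OF ptsD(2)[OF assms]] by (intro sum_nonneg) auto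
 show "pbound (\<Sum>i<d. op_norm (x ! i)) x"
  unfolding pbound_def using ptsD(1)[OF assms] op_norm_nonneg[OF ptsD(2)[OF assms]]
  by (auto intro!: member_le_sum[of _ _ "\<lambda>i. op_norm (x ! i)"])
qed

lemma pbound_close:
 assumes "x \<in> pts d n" "y \<in> pts d n" "pbound M x" "pdist y x \<le> e"
 shows "pbound (M + e) y"
 unfolding pbound_def
proof (intro allI impI)
 fix i assume "i < length y"
 then have i: "i < d" using ptsD(1)[OF assms(2)] by simp
 have "op_norm (y ! i) \<le> op_norm (x ! i) + op_norm (y ! i - x ! i)"
  by (rule op_norm_le_add_diff[OF ptsD(2)[OF assms(2) i] ptsD(2)[OF assms(1) i]])
 also have "\<dots> \<le> M + e"
  using assms(3,4) i ptsD(1)[OF assms(1)] pdist_coord[OF assms(2,1) i] by (auto simp: pbound_def intro!: add_mono)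
 finally show "op_norm (y ! i) \<le> M + e" .
qed

lemma eval_poly_mat_lip:
 assumes \<delta>: "\<And>k l. k < dim_row \<delta> ==> l < dim_col \<delta> ==> free_poly_in d (\<delta> $$ (k, l))" and d: "d > 0" and M: "M \<ge> 0"
 shows "\<exists>L\<ge>0. \<forall>n\<ge>1. \<forall>x\<in>pts d n. \<forall>y\<in>pts d n. pbound M x --> pbound M y -->
  op_norm (eval_poly_mat \<delta> x - eval_poly_mat \<delta> y) \<le> L * pdist x y"
proof -
 let ?p = "dim_row \<delta>" and ?q = "dim_col \<delta>"
 let ?Q = "\<lambda>k l L. \<forall>n\<ge>1. \<forall>x\<in>pts d n. \<forall>y\<in>pts d n. pbound M x --> pbound M y -->
  op_norm (eval_poly (\<delta> $$ (k, l)) x - eval_poly (\<delta> $$ (k, l)) y) \<le> L * pdist x y"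
 have ex: "\<exists>L. L \<ge> 0 \<and> ?Q k l L" if kl: "k < ?p" "l < ?q" for k l
 proof -
  from pf_lip[OF pf_eval_poly[OF d \<delta>[OF kl]] d M] obtain L where "L \<ge> 0" and
   *: "\<forall>n\<ge>1. \<forall>x\<in>pts d n. \<forall>y\<in>pts d n. pbound M x --> pbound M y -->
    op_norm (eval_poly (\<delta> $$ (k, l)) x) \<le> L \<and>
    op_norm (eval_poly (\<delta> $$ (k, l)) x - eval_poly (\<delta> $$ (k, l)) y) \<le> L * pdist x y"
   by (elim exE conjE)
  then show ?thesis using *[rule_format, THEN conjunct2] by (intro exI[of _ L] conjI allI impI ballI)
 qed
 define L where "L k l = (SOME L. L \<ge> 0 \<and> ?Q k l L)" for k l
 have LQ: "L k l \<ge> 0 \<and> ?Q k l (L k l)" if kl: "k < ?p" "l < ?q" for k l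
  unfolding L_def by (rule someI_ex[OF ex[OF kl]])
 have L1: "L k l \<ge> 0" if "k < ?p" "l < ?q" for k l by (rule LQ[OF that, THEN conjunct1])
 have L2: "op_norm (eval_poly (\<delta> $$ (k, l)) x - eval_poly (\<delta> $$ (k, l)) y) \<le> L k l * pdist x y"
  if "k < ?p" "l < ?q" "n \<ge> 1" "x \<in> pts d n" "y \<in> pts d n" "pbound M x" "pbound M y" for k l n x y
  by (rule LQ[OF that(1,2), THEN conjunct2, rule_format, OF that(3-7)])
 note L = L1 L2
 show ?thesis
 proof (intro exI[of _ "\<Sum>k<?p. \<Sum>l<?q. L k l"] conjI allI impI ballI)
  show "0 \<le> (\<Sum>k<?p. \<Sum>l<?q. L k l)" using L(1) by (intro sum_nonneg) auto
  fix n x y assume n: "1 \<le> n" and x: "x \<in> pts d n" and y: "y \<in> pts d n" and b: "pbound M x" "pbound M y"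
  have "op_norm (eval_poly_mat \<delta> x - eval_poly_mat \<delta> y) \<le> (\<Sum>k<?p. \<Sum>l<?q. op_norm (eval_poly (\<delta> $$ (k, l)) x - eval_poly (\<delta> $$ (k, l)) y))"
   unfolding eval_poly_mat_blockmat pts_mlevel[OF x d] pts_mlevel[OF y d]
   using n eval_poly_carrier[OF x d] eval_poly_carrier[OF y d] by (intro blockmat_diff_norm) auto
  also have "\<dots> \<le> (\<Sum>k<?p. \<Sum>l<?q. L k l * pdist x y)"
   using L(2)[OF _ _ n x y b] by (intro sum_mono) auto
  finally show "op_norm (eval_poly_mat \<delta> x - eval_poly_mat \<delta> y) \<le> (\<Sum>k<?p. \<Sum>l<?q. L k l) * pdist x y"
   by (simp add: sum_distrib_right)
 qed
qed

lemma eval_poly_mat_carrier: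
 "x \<in> pts d n ==> d > 0 ==> eval_poly_mat \<delta> x \<in> carrier_mat (dim_row \<delta> * n) (dim_col \<delta> * n)"
 by (simp add: eval_poly_mat_blockmat pts_mlevel)

text \<open>Free polynomials can be rescaled, so the bound 1 in the definition of basic sets may be
  replaced by any positive \<open>c\<close>.\<close>

lemma openin_blockmat:
 assumes G: "\<And>k l. k < p ==> l < q ==> pf d (G k l)" and d: "d > 0" and c: "c > 0"
 shows "openin (free_topology d) {x \<in> nc_space d. op_norm (blockmat p q (mlevel x) (\<lambda>k l. G k l x)) < c}"
proof -
 let ?k = "complex_of_real (1 / c)"
 have "\<forall>k l. \<exists>P. k < p --> l < q --> free_poly_in d P \<and> (\<forall>x\<in>nc_space d. eval_poly P x = ?k \<cdot>\<^sub>m G k l x)"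
  using pf_poly[OF pf_scale[OF G d] d] by blast
 then obtain P where P: "\<And>k l. k < p ==> l < q ==> free_poly_in d (P k l)"
  "\<And>k l x. k < p ==> l < q ==> x \<in> nc_space d ==> eval_poly (P k l) x = ?k \<cdot>\<^sub>m G k l x" by metis
 define \<delta> where "\<delta> = Matrix.mat p q (\<lambda>(k, l). P k l)"
 have e: "eval_poly_mat \<delta> x = ?k \<cdot>\<^sub>m blockmat p q (mlevel x) (\<lambda>k l. G k l x)" if x: "x \<in> nc_space d" for x
 proof -
  have X: "x \<in> pts d (mlevel x)" "mlevel x \<ge> 1" "mlevel x > 0" using x d by (auto simp: nc_space_iff)
  have Gc: "G k l x \<in> carrier_mat (mlevel x) (mlevel x)" if "k < p" "l < q" for k l using pf_carrier[OF G[OF that] X(1) d X(2)] .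
  show ?thesis unfolding eval_poly_mat_blockmat blockmat_def
   by (intro eq_matI) (auto simp: \<delta>_def less_mult_imp_div_less P(2)[OF _ _ x] carrier_matD[OF Gc] X(3) simp del: of_real_divide)
 qed
 have k: "cmod ?k = 1 / c" using c by (simp only: norm_of_real) simp
 have "{x \<in> nc_space d. op_norm (blockmat p q (mlevel x) (\<lambda>k l. G k l x)) < c} = basic_free_set d \<delta>"
  unfolding basic_free_set_def using c by (intro Collect_cong conj_cong refl) (simp only: e op_norm_smult[OF blockmat_carrier] k, simp add: field_simps)
 moreover have "\<forall>p\<in>elements_mat \<delta>. free_poly_in d p"
  unfolding \<delta>_def elements_mat_def using P(1) by auto
 ultimately show ?thesis unfolding free_topology_def
  by (auto intro!: topology_generated_by_Basis)
qed

lemma openin_pf: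
 assumes g: "pf d g" and d: "d > 0" and c: "c > 0"
 shows "openin (free_topology d) {x \<in> nc_space d. op_norm (g x) < c}"
proof -
 have "blockmat 1 1 (mlevel x) (\<lambda>k l. g x) = g x" if "x \<in> nc_space d" for x
 proof -
  have x: "x \<in> pts d (mlevel x)" "mlevel x \<ge> 1" using that d by (auto simp: nc_space_iff)
  show ?thesis using pf_carrier[OF g x(1) d x(2)] by (intro eq_matI) (auto simp: blockmat_def)
 qed
 then have "{x \<in> nc_space d. op_norm (g x) < c} = {x \<in> nc_space d. op_norm (blockmat 1 1 (mlevel x) (\<lambda>k l. g x)) < c}" by auto
 then show ?thesis using openin_blockmat[of 1 1 d "\<lambda>k l. g", OF g d c] by simp
qed

lemma openin_free_subset: "openin (free_topology d) U ==> U \<subseteq> nc_space d"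
 using openin_subset[of "free_topology d" U] unfolding free_topology_def
 by (auto simp: topology_generated_by_topspace basic_free_set_def)

lemma openin_nc_space: 
 assumes "d > 0" shows "openin (free_topology d) (nc_space d)"
proof -
 have "pf d (\<lambda>x. 0\<^sub>m (mlevel x) (mlevel x))"
  by (rule pf.cong[OF pf_const[of d 0]]) (auto intro!: eq_matI)
 from openin_pf[OF this assms, of 1] show ?thesis by simp
qed

lemma fnb_open:
 assumes F: "valid_polys d F" and d: "d > 0"
 shows "openin (free_topology d) (fnb d F)"
proof -
 have "finite F" using F by (simp add: valid_polys_def)
 then show ?thesis using F
 proof (induction F rule: finite_induct)
  case empty
  then show ?case using openin_nc_space[OF d] by (simp add: fnb_def)
 next
  case (insert \<delta> F)
  then have "openin (free_topology d) (fnb d F)" by (auto simp: valid_polys_def)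
  moreover have "openin (free_topology d) (basic_free_set d \<delta>)"
   using insert unfolding free_topology_def valid_polys_def by (auto intro!: topology_generated_by_Basis)
  ultimately have "openin (free_topology d) (fnb d F \<inter> basic_free_set d \<delta>)" by (rule openin_Int)
  moreover have "fnb d F \<inter> basic_free_set d \<delta> = fnb d (insert \<delta> F)" by (auto simp: fnb_def basic_free_set_def)
  ultimately show ?case by simp
 qed
qed

lemma open_base:
 assumes "openin (free_topology d) U" "x \<in> U"
 obtains F where "valid_polys d F" "x \<in> fnb d F" "fnb d F \<subseteq> U"
proof -
 have "generate_topology_on (basic_free_set d ` {\<delta>. \<forall>p \<in> elements_mat \<delta>. free_poly_in d p}) U"
  using assms(1) by (simp add: free_topology_def openin_topology_generated_by_iff)
 then have "\<forall>x\<in>U. \<exists>F. valid_polys d F \<and> x \<in> fnb d F \<and> fnb d F \<subseteq> U"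
 proof induction
  case (Int a b)
  show ?case
  proof
   fix x assume "x \<in> a \<inter> b"
   then obtain F G where "valid_polys d F" "x \<in> fnb d F" "fnb d F \<subseteq> a" "valid_polys d G" "x \<in> fnb d G" "fnb d G \<subseteq> b"
    using Int by (metis IntE)
   then show "\<exists>F. valid_polys d F \<and> x \<in> fnb d F \<and> fnb d F \<subseteq> a \<inter> b"
    by (intro exI[of _ "F \<union> G"]) (auto simp: valid_polys_def fnb_def)
  qed
 next
  case (UN K)
  show ?case
  proof
   fix x assume "x \<in> \<Union>K"
   then obtain k where k: "k \<in> K" "x \<in> k" by auto
   then obtain F where "valid_polys d F" "x \<in> fnb d F" "fnb d F \<subseteq> k" using UN by blast
   then show "\<exists>F. valid_polys d F \<and> x \<in> fnb d F \<and> fnb d F \<subseteq> \<Union>K" using k by blast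
  qed
 next
  case (Basis s)
  then obtain \<delta> where "s = basic_free_set d \<delta>" "\<forall>p\<in>elements_mat \<delta>. free_poly_in d p" by auto
  then show ?case by (intro ballI exI[of _ "{\<delta>}"]) (auto simp: valid_polys_def fnb_def basic_free_set_def)
 qed simp
 then show ?thesis using assms(2) that by blast
qed

text \<open>\<open>\<eta>\<close> must not depend on the level \<open>m\<close>, which openness at
  each single level would not give. Lipschitz constants of free polynomials are level-independent on
  bounded sets, so it suffices to bound the coordinates on \<open>N\<close> and to leave a gap below
  1 in the defining inequalities.\<close>

lemma uniform_interior:
 assumes V: "openin (free_topology d) V" and w: "w \<in> V" "w \<in> pts d n" and d: "d > 0"
 obtains N \<eta> where "openin (free_topology d) N" "w \<in> N" "\<eta> > 0"
  "\<And>m y z. m \<ge> 1 ==> y \<in> N ==> y \<in> pts d m ==> z \<in> pts d m ==> pdist z y < \<eta> ==> z \<in> V"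
proof -
 obtain F where F: "valid_polys d F" "w \<in> fnb d F" "fnb d F \<subseteq> V" by (rule open_base[OF V w(1)])
 have wn: "w \<in> nc_space d" using F(2) by (simp add: fnb_def)
 then have n: "n \<ge> 1" using d pts_mlevel[OF w(2) d] by (simp add: nc_space_iff)
 obtain M0 where M0: "M0 \<ge> 0" "pbound M0 w" using pbound_exists[OF w(2)] by auto
 define M where "M = M0 + 1"
 have M: "M \<ge> 0" "M > 0" "M + 1 \<ge> 0" using M0 by (auto simp: M_def)
 define B where "B = (\<Inter>i\<in>{..<d}. {x \<in> nc_space d. op_norm (x ! i) < M})"
 have B: "openin (free_topology d) B" unfolding B_def
  using d openin_pf[OF pf_var d M(2)] by (intro openin_INT2) auto
 have wB: "w \<in> B" unfolding B_def using M0(2) ptsD(1)[OF w(2)] wn by (auto simp: pbound_def M_def intro: le_less_trans)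
 have Bb: "pbound M y" if "y \<in> B" "y \<in> pts d m" for y m
  using that ptsD(1)[OF that(2)] by (auto simp: B_def pbound_def intro: less_imp_le)
 let ?P = "\<lambda>G N \<eta>. openin (free_topology d) N \<and> w \<in> N \<and> \<eta> > 0 \<and>
  (\<forall>m\<ge>1. \<forall>y z. y \<in> N --> y \<in> pts d m --> z \<in> pts d m --> pdist z y < \<eta> --> z \<in> fnb d G)"
 have one: "\<exists>N \<eta>. ?P {\<delta>} N \<eta>" if \<delta>: "\<delta> \<in> F" for \<delta>
 proof -
  let ?e = "eval_poly_mat \<delta>"
  note vp = valid_polysD[OF F(1) \<delta>]
  \<comment> \<open>Norms below \<open>c\<close> on \<open>N\<close> still leave the margin
    \<open>1 - c\<close> for the passage from \<open>y\<close> to \<open>z\<close>.\<close>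
  define c where "c = (1 + op_norm (?e w)) / 2"
  have "op_norm (?e w) < 1" "op_norm (?e w) \<ge> 0"
   using F(2) \<delta> op_norm_nonneg[OF eval_poly_mat_carrier[OF w(2) d]] by (auto simp: fnb_def)
  then have c: "op_norm (?e w) < c" "c < 1" "c > 0" by (auto simp: c_def)
  obtain L where L: "L \<ge> 0" "\<forall>n\<ge>1. \<forall>x\<in>pts d n. \<forall>y\<in>pts d n. pbound (M + 1) x --> pbound (M + 1) y -->
   op_norm (?e x - ?e y) \<le> L * pdist x y" using eval_poly_mat_lip[OF vp d M(3)] by auto
  \<comment> \<open>The 1 keeps \<open>z\<close> within the bound \<open>M + 1\<close> for which
    \<open>L\<close> was chosen; \<open>L + 1\<close> keeps the denominator positive.\<close>
  define \<eta> where "\<eta> = min 1 ((1 - c) / (L + 1))"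
  have \<eta>: "\<eta> > 0" "\<eta> \<le> 1" "\<eta> \<le> (1 - c) / (L + 1)" using c L(1) by (auto simp: \<eta>_def)
  let ?N = "{x \<in> nc_space d. op_norm (?e x) < c} \<inter> B"
  have "openin (free_topology d) {x \<in> nc_space d. op_norm (?e x) < c}"
   unfolding eval_poly_mat_blockmat by (rule openin_blockmat[OF pf_eval_poly[OF d vp] d c(3)])
  then have oN: "openin (free_topology d) ?N" using B by (rule openin_Int)
  have "z \<in> fnb d {\<delta>}" if m: "m \<ge> 1" and y: "y \<in> ?N" "y \<in> pts d m" and z: "z \<in> pts d m" "pdist z y < \<eta>" for m y z
  proof -
   have yM: "pbound M y" by (rule Bb[OF _ y(2)]) (use y(1) in simp)
   then have b: "pbound (M + 1) y" "pbound (M + 1) z"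
    using pbound_close[OF y(2) z(1) yM, of 1] z(2) \<eta>(2) by (auto simp: pbound_def intro: order_trans)
   have "pdist z y * (L + 1) < (1 - c)"
    using less_le_trans[OF z(2) \<eta>(3)] L(1) by (simp add: pos_less_divide_eq)
   then have "L * pdist z y < 1 - c" using pdist_nonneg[OF z(1) y(2)] by (simp add: algebra_simps)
   moreover have "op_norm (?e z - ?e y) \<le> L * pdist z y" using L(2) m z(1) y(2) b by blast
   moreover have "op_norm (?e z) \<le> op_norm (?e y) + op_norm (?e z - ?e y)"
    by (rule op_norm_le_add_diff[OF eval_poly_mat_carrier[OF z(1) d] eval_poly_mat_carrier[OF y(2) d]])
   ultimately have "op_norm (?e z) < 1" using y(1) by simp
   then show ?thesis using pts_nc_space[OF z(1) m] by (simp add: fnb_def)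
  qed
  then show ?thesis using oN wn wB c(1) \<eta>(1) by (intro exI[of _ ?N] exI[of _ \<eta>]) blast
 qed
 have "\<exists>N \<eta>. ?P G N \<eta>" if "finite G" "G \<subseteq> F" for G
  using that
 proof (induction G rule: finite_induct)
  case empty
  show ?case using openin_nc_space[OF d] wn pts_nc_space by (intro exI[of _ "nc_space d"] exI[of _ 1]) (auto simp: fnb_def)
 next
  case (insert \<delta> G)
  have "\<exists>N \<eta>. ?P {\<delta>} N \<eta>" by (rule one) (use insert(4) in simp)
  then obtain N1 \<eta>1 where 1: "openin (free_topology d) N1" "w \<in> N1" "\<eta>1 > 0"
   "\<forall>m\<ge>1. \<forall>y z. y \<in> N1 --> y \<in> pts d m --> z \<in> pts d m --> pdist z y < \<eta>1 --> z \<in> fnb d {\<delta>}" by (elim exE conjE)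
  have "\<exists>N \<eta>. ?P G N \<eta>" by (rule insert(3)) (use insert(4) in simp)
  then obtain N2 \<eta>2 where 2: "openin (free_topology d) N2" "w \<in> N2" "\<eta>2 > 0"
   "\<forall>m\<ge>1. \<forall>y z. y \<in> N2 --> y \<in> pts d m --> z \<in> pts d m --> pdist z y < \<eta>2 --> z \<in> fnb d G" by (elim exE conjE)
  have "\<forall>m\<ge>1. \<forall>y z. y \<in> N1 \<inter> N2 --> y \<in> pts d m --> z \<in> pts d m --> pdist z y < min \<eta>1 \<eta>2 --> z \<in> fnb d (insert \<delta> G)"
  proof (intro allI impI)
   fix m :: nat and y z assume *: "m \<ge> 1" "y \<in> N1 \<inter> N2" "y \<in> pts d m" "z \<in> pts d m" "pdist z y < min \<eta>1 \<eta>2"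
   have "z \<in> fnb d {\<delta>}" using 1(4)[rule_format, of m y z] * by simp
   moreover have "z \<in> fnb d G" using 2(4)[rule_format, of m y z] * by simp
   ultimately show "z \<in> fnb d (insert \<delta> G)" by (simp add: fnb_def)
  qed
  moreover have "w \<in> N1 \<inter> N2" "min \<eta>1 \<eta>2 > 0" using 1 2 by auto
  ultimately show ?case using openin_Int[OF 1(1) 2(1)] by - (rule exI[of _ "N1 \<inter> N2"], rule exI[of _ "min \<eta>1 \<eta>2"], intro conjI)
 qed
 from this[OF _ order_refl] F(1) obtain N \<eta> where N: "openin (free_topology d) N" "w \<in> N" "\<eta> > 0"
  "\<forall>m\<ge>1. \<forall>y z. y \<in> N --> y \<in> pts d m --> z \<in> pts d m --> pdist z y < \<eta> --> z \<in> fnb d F"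
  unfolding valid_polys_def by (elim meta_impE conjE exE) assumption
 show thesis by (rule that[OF N(1-3)]) (rule subsetD[OF F(3)], rule N(4)[rule_format])
qed

lemma fnb_continuity:
 assumes F: "valid_polys d F" and w: "w \<in> fnb d F" and d: "d > 0" and wn: "w \<in> pts d n"
 shows "\<exists>e>0. \<forall>y\<in>pts d n. pdist y w < e --> y \<in> fnb d F"
proof -
 have n: "n \<ge> 1" using w wn d pts_mlevel[OF wn d] by (auto simp: fnb_def nc_space_iff)
 obtain N e where N: "w \<in> N" "e > 0"
  and near: "\<And>m y z. m \<ge> 1 ==> y \<in> N ==> y \<in> pts d m ==> z \<in> pts d m ==> pdist z y < e ==> z \<in> fnb d F"
  by (rule uniform_interior[OF fnb_open[OF F d] w wn d]) blast
 show ?thesis using near[OF n N(1) wn] N(2) by blast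
qed

text \<open>A free domain need not be closed under direct sums, but a basic neighbourhood contains a
  direct sum exactly when it contains both summands. So it also contains the sum in the other
  order.\<close>

lemma open_dsum_iff:
 assumes U: "openin (free_topology d) U" and d: "d > 0" and x: "x \<in> nc_space d" and y: "y \<in> nc_space d"
  and xy: "point_dsum x y \<in> U"
 shows "x \<in> U" "y \<in> U" "point_dsum y x \<in> U"
proof -
 obtain F where F: "valid_polys d F" "point_dsum x y \<in> fnb d F" "fnb d F \<subseteq> U" using open_base[OF U xy] .
 then show "x \<in> U" "y \<in> U" "point_dsum y x \<in> U"
  using fnb_dsum[OF F(1) x y d] fnb_dsum[OF F(1) y x d] by auto
qed

section \<open>Level-independent bounds for the functional calculus\<close>

lemma poly_spectrum_le:
 assumes x: "x \<in> Mat n" and c: "c \<in> spectrum x"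
 shows "cmod (poly p c) \<le> op_norm (pm p x)"
 using spectrum_eigenvector[OF x c] eigenvalue_le_op_norm[OF pm_carrier[OF x]] pm_eigvec[OF x] by metis

text \<open>A multiple of the characteristic polynomial. The inequality
  \<open>op_norm (pm p y) < 1\<close> holds at \<open>x\<close>, is an open condition in the free
  topology, and forces the spectrum of \<open>y\<close> into \<open>N\<close> at every
  level.\<close>

lemma annihilating_poly_large_off:
 assumes x: "x \<in> Mat n" and N: "open N" "spectrum x \<subseteq> N"
 obtains p where "pm p x = 0\<^sub>m n n" "\<And>z. z \<notin> N ==> cmod (poly p z) \<ge> 2"
proof -
 interpret hc_setting x n N using x N by unfold_locales
 obtain es where es: "char_poly x = (\<Prod>e\<leftarrow>es. [:- e, 1:])" using char_poly_factorized[OF x] by auto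
 have sub: "set es \<subseteq> N" using N(2) spectrum_root[OF x] es by (auto simp: poly_prod_list prod_list_zero_iff image_iff)
 have "\<exists>\<eta>>0. \<forall>z. z \<notin> N --> (\<forall>e\<in>set es. cmod (z - e) \<ge> \<eta>)"
  using sub
 proof (induction es)
  case Nil
  then show ?case by (intro exI[of _ 1]) auto
 next
  case (Cons e es)
  then obtain \<eta> where h: "\<eta> > 0" "\<And>z e. z \<notin> N ==> e \<in> set es ==> cmod (z - e) \<ge> \<eta>" by auto
  obtain d where d: "d > 0" "ball e d \<subseteq> N" using Cons(2) N(1) by (metis list.set_intros(1) openE subsetD)
  show ?case
  proof (intro exI[of _ "min d \<eta>"] conjI allI impI ballI)
   show "0 < min d \<eta>" using d h by simp
   fix z e' assume z: "z \<notin> N" and e': "e' \<in> set (e # es)"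
   have "cmod (z - e) \<ge> d" using z d(2) by (force simp: dist_norm norm_minus_commute)
   then show "min d \<eta> \<le> cmod (z - e')" using h(2)[OF z] e' by (cases "e' = e") (auto simp: min_le_iff_disj)
  qed
 qed
 then obtain \<eta> where h: "\<eta> > 0" "\<And>z e. z \<notin> N ==> e \<in> set es ==> cmod (z - e) \<ge> \<eta>" by auto
 have big: "cmod (poly (char_poly x) z) \<ge> \<eta> ^ length es" if z: "z \<notin> N" for z
 proof -
  have "cmod (poly (\<Prod>e\<leftarrow>fs. [:- e, 1:]) z) \<ge> \<eta> ^ length fs" if "set fs \<subseteq> set es" for fs
   using that
  proof (induction fs)
   case (Cons f fs)
   have "\<eta> * \<eta> ^ length fs \<le> cmod (z - f) * cmod (poly (\<Prod>e\<leftarrow>fs. [:- e, 1:]) z)"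
    using Cons h(1) h(2)[OF z, of f] by (intro mult_mono) auto
   then show ?case by (simp add: norm_mult[symmetric] algebra_simps)
  qed simp
  then show ?thesis using es by auto
 qed
 \<comment> \<open>Raises the lower bound \<open>\<eta> ^ length es\<close> to 2. The distance from
   2 to the bound 1 on \<open>op_norm (pm p y)\<close> is what the estimate of the resolvent lives
   on.\<close>
 let ?c = "complex_of_real (2 / \<eta> ^ length es)"
 show thesis
 proof (rule that[of "[:?c:] * char_poly x"])
  show "pm ([:?c:] * char_poly x) x = 0\<^sub>m n n"
   unfolding pm_mult cayley_hamilton_pm by (rule right_mult_zero_mat[OF pm_carrier[OF x]])
  fix z assume "z \<notin> N"
  have c: "cmod ?c = 2 / \<eta> ^ length es" using h by (simp only: norm_of_real) simp
  have "2 = cmod ?c * \<eta> ^ length es" using c h by simp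
  also have "\<dots> \<le> cmod ?c * cmod (poly (char_poly x) z)" using big[OF \<open>z \<notin> N\<close>] by (intro mult_left_mono) auto
  also have "\<dots> = cmod (poly ([:?c:] * char_poly x) z)"
  proof -
   have "poly ([:?c:] * char_poly x) z = ?c * poly (char_poly x) z" by simp
   then show ?thesis by (simp only: norm_mult)
  qed
  finally show "2 \<le> cmod (poly ([:?c:] * char_poly x) z)" .
 qed
qed

text \<open>p(z) - p(y) is z - y times a divided difference, which is bounded for bounded
  \<open>y\<close> and \<open>z\<close> regardless of the level. The factor \<open>B\<close> is
  meant to be the resolvent, for which z B - y B is the identity.\<close>

lemma pm_divided_difference:
 assumes M: "M \<ge> 0"
 shows "\<exists>K\<ge>0. \<forall>n (y :: complex mat) (B :: complex mat) z. y \<in> Mat n --> B \<in> Mat n --> op_norm y \<le> M --> cmod z \<le> R -->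
  op_norm (poly p z \<cdot>\<^sub>m B - pm p y * B) \<le> K * op_norm (z \<cdot>\<^sub>m B - y * B)"
proof (induction p)
 case 0
 show ?case
 proof (intro exI[of _ 0] conjI allI impI)
  fix n and y B :: "complex mat" and z assume y: "y \<in> Mat n" and B: "B \<in> Mat n"
  have "poly 0 z \<cdot>\<^sub>m B - pm 0 y * B = 0\<^sub>m n n" using y B by (intro eq_matI) (auto simp: pm_0 scalar_prod_def)
  then show "op_norm (poly 0 z \<cdot>\<^sub>m B - pm 0 y * B) \<le> 0 * op_norm (z \<cdot>\<^sub>m B - y * B)" by simp
 qed simp
next
 case (pCons a p)
 obtain K where K: "K \<ge> 0" and IH: "\<And>n (y :: complex mat) (B :: complex mat) z. y \<in> Mat n ==> B \<in> Mat n ==> op_norm y \<le> M ==> cmod z \<le> R ==>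
  op_norm (poly p z \<cdot>\<^sub>m B - pm p y * B) \<le> K * op_norm (z \<cdot>\<^sub>m B - y * B)"
  using pCons(2) by (elim exE conjE) blast
 obtain C where C: "C > 0" "\<And>z. cmod z \<le> R ==> cmod (poly p z) \<le> C" using poly_bound_exists[of R p] by auto
 \<comment> \<open>\<open>C\<close> bounds p(z), the factor of z B - y B in Horner's recursion;
   \<open>M * K\<close> comes from multiplying the error for \<open>p\<close> by
   \<open>y\<close>.\<close>
 show ?case
 proof (intro exI[of _ "C + M * K"] conjI allI impI)
  show "0 \<le> C + M * K" using C M K by simp
  fix n and y B :: "complex mat" and z assume y: "y \<in> Mat n" and B: "B \<in> Mat n" and b: "op_norm y \<le> M" "cmod z \<le> R"
  let ?P = "pm p y" and ?c = "poly p z"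
  have P: "?P \<in> Mat n" using y by simp
  have yB: "y * B \<in> Mat n" and PB: "?P * B \<in> Mat n" and yPB: "y * (?P * B) \<in> Mat n"
   using mult_carrier_mat[OF y B] mult_carrier_mat[OF P B] mult_carrier_mat[OF y mult_carrier_mat[OF P B]] by blast+
  have "pm (pCons a p) y * B = a \<cdot>\<^sub>m B + y * (?P * B)"
  proof -
   have "pm (pCons a p) y * B = (a \<cdot>\<^sub>m 1\<^sub>m n) * B + y * ?P * B"
    unfolding pm_pCons[OF y] by (rule add_mult_distrib_mat[OF _ mult_carrier_mat[OF y P] B]) simp
   then show ?thesis using assoc_mult_mat[OF y P B] mult_smult_assoc_mat[OF one_carrier_mat B, of a] left_mult_one_mat[OF B] by simp
  qed
  moreover have "?c \<cdot>\<^sub>m (z \<cdot>\<^sub>m B - y * B) + y * (?c \<cdot>\<^sub>m B - ?P * B) = ?c \<cdot>\<^sub>m (z \<cdot>\<^sub>m B - y * B) + (?c \<cdot>\<^sub>m (y * B) - y * (?P * B))"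
   using mult_minus_distrib_mat[OF y _ PB, of "?c \<cdot>\<^sub>m B"] mult_smult_distrib[OF y B, of ?c] B by simp
  moreover have "(a + z * ?c) \<cdot>\<^sub>m B - (a \<cdot>\<^sub>m B + y * (?P * B)) = ?c \<cdot>\<^sub>m (z \<cdot>\<^sub>m B - y * B) + (?c \<cdot>\<^sub>m (y * B) - y * (?P * B))"
  proof (rule eq_matI)
   fix i j assume "i < dim_row (?c \<cdot>\<^sub>m (z \<cdot>\<^sub>m B - y * B) + (?c \<cdot>\<^sub>m (y * B) - y * (?P * B)))"
    "j < dim_col (?c \<cdot>\<^sub>m (z \<cdot>\<^sub>m B - y * B) + (?c \<cdot>\<^sub>m (y * B) - y * (?P * B)))"
   then have ij: "i < n" "j < n" using carrier_matD[OF yPB] by (auto simp del: index_mult_mat)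
   show "((a + z * ?c) \<cdot>\<^sub>m B - (a \<cdot>\<^sub>m B + y * (?P * B))) $$ (i, j) =
    (?c \<cdot>\<^sub>m (z \<cdot>\<^sub>m B - y * B) + (?c \<cdot>\<^sub>m (y * B) - y * (?P * B))) $$ (i, j)"
    using ij carrier_matD[OF yPB] carrier_matD[OF yB] carrier_matD[OF B]
    by (simp del: index_mult_mat add: algebra_simps)
  qed (use carrier_matD[OF yPB] carrier_matD[OF yB] carrier_matD[OF B] in \<open>simp_all del: index_mult_mat\<close>)
  ultimately have e: "poly (pCons a p) z \<cdot>\<^sub>m B - pm (pCons a p) y * B = ?c \<cdot>\<^sub>m (z \<cdot>\<^sub>m B - y * B) + y * (?c \<cdot>\<^sub>m B - ?P * B)"
   by simp
  have D: "z \<cdot>\<^sub>m B - y * B \<in> Mat n" and E: "?c \<cdot>\<^sub>m B - ?P * B \<in> Mat n" using yB PB by auto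
  have "op_norm (poly (pCons a p) z \<cdot>\<^sub>m B - pm (pCons a p) y * B) \<le> op_norm (?c \<cdot>\<^sub>m (z \<cdot>\<^sub>m B - y * B)) + op_norm (y * (?c \<cdot>\<^sub>m B - ?P * B))"
   unfolding e using D mult_carrier_mat[OF y E] by (intro op_norm_add[of _ n n]) auto
  also have "\<dots> \<le> cmod ?c * op_norm (z \<cdot>\<^sub>m B - y * B) + op_norm y * op_norm (?c \<cdot>\<^sub>m B - ?P * B)"
   using op_norm_mult[OF y E] op_norm_smult[OF D, of ?c] by simp
  also have "\<dots> \<le> C * op_norm (z \<cdot>\<^sub>m B - y * B) + M * (K * op_norm (z \<cdot>\<^sub>m B - y * B))"
   using C(2)[OF b(2)] b(1) IH[OF y B b] op_norm_nonneg[OF D] op_norm_nonneg[OF E] M C(1) by (intro add_mono mult_mono) auto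
  finally show "op_norm (poly (pCons a p) z \<cdot>\<^sub>m B - pm (pCons a p) y * B) \<le> (C + M * K) * op_norm (z \<cdot>\<^sub>m B - y * B)"
   by (simp add: algebra_simps)
 qed
qed

text \<open>For the resolvent R the divided difference bounds p(z) R - p(y) R by \<open>K\<close>.
  As |p(z)| >= 2 and ||p(y)|| < 1, the term p(y) R can be absorbed and ||R|| <= K remains.\<close>

lemma resolvent_bound:
 assumes M: "M \<ge> 0"
 shows "\<exists>K\<ge>0. \<forall>n y z. y \<in> Mat n --> op_norm y \<le> M --> cmod z \<le> R --> cmod (poly p z) \<ge> 2 -->
  op_norm (pm p y) < 1 --> z \<notin> spectrum y \<and> op_norm (resolvent y z) \<le> K"
proof -
 obtain K where K: "K \<ge> 0" and *: "\<And>n (y :: complex mat) (B :: complex mat) z. y \<in> Mat n ==> B \<in> Mat n ==> op_norm y \<le> M ==> cmod z \<le> R ==>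
  op_norm (poly p z \<cdot>\<^sub>m B - pm p y * B) \<le> K * op_norm (z \<cdot>\<^sub>m B - y * B)"
  using pm_divided_difference[OF M, of R p] by (elim exE conjE) blast
 show ?thesis
 proof (intro exI[of _ K] conjI allI impI)
  fix n y z assume y: "y \<in> Mat n" "op_norm y \<le> M" and z: "cmod z \<le> R" "cmod (poly p z) \<ge> 2" and p: "op_norm (pm p y) < 1"
  show zs: "z \<notin> spectrum y" using poly_spectrum_le[OF y(1), of z p] z p by force
  let ?R = "resolvent y z"
  note R = resolvent[OF y(1) zs]
  have PR: "pm p y * ?R \<in> Mat n" using mult_carrier_mat[OF pm_carrier[OF y(1)] R(2)] .
  have "(z \<cdot>\<^sub>m 1\<^sub>m n - y) * ?R = z \<cdot>\<^sub>m ?R - y * ?R"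
   using minus_mult_distrib_mat[OF _ y(1) R(2), of "z \<cdot>\<^sub>m 1\<^sub>m n"] mult_smult_assoc_mat[OF one_carrier_mat R(2), of z] left_mult_one_mat[OF R(2)] by simp
  then have one: "z \<cdot>\<^sub>m ?R - y * ?R = 1\<^sub>m n" using R(3) by simp
  have "K * op_norm (1\<^sub>m n) \<le> K * 1" using op_norm_one_le K by (intro mult_left_mono) auto
  then have d: "op_norm (poly p z \<cdot>\<^sub>m ?R - pm p y * ?R) \<le> K" using *[OF y(1) R(2) y(2) z(1)] one by simp
  have "op_norm (poly p z \<cdot>\<^sub>m ?R) \<le> op_norm (pm p y * ?R) + op_norm (poly p z \<cdot>\<^sub>m ?R - pm p y * ?R)"
   using R(2) PR by (intro op_norm_le_add_diff[of _ n n]) auto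
  moreover have "op_norm (pm p y * ?R) \<le> op_norm (pm p y) * op_norm ?R" by (rule op_norm_mult[OF pm_carrier[OF y(1)] R(2)])
  moreover have "op_norm (pm p y) * op_norm ?R \<le> 1 * op_norm ?R" using p op_norm_nonneg[OF R(2)] by (intro mult_right_mono) auto
  moreover have "2 * op_norm ?R \<le> op_norm (poly p z \<cdot>\<^sub>m ?R)"
   unfolding op_norm_smult[OF R(2)] using z op_norm_nonneg[OF R(2)] by (intro mult_right_mono) auto
  ultimately show "op_norm ?R \<le> K" using d by linarith
 qed (rule K)
qed

lemma sesquilinear_bound:
 assumes "R \<in> Mat n" "op_norm R \<le> K" "K \<ge> 0"
 shows "cmod (\<Sum>i<n. \<Sum>j<n. w i * b j * R $$ (i, j)) \<le> K * L2_set (\<lambda>i. cmod (w i)) {..<n} * L2_set (\<lambda>j. cmod (b j)) {..<n}"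
proof -
 let ?v = "\<lambda>i. \<Sum>j<n. R $$ (i, j) * b j"
 have "(\<Sum>i<n. \<Sum>j<n. w i * b j * R $$ (i, j)) = (\<Sum>i<n. w i * ?v i)"
  by (simp add: sum_distrib_left mult_ac)
 also have "cmod \<dots> \<le> (\<Sum>i<n. \<bar>cmod (w i)\<bar> * \<bar>cmod (?v i)\<bar>)"
  by (rule order.trans[OF norm_sum]) (simp add: norm_mult)
 also have "\<dots> \<le> L2_set (\<lambda>i. cmod (w i)) {..<n} * L2_set (\<lambda>i. cmod (?v i)) {..<n}" by (rule L2_set_mult_ineq)
 also have "\<dots> \<le> L2_set (\<lambda>i. cmod (w i)) {..<n} * (K * L2_set (\<lambda>j. cmod (b j)) {..<n})"
  using opb_mono[OF op_norm_opb[OF assms(1)] assms(2)] unfolding opb_def by (intro mult_left_mono) auto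
 finally show ?thesis by (simp add: mult_ac)
qed

locale discs =
 fixes \<gamma> :: "complex set" and r :: real
 assumes fin: "finite \<gamma>" and r: "r > 0" and sep: "\<And>c d. c \<in> \<gamma> ==> d \<in> \<gamma> ==> c \<noteq> d ==> r < 1/4 * cmod (c - d)"
begin

definition \<Delta> :: "complex set" where "\<Delta> = (\<Union>c\<in>\<gamma>. ball c r)"

lemma open_\<Delta>: "open \<Delta>" by (auto simp: \<Delta>_def)

text \<open>One neighbourhood serves all functions: it is cut out by a polynomial that vanishes at \<open>x\<close>
 and is large off slightly smaller discs, over whose boundary circles the calculus is a
 contour integral.\<close>

lemma calculus_bound:
 assumes x: "x \<in> Mat n" "spectrum x \<subseteq> \<Delta>"
 obtains p M where "M > 0" "pm p x = 0\<^sub>m n n" "op_norm x < M"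
  "\<And>m y. y \<in> Mat m ==> op_norm (pm p y) < 1 ==> spectrum y \<subseteq> \<Delta>"
  "\<And>h. h holomorphic_on \<Delta> ==> \<exists>K\<ge>0. \<forall>m y. y \<in> Mat m --> op_norm (pm p y) < 1 --> op_norm y < M -->
   op_norm (hol_calculus h y) \<le> K"
proof -
 \<comment> \<open>The spectrum is finite, so it fits into strictly smaller concentric discs; their
   boundary circles are compact subsets of \<open>\<Delta>\<close> and serve as contours.\<close>
 have "\<exists>\<rho>. 0 < \<rho> \<and> \<rho> < r \<and> spectrum x \<subseteq> (\<Union>c\<in>\<gamma>. ball c \<rho>)"
 proof -
  have "\<exists>c\<in>\<gamma>. dist c z < r" if z: "z \<in> spectrum x" for z
   using subsetD[OF x(2) z] unfolding \<Delta>_def UN_iff mem_ball .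
  then obtain C where C: "\<And>z. z \<in> spectrum x ==> C z \<in> \<gamma> \<and> dist (C z) z < r" by metis
  define \<rho>0 where "\<rho>0 = Max (insert 0 ((\<lambda>z. dist (C z) z) ` spectrum x))"
  have fin: "finite (insert 0 ((\<lambda>z. dist (C z) z) ` spectrum x))" using card_finite_spectrum(1)[OF x(1)] by simp
  have "\<rho>0 < r" "\<rho>0 \<ge> 0" unfolding \<rho>0_def using fin r C by (auto simp: Max_less_iff[OF fin])
  then obtain \<rho> where \<rho>: "\<rho>0 < \<rho>" "\<rho> < r" "0 < \<rho>" using dense by (metis order.strict_trans1)
  have "z \<in> (\<Union>c\<in>\<gamma>. ball c \<rho>)" if z: "z \<in> spectrum x" for z
  proof -
   have "dist (C z) z \<le> \<rho>0" unfolding \<rho>0_def using fin z by (intro Max_ge) auto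
   then show ?thesis using C[OF z] \<rho>(1) by (intro UN_I[of "C z"]) auto
  qed
  then show ?thesis using \<rho> by blast
 qed
 then obtain \<rho> where \<rho>: "0 < \<rho>" "\<rho> < r" and sub: "spectrum x \<subseteq> (\<Union>c\<in>\<gamma>. ball c \<rho>)" by auto
 let ?N = "\<Union>c\<in>\<gamma>. ball c \<rho>"
 have oN: "open ?N" by auto
 obtain p where p: "pm p x = 0\<^sub>m n n" "\<And>z. z \<notin> ?N ==> cmod (poly p z) \<ge> 2" using annihilating_poly_large_off[OF x(1) oN sub] by blast
 \<comment> \<open>The centres are more than \<open>4 * r\<close> apart, so a circle about one
   centre meets no disc about another.\<close>
 have circ: "z \<notin> ?N" if "c \<in> \<gamma>" "cmod (z - c) = \<rho>" for z c
 proof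
  assume "z \<in> ?N"
  then obtain d where d: "d \<in> \<gamma>" "dist d z < \<rho>" by auto
  then have "c \<noteq> d" using that by (auto simp: dist_norm norm_minus_commute)
  then have "4 * r < cmod (c - d)" using sep[OF that(1) d(1)] by simp
  also have "cmod (c - d) \<le> cmod (z - c) + cmod (z - d)" using norm_triangle_ineq4[of "z - d" "z - c"] by (simp add: add.commute)
  finally show False using that d \<rho> r by (simp add: dist_norm norm_minus_commute)
 qed
 have spec: "spectrum y \<subseteq> ?N" if y: "y \<in> Mat m" "op_norm (pm p y) < 1" for m y
 proof
  fix c assume "c \<in> spectrum y"
  then have "cmod (poly p c) < 2" using poly_spectrum_le[OF y(1), of c p] y(2) by linarith
  then show "c \<in> ?N" using p(2)[of c] by (metis linorder_not_less)
 qed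
 define M where "M = op_norm x + 1"
 have M: "M > 0" "op_norm x < M" using op_norm_nonneg[OF x(1)] by (auto simp: M_def)
 define R where "R = (\<Sum>c\<in>\<gamma>. cmod c) + r"
 have cR: "cmod z \<le> R" if "c \<in> \<gamma>" "cmod (z - c) = \<rho>" for z c
 proof -
  have "cmod z \<le> cmod c + cmod (z - c)" using norm_triangle_ineq[of c "z - c"] by simp
  also have "cmod c \<le> (\<Sum>c\<in>\<gamma>. cmod c)" using fin that by (intro member_le_sum) auto
  finally show ?thesis using that \<rho> by (simp add: R_def)
 qed
 obtain K where K: "K \<ge> 0" and RK: "\<And>n y z. y \<in> Mat n ==> op_norm y \<le> M ==> cmod z \<le> R ==> cmod (poly p z) \<ge> 2 ==>
  op_norm (pm p y) < 1 ==> z \<notin> spectrum y \<and> op_norm (resolvent y z) \<le> K"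
  using resolvent_bound[of M R p] M(1) by (auto simp: less_imp_le)
 show thesis
 proof (rule that[OF M(1) p(1) M(2)])
  fix m y assume "y \<in> Mat m" "op_norm (pm p y) < 1"
  note sp = spec[OF this]
  show "spectrum y \<subseteq> \<Delta>"
  proof
   fix z assume "z \<in> spectrum y"
   then obtain e where "e \<in> \<gamma>" "dist e z < \<rho>" using sp by auto
   then show "z \<in> \<Delta>" using \<rho>(2) unfolding \<Delta>_def by (intro UN_I[of e]) auto
  qed
 next
  fix h assume h: "h holomorphic_on \<Delta>"
  let ?C = "\<Union>c\<in>\<gamma>. sphere c \<rho>"
  have C\<Delta>: "?C \<subseteq> \<Delta>" using \<rho> by (auto simp: \<Delta>_def)
  have "compact ?C" using fin by (rule compact_UN) auto
  then have "compact (h ` ?C)"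
   by (rule compact_continuous_image[OF continuous_on_subset[OF holomorphic_on_imp_continuous_on[OF h] C\<Delta>]])
  then have "bounded (h ` ?C)" by (rule compact_imp_bounded)
  then obtain H0 where H0': "\<forall>x\<in>h ` ?C. cmod x \<le> H0" unfolding bounded_iff by (elim exE)
  have H0: "cmod (h z) \<le> H0" if "z \<in> ?C" for z by (rule H0'[rule_format, OF imageI[OF that]])
  define H where "H = max 0 H0"
  have H: "H \<ge> 0" "\<And>z c. c \<in> \<gamma> ==> cmod (z - c) = \<rho> ==> cmod (h z) \<le> H"
   proof -
   show "H \<ge> 0" by (simp add: H_def)
   fix z c assume c: "c \<in> \<gamma>" "cmod (z - c) = \<rho>"
   then have "z \<in> ?C" by (auto simp: dist_norm norm_minus_commute)
   then show "cmod (h z) \<le> H" using H0[of z] by (simp add: H_def)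
  qed
  show "\<exists>K\<ge>0. \<forall>m y. y \<in> Mat m --> op_norm (pm p y) < 1 --> op_norm y < M --> op_norm (hol_calculus h y) \<le> K"
  proof (intro exI[of _ "card \<gamma> * (H * K * \<rho>)"] conjI allI impI)
   show "0 \<le> card \<gamma> * (H * K * \<rho>)" using H K \<rho> by simp
   fix m y assume y: "y \<in> Mat m" and yp: "op_norm (pm p y) < 1" and yM: "op_norm y < M"
   let ?A = "hol_calculus h y" and ?\<sigma> = "spectrum y"
   have fs: "finite ?\<sigma>" using card_finite_spectrum(1)[OF y] .
   have circ\<sigma>: "z \<notin> ?\<sigma> \<and> op_norm (resolvent y z) \<le> K" if "c \<in> \<gamma>" "cmod (z - c) = \<rho>" for z c
    using RK[OF y _ cR[OF that] p(2)[OF circ[OF that]] yp] yM by simp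
   define I where "I c i j = 2 * pi * \<i> * (\<Sum>e\<in>?\<sigma> \<inter> ball c \<rho>. residue (\<lambda>z. h z * resolvent y z $$ (i, j)) e)" for c i j
   have int: "((\<lambda>z. h z * resolvent y z $$ (i, j)) has_contour_integral I c i j) (circlepath c \<rho>)"
    if c: "c \<in> \<gamma>" and ij: "i < m" "j < m" for c i j
   proof -
    have hol: "(\<lambda>z. h z * resolvent y z $$ (i, j)) holomorphic_on ball c r - ?\<sigma>"
     using c by (intro holomorphic_on_mult holomorphic_on_subset[OF h] holomorphic_on_subset[OF holomorphic_on_resolvent[OF y ij]]) (auto simp: \<Delta>_def)
    have "?\<sigma> \<inter> ball c r \<subseteq> ball c \<rho>"
    proof
     fix e assume e: "e \<in> ?\<sigma> \<inter> ball c r"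
     then obtain d where d: "d \<in> \<gamma>" "dist d e < \<rho>" using spec[OF y yp] by auto
     have "c = d"
     proof (rule ccontr)
      assume "c \<noteq> d"
      then have "4 * r < dist c d" using sep[OF c d(1)] by (simp add: dist_norm)
      also have "\<dots> \<le> dist c e + dist d e" by (rule dist_triangle2)
      finally show False using e d \<rho> by simp
     qed
     then show "e \<in> ball c \<rho>" using d by simp
    qed
    from residue_circle[OF fs \<rho> this hol] have "contour_integral (circlepath c \<rho>) (\<lambda>z. h z * resolvent y z $$ (i, j)) = I c i j"
     by (simp add: I_def)
    moreover have "(\<lambda>z. h z * resolvent y z $$ (i, j)) contour_integrable_on (circlepath c \<rho>)"
    proof (rule contour_integrable_holomorphic_simple[OF hol])
     show "open (ball c r - ?\<sigma>)" using fs by (intro open_Diff finite_imp_closed) auto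
     show "path_image (circlepath c \<rho>) \<subseteq> ball c r - ?\<sigma>"
      using circ\<sigma>[OF c] \<rho> by (auto simp: dist_norm norm_minus_commute)
    qed simp
    ultimately show ?thesis using has_contour_integral_integral by metis
   qed
   have entry: "2 * pi * \<i> * ?A $$ (i, j) = (\<Sum>c\<in>\<gamma>. I c i j)" if ij: "i < m" "j < m" for i j
   proof -
    have un: "?\<sigma> = (\<Union>c\<in>\<gamma>. ?\<sigma> \<inter> ball c \<rho>)" using spec[OF y yp] by auto
    have "?A $$ (i, j) = (\<Sum>e\<in>?\<sigma>. residue (\<lambda>z. h z * resolvent y z $$ (i, j)) e)"
     by (rule hc_entry[OF y ij])
    also have "\<dots> = (\<Sum>e\<in>(\<Union>c\<in>\<gamma>. ?\<sigma> \<inter> ball c \<rho>). residue (\<lambda>z. h z * resolvent y z $$ (i, j)) e)"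
     by (rule sum.cong[OF un refl])
    also have "\<dots> = (\<Sum>c\<in>\<gamma>. \<Sum>e\<in>?\<sigma> \<inter> ball c \<rho>. residue (\<lambda>z. h z * resolvent y z $$ (i, j)) e)"
    proof (rule sum.UNION_disjoint)
     show "\<forall>c\<in>\<gamma>. \<forall>d\<in>\<gamma>. c \<noteq> d --> ?\<sigma> \<inter> ball c \<rho> \<inter> (?\<sigma> \<inter> ball d \<rho>) = {}"
     proof (intro ballI impI)
      fix c d assume cd: "c \<in> \<gamma>" "d \<in> \<gamma>" "c \<noteq> d"
      have False if "dist c e < \<rho>" "dist d e < \<rho>" for e
       using sep[OF cd] dist_triangle2[of c d e] that \<rho> by (simp add: dist_norm)
      then show "?\<sigma> \<inter> ball c \<rho> \<inter> (?\<sigma> \<inter> ball d \<rho>) = {}" by auto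
     qed
    qed (use fin fs in auto)
    finally show ?thesis by (simp add: I_def sum_distrib_left)
   qed
   have A: "?A \<in> Mat m" using y by simp
   show "op_norm ?A \<le> card \<gamma> * (H * K * \<rho>)"
   proof (rule op_norm_leI[OF A])
    show "opb {..<m} {..<m} (ent ?A) (card \<gamma> * (H * K * \<rho>))"
     unfolding opb_def
    proof
     fix b :: "nat => complex"
     define v where "v i = (\<Sum>j<m. ?A $$ (i, j) * b j)" for i
     \<comment> \<open>Pairing the vector \<open>v\<close>, the image of \<open>b\<close>, with its
       own conjugate yields its squared norm. Only scalar contour integrals then have to be
       estimated, and the operator norm of the resolvent enters as a whole; estimating entries would
       lose a factor that grows with the level.\<close>
     define w where "w i = cnj (v i)" for i
     let ?nv = "L2_set (\<lambda>i. cmod (v i)) {..<m}" and ?nb = "L2_set (\<lambda>j. cmod (b j)) {..<m}"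
     have nw: "L2_set (\<lambda>i. cmod (w i)) {..<m} = ?nv" by (simp add: w_def)
     have "complex_of_real (?nv\<^sup>2) = (\<Sum>i<m. w i * v i)"
     proof -
      have "?nv\<^sup>2 = (\<Sum>i<m. (cmod (v i))\<^sup>2)" by (simp add: L2_set_def sum_nonneg)
      then have "complex_of_real (?nv\<^sup>2) = (\<Sum>i<m. complex_of_real ((cmod (v i))\<^sup>2))" by simp
      also have "\<dots> = (\<Sum>i<m. w i * v i)" 
       by (intro sum.cong refl) (metis w_def complex_norm_square mult.commute)
      finally show ?thesis .
     qed
     also have "\<dots> = (\<Sum>i<m. \<Sum>j<m. w i * b j * ?A $$ (i, j))"
      by (simp add: v_def sum_distrib_left mult_ac)
     finally have sq: "complex_of_real (?nv\<^sup>2) = (\<Sum>i<m. \<Sum>j<m. w i * b j * ?A $$ (i, j))" .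
     have "2 * pi * \<i> * complex_of_real (?nv\<^sup>2) = (\<Sum>i<m. \<Sum>j<m. w i * b j * (2 * pi * \<i> * ?A $$ (i, j)))"
      unfolding sq sum_distrib_left by (intro sum.cong refl) (simp add: mult_ac)
     also have "\<dots> = (\<Sum>i<m. \<Sum>j<m. \<Sum>c\<in>\<gamma>. w i * b j * I c i j)"
      by (intro sum.cong refl) (simp only: entry lessThan_iff sum_distrib_left)
     also have "\<dots> = (\<Sum>i<m. \<Sum>c\<in>\<gamma>. \<Sum>j<m. w i * b j * I c i j)"
      by (intro sum.cong refl sum.swap)
     also have "\<dots> = (\<Sum>c\<in>\<gamma>. \<Sum>i<m. \<Sum>j<m. w i * b j * I c i j)" by (rule sum.swap)
     finally have "cmod (2 * pi * \<i> * complex_of_real (?nv\<^sup>2)) \<le> (\<Sum>c\<in>\<gamma>. cmod (\<Sum>i<m. \<Sum>j<m. w i * b j * I c i j))"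
      by (simp only: norm_sum)
     also have "\<dots> \<le> (\<Sum>c\<in>\<gamma>. (H * (K * ?nv * ?nb)) * (2 * pi * \<rho>))"
     proof (rule sum_mono)
      fix c assume c: "c \<in> \<gamma>"
      have hi: "((\<lambda>z. \<Sum>i<m. \<Sum>j<m. w i * b j * (h z * resolvent y z $$ (i, j))) has_contour_integral (\<Sum>i<m. \<Sum>j<m. w i * b j * I c i j)) (circlepath c \<rho>)"
       using int[OF c] by (intro has_contour_integral_sum has_contour_integral_lmul) auto
      show "cmod (\<Sum>i<m. \<Sum>j<m. w i * b j * I c i j) \<le> (H * (K * ?nv * ?nb)) * (2 * pi * \<rho>)"
      proof (rule has_contour_integral_bound_circlepath[OF hi])
       show "0 \<le> H * (K * ?nv * ?nb)" using H K by simp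
       fix z assume z: "cmod (z - c) = \<rho>"
       note R = circ\<sigma>[OF c z]
       have "(\<Sum>i<m. \<Sum>j<m. w i * b j * (h z * resolvent y z $$ (i, j))) = h z * (\<Sum>i<m. \<Sum>j<m. w i * b j * resolvent y z $$ (i, j))"
        by (simp add: sum_distrib_left mult_ac)
       then have "cmod (\<Sum>i<m. \<Sum>j<m. w i * b j * (h z * resolvent y z $$ (i, j))) = cmod (h z) * cmod (\<Sum>i<m. \<Sum>j<m. w i * b j * resolvent y z $$ (i, j))"
        by (simp add: norm_mult)
       also have "\<dots> \<le> H * (K * L2_set (\<lambda>i. cmod (w i)) {..<m} * ?nb)"
        using R resolvent(2)[OF y] H(1) H(2)[OF c z] K by (intro mult_mono sesquilinear_bound) auto
       finally show "cmod (\<Sum>i<m. \<Sum>j<m. w i * b j * (h z * resolvent y z $$ (i, j))) \<le> H * (K * ?nv * ?nb)"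
        unfolding nw .
      qed (rule \<rho>(1))
     qed
     also have "\<dots> = 2 * pi * (card \<gamma> * (H * K * \<rho>) * ?nb * ?nv)" by (simp add: mult_ac)
     also have "cmod (2 * pi * \<i> * complex_of_real (?nv\<^sup>2)) = 2 * pi * ?nv\<^sup>2"
     proof -
      have "cmod (2 * pi * \<i> * complex_of_real t) = 2 * pi * t" if "t \<ge> 0" for t
       using that by (simp add: norm_mult)
      from this[of "?nv\<^sup>2"] show ?thesis by (simp only: zero_le_power2 simp_thms)
     qed
     finally have "2 * pi * ?nv\<^sup>2 \<le> 2 * pi * (card \<gamma> * (H * K * \<rho>) * ?nb * ?nv)" .
     then have "?nv * ?nv \<le> (card \<gamma> * (H * K * \<rho>) * ?nb) * ?nv" by (simp add: power2_eq_square)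
     moreover have "0 \<le> card \<gamma> * (H * K * \<rho>) * ?nb" using H K \<rho> by simp
     ultimately have "?nv \<le> card \<gamma> * (H * K * \<rho>) * ?nb" 
      using L2_set_nonneg[of "\<lambda>i. cmod (v i)" "{..<m}"] by (metis less_eq_real_def mult_right_le_imp_le)
     then show "L2_set (\<lambda>i. cmod (\<Sum>j<m. ?A $$ (i, j) * b j)) {..<m} \<le> card \<gamma> * (H * K * \<rho>) * ?nb" by (simp add: v_def)
    qed
    show "0 \<le> card \<gamma> * (H * K * \<rho>)" using H K \<rho> by simp
   qed
  qed
 qed
qed

end

section \<open>Coordinates adapted to \<open>\<pi>\<close>\<close>

definition uu :: "nc_point => complex mat" where "uu w = (1/2) \<cdot>\<^sub>m (w ! 0 + w ! 1)"
definition vv :: "nc_point => complex mat" where "vv w = (1/2) \<cdot>\<^sub>m (w ! 0 - w ! 1)"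
definition mkw :: "complex mat => complex mat => nc_point" where "mkw u v = [u + v, u - v]"

lemma uu_vv_carrier [simp]:
 "w \<in> pts 2 n ==> uu w \<in> Mat n" "w \<in> pts 2 n ==> vv w \<in> Mat n"
 using ptsD(2)[of w 2 n 0] ptsD(2)[of w 2 n 1] by (auto simp: uu_def vv_def)

lemma mkw_pts [simp]: "u \<in> Mat n ==> v \<in> Mat n ==> mkw u v \<in> pts 2 n"
 by (auto simp: pts_def mkw_def)

lemma pts2_eqI: "x \<in> pts 2 n ==> y \<in> pts 2 m ==> x ! 0 = y ! 0 ==> x ! 1 = y ! 1 ==> x = y"
 by (rule point_eqI) (auto simp: less_2_cases_iff)

lemma mkw_uu_vv: 
 assumes "w \<in> pts 2 n" shows "mkw (uu w) (vv w) = w"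
proof (rule pts2_eqI[OF mkw_pts[OF uu_vv_carrier[OF assms]] assms])
 note c = ptsD(2)[OF assms, of 0] ptsD(2)[OF assms, of 1]
 show "mkw (uu w) (vv w) ! 0 = w ! 0" "mkw (uu w) (vv w) ! 1 = w ! 1"
  using c by (auto simp: mkw_def uu_def vv_def field_simps intro!: eq_matI)
qed

lemma uu_vv_mkw:
 assumes "u \<in> Mat n" "v \<in> Mat n"
 shows "uu (mkw u v) = u" "vv (mkw u v) = v"
 using assms by (auto simp: mkw_def uu_def vv_def intro!: eq_matI)

lemma list2_pts: "a \<in> Mat n ==> b \<in> Mat n ==> [a, b] \<in> pts 2 n"
 by (auto simp: pts_def)

lemma flip_pts [simp]: "w \<in> pts 2 n ==> flip w \<in> pts 2 n"
 unfolding flip_def by (intro list2_pts ptsD(2)) auto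

lemma uu_vv_flip:
 assumes "w \<in> pts 2 n" shows "uu (flip w) = uu w" "vv (flip w) = - vv w"
 using ptsD(2)[OF assms, of 0] ptsD(2)[OF assms, of 1] by (auto simp: flip_def uu_def vv_def field_simps intro!: eq_matI)

lemma pi_map_uu_vv:
 assumes w: "w \<in> pts 2 n"
 shows "pi_map w = [uu w, vv w * vv w, vv w * uu w * vv w]"
proof -
 let ?a = "w ! 0" and ?b = "w ! 1"
 have a: "?a \<in> Mat n" and b: "?b \<in> Mat n" using ptsD(2)[OF w] by auto
 have D: "?a - ?b \<in> Mat n" and P: "?a + ?b \<in> Mat n" using a b by auto
 have s: "(c \<cdot>\<^sub>m A) * (d \<cdot>\<^sub>m B) = (c * d) \<cdot>\<^sub>m (A * B)" if "A \<in> Mat n" "B \<in> Mat n" for c d :: complex and A B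
  using that by (intro eq_matI) (auto simp: mult_ac)
 have "vv w * vv w = (1/4) \<cdot>\<^sub>m ((?a - ?b) * (?a - ?b))"
  unfolding vv_def s[OF D D] by simp
 moreover have "vv w * uu w * vv w = (1/8) \<cdot>\<^sub>m ((?a - ?b) * (?a + ?b) * (?a - ?b))"
  unfolding vv_def uu_def s[OF D P] s[OF mult_carrier_mat[OF D P] D] by simp
 ultimately show ?thesis by (simp add: pi_map_def Let_def uu_def)
qed

lemma pi_map_pts [simp]: "w \<in> pts 2 n ==> pi_map w \<in> pts 3 n"
 unfolding pi_map_uu_vv by (auto simp: pts_def intro!: mult_carrier_mat[of _ n n])

lemma uu_vv_conj:
 assumes w: "w \<in> pts 2 n" and s: "s \<in> GL n"
 shows "uu (conj_point s w) = conj_mat s (uu w)" "vv (conj_point s w) = conj_mat s (vv w)"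
 using ptsD[OF w] by (simp_all add: uu_def vv_def nth_conj[of w 2] conj_mat_smult[OF s] conj_mat_add[OF s] conj_mat_minus[OF s])

lemma uu_vv_dsum:
 assumes x: "x \<in> pts 2 n" and y: "y \<in> pts 2 m"
 shows "uu (point_dsum x y) = mat_dsum (uu x) (uu y)" "vv (point_dsum x y) = mat_dsum (vv x) (vv y)"
 using ptsD(2)[OF x] ptsD(2)[OF y]
 by (simp_all add: uu_def vv_def nth_dsum[OF ptsD(1)[OF x] ptsD(1)[OF y]] mat_dsum_smult[of _ n _ m] mat_dsum_add[of _ n _ m] mat_dsum_minus[of _ n _ m])

lemma pi_map_conj:
 assumes w: "w \<in> pts 2 n" and s: "s \<in> GL n"
 shows "pi_map (conj_point s w) = conj_point s (pi_map w)"
 using uu_vv_carrier[OF w] mult_carrier_mat[OF uu_vv_carrier(2)[OF w] uu_vv_carrier(1)[OF w]]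
 unfolding pi_map_uu_vv[OF w] pi_map_uu_vv[OF pts_conj[OF w s]] uu_vv_conj[OF w s]
 by (simp only: conj_point_def list.map conj_mat_mult[OF s])

lemma pi_map_dsum:
 assumes x: "x \<in> pts 2 n" and y: "y \<in> pts 2 m"
 shows "pi_map (point_dsum x y) = point_dsum (pi_map x) (pi_map y)"
 using uu_vv_carrier[OF x] uu_vv_carrier[OF y]
  mult_carrier_mat[OF uu_vv_carrier(2)[OF x] uu_vv_carrier(1)[OF x]] mult_carrier_mat[OF uu_vv_carrier(2)[OF y] uu_vv_carrier(1)[OF y]]
 unfolding pi_map_uu_vv[OF x] pi_map_uu_vv[OF y] pi_map_uu_vv[OF pts_dsum[OF x y]] uu_vv_dsum[OF x y]
 by (simp add: point_dsum_def mat_dsum_mult[of _ n _ m])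

lemma mat_uminus_mult_uminus:
 fixes A B :: "complex mat"
 assumes "A \<in> Mat n" "B \<in> Mat n"
 shows "- A * - B = A * B"
 using assms by (intro eq_matI) (simp_all add: scalar_prod_def)

lemma pi_map_flip:
 assumes w: "w \<in> pts 2 n" shows "pi_map (flip w) = pi_map w"
proof -
 note c = uu_vv_carrier[OF w]
 have "- vv w * uu w * - vv w = vv w * uu w * vv w" "- vv w * - vv w = vv w * vv w"
  using mat_uminus_mult_uminus[OF mult_carrier_mat[OF c(2,1)] c(2)] mat_uminus_mult_uminus[OF c(2) c(2)]
   uminus_mult_left_mat[of "vv w" "uu w"] carrier_matD[OF c(1)] carrier_matD[OF c(2)] by simp_all
 then show ?thesis unfolding pi_map_uu_vv[OF w] pi_map_uu_vv[OF flip_pts[OF w]] uu_vv_flip[OF w] by simp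
qed

text \<open>The condition under which the Sylvester equation v X + X v = C is uniquely solvable. The
  case \<open>a = b\<close> excludes the eigenvalue 0.\<close>

definition sylv :: "complex mat => bool" where
 "sylv v \<longleftrightarrow> (\<forall>a\<in>spectrum v. \<forall>b\<in>spectrum v. a + b \<noteq> 0)"

text \<open>a^2 - v^2 = -(a - v)(-a - v), so by determinants a^2 is an eigenvalue of
  \<open>v * v\<close> iff \<open>a\<close> or \<open>-a\<close> is one of \<open>v\<close>; and
  every complex number is a square.\<close>

lemma spectrum_square:
 fixes v :: "complex mat"
 assumes v: "v \<in> Mat n"
 shows "spectrum (v * v) = (\<lambda>a. a\<^sup>2) ` spectrum v"
proof -
 have v2: "v * v \<in> Mat n" by (rule mult_carrier_mat[OF v v])
 have sp: "a\<^sup>2 \<in> spectrum (v * v) \<longleftrightarrow> a \<in> spectrum v \<or> - a \<in> spectrum v" for a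
 proof -
  let ?P = "a \<cdot>\<^sub>m 1\<^sub>m n - v" and ?M = "- a \<cdot>\<^sub>m 1\<^sub>m n - v"
  have c: "?P \<in> Mat n" "?M \<in> Mat n" using v by auto
  have I: "c \<cdot>\<^sub>m 1\<^sub>m n \<in> Mat n" for c :: complex by simp
  have l: "(c \<cdot>\<^sub>m 1\<^sub>m n) * A = c \<cdot>\<^sub>m A" "A * (c \<cdot>\<^sub>m 1\<^sub>m n) = c \<cdot>\<^sub>m A" if "A \<in> Mat n" for A :: "complex mat" and c
   using that by (simp_all add: mult_smult_assoc_mat[of _ n n _ n] mult_smult_distrib[of _ n n _ n])
  have "?P * ?M = a \<cdot>\<^sub>m ?M - (- a \<cdot>\<^sub>m v - v * v)"
   unfolding minus_mult_distrib_mat[OF I v c(2)] mult_minus_distrib_mat[OF v I v] l[OF c(2)] l[OF v] ..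
  then have "a\<^sup>2 \<cdot>\<^sub>m 1\<^sub>m n - v * v = (- 1) \<cdot>\<^sub>m (?P * ?M)"
   using carrier_matD[OF v] carrier_matD[OF v2] by (auto intro!: eq_matI simp: power2_eq_square algebra_simps simp del: index_mult_mat)
  then have "Determinant.det (a\<^sup>2 \<cdot>\<^sub>m 1\<^sub>m n - v * v) = (- 1) ^ n * (Determinant.det ?P * Determinant.det ?M)"
   using det_mult[OF c] carrier_matD[OF mult_carrier_mat[OF c]] by (simp only: Determinant.det_smult)
  then show ?thesis unfolding spectrum_root[OF v] spectrum_root[OF v2] poly_char_poly[OF v] poly_char_poly[OF v2] by simp
 qed
 show ?thesis
 proof (intro equalityI subsetI)
  fix c assume c: "c \<in> spectrum (v * v)"
  have "c = (csqrt c)\<^sup>2" "c = (- csqrt c)\<^sup>2" by auto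
  then show "c \<in> (\<lambda>a. a\<^sup>2) ` spectrum v" using sp[of "csqrt c"] c by (metis imageI)
 qed (use sp in auto)
qed

locale sqrt_branches =
 fixes r :: "complex set => real" and q :: "complex set => complex => complex"
 assumes choice: "sqrt_choice r q"
begin

lemma Gamma_facts:
 assumes "\<gamma> \<in> Gamma"
 shows "finite \<gamma>" "r \<gamma> > 0" "c \<in> \<gamma> ==> r \<gamma> < cmod c"
  "c \<in> \<gamma> ==> d \<in> \<gamma> ==> c \<noteq> d ==> r \<gamma> < 1/4 * cmod (c - d)"
  "q \<gamma> holomorphic_on Delta r \<gamma>" "z \<in> Delta r \<gamma> ==> (q \<gamma> z)\<^sup>2 = z"
 using assms choice by (auto simp: sqrt_choice_def Gamma_def)

lemma discs_Gamma: "\<gamma> \<in> Gamma ==> discs \<gamma> (r \<gamma>)"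
 unfolding discs_def using Gamma_facts(1,2,4) by blast

lemma Delta_discs: "\<gamma> \<in> Gamma ==> Delta r \<gamma> = discs.\<Delta> \<gamma> (r \<gamma>)"
 by (auto simp: Delta_def discs.\<Delta>_def[OF discs_Gamma] dist_norm norm_minus_commute)

lemma open_Delta: "\<gamma> \<in> Gamma ==> open (Delta r \<gamma>)"
 using discs.open_\<Delta>[OF discs_Gamma] Delta_discs by simp

lemma Delta_nonzero: "\<gamma> \<in> Gamma ==> 0 \<notin> Delta r \<gamma>"
 using Gamma_facts(3) by (force simp: Delta_def)

lemma center_Delta: "\<gamma> \<in> Gamma ==> c \<in> \<gamma> ==> c \<in> Delta r \<gamma>"
 using Gamma_facts(2)[of \<gamma>] by (auto simp: Delta_def intro!: bexI[of _ c])

text \<open>A point in two discs would put their centres within twice the radius of each other,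
  against the separation by four radii. So the definite description in \<open>iota\<close> has a
  unique solution.\<close>

lemma iota_eq:
 assumes g: "\<gamma> \<in> Gamma" and c: "c \<in> \<gamma>" "cmod (z - c) < r \<gamma>"
 shows "iota r \<gamma> \<tau> z = \<tau> c"
proof -
 have "(THE c. c \<in> \<gamma> \<and> cmod (z - c) < r \<gamma>) = c"
 proof (rule the_equality)
  fix d assume d: "d \<in> \<gamma> \<and> cmod (z - d) < r \<gamma>"
  show "d = c"
  proof (rule ccontr)
   assume "d \<noteq> c"
   then have "4 * r \<gamma> < cmod (d - c)" using Gamma_facts(4)[OF g, of d c] c d by simp
   also have "cmod (d - c) \<le> cmod (z - c) + cmod (z - d)" using norm_triangle_ineq4[of "z - c" "z - d"] by (simp add: add.commute)
   finally show False using c d Gamma_facts(2)[OF g] by simp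
  qed
 qed (use c in auto)
 then show ?thesis by (simp add: iota_def)
qed

lemma iota_holomorphic: 
 assumes g: "\<gamma> \<in> Gamma" shows "iota r \<gamma> \<tau> holomorphic_on Delta r \<gamma>"
proof -
 have "iota r \<gamma> \<tau> holomorphic_on (\<Union>c\<in>\<gamma>. ball c (r \<gamma>))"
 proof (rule holomorphic_on_UN_open)
  fix c assume c: "c \<in> \<gamma>"
  show "iota r \<gamma> \<tau> holomorphic_on ball c (r \<gamma>)"
   by (rule holomorphic_transform[of "\<lambda>_. \<tau> c"]) (use iota_eq[OF g c] in \<open>auto simp: dist_norm norm_minus_commute\<close>)
 qed auto
 then show ?thesis using Delta_discs[OF g] discs.\<Delta>_def[OF discs_Gamma[OF g]] by simp
qed

lemma signs_sq: "\<tau> \<in> signs \<gamma> ==> c \<in> \<gamma> ==> \<tau> c = 1 \<or> \<tau> c = -1"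
 by (auto simp: signs_def PiE_def Pi_def)

abbreviation root :: "complex set => (complex => complex) => complex => complex" where
 "root \<gamma> \<tau> \<equiv> \<lambda>z. q \<gamma> z * iota r \<gamma> \<tau> z"

lemma root_holomorphic: "\<gamma> \<in> Gamma ==> root \<gamma> \<tau> holomorphic_on Delta r \<gamma>"
 by (intro holomorphic_on_mult Gamma_facts iota_holomorphic)

lemma root_sq:
 assumes "\<gamma> \<in> Gamma" "\<tau> \<in> signs \<gamma>" "z \<in> Delta r \<gamma>"
 shows "root \<gamma> \<tau> z * root \<gamma> \<tau> z = z"
proof -
 obtain c where c: "c \<in> \<gamma>" "cmod (z - c) < r \<gamma>" using assms by (auto simp: Delta_def)
 have "\<tau> c * \<tau> c = 1" using signs_sq[OF assms(2) c(1)] by auto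
 then have "iota r \<gamma> \<tau> z * iota r \<gamma> \<tau> z = 1" using iota_eq[OF assms(1) c] by simp
 moreover have "q \<gamma> z * q \<gamma> z = z" using Gamma_facts(6)[OF assms(1,3)] by (simp add: power2_eq_square)
 ultimately show ?thesis by (simp add: algebra_simps)
qed

text \<open>Multiplicativity of the calculus turns the square of the root function into
  \<open>x\<close>. An eigenvalue \<open>a\<close> of the result satisfies
  \<open>a = root \<gamma> \<tau> (a\<^sup>2)\<close>, so eigenvalues with equal squares coincide;
  opposite ones would be 0, and \<open>Delta r \<gamma>\<close> does not contain 0.\<close>

lemma S_fun_facts:
 assumes g: "\<gamma> \<in> Gamma" and t: "\<tau> \<in> signs \<gamma>" and xc: "x \<in> Mat n" "spectrum x \<subseteq> Delta r \<gamma>"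
 shows "S_fun r q \<gamma> \<tau> x \<in> Mat n" "S_fun r q \<gamma> \<tau> x * S_fun r q \<gamma> \<tau> x = x" "sylv (S_fun r q \<gamma> \<tau> x)"
  "\<exists>p. S_fun r q \<gamma> \<tau> x = pm p x" "a \<in> spectrum (S_fun r q \<gamma> \<tau> x) ==> root \<gamma> \<tau> (a\<^sup>2) = a"
proof -
 interpret hc_setting x n "Delta r \<gamma>" using xc open_Delta[OF g] by unfold_locales
 let ?f = "root \<gamma> \<tau>"
 note h = root_holomorphic[OF g, of \<tau>]
 let ?S = "S_fun r q \<gamma> \<tau> x"
 have S: "?S = hol_calculus ?f x" by (simp add: S_fun_def)
 show c: "?S \<in> Mat n" unfolding S by (rule hc_carrier[OF xc(1)])
 have "hol_calculus (\<lambda>z. ?f z * ?f z) x = hol_calculus (\<lambda>z. z) x"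
  by (rule hc_cong) (rule root_sq[OF g t])
 then show sq: "?S * ?S = x" using hc_mult[OF h h] hc_id S by simp
 have ev: "a = ?f (a\<^sup>2)" "a\<^sup>2 \<in> spectrum x" if a: "a \<in> spectrum ?S" for a
 proof -
  show sp: "a\<^sup>2 \<in> spectrum x" using spectrum_square[OF c] a sq by auto
  obtain y where y: "y \<in> carrier_vec n" "y \<noteq> 0\<^sub>v n" "?S *\<^sub>v y = a \<cdot>\<^sub>v y" using spectrum_eigenvector[OF c a] .
  have "x *\<^sub>v y = ?S *\<^sub>v (?S *\<^sub>v y)" using assoc_mult_mat_vec[OF c c y(1)] sq by simp
  also have "\<dots> = a\<^sup>2 \<cdot>\<^sub>v y" using y mult_mat_vec[OF c y(1)] by (simp add: smult_smult_assoc power2_eq_square)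
  finally have "?S *\<^sub>v y = ?f (a\<^sup>2) \<cdot>\<^sub>v y" unfolding S by (rule hc_eigvec[OF h y(1,2)])
  then have e: "a \<cdot>\<^sub>v y = ?f (a\<^sup>2) \<cdot>\<^sub>v y" using y by simp
  obtain i where "i < n" "vec_index y i \<noteq> 0" using y by (metis carrier_vecD eq_vecI index_zero_vec(1) index_zero_vec(2))
  then show "a = ?f (a\<^sup>2)" using arg_cong[OF e, of "\<lambda>v. vec_index v i"] y by simp
 qed
 show "sylv ?S" unfolding sylv_def
 proof (intro ballI notI)
  fix a b assume ab: "a \<in> spectrum ?S" "b \<in> spectrum ?S" "a + b = 0"
  then have "a\<^sup>2 = b\<^sup>2" by (simp add: add_eq_0_iff)
  then have "a = b" using ev(1)[OF ab(1)] ev(1)[OF ab(2)] by simp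
  then have "a = 0" using ab(3) by simp
  then have "0 \<in> Delta r \<gamma>" using ev(2)[OF ab(1)] xc(2) by auto
  then show False using Delta_nonzero[OF g] by simp
 qed
 show "\<exists>p. ?S = pm p x" using hc_pm[OF h] S by metis
 show "a \<in> spectrum ?S ==> ?f (a\<^sup>2) = a" using ev(1)[of a] by simp
qed

text \<open>The range of the chosen branch of the square root. The number z is either
  \<open>root \<gamma> \<tau> (z\<^sup>2)\<close> or its negative; ruling out the negative expresses
  this as an open condition.\<close>

definition branch :: "complex set => (complex => complex) => complex set" where
 "branch \<gamma> \<tau> = {z. z\<^sup>2 \<in> Delta r \<gamma> \<and> root \<gamma> \<tau> (z\<^sup>2) + z \<noteq> 0}"

lemma open_branch:
 assumes G: "\<gamma> \<in> Gamma" shows "open (branch \<gamma> \<tau>)"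
proof -
 let ?f = "root \<gamma> \<tau>" and ?D = "Delta r \<gamma>"
 define A where "A = (\<lambda>z::complex. z\<^sup>2) -` ?D"
 have oA: "open A" unfolding A_def using open_Delta[OF G] by (intro open_vimage continuous_intros)
 have "(\<lambda>z. ?f (z\<^sup>2)) holomorphic_on A"
  by (rule holomorphic_on_compose_gen[of "\<lambda>z. z\<^sup>2" A ?f ?D, unfolded o_def])
   (use root_holomorphic[OF G, of \<tau>] in \<open>auto simp: A_def intro!: holomorphic_intros\<close>)
 then have "continuous_on A (\<lambda>z. ?f (z\<^sup>2) + z)"
  by (intro continuous_on_add holomorphic_on_imp_continuous_on) (auto intro!: holomorphic_intros)
 then have "open (A \<inter> (\<lambda>z. ?f (z\<^sup>2) + z) -` (- {0}))"
  by (rule continuous_open_preimage[OF _ oA]) auto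
 moreover have "A \<inter> (\<lambda>z. ?f (z\<^sup>2) + z) -` (- {0}) = branch \<gamma> \<tau>" by (auto simp: A_def branch_def)
 ultimately show ?thesis by simp
qed

lemma S_fun_branch:
 assumes G: "\<gamma> \<in> Gamma" and t: "\<tau> \<in> signs \<gamma>" and v: "v \<in> Mat n" and b: "spectrum v \<subseteq> branch \<gamma> \<tau>"
 shows "spectrum (v * v) \<subseteq> Delta r \<gamma>" "S_fun r q \<gamma> \<tau> (v * v) = v"
proof -
 let ?f = "root \<gamma> \<tau>"
 show sp: "spectrum (v * v) \<subseteq> Delta r \<gamma>" using b unfolding spectrum_square[OF v] branch_def by auto
 show "S_fun r q \<gamma> \<tau> (v * v) = v" unfolding S_fun_def
 proof (rule hc_sqrt[OF v open_Delta[OF G] sp root_holomorphic[OF G] open_branch[OF G] b])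
  fix z assume z: "z \<in> branch \<gamma> \<tau>"
  then have zD: "z\<^sup>2 \<in> Delta r \<gamma>" by (simp add: branch_def)
  have "(?f (z\<^sup>2) - z) * (?f (z\<^sup>2) + z) = ?f (z\<^sup>2) * ?f (z\<^sup>2) - z\<^sup>2" by (simp add: algebra_simps power2_eq_square)
  also have "\<dots> = 0" using root_sq[OF G t zD] by simp
  finally show "z\<^sup>2 \<in> Delta r \<gamma> \<and> ?f (z\<^sup>2) = z" using z zD by (auto simp: branch_def)
 qed
qed

lemma spectrum_S_fun_branch:
 assumes G: "\<gamma> \<in> Gamma" and t: "\<tau> \<in> signs \<gamma>" and x: "x \<in> Mat n" "spectrum x \<subseteq> Delta r \<gamma>"
 shows "spectrum (S_fun r q \<gamma> \<tau> x) \<subseteq> branch \<gamma> \<tau>"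
proof
 note f = S_fun_facts[OF G t x]
 fix a assume a: "a \<in> spectrum (S_fun r q \<gamma> \<tau> x)"
 have a2: "a\<^sup>2 \<in> Delta r \<gamma>" using spectrum_square[OF f(1)] a x(2) f(2) by auto
 then have "a \<noteq> 0" using Delta_nonzero[OF G] by auto
 then show "a \<in> branch \<gamma> \<tau>" using a2 f(5)[OF a] by (simp add: branch_def)
qed

text \<open>As \<open>v\<close> has no opposite eigenvalues, each \<open>c\<close> in the spectrum
  of \<open>v * v\<close> has a single square root among the eigenvalues of \<open>v\<close>. The
  sign at \<open>c\<close> records whether the branch \<open>q\<close> chooses that root or its
  negative; then the spectrum of \<open>v\<close> lies in
  \<open>branch \<gamma> \<tau>\<close>.\<close>

lemma sylv_root:
 assumes v: "v \<in> Mat n" and s: "sylv v" and g: "\<gamma> = spectrum (v * v)"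
 shows "\<gamma> \<in> Gamma" "\<exists>\<tau>\<in>signs \<gamma>. S_fun r q \<gamma> \<tau> (v * v) = v"
proof -
 have v2: "v * v \<in> Mat n" by (rule mult_carrier_mat[OF v v])
 have sp: "\<gamma> = (\<lambda>a. a\<^sup>2) ` spectrum v" using g spectrum_square[OF v] by simp
 have nz: "a \<noteq> 0" if "a \<in> spectrum v" for a using s that unfolding sylv_def by fastforce
 show G: "\<gamma> \<in> Gamma" using card_finite_spectrum(1)[OF v2] sp nz g by (auto simp: Gamma_def)
 have ex: "\<exists>a\<in>spectrum v. a\<^sup>2 = c" if "c \<in> \<gamma>" for c using sp that by auto
 define b where "b c = (SOME a. a \<in> spectrum v \<and> a\<^sup>2 = c)" for c
 have b: "b c \<in> spectrum v" "(b c)\<^sup>2 = c" if "c \<in> \<gamma>" for c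
  using someI_ex[of "\<lambda>a. a \<in> spectrum v \<and> a\<^sup>2 = c"] ex[OF that] unfolding b_def by auto
 have bu: "b (a\<^sup>2) = a" if a: "a \<in> spectrum v" for a
 proof -
  have c: "a\<^sup>2 \<in> \<gamma>" using sp a by auto
  have "b (a\<^sup>2) + a \<noteq> 0" using s b[OF c] a unfolding sylv_def by blast
  moreover have "(b (a\<^sup>2) - a) * (b (a\<^sup>2) + a) = 0" using b(2)[OF c] by (simp add: algebra_simps power2_eq_square)
  ultimately show ?thesis by simp
 qed
 \<comment> \<open>A quotient of two square roots of \<open>c\<close>, hence 1 or -1. The
   restriction to \<open>\<gamma>\<close> is needed because \<open>signs \<gamma>\<close> consists
   of extensional functions.\<close>
 define \<tau> where "\<tau> = (\<lambda>c\<in>\<gamma>. b c / q \<gamma> c)"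
 have qn: "q \<gamma> c \<noteq> 0" if "c \<in> \<gamma>" for c
  using Gamma_facts(6)[OF G center_Delta[OF G that]] G that by (auto simp: Gamma_def)
 have t: "\<tau> \<in> signs \<gamma>" unfolding signs_def
 proof (rule PiE_I)
  fix c assume c: "c \<in> \<gamma>"
  have "(b c / q \<gamma> c)\<^sup>2 = 1" using b(2)[OF c] Gamma_facts(6)[OF G center_Delta[OF G c]] qn[OF c]
   by (metis divide_self_if power_divide power_zero_numeral zero_eq_power2)
  then show "\<tau> c \<in> {-1, 1}" using c by (auto simp: \<tau>_def power2_eq_1_iff)
 qed (auto simp: \<tau>_def)
 let ?f = "root \<gamma> \<tau>"
 have fc: "?f c = b c" if c: "c \<in> \<gamma>" for c
  using iota_eq[OF G c, of c \<tau>] Gamma_facts(2)[OF G] c qn[OF c] by (simp add: \<tau>_def)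
 have "spectrum v \<subseteq> branch \<gamma> \<tau>"
 proof
  fix a assume a: "a \<in> spectrum v"
  then have c: "a\<^sup>2 \<in> \<gamma>" using sp by auto
  have "?f (a\<^sup>2) + a \<noteq> 0" using fc[OF c] bu[OF a] nz[OF a] by simp
  then show "a \<in> branch \<gamma> \<tau>" using center_Delta[OF G c] by (simp add: branch_def)
 qed
 then show "\<exists>\<tau>\<in>signs \<gamma>. S_fun r q \<gamma> \<tau> (v * v) = v" using S_fun_branch(2)[OF G t v] t by blast
qed

lemma omega_mkw: "omega r q \<gamma> \<tau> p = mkw (p ! 0) (S_fun r q \<gamma> \<tau> (p ! 1))"
 by (simp add: omega_def mkw_def Let_def)

lemma W_domD:
 assumes "p \<in> W_dom r \<gamma>"
 shows "\<exists>n\<ge>1. p \<in> pts 2 n \<and> p ! 0 \<in> Mat n \<and> p ! 1 \<in> Mat n \<and> spectrum (p ! 1) \<subseteq> Delta r \<gamma>"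
proof -
 obtain n where "n \<ge> 1" "p \<in> pts 2 n" using assms by (auto simp: W_dom_def nc_space_pts)
 then show ?thesis using assms ptsD(2)[of p 2 n] by (intro exI[of _ n]) (auto simp: W_dom_def D_dom_def)
qed

lemma W_domI: "u \<in> Mat n ==> x \<in> Mat n ==> n \<ge> 1 ==> spectrum x \<subseteq> Delta r \<gamma> ==> [u, x] \<in> W_dom r \<gamma>"
 using pts_nc_space[OF list2_pts] by (auto simp: W_dom_def D_dom_def)

lemma S_o_iff:
 assumes S: "S \<subseteq> nc_space 2"
 shows "w \<in> S_o r q S \<longleftrightarrow> w \<in> S \<and> sylv (vv w)"
proof
 assume "w \<in> S_o r q S"
 then obtain \<gamma> \<tau> p where *: "\<gamma> \<in> Gamma" "\<tau> \<in> signs \<gamma>" "p \<in> W_dom r \<gamma>" "w = omega r q \<gamma> \<tau> p" "w \<in> S" by (auto simp: S_o_def)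
 obtain n where n: "p ! 0 \<in> Mat n" "p ! 1 \<in> Mat n" "spectrum (p ! 1) \<subseteq> Delta r \<gamma>" using W_domD[OF *(3)] by auto
 note f = S_fun_facts[OF *(1,2) n(2,3)]
 show "w \<in> S \<and> sylv (vv w)" using * f uu_vv_mkw[OF n(1) f(1)] by (simp add: omega_mkw)
next
 assume w: "w \<in> S \<and> sylv (vv w)"
 then obtain n where n: "w \<in> pts 2 n" "n \<ge> 1" using S by (auto simp: nc_space_pts)
 let ?\<gamma> = "spectrum (vv w * vv w)"
 obtain \<tau> where t: "\<tau> \<in> signs ?\<gamma>" "S_fun r q ?\<gamma> \<tau> (vv w * vv w) = vv w" and G: "?\<gamma> \<in> Gamma"
  using sylv_root[OF uu_vv_carrier(2)[OF n(1)] _ refl] w by auto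
 have "[uu w, vv w * vv w] \<in> W_dom r ?\<gamma>"
  using n mult_carrier_mat[OF uu_vv_carrier(2)[OF n(1)] uu_vv_carrier(2)[OF n(1)]] center_Delta[OF G] by (intro W_domI[of _ n]) auto
 moreover have "omega r q ?\<gamma> \<tau> [uu w, vv w * vv w] = w" using t mkw_uu_vv[OF n(1)] by (simp add: omega_mkw)
 ultimately have "w \<in> omega r q ?\<gamma> \<tau> ` W_dom r ?\<gamma> \<inter> S" using w by (metis IntI image_eqI)
 then show "w \<in> S_o r q S" unfolding S_o_def using G t(1) by blast
qed

end

section \<open>Conditionally nc functions\<close>

lemma conditionally_nc_graded: "conditionally_nc d D f ==> x \<in> D ==> x \<in> pts d n ==> d > 0 ==> f x \<in> Mat n"
 using pts_mlevel unfolding conditionally_nc_def graded_def by metis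

lemma conditionally_nc_conj:
 "conditionally_nc d D f ==> x \<in> D ==> x \<in> pts d n ==> d > 0 ==> s \<in> GL n ==> conj_point s x \<in> D ==>
  f (conj_point s x) = conj_mat s (f x)"
 using pts_mlevel unfolding conditionally_nc_def preserves_similarity_def by metis

lemma conj_block_swap_point:
 assumes "x \<in> pts d n" "y \<in> pts d m"
 shows "conj_point (block_swap n m) (point_dsum x y) = point_dsum y x"
proof (rule point_eqI)
 show "conj_point (block_swap n m) (point_dsum x y) \<in> pts d (n + m)"
  using assms block_swap_GL by (intro pts_conj pts_dsum) auto
 show "point_dsum y x \<in> pts d (m + n)" using assms by simp
 fix i assume i: "i < d"
 show "conj_point (block_swap n m) (point_dsum x y) ! i = point_dsum y x ! i"
  using nth_conj[OF ptsD(1)[OF pts_dsum[OF assms]] i] nth_dsum[OF ptsD(1)[OF assms(1)] ptsD(1)[OF assms(2)] i]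
   nth_dsum[OF ptsD(1)[OF assms(2)] ptsD(1)[OF assms(1)] i] conj_block_swap[OF ptsD(2)[OF assms(1) i] ptsD(2)[OF assms(2) i]] by simp
qed

text \<open>The definition leaves the second block to an auxiliary function. With both orders of the
  summands in \<open>D\<close>, conjugation by \<open>block_swap\<close> identifies its value at
  \<open>b\<close> with \<open>f b\<close>.\<close>

lemma conditionally_nc_dsum:
 assumes f: "conditionally_nc d D f" and d: "d > 0" and D: "a \<in> D" "b \<in> D" "point_dsum a b \<in> D" "point_dsum b a \<in> D"
 shows "f (point_dsum a b) = mat_dsum (f a) (f b)"
proof -
 have sub: "D \<subseteq> nc_space d" using f by (simp add: conditionally_nc_def)
 obtain n where a: "a \<in> pts d n" "n \<ge> 1" using D(1) sub by (auto simp: nc_space_pts)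
 obtain m where b: "b \<in> pts d m" "m \<ge> 1" using D(2) sub by (auto simp: nc_space_pts)
 obtain f' where gr: "graded {y \<in> nc_space d. \<exists>x\<in>D. point_dsum x y \<in> D} f'"
  and f': "\<And>x y. x \<in> D ==> y \<in> nc_space d ==> point_dsum x y \<in> D ==> f (point_dsum x y) = mat_dsum (f x) (f' y)"
  using f unfolding conditionally_nc_def by auto
 have an: "a \<in> nc_space d" "b \<in> nc_space d" using D sub by auto
 have fb': "f' b \<in> Mat m" and fa': "f' a \<in> Mat n"
  using gr D an pts_mlevel[OF a(1) d] pts_mlevel[OF b(1) d] unfolding graded_def by blast+
 note fa = conditionally_nc_graded[OF f D(1) a(1) d] and fb = conditionally_nc_graded[OF f D(2) b(1) d]
 have e1: "f (point_dsum a b) = mat_dsum (f a) (f' b)" using f' D an by simp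
 have e2: "f (point_dsum b a) = mat_dsum (f b) (f' a)" using f' D an by simp
 have "f (conj_point (block_swap n m) (point_dsum a b)) = conj_mat (block_swap n m) (f (point_dsum a b))"
  using D conj_block_swap_point[OF a(1) b(1)] by (intro conditionally_nc_conj[OF f _ pts_dsum[OF a(1) b(1)] d block_swap_GL(1)]) auto
 then have "mat_dsum (f b) (f' a) = mat_dsum (f' b) (f a)"
  using conj_block_swap_point[OF a(1) b(1)] e1 e2 conj_block_swap[OF fa fb'] by simp
 then have "f b = f' b" using fb fa' fb' fa by (rule mat_dsum_inj)
 then show ?thesis using e1 by simp
qed

lemma nth_conj_shear:
 assumes a: "a \<in> pts d n" and b: "b \<in> pts d m" and T: "T \<in> carrier_mat n m" and i: "i < d"
 shows "conj_point (shear n m T) (point_dsum a b) ! i = four_block_mat (a ! i) (a ! i * T - T * b ! i) (0\<^sub>m m n) (b ! i)"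
 using nth_conj[OF ptsD(1)[OF pts_dsum[OF a b]] i] nth_dsum[OF ptsD(1)[OF a] ptsD(1)[OF b] i] conj_shear[OF T ptsD(2)[OF a i] ptsD(2)[OF b i]]
 by simp

lemma conditionally_nc_shear:
 assumes f: "conditionally_nc d D f" and d: "d > 0" and D: "a \<in> D" "b \<in> D" "point_dsum a b \<in> D" "point_dsum b a \<in> D"
  and a: "a \<in> pts d n" and b: "b \<in> pts d m" and T: "T \<in> carrier_mat n m"
  and C: "conj_point (shear n m T) (point_dsum a b) \<in> D"
 shows "f (conj_point (shear n m T) (point_dsum a b)) = four_block_mat (f a) (f a * T - T * f b) (0\<^sub>m m n) (f b)"
 using conditionally_nc_conj[OF f D(3) pts_dsum[OF a b] d shear_GL(1)[OF T] C] conditionally_nc_dsum[OF f d D]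
  conj_shear[OF T conditionally_nc_graded[OF f D(1) a d] conditionally_nc_graded[OF f D(2) b d]] by simp

text \<open>Shearing by an intertwiner fixes the direct sum, hence also the value there, and so the
  corner \<open>f a * T - T * f b\<close> of the conjugated value has to vanish.\<close>

lemma nc_intertwine:
 assumes fa: "f a \<in> Mat n" and fb: "f b \<in> Mat m" and dsum: "f (point_dsum a b) = mat_dsum (f a) (f b)"
  and inv: "\<And>s. s \<in> GL (n + m) ==> conj_point s (point_dsum a b) = point_dsum a b ==> conj_mat s (f (point_dsum a b)) = f (point_dsum a b)"
  and a: "a \<in> pts d n" and b: "b \<in> pts d m" and T: "T \<in> carrier_mat n m"
  and int: "\<And>i. i < d ==> a ! i * T = T * b ! i"
 shows "f a * T = T * f b"
proof -
 have z: "X - X = 0\<^sub>m n m" if "X \<in> carrier_mat n m" for X :: "complex mat" using that by (intro eq_matI) auto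
 have "conj_point (shear n m T) (point_dsum a b) = point_dsum a b"
 proof (rule point_eqI[OF pts_conj[OF pts_dsum[OF a b] shear_GL(1)[OF T]] pts_dsum[OF a b]])
  fix i assume i: "i < d"
  show "conj_point (shear n m T) (point_dsum a b) ! i = point_dsum a b ! i"
   unfolding nth_conj_shear[OF a b T i] int[OF i] nth_dsum[OF ptsD(1)[OF a] ptsD(1)[OF b] i]
   using z[OF mult_carrier_mat[OF T ptsD(2)[OF b i]]] mat_dsum_eq[OF ptsD(2)[OF a i] ptsD(2)[OF b i]] by simp
 qed
 from inv[OF shear_GL(1)[OF T] this] have "four_block_mat (f a) (f a * T - T * f b) (0\<^sub>m m n) (f b) = mat_dsum (f a) (f b)"
  using conj_shear[OF T fa fb] dsum by simp
 then have e: "f a * T - T * f b = 0\<^sub>m n m"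
  using four_block_inj[of "f a" "f a * T - T * f b" "0\<^sub>m m n" "f b" "f a" "0\<^sub>m n m" "0\<^sub>m m n" "f b" n n m m]
   fa fb mult_carrier_mat[OF T fb] by (simp add: mat_dsum_eq[OF fa fb])
 show ?thesis
 proof (rule eq_matI)
  fix i j assume "i < dim_row (T * f b)" "j < dim_col (T * f b)"
  then have ij: "i < n" "j < m" using carrier_matD[OF mult_carrier_mat[OF T fb]] by auto
  have "(f a * T - T * f b) $$ (i, j) = 0" using e ij by simp
  then show "(f a * T) $$ (i, j) = (T * f b) $$ (i, j)"
   using ij carrier_matD[OF mult_carrier_mat[OF T fb]] by (simp del: index_mult_mat)
 qed (use carrier_matD[OF mult_carrier_mat[OF T fb]] carrier_matD[OF mult_carrier_mat[OF fa T]] in auto)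
qed

lemma conditionally_nc_intertwine:
 assumes f: "conditionally_nc d D f" and d: "d > 0" and D: "a \<in> D" "b \<in> D" "point_dsum a b \<in> D" "point_dsum b a \<in> D"
  and a: "a \<in> pts d n" and b: "b \<in> pts d m" and T: "T \<in> carrier_mat n m"
  and int: "\<And>i. i < d ==> a ! i * T = T * b ! i"
 shows "f a * T = T * f b"
proof (rule nc_intertwine[where f = f, OF conditionally_nc_graded[OF f D(1) a d] conditionally_nc_graded[OF f D(2) b d]
   conditionally_nc_dsum[OF f d D] _ a b T int])
 fix s assume s: "s \<in> GL (n + m)" and e: "conj_point s (point_dsum a b) = point_dsum a b"
 show "conj_mat s (f (point_dsum a b)) = f (point_dsum a b)"
  using conditionally_nc_conj[OF f D(3) pts_dsum[OF a b] d s] e D(3) by simp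
qed

text \<open>Only the corner grows with \<open>c\<close>, in proportion to \<open>pdist a b\<close>.
  The closer \<open>a\<close> and \<open>b\<close> are, the larger a shear can be used without
  leaving a given neighbourhood of \<open>point_dsum w w\<close>.\<close>

lemma pdist_dsum_shear:
 assumes a: "a \<in> pts d n" and b: "b \<in> pts d n" and w: "w \<in> pts d n"
 shows "pdist (conj_point (shear n n (c \<cdot>\<^sub>m 1\<^sub>m n)) (point_dsum a b)) (point_dsum w w) \<le> pdist a w + cmod c * pdist a b + pdist b w"
proof -
 let ?T = "c \<cdot>\<^sub>m 1\<^sub>m n" 
 have T: "?T \<in> Mat n" by simp
 let ?P = "conj_point (shear n n ?T) (point_dsum a b)"
 have len: "length ?P = d" using ptsD(1)[OF pts_conj[OF pts_dsum[OF a b] shear_GL(1)[OF T]]] .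
 have "pdist ?P (point_dsum w w) = (\<Sum>i<d. op_norm (?P ! i - point_dsum w w ! i))" by (simp add: pdist_def len)
 also have "\<dots> \<le> (\<Sum>i<d. op_norm (a ! i - w ! i) + cmod c * op_norm (a ! i - b ! i) + op_norm (b ! i - w ! i))"
 proof (rule sum_mono)
  fix i assume "i \<in> {..<d}"
  then have i: "i < d" by simp
  note A = ptsD(2)[OF a i] and B = ptsD(2)[OF b i] and W = ptsD(2)[OF w i]
  have "a ! i * ?T - ?T * b ! i = c \<cdot>\<^sub>m (a ! i - b ! i)"
   using A B by (simp add: mult_smult_distrib[of _ n n _ n] mult_smult_assoc_mat[of _ n n _ n]) (intro eq_matI, auto simp: algebra_simps)
  then have "?P ! i - point_dsum w w ! i = four_block_mat (a ! i - w ! i) (c \<cdot>\<^sub>m (a ! i - b ! i)) (0\<^sub>m n n) (b ! i - w ! i)"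
   unfolding nth_conj_shear[OF a b T i] nth_dsum[OF ptsD(1)[OF w] ptsD(1)[OF w] i]
   using A B W by (simp add: mat_dsum_eq[OF W W]) (intro eq_matI, auto)
  then have "op_norm (?P ! i - point_dsum w w ! i) \<le> op_norm (a ! i - w ! i) + op_norm (c \<cdot>\<^sub>m (a ! i - b ! i)) + op_norm (b ! i - w ! i)"
   using op_norm_upper_triangular_le[of "a ! i - w ! i" n "c \<cdot>\<^sub>m (a ! i - b ! i)" n "b ! i - w ! i"] A B W by simp
  then show "op_norm (?P ! i - point_dsum w w ! i) \<le> op_norm (a ! i - w ! i) + cmod c * op_norm (a ! i - b ! i) + op_norm (b ! i - w ! i)"
   using op_norm_smult[of "a ! i - b ! i" n n c] B by simp
 qed
 also have "\<dots> = pdist a w + cmod c * pdist a b + pdist b w"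
  using ptsD(1)[OF a] ptsD(1)[OF b] by (simp add: pdist_def sum.distrib sum_distrib_left)
 finally show ?thesis .
qed

lemma pdist_commute: "a \<in> pts d n ==> b \<in> pts d n ==> pdist a b = pdist b a"
 unfolding pdist_def using ptsD[of a d n] ptsD[of b d n] by (auto intro!: sum.cong op_norm_minus_commute[of _ n n])

lemma pdist_triangle:
 assumes "a \<in> pts d n" "b \<in> pts d n" "c \<in> pts d n"
 shows "pdist a c \<le> pdist a b + pdist b c"
 unfolding pdist_def ptsD(1)[OF assms(1)] ptsD(1)[OF assms(2)] sum.distrib[symmetric]
 using op_norm_triangle[OF ptsD(2)[OF assms(1)] ptsD(2)[OF assms(2)] ptsD(2)[OF assms(3)]] by (intro sum_mono) simp

lemma op_norm_eq_0: "A \<in> carrier_mat n m ==> op_norm A = 0 ==> A = 0\<^sub>m n m"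
 using entry_le_op_norm[of A n m] by (intro eq_matI) force+

lemma pdist_eq_0:
 assumes a: "a \<in> pts d n" and b: "b \<in> pts d n" and "pdist a b = 0"
 shows "a = b"
proof (rule point_eqI[OF a b])
 fix i assume i: "i < d"
 note A = ptsD(2)[OF a i] and B = ptsD(2)[OF b i]
 have "op_norm (a ! i - b ! i) = 0"
  using pdist_coord[OF a b i] assms(3) op_norm_nonneg[of "a ! i - b ! i" n n] B by auto
 then have "a ! i - b ! i = 0\<^sub>m n n" using B by (intro op_norm_eq_0) auto
 then have "(a ! i - b ! i) $$ (k, l) = 0" if "k < n" "l < n" for k l using that by simp
 then show "a ! i = b ! i" using A B by (intro eq_matI) auto
qed

text \<open>\<open>A\<close> is a union of similarity classes relative to \<open>S\<close>. A
  conjugate of a direct sum in \<open>A\<close> then belongs to the domain \<open>A\<close> as soon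
  as it stays in the open set \<open>S\<close>.\<close>

definition sim_closed :: "nc_point set => nc_point set => bool" where
 "sim_closed S A \<longleftrightarrow> A \<subseteq> S \<and> (\<forall>w\<in>A. \<forall>s\<in>GL (mlevel w). conj_point s w \<in> S --> conj_point s w \<in> A)"

lemma sim_closed_swap:
 assumes "sim_closed S A" "openin (free_topology d) S" "d > 0" "a \<in> pts d n" "b \<in> pts d m" "n \<ge> 1" "m \<ge> 1" "point_dsum a b \<in> A"
 shows "point_dsum b a \<in> A"
proof -
 have "point_dsum b a \<in> S"
  using assms open_dsum_iff(3)[of d S a b] pts_nc_space unfolding sim_closed_def by blast
 then show ?thesis using assms conj_block_swap_point[OF assms(4,5)] block_swap_GL(1)[of n m] pts_mlevel[OF pts_dsum[OF assms(4,5)] assms(3)]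
  unfolding sim_closed_def by metis
qed

text \<open>The difference quotients of \<open>f\<close> are corner entries of values of \<open>f\<close>, so local boundedness
 makes \<open>f\<close> Lipschitz, even near points outside its domain.\<close>

lemma locally_lipschitz:
 assumes S: "openin (free_topology d) S" and d: "d > 0" and A: "sim_closed S A"
  and f: "conditionally_nc d A f" and bdd: "freely_locally_bounded_on d S A f"
  and w: "w \<in> S" "w \<in> pts d n" "n \<ge> 1"
 shows "\<exists>e>0. \<exists>L\<ge>0. \<forall>a b. a \<in> A --> b \<in> A --> a \<in> pts d n --> b \<in> pts d n --> pdist a w < e --> pdist b w < e -->
  point_dsum a b \<in> A --> op_norm (f a - f b) \<le> L * pdist a b"
proof -
 obtain V C0 where V: "openin (free_topology d) V" "w \<in> V" and C0: "\<forall>x\<in>V \<inter> A. op_norm (f x) \<le> C0"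
  using bdd w(1) unfolding freely_locally_bounded_on_def bounded_values_on_def by blast
 define C where "C = max 0 C0"
 have C: "C \<ge> 0" "\<And>x. x \<in> V ==> x \<in> A ==> op_norm (f x) \<le> C" using C0 by (auto simp: C_def intro: max.coboundedI2)
 have "openin (free_topology d) (V \<inter> S)" "w \<in> V \<inter> S" using V S w by auto
 then obtain F where F: "valid_polys d F" "w \<in> fnb d F" "fnb d F \<subseteq> V \<inter> S" by (rule open_base)
 have wn: "w \<in> nc_space d" by (rule pts_nc_space[OF w(2,3)])
 have "point_dsum w w \<in> fnb d F" using fnb_dsum[OF F(1) wn wn d] F(2) by simp
 from fnb_continuity[OF F(1) this d pts_dsum[OF w(2) w(2)]] obtain e0 where
  e0: "e0 > 0" "\<And>y. y \<in> pts d (n + n) ==> pdist y (point_dsum w w) < e0 ==> y \<in> fnb d F" by auto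
 show ?thesis
 proof (rule exI[of _ "e0 / 4"], rule conjI, simp add: e0(1), rule exI[of _ "2 * C / e0"], intro conjI allI impI)
  show "0 \<le> 2 * C / e0" using e0 C by auto
  fix a b assume ab: "a \<in> A" "b \<in> A" and a: "a \<in> pts d n" and b: "b \<in> pts d n" and close: "pdist a w < e0 / 4" "pdist b w < e0 / 4"
   and dab: "point_dsum a b \<in> A"
  have dba: "point_dsum b a \<in> A" by (rule sim_closed_swap[OF A S d a b w(3) w(3) dab])
  note fa = conditionally_nc_graded[OF f ab(1) a d] and fb = conditionally_nc_graded[OF f ab(2) b d]
  show "op_norm (f a - f b) \<le> 2 * C / e0 * pdist a b"
  proof (cases "pdist a b = 0")
   case True
   then have "a = b" using pdist_eq_0[OF a b] by simp
   then have "f a - f b = 0\<^sub>m n n" using fb by (intro eq_matI) auto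
   then show ?thesis using True by simp
  next
   case False
   then have p: "pdist a b > 0" using pdist_nonneg[OF a b] by simp
   \<comment> \<open>Half of \<open>e0\<close> is spent on the corner, and the two diagonal blocks
     use less than a quarter each. A value of norm at most \<open>C\<close> whose corner is
     \<open>?t\<close> times the difference gives the constant \<open>2 * C / e0\<close>.\<close>
   let ?t = "e0 / (2 * pdist a b)"
   let ?c = "complex_of_real ?t"
   let ?T = "?c \<cdot>\<^sub>m 1\<^sub>m n"
   have T: "?T \<in> Mat n" by simp
   have c: "cmod ?c = ?t" using e0 p by (simp only: norm_of_real) simp
   let ?P = "conj_point (shear n n ?T) (point_dsum a b)"
   have Pp: "?P \<in> pts d (n + n)" by (rule pts_conj[OF pts_dsum[OF a b] shear_GL(1)[OF T]])
   have "pdist ?P (point_dsum w w) \<le> pdist a w + ?t * pdist a b + pdist b w"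
    using pdist_dsum_shear[OF a b w(2), of ?c] unfolding c .
   also have "?t * pdist a b = e0 / 2" using p by simp
   finally have "?P \<in> fnb d F" using close by (intro e0(2)[OF Pp]) simp
   then have PV: "?P \<in> V" "?P \<in> S" using F(3) by auto
   have PA: "?P \<in> A" using A dab PV(2) shear_GL(1)[OF T] pts_mlevel[OF pts_dsum[OF a b] d] unfolding sim_closed_def by metis
   have "f ?P = four_block_mat (f a) (f a * ?T - ?T * f b) (0\<^sub>m n n) (f b)"
    by (rule conditionally_nc_shear[OF f d ab dab dba a b T PA])
   moreover have Te: "f a * ?T - ?T * f b = ?c \<cdot>\<^sub>m (f a - f b)"
   proof -
    have "f a * ?T = ?c \<cdot>\<^sub>m f a" using mult_smult_distrib[OF fa one_carrier_mat, of ?c] right_mult_one_mat[OF fa] by simp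
    moreover have "?T * f b = ?c \<cdot>\<^sub>m f b" using mult_smult_assoc_mat[OF one_carrier_mat fb, of ?c] left_mult_one_mat[OF fb] by simp
    ultimately show ?thesis using fa fb by (intro eq_matI) (auto simp: algebra_simps)
   qed
   ultimately have "op_norm (?c \<cdot>\<^sub>m (f a - f b)) \<le> op_norm (f ?P)"
    using op_norm_four_block_corner[OF fa _ zero_carrier_mat fb, of "?c \<cdot>\<^sub>m (f a - f b)"] fb by simp
   also have "\<dots> \<le> C" by (rule C(2)[OF PV(1) PA])
   finally have "?t * op_norm (f a - f b) \<le> C" unfolding op_norm_smult[OF minus_carrier_mat[OF fb]] c .
   then show ?thesis using p e0(1) by (simp add: field_simps)
  qed
 qed
qed

section \<open>Entrywise limits\<close>

text \<open>Only the limit is required to have format n x n. For the sequence this is a separate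
  \<open>eventually\<close> condition, since the approximating points belong to the domain only from
  some index on.\<close>

definition mconv :: "nat => (nat => complex mat) => complex mat => bool" where
 "mconv n g A \<longleftrightarrow> A \<in> Mat n \<and> (\<forall>i<n. \<forall>j<n. (\<lambda>m. g m $$ (i, j)) \<longlonglongrightarrow> A $$ (i, j))"

lemma mconv_unique:
 assumes "mconv n g A" "mconv n g B" shows "A = B"
proof (rule eq_matI)
 fix i j assume "i < dim_row B" "j < dim_col B"
 then have "i < n" "j < n" using assms by (auto simp: mconv_def)
 then show "A $$ (i, j) = B $$ (i, j)" using assms LIMSEQ_unique unfolding mconv_def by blast
qed (use assms in \<open>auto simp: mconv_def\<close>)

lemma mconv_cong:
 assumes "mconv n g A" "\<forall>\<^sub>F m in sequentially. g m = h m" shows "mconv n h A"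
 unfolding mconv_def
proof (intro conjI allI impI)
 fix i j assume ij: "i < n" "j < n"
 have "(\<lambda>m. g m $$ (i, j)) \<longlonglongrightarrow> A $$ (i, j)" using assms(1) ij by (auto simp: mconv_def)
 moreover have "\<forall>\<^sub>F m in sequentially. g m $$ (i, j) = h m $$ (i, j)" using assms(2) by eventually_elim simp
 ultimately show "(\<lambda>m. h m $$ (i, j)) \<longlonglongrightarrow> A $$ (i, j)" by (rule Lim_transform_eventually)
qed (use assms in \<open>auto simp: mconv_def\<close>)

lemma mconv_mult:
 assumes "mconv n g A" "mconv n h B" "\<forall>\<^sub>F m in sequentially. g m \<in> Mat n" "\<forall>\<^sub>F m in sequentially. h m \<in> Mat n"
 shows "mconv n (\<lambda>m. g m * h m) (A * B)"
 unfolding mconv_def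
proof (intro conjI allI impI)
 have A: "A \<in> Mat n" and B: "B \<in> Mat n" using assms by (auto simp: mconv_def)
 then show "A * B \<in> Mat n" by (rule mult_carrier_mat)
 fix i j assume ij: "i < n" "j < n"
 have "(\<lambda>m. \<Sum>l<n. g m $$ (i, l) * h m $$ (l, j)) \<longlonglongrightarrow> (\<Sum>l<n. A $$ (i, l) * B $$ (l, j))"
  using assms(1,2) ij by (intro tendsto_sum tendsto_mult) (auto simp: mconv_def)
 moreover have "\<forall>\<^sub>F m in sequentially. (\<Sum>l<n. g m $$ (i, l) * h m $$ (l, j)) = (g m * h m) $$ (i, j)"
  using assms(3,4) by eventually_elim (rule index_mult_mat_sum[OF _ _ ij, symmetric])
 ultimately show "(\<lambda>m. (g m * h m) $$ (i, j)) \<longlonglongrightarrow> (A * B) $$ (i, j)"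
  unfolding index_mult_mat_sum[OF A B ij] by (rule Lim_transform_eventually)
qed

lemma mconv_const: "A \<in> Mat n ==> mconv n (\<lambda>_. A) A"
 by (simp add: mconv_def)

lemma mconv_conj:
 assumes "mconv n g A" "s \<in> GL n" "\<forall>\<^sub>F m in sequentially. g m \<in> Mat n"
 shows "mconv n (\<lambda>m. conj_mat s (g m)) (conj_mat s A)"
 unfolding conj_mat_def
proof (intro mconv_mult mconv_const assms GL_D[OF assms(2)])
 show "\<forall>\<^sub>F m in sequentially. mat_inv s * g m \<in> Mat n"
  using assms(3) by eventually_elim (rule mult_carrier_mat[OF GL_D(2)[OF assms(2)]])
qed (use GL_D[OF assms(2)] in auto)

lemma mconv_dsum:
 assumes "mconv n g A" "mconv k h B" "\<forall>\<^sub>F m in sequentially. g m \<in> Mat n" "\<forall>\<^sub>F m in sequentially. h m \<in> Mat k"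
 shows "mconv (n + k) (\<lambda>m. mat_dsum (g m) (h m)) (mat_dsum A B)"
 unfolding mconv_def
proof (intro conjI allI impI)
 have A: "A \<in> Mat n" and B: "B \<in> Mat k" using assms by (auto simp: mconv_def)
 then show "mat_dsum A B \<in> carrier_mat (n + k) (n + k)" by simp
 fix i j assume ij: "i < n + k" "j < n + k"
 have e: "mat_dsum X Y $$ (i, j) = (if i < n then if j < n then X $$ (i, j) else 0 else if j < n then 0 else Y $$ (i - n, j - n))"
  if "X \<in> Mat n" "Y \<in> Mat k" for X Y using that ij by (auto simp: mat_dsum_def)
 have "(\<lambda>m. if i < n then if j < n then g m $$ (i, j) else 0 else if j < n then 0 else h m $$ (i - n, j - n)) \<longlonglongrightarrow> mat_dsum A B $$ (i, j)"
  unfolding e[OF A B] using assms(1,2) ij by (auto simp: mconv_def)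
 moreover have "\<forall>\<^sub>F m in sequentially. (if i < n then if j < n then g m $$ (i, j) else 0 else if j < n then 0 else h m $$ (i - n, j - n)) = mat_dsum (g m) (h m) $$ (i, j)"
  using assms(3,4) by eventually_elim (rule e[symmetric])
 ultimately show "(\<lambda>m. mat_dsum (g m) (h m) $$ (i, j)) \<longlonglongrightarrow> mat_dsum A B $$ (i, j)" by (rule Lim_transform_eventually)
qed

lemma mconv_op_norm_le:
 assumes g: "mconv n g A" and b: "\<forall>\<^sub>F m in sequentially. g m \<in> Mat n \<and> op_norm (g m) \<le> C" and C: "C \<ge> 0"
 shows "op_norm A \<le> C"
proof (rule op_norm_leI[OF _ _ C])
 show "A \<in> Mat n" using g by (simp add: mconv_def)
 show "opb {..<n} {..<n} (ent A) C"
  unfolding opb_def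
 proof
  fix v :: "nat => complex"
  show "L2_set (\<lambda>i. cmod (\<Sum>j<n. A $$ (i, j) * v j)) {..<n} \<le> C * L2_set (\<lambda>j. cmod (v j)) {..<n}"
  proof (rule tendsto_upperbound)
   show "(\<lambda>m. L2_set (\<lambda>i. cmod (\<Sum>j<n. g m $$ (i, j) * v j)) {..<n}) \<longlonglongrightarrow> L2_set (\<lambda>i. cmod (\<Sum>j<n. A $$ (i, j) * v j)) {..<n}"
    unfolding L2_set_def using g by (intro tendsto_intros) (auto simp: mconv_def)
   show "\<forall>\<^sub>F m in sequentially. L2_set (\<lambda>i. cmod (\<Sum>j<n. g m $$ (i, j) * v j)) {..<n} \<le> C * L2_set (\<lambda>j. cmod (v j)) {..<n}"
    using b
   proof eventually_elim
    case (elim m)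
    then show ?case using opb_mono[OF op_norm_opb[of "g m" n n], of C] unfolding opb_def by blast
   qed
  qed simp
 qed
qed

lemma mconv_close:
 assumes "mconv n g A" "\<forall>\<^sub>F m in sequentially. g m \<in> Mat n \<and> h m \<in> Mat n \<and> op_norm (h m - g m) \<le> e m" "e \<longlonglongrightarrow> 0"
 shows "mconv n h A"
 unfolding mconv_def
proof (intro conjI allI impI)
 fix i j assume ij: "i < n" "j < n"
 have "(\<lambda>m. h m $$ (i, j) - g m $$ (i, j)) \<longlonglongrightarrow> 0"
 proof (rule Lim_null_comparison[OF _ assms(3)])
  show "\<forall>\<^sub>F m in sequentially. cmod (h m $$ (i, j) - g m $$ (i, j)) \<le> e m"
   using assms(2)
  proof eventually_elim
   case (elim m)
   then show ?case using entry_le_op_norm[of "h m - g m" n n i j] ij by auto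
  qed
 qed
 moreover have "(\<lambda>m. g m $$ (i, j)) \<longlonglongrightarrow> A $$ (i, j)" using assms(1) ij by (auto simp: mconv_def)
 ultimately have "(\<lambda>m. (h m $$ (i, j) - g m $$ (i, j)) + g m $$ (i, j)) \<longlonglongrightarrow> 0 + A $$ (i, j)" by (rule tendsto_add)
 then show "(\<lambda>m. h m $$ (i, j)) \<longlonglongrightarrow> A $$ (i, j)" by simp
qed (use assms in \<open>auto simp: mconv_def\<close>)

lemma mconv_Cauchy:
 assumes c: "\<forall>\<^sub>F m in sequentially. g m \<in> Mat n"
  and b: "\<And>e. e > 0 ==> \<exists>M. \<forall>m\<ge>M. \<forall>l\<ge>M. op_norm (g m - g l) < e"
 shows "\<exists>A. mconv n g A"
proof -
 obtain M0 where M0: "\<And>m. m \<ge> M0 ==> g m \<in> Mat n" using c by (auto simp: eventually_sequentially)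
 have "convergent (\<lambda>m. g m $$ (i, j))" if ij: "i < n" "j < n" for i j
 proof (rule Cauchy_convergent, rule CauchyI)
  fix e :: real assume "e > 0"
  then obtain M where M: "\<And>m l. m \<ge> M ==> l \<ge> M ==> op_norm (g m - g l) < e" using b by blast
  show "\<exists>M. \<forall>m\<ge>M. \<forall>l\<ge>M. cmod (g m $$ (i, j) - g l $$ (i, j)) < e"
  proof (intro exI[of _ "max M M0"] allI impI)
   fix m l assume ml: "m \<ge> max M M0" "l \<ge> max M M0"
   have "g m \<in> Mat n" "g l \<in> Mat n" using M0 ml by auto
   then have "cmod (g m $$ (i, j) - g l $$ (i, j)) \<le> op_norm (g m - g l)"
    using entry_le_op_norm[of "g m - g l" n n i j] ij by auto
   then show "cmod (g m $$ (i, j) - g l $$ (i, j)) < e" using M[of m l] ml by simp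
  qed
 qed
 then have "\<forall>i j. \<exists>a. i < n --> j < n --> (\<lambda>m. g m $$ (i, j)) \<longlonglongrightarrow> a" by (auto simp: convergent_def)
 then obtain a where a: "\<And>i j. i < n ==> j < n ==> (\<lambda>m. g m $$ (i, j)) \<longlonglongrightarrow> a i j" by metis
 show ?thesis by (intro exI[of _ "Matrix.mat n n (\<lambda>(i, j). a i j)"]) (auto simp: mconv_def a)
qed

lemma near_open:
 assumes V: "openin (free_topology d) V" and d: "d > 0" and w: "w \<in> V" "w \<in> pts d n" "n \<ge> 1"
 shows "\<exists>e>0. \<forall>a b. a \<in> pts d n --> b \<in> pts d n --> pdist a w < e --> pdist b w < e -->
  a \<in> V \<and> b \<in> V \<and> point_dsum a b \<in> V"
proof -
 obtain F where F: "valid_polys d F" "w \<in> fnb d F" "fnb d F \<subseteq> V" by (rule open_base[OF V w(1)])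
 from fnb_continuity[OF F(1,2) d w(2)] obtain e where e: "e > 0" "\<And>y. y \<in> pts d n ==> pdist y w < e ==> y \<in> fnb d F" by auto
 show ?thesis
 proof (intro exI[of _ e] conjI allI impI e(1))
  fix a b assume a: "a \<in> pts d n" "pdist a w < e" and b: "b \<in> pts d n" "pdist b w < e"
  have "a \<in> fnb d F" "b \<in> fnb d F" using e(2) a b by auto
  moreover from this have "point_dsum a b \<in> fnb d F"
   using fnb_dsum[OF F(1) pts_nc_space[OF a(1) w(3)] pts_nc_space[OF b(1) w(3)] d] by simp
  ultimately show "a \<in> V" "b \<in> V" "point_dsum a b \<in> V" using F(3) by auto
 qed
qed

text \<open>\<open>w\<close> is a point of \<open>S\<close>, possibly outside the domain
  \<open>A\<close> of \<open>f\<close>. With \<open>A\<close> the smaller set the setting yields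
  extensions; with \<open>A\<close> the larger set, containing \<open>w\<close>, it yields their
  uniqueness.\<close>

locale lipschitz_setting =
 fixes d :: nat and S A :: "nc_point set" and f :: "nc_point => complex mat" and w :: nc_point and n :: nat
 assumes S: "openin (free_topology d) S" and d: "d > 0" and A: "sim_closed S A"
  and f: "conditionally_nc d A f" and bdd: "freely_locally_bounded_on d S A f"
  and w: "w \<in> S" "w \<in> pts d n" "n \<ge> 1"
begin

definition appr :: "(nat => nc_point) => bool" where
 "appr a \<longleftrightarrow> (\<forall>\<^sub>F m in sequentially. a m \<in> A \<and> a m \<in> pts d n) \<and> (\<lambda>m. pdist (a m) w) \<longlonglongrightarrow> 0"

lemma appr_carrier: "appr a ==> \<forall>\<^sub>F m in sequentially. f (a m) \<in> Mat n"
 unfolding appr_def using conditionally_nc_graded[OF f _ _ d] by (auto elim: eventually_mono)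

text \<open>The Lipschitz bound makes the values a Cauchy sequence, but it is available only for
  pairs whose direct sum lies in \<open>A\<close>; hence the condition on all late pairs, equal
  indices included.\<close>

lemma seq_converges:
 assumes a: "appr a" and pair: "\<exists>M. \<forall>m\<ge>M. \<forall>l\<ge>M. point_dsum (a m) (a l) \<in> A"
 shows "\<exists>L. mconv n (\<lambda>m. f (a m)) L"
proof (rule mconv_Cauchy[OF appr_carrier[OF a]])
 fix e :: real assume e: "e > 0"
 obtain e0 L where e0: "e0 > 0" "L \<ge> 0" and lip: "\<And>a b. a \<in> A ==> b \<in> A ==> a \<in> pts d n ==> b \<in> pts d n ==> pdist a w < e0 ==> pdist b w < e0 ==>
  point_dsum a b \<in> A ==> op_norm (f a - f b) \<le> L * pdist a b"
  using locally_lipschitz[OF S d A f bdd w] by blast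
 define e1 where "e1 = min e0 (e / (2 * (L + 1)))"
 have e1: "e1 > 0" using e0 e by (simp add: e1_def)
 have "\<forall>\<^sub>F m in sequentially. pdist (a m) w < e1" using a e1 unfolding appr_def by (auto intro: order_tendstoD)
 moreover have "\<forall>\<^sub>F m in sequentially. a m \<in> A \<and> a m \<in> pts d n" using a by (simp add: appr_def)
 ultimately have "\<forall>\<^sub>F m in sequentially. a m \<in> A \<and> a m \<in> pts d n \<and> pdist (a m) w < e1" by eventually_elim simp
 then obtain M1 where M1: "\<And>m. m \<ge> M1 ==> a m \<in> A \<and> a m \<in> pts d n \<and> pdist (a m) w < e1" by (auto simp: eventually_sequentially)
 obtain M2 where M2: "\<And>m l. m \<ge> M2 ==> l \<ge> M2 ==> point_dsum (a m) (a l) \<in> A" using pair by auto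
 show "\<exists>M. \<forall>m\<ge>M. \<forall>l\<ge>M. op_norm (f (a m) - f (a l)) < e"
 proof (intro exI[of _ "max M1 M2"] allI impI)
  fix m l assume ml: "m \<ge> max M1 M2" "l \<ge> max M1 M2"
  have am: "a m \<in> A" "a m \<in> pts d n" "pdist (a m) w < e1" using M1[of m] ml by auto
  have al: "a l \<in> A" "a l \<in> pts d n" "pdist (a l) w < e1" using M1[of l] ml by auto
  have p: "pdist (a m) (a l) < e / (L + 1)"
  proof -
   have "pdist (a m) (a l) \<le> pdist (a m) w + pdist w (a l)" by (rule pdist_triangle[OF am(2) w(2) al(2)])
   also have "pdist w (a l) = pdist (a l) w" by (rule pdist_commute[OF w(2) al(2)])
   also have "pdist (a m) w + pdist (a l) w < 2 * (e / (2 * (L + 1)))" using am(3) al(3) unfolding e1_def by linarith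
   also have "2 * (e / (2 * (L + 1))) = e / (L + 1)" using e0 by (simp add: field_simps)
   finally show ?thesis .
  qed
  have "op_norm (f (a m) - f (a l)) \<le> L * pdist (a m) (a l)"
   using am al M2[of m l] ml by (intro lip) (auto simp: e1_def)
  also have "\<dots> \<le> (L + 1) * pdist (a m) (a l)" using pdist_nonneg[OF am(2) al(2)] by (simp add: distrib_right)
  also have "\<dots> < e" using p e0 by (simp add: field_simps)
  finally show "op_norm (f (a m) - f (a l)) < e" .
 qed
qed

lemma same_limit:
 assumes a: "appr a" and b: "appr b" and pair: "\<forall>\<^sub>F m in sequentially. point_dsum (a m) (b m) \<in> A"
  and L: "mconv n (\<lambda>m. f (a m)) X"
 shows "mconv n (\<lambda>m. f (b m)) X"
proof -
 obtain e0 L where e0: "e0 > 0" "L \<ge> 0" and lip: "\<And>a b. a \<in> A ==> b \<in> A ==> a \<in> pts d n ==> b \<in> pts d n ==> pdist a w < e0 ==> pdist b w < e0 ==>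
  point_dsum a b \<in> A ==> op_norm (f a - f b) \<le> L * pdist a b"
  using locally_lipschitz[OF S d A f bdd w] by blast
 have ea: "\<forall>\<^sub>F m in sequentially. a m \<in> A \<and> a m \<in> pts d n" and eb: "\<forall>\<^sub>F m in sequentially. b m \<in> A \<and> b m \<in> pts d n"
  using a b by (auto simp: appr_def)
 have ca: "\<forall>\<^sub>F m in sequentially. pdist (a m) w < e0" and cb: "\<forall>\<^sub>F m in sequentially. pdist (b m) w < e0"
  using a b e0(1) unfolding appr_def by (auto intro: order_tendstoD)
 show ?thesis
 proof (rule mconv_close[OF L])
  have "(\<lambda>m. L * (pdist (a m) w + pdist (b m) w)) \<longlonglongrightarrow> L * (0 + 0)"
   using a b unfolding appr_def by (intro tendsto_intros) auto
  then show "(\<lambda>m. L * (pdist (a m) w + pdist (b m) w)) \<longlonglongrightarrow> 0" by simp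
  show "\<forall>\<^sub>F m in sequentially. f (a m) \<in> Mat n \<and> f (b m) \<in> Mat n \<and> op_norm (f (b m) - f (a m)) \<le> L * (pdist (a m) w + pdist (b m) w)"
   using ea eb ca cb pair
  proof eventually_elim
   case (elim m)
   then have p: "a m \<in> pts d n" "b m \<in> pts d n" by auto
   have c: "f (a m) \<in> Mat n" "f (b m) \<in> Mat n" using conditionally_nc_graded[OF f _ _ d] elim by auto
   have "op_norm (f (b m) - f (a m)) = op_norm (f (a m) - f (b m))" by (rule op_norm_minus_commute[OF c(2,1)])
   also have "\<dots> \<le> L * pdist (a m) (b m)" using elim by (intro lip) auto
   also have "\<dots> \<le> L * (pdist (a m) w + pdist (b m) w)"
    using pdist_triangle[OF p(1) w(2) p(2)] pdist_commute[OF w(2) p(2)] e0(2) by (intro mult_left_mono) auto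
   finally show ?case using c by simp
  qed
 qed
qed

lemma constant_limit:
 assumes a: "appr a" and wA: "w \<in> A" and pair: "\<forall>\<^sub>F m in sequentially. point_dsum w (a m) \<in> A"
 shows "mconv n (\<lambda>m. f (a m)) (f w)"
proof (rule same_limit[OF _ a pair mconv_const[OF conditionally_nc_graded[OF f wA w(2) d]]])
 have "w ! i - w ! i = 0\<^sub>m n n" if "i < d" for i using ptsD(2)[OF w(2) that] by (intro eq_matI) auto
 then have "pdist w w = 0" unfolding pdist_def using ptsD(1)[OF w(2)] by simp
 then show "appr (\<lambda>_. w)" unfolding appr_def using wA w(2) by simp
qed

text \<open>A bound on a neighbourhood passes to the limits at all of its points, so the extension
  is bounded there uniformly over the levels. \<open>max 0 C\<close> is used because
  \<open>C\<close> is not assumed nonnegative.\<close>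

lemma limit_bounded:
 assumes a: "appr a" and X: "mconv n (\<lambda>m. f (a m)) X" and V: "openin (free_topology d) V" "w \<in> V" and C: "\<forall>x\<in>V \<inter> A. op_norm (f x) \<le> C"
 shows "op_norm X \<le> max 0 C"
proof (rule mconv_op_norm_le[OF X])
 obtain e where e1: "e > 0" and e2: "\<forall>a b. a \<in> pts d n --> b \<in> pts d n --> pdist a w < e --> pdist b w < e -->
  a \<in> V \<and> b \<in> V \<and> point_dsum a b \<in> V"
  using near_open[OF V(1) d V(2) w(2,3)] by (elim exE conjE)
 have "\<forall>\<^sub>F m in sequentially. pdist (a m) w < e" "\<forall>\<^sub>F m in sequentially. a m \<in> A \<and> a m \<in> pts d n"
  using a e1 unfolding appr_def by (auto intro: order_tendstoD)
 then show "\<forall>\<^sub>F m in sequentially. f (a m) \<in> Mat n \<and> op_norm (f (a m)) \<le> max 0 C"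
  using appr_carrier[OF a]
 proof eventually_elim
  case (elim m)
  then have m: "a m \<in> A" "a m \<in> pts d n" by auto
  have "a m \<in> V" using e2[rule_format, OF m(2) m(2) elim(1) elim(1)] by simp
  then have "op_norm (f (a m)) \<le> C" using C m(1) by blast
  then show ?case using elim(3) by simp
 qed
qed simp

end

text \<open>When \<open>D\<close> contains the second summands that occur, \<open>f\<close> itself
  can serve as the auxiliary function on them.\<close>

lemma conditionally_nc_I:
 assumes "D \<subseteq> nc_space d" "graded D f" "preserves_similarity D f"
  "\<And>x y. x \<in> D ==> y \<in> nc_space d ==> point_dsum x y \<in> D ==> y \<in> D \<and> f (point_dsum x y) = mat_dsum (f x) (f y)"
 shows "conditionally_nc d D f"
proof -
 have "graded {y \<in> nc_space d. \<exists>x\<in>D. point_dsum x y \<in> D} f" unfolding graded_def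
 proof
  fix y assume "y \<in> {y \<in> nc_space d. \<exists>x\<in>D. point_dsum x y \<in> D}"
  then obtain x where "x \<in> D" "y \<in> nc_space d" "point_dsum x y \<in> D" by blast
  then have "y \<in> D" using assms(4) by blast
  then show "f y \<in> carrier_mat (mlevel y) (mlevel y)" using assms(2) by (simp add: graded_def)
 qed
 moreover have "\<forall>x\<in>D. \<forall>y\<in>nc_space d. point_dsum x y \<in> D --> f (point_dsum x y) = mat_dsum (f x) (f y)"
  using assms(4) by blast
 ultimately have "\<exists>f'. graded {y \<in> nc_space d. \<exists>x\<in>D. point_dsum x y \<in> D} f' \<and>
  (\<forall>x\<in>D. \<forall>y\<in>nc_space d. point_dsum x y \<in> D --> f (point_dsum x y) = mat_dsum (f x) (f' y))" by blast
 then show ?thesis unfolding conditionally_nc_def using assms(1-3) by (intro conjI)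
qed

lemma freely_holomorphic_bounded:
 assumes "freely_holomorphic d D f" shows "freely_locally_bounded_on d D D f"
 unfolding freely_locally_bounded_on_def
proof
 fix z assume "z \<in> D"
 then obtain U where "openin (free_topology d) U" "z \<in> U" "U \<subseteq> D" "bounded_values_on U f"
  using assms unfolding freely_holomorphic_def tau_holomorphic_def by blast
 moreover from this have "U \<inter> D = U" by blast
 ultimately show "\<exists>V. openin (free_topology d) V \<and> z \<in> V \<and> bounded_values_on (V \<inter> D) f" by (intro exI[of _ U]) simp
qed

lemma mconv_subseq:
 assumes "mconv n g A" "strict_mono k" shows "mconv n (\<lambda>m. g (k m)) A"
 unfolding mconv_def
proof (intro conjI allI impI)
 fix i j assume "i < n" "j < n"
 then have "(\<lambda>m. g m $$ (i, j)) \<longlonglongrightarrow> A $$ (i, j)" using assms(1) by (simp add: mconv_def)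
 from LIMSEQ_subseq_LIMSEQ[OF this assms(2)] show "(\<lambda>m. g (k m) $$ (i, j)) \<longlonglongrightarrow> A $$ (i, j)" by (simp add: o_def)
qed (use assms in \<open>auto simp: mconv_def\<close>)

section \<open>Extension from \<open>S_o\<close> to \<open>S\<close>\<close>

definition shiftv :: "complex => nc_point => nc_point" where
 "shiftv t w = mkw (uu w) (vv w + t \<cdot>\<^sub>m 1\<^sub>m (mlevel w))"

lemma shiftv:
 assumes w: "w \<in> pts 2 n"
 shows "shiftv t w \<in> pts 2 n" "uu (shiftv t w) = uu w" "vv (shiftv t w) = vv w + t \<cdot>\<^sub>m 1\<^sub>m n"
proof -
 have c: "vv w + t \<cdot>\<^sub>m 1\<^sub>m n \<in> Mat n" using uu_vv_carrier[OF w] by simp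
 have m: "mlevel w = n" using pts_mlevel[OF w] by simp
 show "shiftv t w \<in> pts 2 n" "uu (shiftv t w) = uu w" "vv (shiftv t w) = vv w + t \<cdot>\<^sub>m 1\<^sub>m n"
  unfolding shiftv_def m using mkw_pts[OF uu_vv_carrier(1)[OF w] c] uu_vv_mkw[OF uu_vv_carrier(1)[OF w] c] by auto
qed

lemma pts2_uu_vv_eqI: "x \<in> pts 2 n ==> y \<in> pts 2 n ==> uu x = uu y ==> vv x = vv y ==> x = y"
 using mkw_uu_vv by metis

lemma shiftv_0: "w \<in> pts 2 n ==> shiftv 0 w = w"
proof (rule pts2_uu_vv_eqI[of _ n])
 assume w: "w \<in> pts 2 n"
 have "vv w + 0 \<cdot>\<^sub>m 1\<^sub>m n = vv w" using uu_vv_carrier(2)[OF w] by (intro eq_matI) auto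
 then show "shiftv 0 w \<in> pts 2 n" "uu (shiftv 0 w) = uu w" "vv (shiftv 0 w) = vv w" using shiftv[OF w, of 0] by auto
qed

lemma shiftv_conj:
 assumes w: "w \<in> pts 2 n" and s: "s \<in> GL n"
 shows "shiftv t (conj_point s w) = conj_point s (shiftv t w)"
proof (rule pts2_uu_vv_eqI)
 note c = uu_vv_conj[OF _ s]
 show "uu (shiftv t (conj_point s w)) = uu (conj_point s (shiftv t w))"
  using shiftv[OF w] shiftv[OF pts_conj[OF w s]] c[OF w] c[OF shiftv(1)[OF w]] by simp
 have "conj_mat s (vv w + t \<cdot>\<^sub>m 1\<^sub>m n) = conj_mat s (vv w) + t \<cdot>\<^sub>m 1\<^sub>m n"
  using conj_mat_add[OF s uu_vv_carrier(2)[OF w], of "t \<cdot>\<^sub>m 1\<^sub>m n"] conj_mat_smult[OF s one_carrier_mat, of t] conj_mat_one[OF s] by simp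
 then show "vv (shiftv t (conj_point s w)) = vv (conj_point s (shiftv t w))"
  using shiftv[OF w] shiftv[OF pts_conj[OF w s]] c[OF w] c[OF shiftv(1)[OF w]] by simp
qed (use shiftv(1)[OF w] shiftv(1)[OF pts_conj[OF w s]] s in auto)

lemma shiftv_dsum:
 assumes x: "x \<in> pts 2 n" and y: "y \<in> pts 2 m"
 shows "shiftv t (point_dsum x y) = point_dsum (shiftv t x) (shiftv t y)"
proof (rule pts2_uu_vv_eqI)
 note xy = shiftv[OF pts_dsum[OF x y], of t] and sx = shiftv[OF x, of t] and sy = shiftv[OF y, of t]
 show "shiftv t (point_dsum x y) \<in> pts 2 (n + m)" by (rule xy(1))
 show "point_dsum (shiftv t x) (shiftv t y) \<in> pts 2 (n + m)" using sx(1) sy(1) by simp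
 show "uu (shiftv t (point_dsum x y)) = uu (point_dsum (shiftv t x) (shiftv t y))"
  using xy(2) sx(2) sy(2) uu_vv_dsum[OF sx(1) sy(1)] uu_vv_dsum[OF x y] by simp
 have "mat_dsum (vv x) (vv y) + t \<cdot>\<^sub>m 1\<^sub>m (n + m) = mat_dsum (vv x + t \<cdot>\<^sub>m 1\<^sub>m n) (vv y + t \<cdot>\<^sub>m 1\<^sub>m m)"
  using uu_vv_carrier[OF x] uu_vv_carrier[OF y]
  by (simp add: mat_dsum_add[of _ n _ m, symmetric] mat_dsum_smult[of _ n _ m, symmetric] mat_dsum_one)
 then show "vv (shiftv t (point_dsum x y)) = vv (point_dsum (shiftv t x) (shiftv t y))"
  using xy(3) sx(3) sy(3) uu_vv_dsum[OF sx(1) sy(1)] uu_vv_dsum[OF x y] by simp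
qed

lemma shiftv_flip:
 assumes w: "w \<in> pts 2 n"
 shows "shiftv t (flip w) = flip (shiftv (- t) w)"
proof (rule pts2_uu_vv_eqI)
 note s = shiftv[OF w, of "- t"] and sf = shiftv[OF flip_pts[OF w], of t]
 show "uu (shiftv t (flip w)) = uu (flip (shiftv (- t) w))"
  using s sf uu_vv_flip[OF w] uu_vv_flip[OF s(1)] by simp
 have "- vv w + t \<cdot>\<^sub>m 1\<^sub>m n = - (vv w + (- t) \<cdot>\<^sub>m 1\<^sub>m n)"
  using uu_vv_carrier(2)[OF w] by (intro eq_matI) auto
 then show "vv (shiftv t (flip w)) = vv (flip (shiftv (- t) w))"
  using s sf uu_vv_flip[OF w] uu_vv_flip[OF s(1)] by simp
qed (use shiftv(1)[OF w] shiftv(1)[OF flip_pts[OF w]] in auto)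

lemma pdist_pts2:
 assumes "x \<in> pts 2 n" "y \<in> pts 2 n"
 shows "pdist x y = op_norm (x ! 0 - y ! 0) + op_norm (x ! 1 - y ! 1)"
 using ptsD(1)[OF assms(1)] by (simp add: pdist_def numeral_2_eq_2)

lemma pdist_shiftv:
 assumes w: "w \<in> pts 2 n"
 shows "pdist (shiftv t w) w \<le> 2 * cmod t"
proof -
 note c = ptsD(2)[OF w, of 0] ptsD(2)[OF w, of 1]
 have m: "mlevel w = n" using pts_mlevel[OF w] by simp
 have "w ! 0 = uu w + vv w" "w ! 1 = uu w - vv w" 
  using arg_cong[OF mkw_uu_vv[OF w], of "\<lambda>x. x ! 0"] arg_cong[OF mkw_uu_vv[OF w], of "\<lambda>x. x ! 1"] by (simp_all add: mkw_def)
 then have "shiftv t w ! 0 - w ! 0 = t \<cdot>\<^sub>m 1\<^sub>m n" "shiftv t w ! 1 - w ! 1 = (- t) \<cdot>\<^sub>m 1\<^sub>m n"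
  using uu_vv_carrier[OF w] by (auto simp: shiftv_def mkw_def m intro!: eq_matI)
 then have "pdist (shiftv t w) w = cmod t * op_norm (1\<^sub>m n) + cmod t * op_norm (1\<^sub>m n)"
  unfolding pdist_pts2[OF shiftv(1)[OF w] w] by (simp add: op_norm_smult[OF one_carrier_mat])
 also have "\<dots> \<le> cmod t * 1 + cmod t * 1" using op_norm_one_le by (intro add_mono mult_left_mono) auto
 finally show ?thesis by simp
qed

lemma spectrum_shift:
 fixes v :: "complex mat"
 assumes v: "v \<in> Mat n"
 shows "spectrum (v + t \<cdot>\<^sub>m 1\<^sub>m n) = (\<lambda>a. a + t) ` spectrum v"
proof -
 have vt: "v + t \<cdot>\<^sub>m 1\<^sub>m n \<in> Mat n" using v by simp
 have "poly (char_poly (v + t \<cdot>\<^sub>m 1\<^sub>m n)) z = poly (char_poly v) (z - t)" for z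
 proof -
  have "z \<cdot>\<^sub>m 1\<^sub>m n - (v + t \<cdot>\<^sub>m 1\<^sub>m n) = (z - t) \<cdot>\<^sub>m 1\<^sub>m n - v" using v by (intro eq_matI) auto
  then show ?thesis by (simp add: poly_char_poly[OF v] poly_char_poly[OF vt])
 qed
 then have *: "z \<in> spectrum (v + t \<cdot>\<^sub>m 1\<^sub>m n) \<longleftrightarrow> z - t \<in> spectrum v" for z
  by (simp add: spectrum_root[OF v] spectrum_root[OF vt])
 show ?thesis
 proof (rule Set.set_eqI, rule iffI)
  fix z assume "z \<in> spectrum (v + t \<cdot>\<^sub>m 1\<^sub>m n)"
  then have "z - t \<in> spectrum v" using * by blast
  then show "z \<in> (\<lambda>a. a + t) ` spectrum v" by (rule image_eqI[rotated]) simp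
 next
  fix z assume "z \<in> (\<lambda>a. a + t) ` spectrum v"
  then obtain a where "a \<in> spectrum v" "z = a + t" by blast
  then show "z \<in> spectrum (v + t \<cdot>\<^sub>m 1\<^sub>m n)" unfolding * by simp
 qed
qed

lemma spectrum_uminus:
 fixes v :: "complex mat"
 assumes v: "v \<in> Mat n"
 shows "a \<in> spectrum (- v) ==> - a \<in> spectrum v"
proof -
 assume a: "a \<in> spectrum (- v)"
 have mv: "- v \<in> Mat n" using v by simp
 obtain y where y: "y \<in> carrier_vec n" "y \<noteq> 0\<^sub>v n" "- v *\<^sub>v y = a \<cdot>\<^sub>v y" using spectrum_eigenvector[OF mv a] .
 have "v *\<^sub>v y = (- a) \<cdot>\<^sub>v y"
 proof (rule eq_vecI)
  fix i assume "i < dim_vec ((- a) \<cdot>\<^sub>v y)"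
  then have i: "i < n" using y by simp
  have "vec_index (- v *\<^sub>v y) i = a * vec_index y i" using y(1,3) i by simp
  moreover have "vec_index (- v *\<^sub>v y) i = - vec_index (v *\<^sub>v y) i" using v y(1) i by simp
  ultimately have "- vec_index (v *\<^sub>v y) i = a * vec_index y i" by simp
  then have "vec_index (v *\<^sub>v y) i = - (a * vec_index y i)" by (metis minus_minus)
  then show "vec_index (v *\<^sub>v y) i = vec_index ((- a) \<cdot>\<^sub>v y) i" using i y(1) by (simp del: index_mult_mat_vec)
 qed (use v y in auto)
 then show "- a \<in> spectrum v" using y carrier_matD[OF v] unfolding spectrum_def eigenvalue_def eigenvector_def by auto
qed

lemma sylv_uminus: "v \<in> Mat n ==> sylv v ==> sylv (- v)"
 unfolding sylv_def
proof (intro ballI)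
 fix a b assume v: "v \<in> Mat n" and s: "\<forall>a\<in>spectrum v. \<forall>b\<in>spectrum v. a + b \<noteq> 0"
  and ab: "a \<in> spectrum (- v)" "b \<in> spectrum (- v)"
 have "- a + - b \<noteq> 0" using s spectrum_uminus[OF v ab(1)] spectrum_uminus[OF v ab(2)] by blast
 then show "a + b \<noteq> 0" by (simp add: add_eq_0_iff)
qed

text \<open>Positive reals, so that no sum of two of them vanishes; this is what makes the direct
  sum of two shifted points have no opposite eigenvalues.\<close>

definition tt :: "nat => complex" where "tt m = complex_of_real (1 / (real m + 1))"

lemma tt: "cmod (tt m) = 1 / (real m + 1)" "tt m \<noteq> 0" "tt m + tt l \<noteq> 0"
proof -
 have p: "1 / (real m + 1) > 0" for m by simp
 show "cmod (tt m) = 1 / (real m + 1)" using p[of m] by (simp only: tt_def norm_of_real abs_of_pos)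
 show "tt m \<noteq> 0" using p[of m] by (simp only: tt_def of_real_eq_0_iff)
 have "1 / (real m + 1) + 1 / (real l + 1) > 0" using p[of m] p[of l] by linarith
 then show "tt m + tt l \<noteq> 0" unfolding tt_def of_real_add[symmetric] of_real_eq_0_iff by linarith
qed

lemma tt_limit: "(\<lambda>m. cmod (tt m)) \<longlonglongrightarrow> 0"
 unfolding tt using LIMSEQ_inverse_real_of_nat by (simp add: inverse_eq_divide add.commute)

locale nc_symmetric = sqrt_branches r q for r q +
 fixes S :: "nc_point set"
 assumes dom: "free_domain 2 S"
  and sym: "symmetric_set S"
  and closed: "\<And>w1 w2. w1 \<in> S ==> w2 \<in> S ==> similar_points (pi_map w1) (pi_map w2) ==> point_dsum w1 w2 \<in> S"
begin

lemma S_open: "openin (free_topology 2) S" using dom by (simp add: free_domain_def)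

lemma S_sub: "S \<subseteq> nc_space 2" by (rule openin_free_subset[OF S_open])

lemma S_level:
 assumes "w \<in> S" obtains n where "w \<in> pts 2 n" "n \<ge> 1"
proof -
 have "w \<in> nc_space 2" using assms S_sub by blast
 then show ?thesis using that by (auto simp: nc_space_pts)
qed

abbreviation "So \<equiv> S_o r q S"

lemma So_iff: "w \<in> So \<longleftrightarrow> w \<in> S \<and> sylv (vv w)" by (rule S_o_iff[OF S_sub])

lemma So_sub: "So \<subseteq> S" using So_iff by blast

lemma sim_closed_So: "sim_closed S So"
 unfolding sim_closed_def
proof (intro conjI ballI impI So_sub)
 fix w s assume w: "w \<in> So" and s: "s \<in> GL (mlevel w)" and c: "conj_point s w \<in> S"
 obtain n where n: "w \<in> pts 2 n" "n \<ge> 1" using S_level w So_sub by blast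
 have s: "s \<in> GL n" using s pts_mlevel[OF n(1)] by simp
 show "conj_point s w \<in> So"
  using w c spectrum_conj[OF s uu_vv_carrier(2)[OF n(1)]] by (simp add: So_iff uu_vv_conj[OF n(1) s] sylv_def)
qed

lemma sim_closed_S: "sim_closed S S" by (simp add: sim_closed_def)

lemma flip_So: "w \<in> So ==> flip w \<in> So"
proof -
 assume w: "w \<in> So"
 obtain n where n: "w \<in> pts 2 n" "n \<ge> 1" using S_level w So_sub by blast
 show "flip w \<in> So" using w sym sylv_uminus[OF uu_vv_carrier(2)[OF n(1)]] uu_vv_flip[OF n(1)]
  by (simp add: So_iff symmetric_set_def)
qed

lemma S_summands:
 assumes "x \<in> nc_space 2" "y \<in> nc_space 2" "point_dsum x y \<in> S"
 shows "x \<in> S \<and> y \<in> S \<and> point_dsum y x \<in> S"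
 using open_dsum_iff[OF S_open zero_less_numeral assms] by (intro conjI)

lemma So_summands:
 assumes x: "x \<in> nc_space 2" and y: "y \<in> nc_space 2" and xy: "point_dsum x y \<in> So"
 shows "x \<in> So \<and> y \<in> So \<and> point_dsum y x \<in> So"
proof -
 obtain n where n: "x \<in> pts 2 n" "n \<ge> 1" using x by (auto simp: nc_space_pts)
 obtain m where m: "y \<in> pts 2 m" "m \<ge> 1" using y by (auto simp: nc_space_pts)
 note sp = spectrum_dsum[OF uu_vv_carrier(2)[OF n(1)] uu_vv_carrier(2)[OF m(1)]]
  spectrum_dsum[OF uu_vv_carrier(2)[OF m(1)] uu_vv_carrier(2)[OF n(1)]]
 show ?thesis using xy S_summands[OF x y] unfolding So_iff uu_vv_dsum[OF n(1) m(1)] uu_vv_dsum[OF m(1) n(1)] sylv_def sp by blast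
qed

text \<open>The eigenvalue sums that must not vanish have the form a + b + s, where s is 2t, 2t' or
  t + t'. A nonzero a + b is bounded away from 0 and cannot be cancelled by a small s; if a + b = 0,
  it is enough that s is nonzero. Under \<open>sylv (vv w)\<close> the latter case does not occur,
  and zero shifts are admissible.\<close>

lemma shift_pair:
 assumes w: "w \<in> S" "w \<in> pts 2 n" "n \<ge> 1"
 shows "\<exists>\<delta>>0. \<forall>t t'. cmod t < \<delta> --> cmod t' < \<delta> --> shiftv t w \<in> S \<and> point_dsum (shiftv t w) (shiftv t' w) \<in> S \<and>
  (sylv (vv w) \<or> (t \<noteq> 0 \<and> t' \<noteq> 0 \<and> t + t' \<noteq> 0) --> shiftv t w \<in> So \<and> point_dsum (shiftv t w) (shiftv t' w) \<in> So)"
proof -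
 let ?v = "vv w"
 have v: "?v \<in> Mat n" using w by simp
 have fin: "finite ((\<lambda>(a, b). cmod (a + b)) ` (spectrum ?v \<times> spectrum ?v) - {0})"
  using card_finite_spectrum(1)[OF v] by auto
 \<comment> \<open>The least modulus of a nonzero eigenvalue sum; inserting 1 keeps the set
   nonempty.\<close>
 define D where "D = Min (insert 1 ((\<lambda>(a, b). cmod (a + b)) ` (spectrum ?v \<times> spectrum ?v) - {0}))"
 have D: "D > 0" unfolding D_def using fin by (subst Min_gr_iff) auto
 have key: "a + b + s \<noteq> 0" if "a \<in> spectrum ?v" "b \<in> spectrum ?v" "cmod s < D" "s \<noteq> 0 \<or> sylv ?v" for a b s
 proof (cases "a + b = 0")
  case True
  then show ?thesis using that by (auto simp: sylv_def)
 next
  case False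
  then have "D \<le> cmod (a + b)" unfolding D_def using fin that by (intro Min_le) (auto intro!: image_eqI[of _ _ "(a, b)"])
  then show ?thesis using that(3) by (metis add_eq_0_iff norm_minus_cancel not_less)
 qed
 obtain e where e: "e > 0" "\<And>a b. a \<in> pts 2 n ==> b \<in> pts 2 n ==> pdist a w < e ==> pdist b w < e ==> a \<in> S \<and> b \<in> S \<and> point_dsum a b \<in> S"
  using near_open[OF S_open _ w] by auto
 \<comment> \<open>The halves are due to s being as large as two shifts, and to a shift by
   \<open>t\<close> moving the point by up to \<open>2 * cmod t\<close>.\<close>
 show ?thesis
 proof (intro exI[of _ "min (D / 2) (e / 2)"] conjI allI impI)
  show "0 < min (D / 2) (e / 2)" using D e by simp
  fix t t' assume t: "cmod t < min (D / 2) (e / 2)" "cmod t' < min (D / 2) (e / 2)"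
  note p = shiftv[OF w(2)]
  have "pdist (shiftv t w) w < e" "pdist (shiftv t' w) w < e" using pdist_shiftv[OF w(2), of t] pdist_shiftv[OF w(2), of t'] t by auto
  from e(2)[OF p(1) p(1) this] show inS: "shiftv t w \<in> S" "point_dsum (shiftv t w) (shiftv t' w) \<in> S" by auto
  assume c: "sylv (vv w) \<or> (t \<noteq> 0 \<and> t' \<noteq> 0 \<and> t + t' \<noteq> 0)"
  have s1: "cmod (t + t) < D" "cmod (t' + t') < D" "cmod (t + t') < D"
   using t norm_triangle_ineq[of t t] norm_triangle_ineq[of t' t'] norm_triangle_ineq[of t t'] by auto
  have k1: "(a + t) + (b + t) \<noteq> 0" "(a + t') + (b + t') \<noteq> 0" "(a + t) + (b + t') \<noteq> 0" "(a + t') + (b + t) \<noteq> 0"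
   if "a \<in> spectrum ?v" "b \<in> spectrum ?v" for a b
   using key[OF that s1(1)] key[OF that s1(2)] key[OF that s1(3)] c by (auto simp: algebra_simps)
  have sp: "spectrum (vv (shiftv t w)) = (\<lambda>a. a + t) ` spectrum ?v" "spectrum (vv (shiftv t' w)) = (\<lambda>a. a + t') ` spectrum ?v"
   using p(3) spectrum_shift[OF v] by auto
  have "spectrum (vv (point_dsum (shiftv t w) (shiftv t' w))) = (\<lambda>a. a + t) ` spectrum ?v \<union> (\<lambda>a. a + t') ` spectrum ?v"
   unfolding uu_vv_dsum(2)[OF p(1) p(1)] using spectrum_dsum[OF uu_vv_carrier(2)[OF p(1)] uu_vv_carrier(2)[OF p(1)]] sp by simp
  then have "sylv (vv (point_dsum (shiftv t w) (shiftv t' w)))" unfolding sylv_def using k1 by auto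
  then show "point_dsum (shiftv t w) (shiftv t' w) \<in> So" using inS by (simp add: So_iff)
  show "shiftv t w \<in> So" using inS(1) k1(1) unfolding So_iff sylv_def sp by auto
 qed
qed

lemma eventually_tt: "\<delta> > 0 ==> \<forall>\<^sub>F m in sequentially. cmod (tt m) < \<delta>"
 using order_tendstoD(2)[OF tt_limit] by simp

lemma pdist_shiftv_limit:
 assumes "w \<in> pts 2 n" "(\<lambda>m. cmod (t m)) \<longlonglongrightarrow> 0"
 shows "(\<lambda>m. pdist (shiftv (t m) w) w) \<longlonglongrightarrow> 0"
proof (rule real_tendsto_sandwich[of "\<lambda>_. 0" _ _ "\<lambda>m. 2 * cmod (t m)"])
 show "(\<lambda>m. 2 * cmod (t m)) \<longlonglongrightarrow> 0" using tendsto_mult[OF tendsto_const assms(2), of 2] by simp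
qed (use pdist_nonneg[OF shiftv(1)[OF assms(1)] assms(1)] pdist_shiftv[OF assms(1)] in auto)

definition ext :: "(nc_point => complex mat) => nc_point => complex mat" where
 "ext f w = (if w \<in> S then Matrix.mat (mlevel w) (mlevel w) (\<lambda>ij. lim (\<lambda>m. f (shiftv (tt m) w) $$ ij)) else undefined)"

context
 fixes f assumes f: "conditionally_nc 2 So f" and bdd: "freely_locally_bounded_on 2 S So f"
begin

lemma lipschitz_So: "w \<in> S ==> w \<in> pts 2 n ==> n \<ge> 1 ==> lipschitz_setting 2 S So f w n"
 using f bdd S_open sim_closed_So by unfold_locales auto

lemma appr_shift:
 assumes w: "w \<in> S" "w \<in> pts 2 n" "n \<ge> 1"
  and t: "(\<lambda>m. cmod (t m)) \<longlonglongrightarrow> 0" "\<And>m. t m \<noteq> 0"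
 shows "lipschitz_setting.appr 2 So w n (\<lambda>m. shiftv (t m) w)"
proof -
 interpret lipschitz_setting 2 S So f w n by (rule lipschitz_So[OF w])
 obtain \<delta> where d: "\<delta> > 0" "\<And>t t'. cmod t < \<delta> ==> cmod t' < \<delta> ==> t \<noteq> 0 ==> t' \<noteq> 0 ==> t + t' \<noteq> 0 ==> shiftv t w \<in> So"
  using shift_pair[OF w] by blast
 have "\<forall>\<^sub>F m in sequentially. cmod (t m) < \<delta>" using order_tendstoD(2)[OF t(1) d(1)] .
 then have "\<forall>\<^sub>F m in sequentially. shiftv (t m) w \<in> So \<and> shiftv (t m) w \<in> pts 2 n"
 proof eventually_elim
  case (elim m)
  then show ?case using d(2)[of "t m" "t m"] t(2)[of m] shiftv(1)[OF w(2)] by simp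
 qed
 then show ?thesis unfolding appr_def using pdist_shiftv_limit[OF w(2) t(1)] by simp
qed

lemma ext_conv:
 assumes w: "w \<in> S" "w \<in> pts 2 n" "n \<ge> 1"
 shows "mconv n (\<lambda>m. f (shiftv (tt m) w)) (ext f w)"
proof -
 interpret lipschitz_setting 2 S So f w n by (rule lipschitz_So[OF w])
 have a: "appr (\<lambda>m. shiftv (tt m) w)" by (rule appr_shift[OF w tt_limit tt(2)])
 obtain \<delta> where d: "\<delta> > 0" "\<And>t t'. cmod t < \<delta> ==> cmod t' < \<delta> ==> t \<noteq> 0 ==> t' \<noteq> 0 ==> t + t' \<noteq> 0 ==> point_dsum (shiftv t w) (shiftv t' w) \<in> So"
  using shift_pair[OF w] by blast
 obtain M where M: "\<And>m. m \<ge> M ==> cmod (tt m) < \<delta>" using eventually_tt[OF d(1)] by (auto simp: eventually_sequentially)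
 have "\<exists>M. \<forall>m\<ge>M. \<forall>l\<ge>M. point_dsum (shiftv (tt m) w) (shiftv (tt l) w) \<in> So"
  using M tt(2,3) by (intro exI[of _ M] allI impI d(2)) auto
 from seq_converges[OF a this] obtain L where L: "mconv n (\<lambda>m. f (shiftv (tt m) w)) L" by auto
 have "ext f w = L"
 proof (rule eq_matI)
  have Lc: "L \<in> Mat n" using L by (simp add: mconv_def)
  have m: "mlevel w = n" using pts_mlevel[OF w(2)] by simp
  then show "dim_row (ext f w) = dim_row L" "dim_col (ext f w) = dim_col L" using Lc w by (auto simp: ext_def)
  fix i j assume "i < dim_row L" "j < dim_col L"
  then have ij: "i < n" "j < n" using Lc by auto
  then show "ext f w $$ (i, j) = L $$ (i, j)" using L m w by (auto simp: ext_def mconv_def intro: limI)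
 qed
 then show ?thesis using L by simp
qed

lemma ext_carrier: "w \<in> S ==> w \<in> pts 2 n ==> n \<ge> 1 ==> ext f w \<in> Mat n"
 using ext_conv by (simp add: mconv_def)

text \<open>At a point of S_o the shift 0 is admissible in \<open>shift_pair\<close>, so the point
  forms pairs with its own shifts and the limit along them is the value at the point.\<close>

lemma ext_agrees:
 assumes wo: "w \<in> So" shows "ext f w = f w"
proof -
 have wS: "w \<in> S" "sylv (vv w)" using wo So_iff by auto
 obtain n where n: "w \<in> pts 2 n" "n \<ge> 1" using S_level wS by blast
 interpret lipschitz_setting 2 S So f w n by (rule lipschitz_So[OF wS(1) n])
 have a: "appr (\<lambda>m. shiftv (tt m) w)" by (rule appr_shift[OF wS(1) n tt_limit tt(2)])
 obtain \<delta> where d: "\<delta> > 0" "\<And>t t'. cmod t < \<delta> ==> cmod t' < \<delta> ==> point_dsum (shiftv t w) (shiftv t' w) \<in> So"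
  using shift_pair[OF wS(1) n] wS(2) by blast
 have "\<forall>\<^sub>F m in sequentially. point_dsum w (shiftv (tt m) w) \<in> So"
  using eventually_tt[OF d(1)]
 proof eventually_elim
  case (elim m)
  then show ?case using d(2)[OF _ elim, of 0] d(1) shiftv_0[OF n(1)] by simp
 qed
 from constant_limit[OF a wo this] show ?thesis using mconv_unique[OF ext_conv[OF wS(1) n]] by metis
qed

lemma ext_dsum:
 assumes x: "x \<in> S" "x \<in> pts 2 n" "n \<ge> 1" and y: "y \<in> S" "y \<in> pts 2 k" "k \<ge> 1" and xy: "point_dsum x y \<in> S"
 shows "ext f (point_dsum x y) = mat_dsum (ext f x) (ext f y)"
proof -
 have xyp: "point_dsum x y \<in> pts 2 (n + k)" "n + k \<ge> 1" using x y by auto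
 have ev: "\<forall>\<^sub>F m in sequentially. shiftv (tt m) w \<in> So" if "w \<in> S" "w \<in> pts 2 l" "l \<ge> 1" for w l
  using appr_shift[OF that tt_limit tt(2)] lipschitz_setting.appr_def[OF lipschitz_So[OF that]] by (auto elim: eventually_mono)
 have c: "\<forall>\<^sub>F m in sequentially. f (shiftv (tt m) w) \<in> Mat l" if "w \<in> S" "w \<in> pts 2 l" "l \<ge> 1" for w l
  using ev[OF that] by eventually_elim (rule conditionally_nc_graded[OF f _ shiftv(1)[OF that(2)]], auto)
 have "mconv (n + k) (\<lambda>m. mat_dsum (f (shiftv (tt m) x)) (f (shiftv (tt m) y))) (mat_dsum (ext f x) (ext f y))"
  by (rule mconv_dsum[OF ext_conv[OF x] ext_conv[OF y] c[OF x] c[OF y]])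
 moreover have "\<forall>\<^sub>F m in sequentially. mat_dsum (f (shiftv (tt m) x)) (f (shiftv (tt m) y)) = f (shiftv (tt m) (point_dsum x y))"
  using ev[OF x] ev[OF y] ev[OF xy xyp]
 proof eventually_elim
  case (elim m)
  have d: "point_dsum (shiftv (tt m) x) (shiftv (tt m) y) \<in> So" using elim(3) shiftv_dsum[OF x(2) y(2)] by simp
  have "point_dsum (shiftv (tt m) y) (shiftv (tt m) x) \<in> So"
   using So_summands[OF pts_nc_space[OF shiftv(1)[OF x(2)] x(3)] pts_nc_space[OF shiftv(1)[OF y(2)] y(3)] d] by simp
  then show ?case using conditionally_nc_dsum[OF f _ elim(1,2) d] shiftv_dsum[OF x(2) y(2)] by simp
 qed
 ultimately have "mconv (n + k) (\<lambda>m. f (shiftv (tt m) (point_dsum x y))) (mat_dsum (ext f x) (ext f y))" by (rule mconv_cong)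
 then show ?thesis using mconv_unique[OF ext_conv[OF xy xyp]] by blast
qed

lemma ext_conj:
 assumes x: "x \<in> S" "x \<in> pts 2 n" "n \<ge> 1" and s: "s \<in> GL n" and sx: "conj_point s x \<in> S"
 shows "ext f (conj_point s x) = conj_mat s (ext f x)"
proof -
 have ev: "\<forall>\<^sub>F m in sequentially. shiftv (tt m) w \<in> So" if "w \<in> S" "w \<in> pts 2 n" for w
  using appr_shift[OF that x(3) tt_limit tt(2)] lipschitz_setting.appr_def[OF lipschitz_So[OF that x(3)]] by (auto elim: eventually_mono)
 have c: "\<forall>\<^sub>F m in sequentially. f (shiftv (tt m) x) \<in> Mat n"
  using ev[OF x(1,2)] by eventually_elim (rule conditionally_nc_graded[OF f _ shiftv(1)[OF x(2)]], auto)
 have "mconv n (\<lambda>m. conj_mat s (f (shiftv (tt m) x))) (conj_mat s (ext f x))" by (rule mconv_conj[OF ext_conv[OF x] s c])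
 moreover have "\<forall>\<^sub>F m in sequentially. conj_mat s (f (shiftv (tt m) x)) = f (shiftv (tt m) (conj_point s x))"
  using ev[OF x(1,2)] ev[OF sx pts_conj[OF x(2) s]]
 proof eventually_elim
  case (elim m)
  then show ?case using conditionally_nc_conj[OF f elim(1) shiftv(1)[OF x(2)] _ s] shiftv_conj[OF x(2) s] by simp
 qed
 ultimately have "mconv n (\<lambda>m. f (shiftv (tt m) (conj_point s x))) (conj_mat s (ext f x))" by (rule mconv_cong)
 then show ?thesis using mconv_unique[OF ext_conv[OF sx pts_conj[OF x(2) s] x(3)]] by blast
qed

text \<open>The flip turns a shift by t into one by -t, so limits from two sides have to be
  compared. The shifts t and -t do not form an admissible pair, as their sum is 0; therefore
  \<open>- tt m\<close> is paired with \<open>tt (2 * m + 1)\<close>, which has a different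
  modulus.\<close>

lemma ext_flip:
 assumes sf: "\<And>w. w \<in> So ==> f (flip w) = f w" and ws: "w \<in> S"
 shows "ext f (flip w) = ext f w"
proof -
 obtain n where n: "w \<in> pts 2 n" "n \<ge> 1" using S_level ws by blast
 have fw: "flip w \<in> S" using ws sym by (simp add: symmetric_set_def)
 interpret lipschitz_setting 2 S So f w n by (rule lipschitz_So[OF ws n])
 define k where "k m = 2 * m + 1" for m :: nat
 have sk: "strict_mono k" by (auto simp: k_def strict_mono_def)
 have lk: "(\<lambda>m. cmod (tt (k m))) \<longlonglongrightarrow> 0" using LIMSEQ_subseq_LIMSEQ[OF tt_limit sk] by (simp add: o_def)
 have lm: "(\<lambda>m. cmod (- tt m)) \<longlonglongrightarrow> 0" using tt_limit by simp
 have a: "appr (\<lambda>m. shiftv (tt (k m)) w)" by (rule appr_shift[OF ws n lk tt(2)])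
 have b: "appr (\<lambda>m. shiftv (- tt m) w)" by (rule appr_shift[OF ws n lm]) (simp add: tt(2))
 have La: "mconv n (\<lambda>m. f (shiftv (tt (k m)) w)) (ext f w)" using mconv_subseq[OF ext_conv[OF ws n] sk] .
 obtain \<delta> where d: "\<delta> > 0" "\<And>t t'. cmod t < \<delta> ==> cmod t' < \<delta> ==> t \<noteq> 0 ==> t' \<noteq> 0 ==> t + t' \<noteq> 0 ==> point_dsum (shiftv t w) (shiftv t' w) \<in> So"
  using shift_pair[OF ws n] by blast
 have ne: "tt (k m) + - tt m \<noteq> 0" for m
 proof
  assume "tt (k m) + - tt m = 0"
  then have "cmod (tt (k m)) = cmod (tt m)" by simp
  then show False unfolding tt by (simp add: k_def field_simps)
 qed
 have "\<forall>\<^sub>F m in sequentially. point_dsum (shiftv (tt (k m)) w) (shiftv (- tt m) w) \<in> So"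
  using order_tendstoD(2)[OF lk d(1)] order_tendstoD(2)[OF lm d(1)]
 proof eventually_elim
  case (elim m)
  then show ?case using d(2)[OF elim tt(2) _ ne[of m]] tt(2)[of m] by simp
 qed
 from same_limit[OF a b this La] have "mconv n (\<lambda>m. f (shiftv (- tt m) w)) (ext f w)" .
 moreover have "\<forall>\<^sub>F m in sequentially. f (shiftv (- tt m) w) = f (shiftv (tt m) (flip w))"
 proof -
  have "\<forall>\<^sub>F m in sequentially. shiftv (- tt m) w \<in> So" using b by (auto simp: appr_def elim: eventually_mono)
  then show ?thesis by eventually_elim (simp add: shiftv_flip[OF n(1)] sf)
 qed
 ultimately have "mconv n (\<lambda>m. f (shiftv (tt m) (flip w))) (ext f w)" by (rule mconv_cong)
 then show ?thesis using mconv_unique[OF ext_conv[OF fw flip_pts[OF n(1)] n(2)]] by blast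
qed

lemma ext_conditionally_nc: "conditionally_nc 2 S (ext f)"
proof (rule conditionally_nc_I[OF S_sub])
 show "graded S (ext f)" unfolding graded_def
 proof
  fix w assume w: "w \<in> S"
  obtain n where n: "w \<in> pts 2 n" "n \<ge> 1" using S_level w by blast
  show "ext f w \<in> carrier_mat (mlevel w) (mlevel w)" using ext_carrier[OF w n] pts_mlevel[OF n(1)] by simp
 qed
 show "preserves_similarity S (ext f)" unfolding preserves_similarity_def
 proof (intro ballI impI)
  fix w s assume w: "w \<in> S" and s: "s \<in> GL (mlevel w)" and c: "conj_point s w \<in> S"
  obtain n where n: "w \<in> pts 2 n" "n \<ge> 1" using S_level w by blast
  show "ext f (conj_point s w) = conj_mat s (ext f w)" using ext_conj[OF w n _ c] s pts_mlevel[OF n(1)] by simp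
 qed
 fix x y assume x: "x \<in> S" and y: "y \<in> nc_space 2" and xy: "point_dsum x y \<in> S"
 have yS: "y \<in> S" using S_summands[OF _ y xy] x S_sub by blast
 obtain n where n: "x \<in> pts 2 n" "n \<ge> 1" using S_level x by blast
 obtain m where m: "y \<in> pts 2 m" "m \<ge> 1" using S_level yS by blast
 show "y \<in> S \<and> ext f (point_dsum x y) = mat_dsum (ext f x) (ext f y)" using yS ext_dsum[OF x n yS m xy] by simp
qed

lemma ext_bounded:
 assumes w: "w \<in> S"
 shows "\<exists>U. openin (free_topology 2) U \<and> w \<in> U \<and> U \<subseteq> S \<and> bounded_values_on U (ext f)"
proof -
 obtain V C0 where V: "openin (free_topology 2) V" "w \<in> V" and C0: "\<forall>x\<in>V \<inter> So. op_norm (f x) \<le> C0"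
  using bdd w unfolding freely_locally_bounded_on_def bounded_values_on_def by blast
 have "op_norm (ext f x) \<le> max 0 C0" if x: "x \<in> V \<inter> S" for x
 proof -
  obtain n where n: "x \<in> pts 2 n" "n \<ge> 1" using S_level x by blast
  interpret lipschitz_setting 2 S So f x n using lipschitz_So[OF _ n] x by blast
  have xS: "x \<in> S" using x by blast
  have a: "appr (\<lambda>m. shiftv (tt m) x)" by (rule appr_shift[OF xS n tt_limit tt(2)])
  show ?thesis by (rule limit_bounded[OF a ext_conv[OF xS n] V(1) _ C0]) (use x in simp)
 qed
 then have "bounded_values_on (V \<inter> S) (ext f)" unfolding bounded_values_on_def by blast
 then show ?thesis using V w S_open by (intro exI[of _ "V \<inter> S"]) auto
qed

text \<open>A basic neighbourhood inside \<open>S\<close> is an nc-set, so it contains the direct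
  sums in both orders, and conditional additivity becomes additivity there.\<close>

lemma ext_freely_holomorphic: "freely_holomorphic 2 S (ext f)"
 unfolding freely_holomorphic_def tau_holomorphic_def
proof (intro conjI ballI S_open)
 note cn = ext_conditionally_nc
 show "graded S (ext f)" using cn by (simp add: conditionally_nc_def)
 fix w assume w: "w \<in> S"
 show "\<exists>U. openin (free_topology 2) U \<and> w \<in> U \<and> U \<subseteq> S \<and> bounded_values_on U (ext f)" by (rule ext_bounded[OF w])
 obtain F where F: "valid_polys 2 F" "w \<in> fnb 2 F" "fnb 2 F \<subseteq> S" by (rule open_base[OF S_open w])
 have sub: "fnb 2 F \<subseteq> nc_space 2" by (auto simp: fnb_def)
 have ncs: "nc_set 2 (fnb 2 F)" unfolding nc_set_def using sub fnb_dsum[OF F(1)] by auto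
 have "nc_function 2 (fnb 2 F) (ext f)" unfolding nc_function_def
 proof (intro conjI ballI ncs)
  show "graded (fnb 2 F) (ext f)" "preserves_similarity (fnb 2 F) (ext f)"
   using cn F(3) unfolding conditionally_nc_def graded_def preserves_similarity_def by blast+
  fix x y assume xy: "x \<in> fnb 2 F" "y \<in> fnb 2 F"
  then have d: "x \<in> S" "y \<in> S" "point_dsum x y \<in> S" "point_dsum y x \<in> S" using ncs F(3) unfolding nc_set_def by blast+
  show "ext f (point_dsum x y) = mat_dsum (ext f x) (ext f y)" by (rule conditionally_nc_dsum[OF cn _ d]) simp
 qed
 then show "\<exists>U. openin (free_topology 2) U \<and> w \<in> U \<and> U \<subseteq> S \<and> nc_function 2 U (ext f)"
  using F fnb_open[OF F(1)] by (intro exI[of _ "fnb 2 F"]) auto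
qed

end

text \<open>On \<open>S\<close> the point \<open>w\<close> forms pairs with its own shifts, so both
  functions are limits of their values at shifts, and these lie in S_o.\<close>

lemma determined_by_So:
 assumes f: "conditionally_nc 2 S f" "freely_locally_bounded_on 2 S S f"
  and g: "conditionally_nc 2 S g" "freely_locally_bounded_on 2 S S g"
  and eq: "\<And>w. w \<in> So ==> f w = g w" and ws: "w \<in> S"
 shows "f w = g w"
proof -
 obtain n where n: "w \<in> pts 2 n" "n \<ge> 1" using S_level ws by blast
 have lim: "mconv n (\<lambda>m. h (shiftv (tt m) w)) (h w)" if h: "conditionally_nc 2 S h" "freely_locally_bounded_on 2 S S h" for h
 proof -
  interpret lipschitz_setting 2 S S h w n using h S_open sim_closed_S ws n by unfold_locales auto
  obtain \<delta> where d: "\<delta> > 0" "\<And>t t'. cmod t < \<delta> ==> cmod t' < \<delta> ==> shiftv t w \<in> S \<and> point_dsum (shiftv t w) (shiftv t' w) \<in> S"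
   using shift_pair[OF ws n] by blast
  have "\<forall>\<^sub>F m in sequentially. shiftv (tt m) w \<in> S \<and> shiftv (tt m) w \<in> pts 2 n"
   using eventually_tt[OF d(1)] by eventually_elim (use d(2) shiftv(1)[OF n(1)] in blast)
  then have a: "appr (\<lambda>m. shiftv (tt m) w)" unfolding appr_def using pdist_shiftv_limit[OF n(1) tt_limit] by simp
  have "\<forall>\<^sub>F m in sequentially. point_dsum w (shiftv (tt m) w) \<in> S"
   using eventually_tt[OF d(1)]
  proof eventually_elim
   case (elim m)
   then show ?case using d(2)[OF _ elim, of 0] d(1) shiftv_0[OF n(1)] by simp
  qed
  from constant_limit[OF a ws this] show ?thesis .
 qed
 obtain \<delta> where d: "\<delta> > 0" "\<And>t t'. cmod t < \<delta> ==> cmod t' < \<delta> ==> t \<noteq> 0 ==> t' \<noteq> 0 ==> t + t' \<noteq> 0 ==> shiftv t w \<in> So"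
  using shift_pair[OF ws n] by blast
 have "\<forall>\<^sub>F m in sequentially. f (shiftv (tt m) w) = g (shiftv (tt m) w)"
  using eventually_tt[OF d(1)]
 proof eventually_elim
  case (elim m)
  show ?case by (rule eq[OF d(2)[OF elim elim tt(2) tt(2) tt(3)]])
 qed
 then have "mconv n (\<lambda>m. g (shiftv (tt m) w)) (f w)" by (rule mconv_cong[OF lim[OF f]])
 then show ?thesis using mconv_unique[OF lim[OF g]] by metis
qed

end

section \<open>Descent along \<open>\<pi>\<close>\<close>

lemma sq_mult_carrier [simp]: "A \<in> Mat n ==> B \<in> Mat n ==> A * B \<in> Mat n"
 by (rule mult_carrier_mat)

lemma conditionally_nc_subset:
 assumes "conditionally_nc d D f" "D' \<subseteq> D" shows "conditionally_nc d D' f"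
proof -
 obtain f' where gr: "graded {y \<in> nc_space d. \<exists>x\<in>D. point_dsum x y \<in> D} f'"
  and f': "\<forall>x\<in>D. \<forall>y\<in>nc_space d. point_dsum x y \<in> D --> f (point_dsum x y) = mat_dsum (f x) (f' y)"
  using assms(1) unfolding conditionally_nc_def by (elim exE conjE)
 have 1: "D \<subseteq> nc_space d" "graded D f" "preserves_similarity D f" using assms(1) unfolding conditionally_nc_def by auto
 have "graded {y \<in> nc_space d. \<exists>x\<in>D'. point_dsum x y \<in> D'} f'" using gr assms(2) unfolding graded_def by blast
 moreover have "\<forall>x\<in>D'. \<forall>y\<in>nc_space d. point_dsum x y \<in> D' --> f (point_dsum x y) = mat_dsum (f x) (f' y)"
  using f' assms(2) by blast
 moreover have "D' \<subseteq> nc_space d" "graded D' f" "preserves_similarity D' f"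
  using 1 assms(2) unfolding graded_def preserves_similarity_def by blast+
 ultimately show ?thesis unfolding conditionally_nc_def by blast
qed

lemma conditionally_nc_cong:
 assumes f: "conditionally_nc d D f" and eq: "\<And>x. x \<in> D ==> f x = g x"
 shows "conditionally_nc d D g"
proof -
 obtain f' where gr: "graded {y \<in> nc_space d. \<exists>x\<in>D. point_dsum x y \<in> D} f'"
  and f': "\<And>x y. x \<in> D ==> y \<in> nc_space d ==> point_dsum x y \<in> D ==> f (point_dsum x y) = mat_dsum (f x) (f' y)"
  using f unfolding conditionally_nc_def by blast
 have 1: "D \<subseteq> nc_space d" "graded D f" "preserves_similarity D f" using f unfolding conditionally_nc_def by auto
 show ?thesis unfolding conditionally_nc_def
 proof (intro conjI exI[of _ f'] ballI impI gr)
  show "graded D g" using 1(2) eq by (simp add: graded_def)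
  show "preserves_similarity D g" using 1(3) eq by (simp add: preserves_similarity_def)
  fix x y assume "x \<in> D" "y \<in> nc_space d" "point_dsum x y \<in> D"
  then show "g (point_dsum x y) = mat_dsum (g x) (f' y)" using f' eq by simp
 qed (rule 1(1))
qed

lemma pi_map_nc_space: "w \<in> nc_space 2 ==> pi_map w \<in> nc_space 3"
proof -
 assume "w \<in> nc_space 2"
 then obtain n where "w \<in> pts 2 n" "n \<ge> 1" by (auto simp: nc_space_pts)
 then show "pi_map w \<in> nc_space 3" by (intro pts_nc_space[OF pi_map_pts])
qed

lemma pi_map_mlevel: "w \<in> pts 2 n ==> mlevel (pi_map w) = n"
 using pts_mlevel[OF pi_map_pts] by simp

lemma conditionally_nc_pullback:
 assumes F: "conditionally_nc 3 (pi_map ` A) F" and A: "A \<subseteq> nc_space 2"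
 shows "conditionally_nc 2 A (\<lambda>w. F (pi_map w))"
proof -
 obtain F' where gr: "graded {y \<in> nc_space 3. \<exists>x\<in>pi_map ` A. point_dsum x y \<in> pi_map ` A} F'"
  and F': "\<And>x y. x \<in> pi_map ` A ==> y \<in> nc_space 3 ==> point_dsum x y \<in> pi_map ` A ==> F (point_dsum x y) = mat_dsum (F x) (F' y)"
  using F unfolding conditionally_nc_def by blast
 have lv: "\<exists>n\<ge>1. w \<in> pts 2 n" if "w \<in> nc_space 2" for w using that by (auto simp: nc_space_pts)
 have ds: "pi_map (point_dsum x y) = point_dsum (pi_map x) (pi_map y)" if "x \<in> nc_space 2" "y \<in> nc_space 2" for x y
  using lv[OF that(1)] lv[OF that(2)] pi_map_dsum by blast
 have ml: "mlevel (pi_map w) = mlevel w" if "w \<in> nc_space 2" for w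
  using lv[OF that] pi_map_mlevel pts_mlevel[of w 2] by auto
 show ?thesis unfolding conditionally_nc_def
 proof (intro conjI exI[of _ "\<lambda>w. F' (pi_map w)"] A ballI impI)
  show "graded A (\<lambda>w. F (pi_map w))" unfolding graded_def
  proof
   fix w assume w: "w \<in> A"
   then have "F (pi_map w) \<in> carrier_mat (mlevel (pi_map w)) (mlevel (pi_map w))"
    using F unfolding conditionally_nc_def graded_def by blast
   then show "F (pi_map w) \<in> carrier_mat (mlevel w) (mlevel w)" using ml w A by auto
  qed
  show "preserves_similarity A (\<lambda>w. F (pi_map w))" unfolding preserves_similarity_def
  proof (intro ballI impI)
   fix w s assume w: "w \<in> A" and s: "s \<in> GL (mlevel w)" and c: "conj_point s w \<in> A"
   obtain n where n: "w \<in> pts 2 n" using lv w A by blast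
   have s': "s \<in> GL n" using s pts_mlevel[OF n] by simp
   have e: "pi_map (conj_point s w) = conj_point s (pi_map w)" by (rule pi_map_conj[OF n s'])
   have "s \<in> GL (mlevel (pi_map w))" using s ml w A by auto
   moreover have "conj_point s (pi_map w) \<in> pi_map ` A" using imageI[OF c, of pi_map] e by simp
   moreover have "preserves_similarity (pi_map ` A) F" using F by (simp add: conditionally_nc_def)
   ultimately show "F (pi_map (conj_point s w)) = conj_mat s (F (pi_map w))"
    unfolding e preserves_similarity_def using imageI[OF w, of pi_map] by blast
  qed
  show "graded {y \<in> nc_space 2. \<exists>x\<in>A. point_dsum x y \<in> A} (\<lambda>w. F' (pi_map w))" unfolding graded_def
  proof
   fix y assume "y \<in> {y \<in> nc_space 2. \<exists>x\<in>A. point_dsum x y \<in> A}"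
   then obtain x where y: "y \<in> nc_space 2" and x: "x \<in> A" "point_dsum x y \<in> A" by blast
   have "point_dsum (pi_map x) (pi_map y) \<in> pi_map ` A" using ds[OF _ y, of x] x A by (metis imageI subsetD)
   then have "pi_map y \<in> {y \<in> nc_space 3. \<exists>x\<in>pi_map ` A. point_dsum x y \<in> pi_map ` A}"
    using pi_map_nc_space[OF y] x(1) by blast
   then have "F' (pi_map y) \<in> carrier_mat (mlevel (pi_map y)) (mlevel (pi_map y))" using gr unfolding graded_def by blast
   then show "F' (pi_map y) \<in> carrier_mat (mlevel y) (mlevel y)" using ml[OF y] by simp
  qed
  fix x y assume x: "x \<in> A" and y: "y \<in> nc_space 2" and xy: "point_dsum x y \<in> A"
  have e: "pi_map (point_dsum x y) = point_dsum (pi_map x) (pi_map y)" using ds[OF _ y] x A by blast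
  have "point_dsum (pi_map x) (pi_map y) \<in> pi_map ` A" using imageI[OF xy, of pi_map] e by simp
  then show "F (pi_map (point_dsum x y)) = mat_dsum (F (pi_map x)) (F' (pi_map y))"
   unfolding e using F'[OF imageI[OF x] pi_map_nc_space[OF y]] by simp
 qed
qed

lemma locally_bounded_pullback:
 assumes "bounded_along_pi S (pi_map ` A) F"
 shows "freely_locally_bounded_on 2 S A (\<lambda>w. F (pi_map w))"
 unfolding freely_locally_bounded_on_def
proof
 fix z assume "z \<in> S"
 then obtain U where U: "openin (free_topology 2) U" "z \<in> U" "bounded_values_on (pi_map ` U \<inter> pi_map ` A) F"
  using assms unfolding bounded_along_pi_def by blast
 then obtain C where C: "\<And>x. x \<in> pi_map ` U \<inter> pi_map ` A ==> op_norm (F x) \<le> C" unfolding bounded_values_on_def by blast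
 have "bounded_values_on (U \<inter> A) (\<lambda>w. F (pi_map w))" unfolding bounded_values_on_def using C by blast
 then show "\<exists>V. openin (free_topology 2) V \<and> z \<in> V \<and> bounded_values_on (V \<inter> A) (\<lambda>w. F (pi_map w))" using U by blast
qed

context nc_symmetric
begin

text \<open>By \<open>sylv_root\<close> the matrix \<open>v\<close> is a value of the calculus at
  \<open>v * v\<close>, and all such values are polynomials of the argument.\<close>

lemma root_pm:
 assumes v: "v \<in> Mat n" and s: "sylv v"
 obtains p where "v = pm p (v * v)"
proof -
 let ?\<gamma> = "spectrum (v * v)"
 have G: "?\<gamma> \<in> Gamma" by (rule sylv_root(1)[OF v s refl])
 obtain \<tau> where t: "\<tau> \<in> signs ?\<gamma>" "S_fun r q ?\<gamma> \<tau> (v * v) = v" using sylv_root(2)[OF v s refl] by blast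
 have "spectrum (v * v) \<subseteq> Delta r ?\<gamma>" using center_Delta[OF G] by blast
 from S_fun_facts(4)[OF G t(1) mult_carrier_mat[OF v v] this] t(2) show ?thesis using that by metis
qed

lemma sylv_inverse:
 assumes v: "v \<in> Mat n" and s: "sylv v"
 obtains W where "W \<in> Mat n" "v * W = 1\<^sub>m n" "W * v = 1\<^sub>m n"
proof -
 have "0 \<notin> spectrum v" using s unfolding sylv_def by force
 note R = resolvent[OF v this]
 have e: "0 \<cdot>\<^sub>m 1\<^sub>m n - v = - v" using v by (intro eq_matI) auto
 have "v * (- resolvent v 0) = (- v) * resolvent v 0" "(- resolvent v 0) * v = resolvent v 0 * (- v)"
  using v carrier_matD[OF R(2)] carrier_matD[OF v] by simp_all
 then show ?thesis using R e by (intro that[of "- resolvent v 0"]) auto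
qed

text \<open>If \<open>\<pi>(w\<^sub>1) = s\<^sup>-\<^sup>1 \<pi>(w\<^sub>2) s\<close>, then \<open>J = (s\<^sup>-\<^sup>1 v\<^sub>2 s)\<^sup>-\<^sup>1 v\<^sub>1\<close> is an involution which commutes with \<open>u\<^sub>1\<close>, and \<open>1 + J\<close> and
 \<open>1 - J\<close> intertwine \<open>w\<^sub>1\<close> with \<open>s\<^sup>-\<^sup>1 w\<^sub>2 s\<close> and with its flip.\<close>

lemma descent:
 assumes f: "conditionally_nc 2 S f" and ff: "\<And>w. w \<in> S ==> f (flip w) = f w"
  and w1: "w1 \<in> S" "w1 \<in> pts 2 n" "n \<ge> 1" and w2: "w2 \<in> So" "w2 \<in> pts 2 n" and s: "s \<in> GL n"
  and pi: "pi_map w1 = conj_point s (pi_map w2)"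
 shows "f w1 = conj_mat s (f w2)"
proof -
 note sD = GL_D[OF s]
 let ?t = "mat_inv s"
 define u1 v1 u2 v2 V where "u1 = uu w1" and "v1 = vv w1" and "u2 = uu w2" and "v2 = vv w2" and "V = conj_mat s (vv w2)"
 have c: "u1 \<in> Mat n" "v1 \<in> Mat n" "u2 \<in> Mat n" "v2 \<in> Mat n" "V \<in> Mat n" "?t \<in> Mat n" "s \<in> Mat n"
  using w1 w2 s sD by (auto simp: u1_def v1_def u2_def v2_def V_def)
 note as = assoc_mult_mat[of _ n n _ n _ n]
 have L: "[u1, v1 * v1, v1 * u1 * v1] = [conj_mat s u2, conj_mat s (v2 * v2), conj_mat s (v2 * u2 * v2)]"
  using pi unfolding pi_map_uu_vv[OF w1(2)] pi_map_uu_vv[OF w2(2)] conj_point_def u1_def v1_def u2_def v2_def by (simp only: list.map)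
 note L' = L[unfolded list.inject]
 have p1: "u1 = conj_mat s u2" and q2: "v1 * v1 = conj_mat s (v2 * v2)" and q3: "v1 * u1 * v1 = conj_mat s (v2 * u2 * v2)"
  using L'[THEN conjunct1] L'[THEN conjunct2, THEN conjunct1] L'[THEN conjunct2, THEN conjunct2, THEN conjunct1] .
 have Vd: "conj_mat s v2 = V" by (simp add: V_def v2_def)
 have p2: "v1 * v1 = V * V" unfolding q2 conj_mat_mult[OF s c(4,4)] Vd ..
 have p3: "v1 * u1 * v1 = V * u1 * V"
  unfolding q3 conj_mat_mult[OF s mult_carrier_mat[OF c(4,3)] c(4)] conj_mat_mult[OF s c(4,3)] Vd p1[symmetric] ..
 have w2S: "w2 \<in> S" and sy: "sylv v2" using w2 So_iff by (auto simp: v2_def)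
 obtain p where p: "v2 = pm p (v2 * v2)" using root_pm[OF c(4) sy] .
 \<comment> \<open>Conjugation carries over the polynomial relation between \<open>v2\<close> and
   its square, and \<open>V * V\<close> equals \<open>v1 * v1\<close>.\<close>
 have "V = pm p (v1 * v1)"
 proof -
  have "V = conj_mat s (pm p (v2 * v2))" using p by (simp add: V_def v2_def)
  also have "\<dots> = pm p (conj_mat s (v2 * v2))" using pm_conj[OF s mult_carrier_mat[OF c(4,4)]] by simp
  also have "conj_mat s (v2 * v2) = v1 * v1" using p2 conj_mat_mult[OF s c(4,4)] by (simp add: V_def v2_def)
  finally show ?thesis .
 qed
 then have Vv: "V * v1 = v1 * V" using pm_commute[OF mult_carrier_mat[OF c(2,2)] c(2)] c by (simp add: as)
 have sV: "sylv V" using sy spectrum_conj[OF s c(4)] by (simp add: sylv_def V_def v2_def)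
 obtain W where W: "W \<in> Mat n" "V * W = 1\<^sub>m n" "W * V = 1\<^sub>m n" using sylv_inverse[OF c(5) sV] .
 define J where "J = W * v1"
 have J: "J \<in> Mat n" using W c by (simp add: J_def)
 have VJ: "V * J = v1"
 proof -
  have "V * J = (V * W) * v1" unfolding J_def using W(1) c by (simp add: as)
  then show ?thesis using W c by simp
 qed
 have JV: "J * V = v1"
 proof -
  have "J * V = W * (v1 * V)" unfolding J_def using W(1) c by (simp add: as)
  also have "\<dots> = W * (V * v1)" by (simp only: Vv)
  also have "\<dots> = (W * V) * v1" using W(1) c by (simp add: as)
  finally show ?thesis using W c by simp
 qed
 have vW: "v1 * W = W * v1"
 proof -
  have "v1 * W = (W * V) * (v1 * W)" using W c by simp
  also have "\<dots> = W * ((V * v1) * W)" using W(1) c by (simp add: as)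
  also have "\<dots> = W * ((v1 * V) * W)" by (simp only: Vv)
  also have "\<dots> = (W * v1) * (V * W)" using W(1) c by (simp add: as)
  finally show ?thesis using W c by simp
 qed
 have JJ: "J * J = 1\<^sub>m n"
 proof -
  have "J * J = W * ((v1 * W) * v1)" unfolding J_def using W(1) c by (simp add: as)
  also have "\<dots> = W * (W * (v1 * v1))" unfolding vW using W(1) c by (simp add: as)
  also have "\<dots> = W * ((W * V) * V)" unfolding p2 using W(1) c by (simp add: as)
  finally show ?thesis using W c by simp
 qed
 \<comment> \<open>Multiplying \<open>v1 * u1 * v1 = V * u1 * V\<close> by \<open>W\<close> on both
   sides gives u1 = J u1 J, and J is its own inverse. This is the use made of the third component of
   \<open>\<pi>\<close>.\<close>
 have uJ: "u1 * J = J * u1"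
 proof -
  have "W * (V * u1 * V) * W = u1"
  proof -
   have "W * (V * u1 * V) * W = (W * V) * (u1 * (V * W))" using W(1) c by (simp add: as)
   then show ?thesis using W c by simp
  qed
  moreover have "W * (V * u1 * V) * W = J * u1 * J"
  proof -
   have "W * (v1 * u1 * v1) * W = (W * v1) * (u1 * (v1 * W))" using W(1) c by (simp add: as)
   then show ?thesis unfolding p3[symmetric] vW using J c by (simp add: J_def[symmetric] as)
  qed
  ultimately have e: "u1 = J * u1 * J" by simp
  have "J * u1 = J * (J * u1 * J)" using e by simp
  also have "\<dots> = (J * J) * (u1 * J)" using J c by (simp add: as)
  finally show ?thesis using JJ J c by simp
 qed
 have vJ: "v1 * J = V"
 proof -
  have "v1 * J = V * (J * J)" unfolding VJ[symmetric] using J c by (simp add: as)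
  then show ?thesis using JJ c by simp
 qed
 have conv: "X * ?t = ?t * a" if "a \<in> Mat n" "X = conj_mat s a" for X a
 proof -
  have "X * ?t = ?t * (a * (s * ?t))" unfolding that(2) conj_mat_def using that(1) c by (simp add: as)
  then show ?thesis using sD that(1) by simp
 qed
 have w10: "w1 ! 0 = u1 + v1" "w1 ! 1 = u1 - v1"
  using arg_cong[OF mkw_uu_vv[OF w1(2)], of "\<lambda>x. x ! 0"] arg_cong[OF mkw_uu_vv[OF w1(2)], of "\<lambda>x. x ! 1"] by (simp_all add: mkw_def u1_def v1_def)
 have w20: "w2 ! 0 = u2 + v2" "w2 ! 1 = u2 - v2"
  using arg_cong[OF mkw_uu_vv[OF w2(2)], of "\<lambda>x. x ! 0"] arg_cong[OF mkw_uu_vv[OF w2(2)], of "\<lambda>x. x ! 1"] by (simp_all add: mkw_def u2_def v2_def)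
 have cP: "u1 + V = conj_mat s (w2 ! 0)" and cM: "u1 - V = conj_mat s (w2 ! 1)"
  unfolding w20 p1 V_def using c by (simp_all add: conj_mat_add[OF s] conj_mat_minus[OF s] v2_def[symmetric])
 have tP: "(u1 + V) * ?t = ?t * (w2 ! 0)" and tM: "(u1 - V) * ?t = ?t * (w2 ! 1)"
  using conv[OF _ cP] conv[OF _ cM] ptsD(2)[OF w2(2)] by simp_all
 \<comment> \<open>Twice the projections onto the eigenspaces of \<open>J\<close>. Since
   \<open>v1 = V * J\<close>, on the eigenspace for 1 the matrix \<open>v1\<close> acts as
   \<open>V\<close>, on the other one as \<open>-V\<close>; the latter is the second coordinate of
   the flip.\<close>
 define E F where "E = 1\<^sub>m n + J" and "F = 1\<^sub>m n - J"
 have EF: "E \<in> Mat n" "F \<in> Mat n" using J by (auto simp: E_def F_def)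
 have i1: "(u1 + v1) * E = E * (u1 + V)" "(u1 - v1) * E = E * (u1 - V)" "(u1 + v1) * F = F * (u1 - V)" "(u1 - v1) * F = F * (u1 + V)"
 proof -
  have P: "u1 + v1 \<in> Mat n" "u1 - v1 \<in> Mat n" "u1 + V \<in> Mat n" "u1 - V \<in> Mat n"
   using c by auto
  have m: "(u1 + v1) * E = (u1 + v1) + (J * u1 + V)" "(u1 - v1) * E = (u1 - v1) + (J * u1 - V)"
   "(u1 + v1) * F = (u1 + v1) - (J * u1 + V)" "(u1 - v1) * F = (u1 - v1) - (J * u1 - V)"
   unfolding E_def F_def mult_add_distrib_mat[OF P(1) one_carrier_mat J] mult_add_distrib_mat[OF P(2) one_carrier_mat J]
    mult_minus_distrib_mat[OF P(1) one_carrier_mat J] mult_minus_distrib_mat[OF P(2) one_carrier_mat J]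
    right_mult_one_mat[OF P(1)] right_mult_one_mat[OF P(2)] add_mult_distrib_mat[OF c(1,2) J] minus_mult_distrib_mat[OF c(1,2) J] uJ vJ
   by (rule refl)+
  have m': "E * (u1 + V) = (u1 + V) + (J * u1 + v1)" "E * (u1 - V) = (u1 - V) + (J * u1 - v1)"
   "F * (u1 - V) = (u1 - V) - (J * u1 - v1)" "F * (u1 + V) = (u1 + V) - (J * u1 + v1)"
   unfolding E_def F_def add_mult_distrib_mat[OF one_carrier_mat J P(3)] add_mult_distrib_mat[OF one_carrier_mat J P(4)]
    minus_mult_distrib_mat[OF one_carrier_mat J P(3)] minus_mult_distrib_mat[OF one_carrier_mat J P(4)]
    left_mult_one_mat[OF P(3)] left_mult_one_mat[OF P(4)] mult_add_distrib_mat[OF J c(1,5)] mult_minus_distrib_mat[OF J c(1,5)] JV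
   by (rule refl)+
  have Ju: "J * u1 \<in> Mat n" using J c by simp
  have g: "(a + b) + (d + e) = (a + e) + (d + b)" "(a - b) + (d - e) = (a - e) + (d - b)" "(a + b) - (d + e) = (a - e) - (d - b)" "(a - b) - (d - e) = (a + e) - (d + b)"
   if "a \<in> Mat n" "b \<in> Mat n" "d \<in> Mat n" "e \<in> Mat n" for a b d e :: "complex mat"
   using that by (auto intro!: eq_matI)
  show "(u1 + v1) * E = E * (u1 + V)" "(u1 - v1) * E = E * (u1 - V)" "(u1 + v1) * F = F * (u1 - V)" "(u1 - v1) * F = F * (u1 + V)"
   unfolding m m' using g[OF c(1) c(2) Ju c(5)] by auto
 qed
 have fl: "flip w2 \<in> S" using w2S sym by (simp add: symmetric_set_def)
 have flp: "flip w2 \<in> pts 2 n" using w2 by simp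
 \<comment> \<open>\<open>w2\<close> and its flip have the same image under \<open>\<pi>\<close>, so
   the closure assumption on \<open>S\<close> applies to both.\<close>
 have d1: "point_dsum w1 w \<in> S \<and> point_dsum w w1 \<in> S" if "w \<in> S" "w \<in> pts 2 n" "pi_map w = pi_map w2" for w
 proof -
  have "similar_points (pi_map w1) (pi_map w)"
   unfolding similar_points_def using pi that(3) s pi_map_mlevel[OF that(2)] by auto
  then have "point_dsum w1 w \<in> S" by (rule closed[OF w1(1) that(1)])
  then show ?thesis using S_summands[OF pts_nc_space[OF w1(2,3)] pts_nc_space[OF that(2) w1(3)]] by simp
 qed
 have d2: "(0::nat) < 2" by simp
 note fc1 = conditionally_nc_graded[OF f w1(1,2) d2] and fc2 = conditionally_nc_graded[OF f w2S w2(2) d2]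
 have I1: "f w1 * (E * ?t) = (E * ?t) * f w2"
 proof (rule conditionally_nc_intertwine[OF f d2 w1(1) w2S _ _ w1(2) w2(2)])
  show "point_dsum w1 w2 \<in> S" "point_dsum w2 w1 \<in> S" using d1[OF w2S w2(2) refl] by auto
  show "E * ?t \<in> Mat n" using EF c by simp
  fix i :: nat assume "i < 2"
  then consider "i = 0" | "i = 1" by linarith
  then show "w1 ! i * (E * ?t) = E * ?t * w2 ! i"
  proof cases
   case 1
   have "(u1 + v1) * (E * ?t) = E * ((u1 + V) * ?t)" using i1(1) EF c by (simp add: as[symmetric])
   then show ?thesis unfolding 1 w10 tP using EF c ptsD(2)[OF w2(2), of 0] by (simp add: as)
  next
   case 2
   have "(u1 - v1) * (E * ?t) = E * ((u1 - V) * ?t)" using i1(2) EF c by (simp add: as[symmetric])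
   then show ?thesis unfolding 2 w10 tM using EF c ptsD(2)[OF w2(2), of 1] by (simp add: as)
  qed
 qed
 have I2: "f w1 * (F * ?t) = (F * ?t) * f (flip w2)"
 proof (rule conditionally_nc_intertwine[OF f d2 w1(1) fl _ _ w1(2) flp])
  show "point_dsum w1 (flip w2) \<in> S" "point_dsum (flip w2) w1 \<in> S" using d1[OF fl flp pi_map_flip[OF w2(2)]] by auto
  show "F * ?t \<in> Mat n" using EF c by simp
  have fn: "flip w2 ! 0 = w2 ! 1" "flip w2 ! 1 = w2 ! 0" by (simp_all add: flip_def)
  fix i :: nat assume "i < 2"
  then consider "i = 0" | "i = 1" by linarith
  then show "w1 ! i * (F * ?t) = F * ?t * flip w2 ! i"
  proof cases
   case 1
   have "(u1 + v1) * (F * ?t) = F * ((u1 - V) * ?t)" using i1(3) EF c by (simp add: as[symmetric])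
   then show ?thesis unfolding 1 w10 tM fn using EF c ptsD(2)[OF w2(2), of 1] by (simp add: as)
  next
   case 2
   have "(u1 - v1) * (F * ?t) = F * ((u1 + V) * ?t)" using i1(4) EF c by (simp add: as[symmetric])
   then show ?thesis unfolding 2 w10 tP fn using EF c ptsD(2)[OF w2(2), of 0] by (simp add: as)
  qed
 qed
 have cT: "E * ?t \<in> Mat n" "F * ?t \<in> Mat n" using EF c by auto
 \<comment> \<open>The two intertwining relations can be added because \<open>f\<close> has the same
   value at \<open>w2\<close> and at its flip; in the sum \<open>J\<close> drops out.\<close>
 have sum: "E * ?t + F * ?t = 2 \<cdot>\<^sub>m ?t"
 proof -
  have "E * ?t + F * ?t = (E + F) * ?t" by (rule add_mult_distrib_mat[OF EF(1,2) c(6), symmetric])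
  also have "E + F = 2 \<cdot>\<^sub>m 1\<^sub>m n" unfolding E_def F_def using J by (intro eq_matI) auto
  also have "(2 \<cdot>\<^sub>m 1\<^sub>m n) * ?t = 2 \<cdot>\<^sub>m ?t" using mult_smult_assoc_mat[OF one_carrier_mat c(6), of 2] left_mult_one_mat[OF c(6)] by simp
  finally show ?thesis .
 qed
 have "f w1 * (E * ?t) + f w1 * (F * ?t) = (E * ?t) * f w2 + (F * ?t) * f w2" using I1 I2 ff[OF w2S] by simp
 then have "f w1 * (2 \<cdot>\<^sub>m ?t) = (2 \<cdot>\<^sub>m ?t) * f w2"
  using mult_add_distrib_mat[OF fc1 cT] add_mult_distrib_mat[OF cT fc2] sum by simp
 then have "2 \<cdot>\<^sub>m (f w1 * ?t) = 2 \<cdot>\<^sub>m (?t * f w2)"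
  using mult_smult_distrib[OF fc1 c(6)] mult_smult_assoc_mat[OF c(6) fc2] by simp
 moreover have "(1/2) \<cdot>\<^sub>m (2 \<cdot>\<^sub>m A) = A" for A :: "complex mat" by (intro eq_matI) auto
 ultimately have e: "f w1 * ?t = ?t * f w2" by metis
 have "f w1 = f w1 * (?t * s)" using sD fc1 by simp
 also have "\<dots> = (f w1 * ?t) * s" using fc1 c by (simp add: as)
 finally show ?thesis unfolding e conj_mat_def .
qed

abbreviation "Go \<equiv> G_o r q S"

lemma Go_image: "Go = pi_map ` So" by (simp add: G_o_def)

text \<open>\<open>SOME\<close> picks an arbitrary preimage in S_o. For a symmetric conditionally nc
  \<open>f\<close> the choice does not matter, by \<open>descent\<close> with the identity as
  similarity.\<close>

definition push :: "(nc_point => complex mat) => nc_point => complex mat" where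
 "push f X = (if X \<in> Go then f (SOME w. w \<in> So \<and> pi_map w = X) else undefined)"

context
 fixes f assumes f: "conditionally_nc 2 S f" and ff: "\<And>w. w \<in> S ==> f (flip w) = f w"
begin

text \<open>\<open>w\<close> itself may lie outside S_o: a free neighbourhood contains such points,
  and their images can still belong to G_o. The local bound along \<open>\<pi>\<close> has to cover
  them. In \<open>descent\<close> only the other point is required to be in S_o.\<close>

lemma push_eq:
 assumes w: "w \<in> S" "pi_map w \<in> Go"
 shows "push f (pi_map w) = f w"
proof -
 obtain n where n: "w \<in> pts 2 n" "n \<ge> 1" using S_level w by blast
 define w' where "w' = (SOME w'. w' \<in> So \<and> pi_map w' = pi_map w)"
 have "\<exists>w'. w' \<in> So \<and> pi_map w' = pi_map w" using w(2) unfolding Go_image by (auto simp: image_iff)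
 then have w': "w' \<in> So \<and> pi_map w' = pi_map w" unfolding w'_def by (rule someI_ex)
 obtain m where m: "w' \<in> pts 2 m" "m \<ge> 1" using S_level w' So_sub by blast
 have "m = n" using w' pi_map_mlevel[OF n(1)] pi_map_mlevel[OF m(1)] by simp
 then have w'n: "w' \<in> pts 2 n" using m by simp
 have "pi_map w = conj_point (1\<^sub>m n) (pi_map w')"
 proof -
  have "conj_point (1\<^sub>m n) (pi_map w) = pi_map w"
   using pi_map_pts[OF n(1)] by (intro point_eqI[of _ 3 n _ n]) (auto simp: GL_one nth_conj[OF ptsD(1)] conj_mat_by_one ptsD(2))
  then show ?thesis using w' by simp
 qed
 from descent[OF f ff w(1) n _ w'n GL_one(1) this] w' have "f w = conj_mat (1\<^sub>m n) (f w')" by blast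
 also have "\<dots> = f w'" using conj_mat_by_one[OF conditionally_nc_graded[OF f _ w'n]] w' So_sub by auto
 finally show ?thesis unfolding push_def w'_def using w(2) by simp
qed

lemma push_So: "w \<in> So ==> push f (pi_map w) = f w"
 using push_eq[of w] So_sub by (auto simp: Go_image)

text \<open>The matrix \<open>vv Z\<close> is a polynomial in its square, and the square is block
  diagonal because it is a component of the image. Hence \<open>vv Z\<close> is block diagonal too,
  and \<open>Z\<close> splits as a direct sum of points lying over the two summands.\<close>

lemma Go_summand:
 assumes w: "w \<in> So" and Y: "Y \<in> nc_space 3" and XY: "point_dsum (pi_map w) Y \<in> Go"
 obtains w1 w2 where "w1 \<in> So" "w2 \<in> So" "point_dsum w1 w2 \<in> So" "point_dsum w2 w1 \<in> So" "pi_map w1 = pi_map w" "pi_map w2 = Y"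
  "point_dsum (pi_map w) Y = pi_map (point_dsum w1 w2)"
proof -
 obtain n where n: "w \<in> pts 2 n" "n \<ge> 1" using S_level w So_sub by blast
 obtain m where m: "Y \<in> pts 3 m" "m \<ge> 1" using Y by (auto simp: nc_space_pts)
 obtain Z where Z: "Z \<in> So" "point_dsum (pi_map w) Y = pi_map Z" using XY unfolding Go_image by blast
 obtain k where k: "Z \<in> pts 2 k" "k \<ge> 1" using S_level Z So_sub by blast
 have "mlevel (point_dsum (pi_map w) Y) = n + m" by (rule pts_mlevel[OF pts_dsum[OF pi_map_pts[OF n(1)] m(1)]]) simp
 then have kn: "k = n + m" using Z(2) pi_map_mlevel[OF k(1)] by simp
 note Xc = ptsD(2)[OF pi_map_pts[OF n(1)]] and Yc = ptsD(2)[OF m(1)]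
 have pZ: "pi_map Z ! i = mat_dsum (pi_map w ! i) (Y ! i)" if "i < 3" for i
  using nth_dsum[OF ptsD(1)[OF pi_map_pts[OF n(1)]] ptsD(1)[OF m(1)] that] Z(2) by simp
 have U: "uu Z = mat_dsum (pi_map w ! 0) (Y ! 0)" and VV: "vv Z * vv Z = mat_dsum (pi_map w ! 1) (Y ! 1)"
  using pZ[of 0] pZ[of 1] unfolding pi_map_uu_vv[OF k(1)] by simp_all
 obtain p where p: "vv Z = pm p (vv Z * vv Z)" using root_pm[OF uu_vv_carrier(2)[OF k(1)]] Z(1) So_iff by blast
 define v1 v2 where "v1 = pm p (pi_map w ! 1)" and "v2 = pm p (Y ! 1)"
 have vc: "v1 \<in> Mat n" "v2 \<in> Mat m" using Xc[of 1] Yc[of 1] by (auto simp: v1_def v2_def)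
 have V: "vv Z = mat_dsum v1 v2"
  using p unfolding VV v1_def v2_def using pm_dsum[OF Xc[of 1] Yc[of 1]] by simp
 define w1 w2 where "w1 = mkw (pi_map w ! 0) v1" and "w2 = mkw (Y ! 0) v2"
 have w1: "w1 \<in> pts 2 n" and w2: "w2 \<in> pts 2 m" using vc Xc[of 0] Yc[of 0] by (auto simp: w1_def w2_def)
 have "uu w1 = pi_map w ! 0" "vv w1 = v1" "uu w2 = Y ! 0" "vv w2 = v2"
  using uu_vv_mkw[OF _ vc(1)] uu_vv_mkw[OF _ vc(2)] Xc[of 0] Yc[of 0] by (auto simp: w1_def w2_def)
 then have Ze: "Z = point_dsum w1 w2"
  using uu_vv_dsum[OF w1 w2] U V k(1) kn by (intro pts2_uu_vv_eqI[of _ "n + m"]) (auto simp: w1 w2)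
 have inS: "w1 \<in> So" "w2 \<in> So" "point_dsum w2 w1 \<in> So"
  using So_summands[OF pts_nc_space[OF w1 n(2)] pts_nc_space[OF w2 m(2)]] Z(1) Ze by auto
 have e: "point_dsum (pi_map w1) (pi_map w2) = point_dsum (pi_map w) Y" using pi_map_dsum[OF w1 w2] Z(2) Ze by simp
 note q1 = pi_map_pts[OF w1] and q2 = pi_map_pts[OF w2]
 have ei: "pi_map w1 ! i = pi_map w ! i \<and> pi_map w2 ! i = Y ! i" if i: "i < 3" for i
 proof -
  have "mat_dsum (pi_map w1 ! i) (pi_map w2 ! i) = mat_dsum (pi_map w ! i) (Y ! i)"
   using arg_cong[OF e, of "\<lambda>x. x ! i"] nth_dsum[OF ptsD(1)[OF q1] ptsD(1)[OF q2] i]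
    nth_dsum[OF ptsD(1)[OF pi_map_pts[OF n(1)]] ptsD(1)[OF m(1)] i] by simp
  from mat_dsum_inj[OF this ptsD(2)[OF q1 i] ptsD(2)[OF q2 i] Xc[OF i] Yc[OF i]] show ?thesis by simp
 qed
 have "pi_map w1 = pi_map w" by (rule point_eqI[OF q1 pi_map_pts[OF n(1)]]) (use ei in auto)
 moreover have "pi_map w2 = Y" by (rule point_eqI[OF q2 m(1)]) (use ei in auto)
 ultimately show ?thesis using that[of w1 w2] inS Z Ze by simp
qed

lemma push_conditionally_nc: "conditionally_nc 3 Go (push f)"
proof (rule conditionally_nc_I)
 show sub: "Go \<subseteq> nc_space 3" unfolding Go_image using pi_map_nc_space So_sub S_sub by blast
 show "graded Go (push f)" unfolding graded_def Go_image
 proof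
  fix X assume "X \<in> pi_map ` So"
  then obtain w where w: "w \<in> So" "X = pi_map w" by blast
  obtain n where n: "w \<in> pts 2 n" "n \<ge> 1" using S_level w So_sub by blast
  have "w \<in> S" using w So_sub by blast
  from conditionally_nc_graded[OF f this n(1)] show "push f X \<in> carrier_mat (mlevel X) (mlevel X)"
   using push_So[OF w(1)] w(2) pi_map_mlevel[OF n(1)] by simp
 qed
 show "preserves_similarity Go (push f)" unfolding preserves_similarity_def
 proof (intro ballI impI)
  fix X s assume X: "X \<in> Go" and s: "s \<in> GL (mlevel X)" and c: "conj_point s X \<in> Go"
  obtain w where w: "w \<in> So" "X = pi_map w" using X unfolding Go_image by blast
  obtain w' where w': "w' \<in> So" "conj_point s X = pi_map w'" using c unfolding Go_image by blast
  obtain n where n: "w \<in> pts 2 n" "n \<ge> 1" using S_level w So_sub by blast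
  obtain m where m: "w' \<in> pts 2 m" "m \<ge> 1" using S_level w' So_sub by blast
  have sn: "s \<in> GL n" using s w(2) pi_map_mlevel[OF n(1)] by simp
  have "mlevel (conj_point s X) = n" using pts_conj[OF pi_map_pts[OF n(1)] sn] w(2) pts_mlevel[of "conj_point s X" 3 n] by simp
  then have "m = n" using w'(2) pi_map_mlevel[OF m(1)] by simp
  then have m: "w' \<in> pts 2 n" using m by simp
  have "w' \<in> S" using w' So_sub by blast
  from descent[OF f ff this m n(2) w(1) n(1) sn] w(2) w'(2) have "f w' = conj_mat s (f w)" by simp
  then show "push f (conj_point s X) = conj_mat s (push f X)" using push_So[OF w(1)] push_So[OF w'(1)] w(2) w'(2) by simp
 qed
 fix X Y assume X: "X \<in> Go" and Y: "Y \<in> nc_space 3" and XY: "point_dsum X Y \<in> Go"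
 obtain w where w: "w \<in> So" "X = pi_map w" using X unfolding Go_image by blast
 obtain w1 w2 where *: "w1 \<in> So" "w2 \<in> So" "point_dsum w1 w2 \<in> So" "point_dsum w2 w1 \<in> So" "pi_map w1 = pi_map w" "pi_map w2 = Y"
  "point_dsum (pi_map w) Y = pi_map (point_dsum w1 w2)" using Go_summand[OF w(1) Y] XY w(2) by blast
 have "f (point_dsum w1 w2) = mat_dsum (f w1) (f w2)"
  using * So_sub by (intro conditionally_nc_dsum[OF f]) auto
 then have "push f (point_dsum X Y) = mat_dsum (push f X) (push f Y)"
  using push_So[OF *(1)] push_So[OF *(2)] push_So[OF *(3)] *(5-7) w(2) by simp
 then show "Y \<in> Go \<and> push f (point_dsum X Y) = mat_dsum (push f X) (push f Y)" using *(2,6) unfolding Go_image by blast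
qed

lemma push_bounded:
 assumes bdd: "freely_locally_bounded_on 2 S S f"
 shows "bounded_along_pi S Go (push f)"
 unfolding bounded_along_pi_def
proof
 fix w assume w: "w \<in> S"
 obtain V C where V: "openin (free_topology 2) V" "w \<in> V" and C: "\<forall>x\<in>V \<inter> S. op_norm (f x) \<le> C"
  using bdd w unfolding freely_locally_bounded_on_def bounded_values_on_def by blast
 have "bounded_values_on (pi_map ` (V \<inter> S) \<inter> Go) (push f)" unfolding bounded_values_on_def
 proof (intro exI[of _ C] ballI)
  fix X assume "X \<in> pi_map ` (V \<inter> S) \<inter> Go"
  then obtain w' where w': "w' \<in> V \<inter> S" "X = pi_map w'" "pi_map w' \<in> Go" by blast
  then show "op_norm (push f X) \<le> C" using push_eq[of w'] C by auto
 qed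
 then show "\<exists>U. openin (free_topology 2) U \<and> w \<in> U \<and> bounded_values_on (pi_map ` U \<inter> Go) (push f)"
  using V w S_open by (intro exI[of _ "V \<inter> S"]) auto
qed

end

end

section \<open>Extension from \<open>S_oo\<close> to \<open>S_o\<close>\<close>

lemma freely_locally_bounded_on_cong:
 assumes "freely_locally_bounded_on d S A f" "A' \<subseteq> A" "\<And>w. w \<in> A' ==> f' w = f w"
 shows "freely_locally_bounded_on d S A' f'"
 unfolding freely_locally_bounded_on_def
proof
 fix w assume "w \<in> S"
 then obtain V C where V: "openin (free_topology d) V" "w \<in> V" and C: "\<forall>x\<in>V \<inter> A. op_norm (f x) \<le> C"
  using assms(1) unfolding freely_locally_bounded_on_def bounded_values_on_def by blast
 have "op_norm (f' x) \<le> C" if x: "x \<in> V \<inter> A'" for x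
 proof -
  have "x \<in> V \<inter> A" using x assms(2) by auto
  then show ?thesis using C assms(3)[of x] x by simp
 qed
 then have "bounded_values_on (V \<inter> A') f'" unfolding bounded_values_on_def by blast
 then show "\<exists>V. openin (free_topology d) V \<and> w \<in> V \<and> bounded_values_on (V \<inter> A') f'" using V by (intro exI[of _ V] conjI)
qed

lemma conj_dsum:
 assumes "s \<in> GL n" "t \<in> GL m" "A \<in> Mat n" "B \<in> Mat m"
 shows "conj_mat (mat_dsum s t) (mat_dsum A B) = mat_dsum (conj_mat s A) (conj_mat t B)"
 using GL_D[OF assms(1)] GL_D[OF assms(2)] assms(3,4) unfolding conj_mat_def GL_dsum(2)[OF assms(1,2)]
 by (simp add: mat_dsum_mult[of _ n _ m])

section \<open>Noncommutation with the matrices I_tau\<close>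

context sqrt_branches
begin

definition nonc :: "complex set => complex mat => complex mat => bool" where
 "nonc \<gamma> u x \<longleftrightarrow> (\<forall>\<tau>\<in>signs \<gamma>. \<not> \<tau> constant_on \<gamma> --> u * I_fun r \<gamma> \<tau> x \<noteq> I_fun r \<gamma> \<tau> x * u)"

lemma U_dom_nonc: "p \<in> U_dom r \<gamma> \<longleftrightarrow> p \<in> W_dom r \<gamma> \<and> nonc \<gamma> (p ! 0) (p ! 1)"
 by (simp add: U_dom_def nonc_def)

lemma I_fun_carrier [simp]: "x \<in> Mat n ==> I_fun r \<gamma> \<tau> x \<in> Mat n"
 by (simp add: I_fun_def)

lemma
 assumes "\<gamma> \<in> Gamma" "x \<in> Mat n" "y \<in> Mat m" "spectrum x \<subseteq> Delta r \<gamma>" "spectrum y \<subseteq> Delta r \<gamma>"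
 shows I_fun_dsum: "I_fun r \<gamma> \<tau> (mat_dsum x y) = mat_dsum (I_fun r \<gamma> \<tau> x) (I_fun r \<gamma> \<tau> y)"
  and S_fun_dsum: "S_fun r q \<gamma> \<tau> (mat_dsum x y) = mat_dsum (S_fun r q \<gamma> \<tau> x) (S_fun r q \<gamma> \<tau> y)"
 unfolding I_fun_def S_fun_def
 using hc_dsum[OF assms(2,3) open_Delta[OF assms(1)] assms(4,5)] iota_holomorphic[OF assms(1)] root_holomorphic[OF assms(1)] by blast+

lemma
 assumes "\<gamma> \<in> Gamma" "x \<in> Mat n" "s \<in> GL n" "spectrum x \<subseteq> Delta r \<gamma>"
 shows I_fun_conj: "I_fun r \<gamma> \<tau> (conj_mat s x) = conj_mat s (I_fun r \<gamma> \<tau> x)"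
  and S_fun_conj: "S_fun r q \<gamma> \<tau> (conj_mat s x) = conj_mat s (S_fun r q \<gamma> \<tau> x)"
 unfolding I_fun_def S_fun_def
 using hc_conj[OF assms(2,3) open_Delta[OF assms(1)] assms(4)] iota_holomorphic[OF assms(1)] root_holomorphic[OF assms(1)] by blast+

lemma nonc_conj:
 assumes g: "\<gamma> \<in> Gamma" and x: "x \<in> Mat n" and u: "u \<in> Mat n" and s: "s \<in> GL n" and sp: "spectrum x \<subseteq> Delta r \<gamma>"
  and nc: "nonc \<gamma> u x"
 shows "nonc \<gamma> (conj_mat s u) (conj_mat s x)"
 unfolding nonc_def
proof (intro ballI impI notI)
 fix \<tau> assume t: "\<tau> \<in> signs \<gamma>" "\<not> \<tau> constant_on \<gamma>"
  and e: "conj_mat s u * I_fun r \<gamma> \<tau> (conj_mat s x) = I_fun r \<gamma> \<tau> (conj_mat s x) * conj_mat s u"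
 have I: "I_fun r \<gamma> \<tau> x \<in> Mat n" using x by simp
 have "conj_mat s (u * I_fun r \<gamma> \<tau> x) = conj_mat s (I_fun r \<gamma> \<tau> x * u)"
  using e unfolding I_fun_conj[OF g x s sp] conj_mat_mult[OF s u I] conj_mat_mult[OF s I u] .
 then have "u * I_fun r \<gamma> \<tau> x = I_fun r \<gamma> \<tau> x * u"
  by (rule conj_mat_inj[OF s mult_carrier_mat[OF u I] mult_carrier_mat[OF I u]])
 then show False using nc t unfolding nonc_def by blast
qed

text \<open>Both factors of the commutator are block diagonal, so a single nonzero block is enough.
  This requires the same \<open>\<gamma>\<close> for both summands.\<close>

lemma nonc_dsum:
 assumes g: "\<gamma> \<in> Gamma" and x: "x \<in> Mat n" "u \<in> Mat n" and y: "y \<in> Mat m" "v \<in> Mat m"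
  and sp: "spectrum x \<subseteq> Delta r \<gamma>" "spectrum y \<subseteq> Delta r \<gamma>" and nc: "nonc \<gamma> u x \<or> nonc \<gamma> v y"
 shows "nonc \<gamma> (mat_dsum u v) (mat_dsum x y)"
 unfolding nonc_def
proof (intro ballI impI notI)
 fix \<tau> assume t: "\<tau> \<in> signs \<gamma>" "\<not> \<tau> constant_on \<gamma>"
  and e: "mat_dsum u v * I_fun r \<gamma> \<tau> (mat_dsum x y) = I_fun r \<gamma> \<tau> (mat_dsum x y) * mat_dsum u v"
 have I: "I_fun r \<gamma> \<tau> x \<in> Mat n" "I_fun r \<gamma> \<tau> y \<in> Mat m" using x y by auto
 have e': "mat_dsum (u * I_fun r \<gamma> \<tau> x) (v * I_fun r \<gamma> \<tau> y) = mat_dsum (I_fun r \<gamma> \<tau> x * u) (I_fun r \<gamma> \<tau> y * v)"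
  using e unfolding I_fun_dsum[OF g x(1) y(1) sp] mat_dsum_mult[OF x(2) y(2) I] mat_dsum_mult[OF I x(2) y(2)] .
 have "u * I_fun r \<gamma> \<tau> x = I_fun r \<gamma> \<tau> x * u" "v * I_fun r \<gamma> \<tau> y = I_fun r \<gamma> \<tau> y * v"
  using mat_dsum_inj[OF e' mult_carrier_mat[OF x(2) I(1)] mult_carrier_mat[OF y(2) I(2)] mult_carrier_mat[OF I(1) x(2)] mult_carrier_mat[OF I(2) y(2)]] by auto
 then show False using nc t unfolding nonc_def by blast
qed

text \<open>Reversing all signs gives another member of \<open>signs \<gamma>\<close>. For this
  reason S_oo is invariant under the flip, which changes the sign of v and keeps v^2.\<close>

lemma S_fun_uminus:
 assumes g: "\<gamma> \<in> Gamma" and t: "\<tau> \<in> signs \<gamma>" and x: "x \<in> Mat n" "spectrum x \<subseteq> Delta r \<gamma>"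
 shows "\<exists>\<tau>'\<in>signs \<gamma>. S_fun r q \<gamma> \<tau>' x = - S_fun r q \<gamma> \<tau> x"
proof -
 interpret hc_setting x n "Delta r \<gamma>" using x open_Delta[OF g] by unfold_locales
 define \<tau>' where "\<tau>' = (\<lambda>c\<in>\<gamma>. - \<tau> c)"
 have t': "\<tau>' \<in> signs \<gamma>" unfolding signs_def
 proof (rule PiE_I)
  fix c assume c: "c \<in> \<gamma>"
  then show "\<tau>' c \<in> {-1, 1}" using signs_sq[OF t c] by (auto simp: \<tau>'_def)
 qed (simp add: \<tau>'_def)
 have "hol_calculus (root \<gamma> \<tau>') x = hol_calculus (\<lambda>z. (-1) * root \<gamma> \<tau> z) x"
 proof (rule hc_cong)
  fix z assume "z \<in> Delta r \<gamma>"
  then obtain c where c: "c \<in> \<gamma>" "cmod (z - c) < r \<gamma>" by (auto simp: Delta_def)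
  show "root \<gamma> \<tau>' z = (-1) * root \<gamma> \<tau> z" unfolding iota_eq[OF g c] using c by (simp add: \<tau>'_def)
 qed
 also have "\<dots> = (-1) \<cdot>\<^sub>m hol_calculus (root \<gamma> \<tau>) x" by (rule hc_scale[OF root_holomorphic[OF g]])
 also have "\<dots> = - hol_calculus (root \<gamma> \<tau>) x" by (intro eq_matI) auto
 finally show ?thesis using t' unfolding S_fun_def by blast
qed

text \<open>Each entry of the commutator is affine in \<open>t\<close>. By assumption one of them is
  not identically 0, so it has at most one zero.\<close>

lemma commuting_line:
 assumes A: "A \<in> Mat n" and B: "B \<in> Mat n" and I: "I \<in> Mat n" and ne: "A * I \<noteq> I * A \<or> B * I \<noteq> I * B"
 shows "finite {t::complex. (A + t \<cdot>\<^sub>m B) * I = I * (A + t \<cdot>\<^sub>m B)}"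
proof -
 have c: "A * I \<in> Mat n" "I * A \<in> Mat n" "B * I \<in> Mat n" "I * B \<in> Mat n" using A B I by auto
 have ent: "\<exists>i j. i < n \<and> j < n \<and> X $$ (i, j) \<noteq> Y $$ (i, j)" if "X \<noteq> Y" "X \<in> Mat n" "Y \<in> Mat n" for X Y :: "complex mat"
  using that by (metis carrier_matD eq_matI)
 obtain i j where ij: "i < n" "j < n" and d: "(A * I) $$ (i, j) \<noteq> (I * A) $$ (i, j) \<or> (B * I) $$ (i, j) \<noteq> (I * B) $$ (i, j)"
  using ne ent[OF _ c(1,2)] ent[OF _ c(3,4)] by blast
 let ?a = "(A * I) $$ (i, j) - (I * A) $$ (i, j)" and ?b = "(B * I) $$ (i, j) - (I * B) $$ (i, j)"
 have "?a + t * ?b = 0" if e: "(A + t \<cdot>\<^sub>m B) * I = I * (A + t \<cdot>\<^sub>m B)" for t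
 proof -
  have tB: "t \<cdot>\<^sub>m B \<in> Mat n" using B by simp
  have "(A * I + t \<cdot>\<^sub>m (B * I)) $$ (i, j) = (I * A + t \<cdot>\<^sub>m (I * B)) $$ (i, j)"
   using e unfolding add_mult_distrib_mat[OF A tB I] mult_smult_assoc_mat[OF B I] mult_add_distrib_mat[OF I A tB] mult_smult_distrib[OF I B] by simp
  then show ?thesis using ij carrier_matD[OF c(3)] carrier_matD[OF c(4)] by (simp add: algebra_simps del: index_mult_mat(1))
 qed
 then have "{t. (A + t \<cdot>\<^sub>m B) * I = I * (A + t \<cdot>\<^sub>m B)} \<subseteq> {t. poly [:?a, ?b:] t = 0}" by auto
 moreover have "[:?a, ?b:] \<noteq> 0" using d by auto
 ultimately show ?thesis by (rule finite_subset[OF _ poly_roots_finite])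
qed

text \<open>There are finitely many sign functions and each rules out finitely many
  \<open>t\<close>, so a small punctured disc about 0 avoids all of them.\<close>

lemma nonc_perturb:
 assumes x: "x \<in> Mat n" and u: "u \<in> Mat n" and k: "k \<in> Mat n" and g: "finite \<gamma>" and nk: "nonc \<gamma> k x"
 shows "\<exists>\<delta>>0. \<forall>t. t \<noteq> 0 --> cmod t < \<delta> --> nonc \<gamma> (u + t \<cdot>\<^sub>m k) x"
proof -
 let ?B = "\<lambda>\<tau>. {t. (u + t \<cdot>\<^sub>m k) * I_fun r \<gamma> \<tau> x = I_fun r \<gamma> \<tau> x * (u + t \<cdot>\<^sub>m k)}"
 let ?T = "{\<tau> \<in> signs \<gamma>. \<not> \<tau> constant_on \<gamma>}"
 have "finite (signs \<gamma>)" unfolding signs_def using g by (intro finite_PiE) auto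
 moreover have "finite (?B \<tau>)" if "\<tau> \<in> ?T" for \<tau>
  using nk that unfolding nonc_def by (intro commuting_line[OF u k I_fun_carrier[OF x]]) blast
 ultimately have "finite (\<Union>\<tau>\<in>?T. ?B \<tau>)" by (intro finite_UN_I) auto
 then obtain d where d: "d > 0" "\<forall>t\<in>(\<Union>\<tau>\<in>?T. ?B \<tau>). t \<noteq> 0 --> d \<le> dist 0 t" using finite_set_avoid[of _ "0::complex"] by blast
 show ?thesis unfolding nonc_def
 proof (intro exI[of _ d] conjI d(1) allI impI ballI notI)
  fix t :: complex and \<tau>
  assume t: "t \<noteq> 0" "cmod t < d" and \<tau>: "\<tau> \<in> signs \<gamma>" "\<not> \<tau> constant_on \<gamma>"
   and "(u + t \<cdot>\<^sub>m k) * I_fun r \<gamma> \<tau> x = I_fun r \<gamma> \<tau> x * (u + t \<cdot>\<^sub>m k)"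
  then have "t \<in> (\<Union>\<tau>\<in>?T. ?B \<tau>)" by (intro UN_I[of \<tau>]) simp_all
  from bspec[OF d(2) this] show False using t by simp
 qed
qed

text \<open>A rank-one matrix that maps an eigenvector to one of a different eigenvalue does not commute
 with \<open>I\<close>; a generic combination of such matrices serves all nonscalar \<open>I\<^sub>\<tau>(x)\<close> at once.\<close>

lemma nonc_exists:
 assumes x: "x \<in> Mat n" and G: "spectrum x \<in> Gamma"
 shows "\<exists>k\<in>Mat n. nonc (spectrum x) k x"
proof -
 let ?\<gamma> = "spectrum x" and ?I = "\<lambda>\<tau>. I_fun r (spectrum x) \<tau> x"
 have sp: "?\<gamma> \<subseteq> Delta r ?\<gamma>" using center_Delta[OF G] by blast
 interpret hc_setting x n "Delta r ?\<gamma>" using x open_Delta[OF G] sp by unfold_locales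
 have I: "?I \<tau> \<in> Mat n" for \<tau> using x by simp
 have Iy: "?I \<tau> *\<^sub>v y = \<tau> c \<cdot>\<^sub>v y" if "c \<in> ?\<gamma>" "y \<in> carrier_vec n" "y \<noteq> 0\<^sub>v n" "x *\<^sub>v y = c \<cdot>\<^sub>v y" for c y \<tau>
  unfolding I_fun_def using hc_eigvec[OF iota_holomorphic[OF G, of \<tau>] that(2-4)] iota_eq[OF G that(1), of c] Gamma_facts(2)[OF G] by simp
 have one: "\<exists>k\<in>Mat n. k * ?I \<tau> \<noteq> ?I \<tau> * k" if t: "\<not> \<tau> constant_on ?\<gamma>" for \<tau>
 proof -
  obtain c d where cd: "c \<in> ?\<gamma>" "d \<in> ?\<gamma>" "\<tau> c \<noteq> \<tau> d" using t unfolding constant_on_def by metis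
  obtain y where y: "y \<in> carrier_vec n" "y \<noteq> 0\<^sub>v n" "x *\<^sub>v y = c \<cdot>\<^sub>v y" using spectrum_eigenvector[OF x cd(1)] .
  obtain z where z: "z \<in> carrier_vec n" "z \<noteq> 0\<^sub>v n" "x *\<^sub>v z = d \<cdot>\<^sub>v z" using spectrum_eigenvector[OF x cd(2)] .
  obtain j where j: "j < n" "vec_index y j \<noteq> 0" using y(1,2) by (metis carrier_vecD eq_vecI index_zero_vec(1) index_zero_vec(2))
  obtain i where i: "i < n" "vec_index z i \<noteq> 0" using z(1,2) by (metis carrier_vecD eq_vecI index_zero_vec(1) index_zero_vec(2))
  define k where "k = Matrix.mat n n (\<lambda>(i, l). if l = j then vec_index z i else 0)"
  have k: "k \<in> Mat n" by (simp add: k_def)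
  have ky: "k *\<^sub>v v = vec_index v j \<cdot>\<^sub>v z" if v: "v \<in> carrier_vec n" for v
  proof (rule eq_vecI)
   fix i assume "i < dim_vec (vec_index v j \<cdot>\<^sub>v z)"
   then have i: "i < n" using z by simp
   have "vec_index (k *\<^sub>v v) i = (\<Sum>l<n. k $$ (i, l) * vec_index v l)"
    using k v i by (auto simp: scalar_prod_def atLeast0LessThan intro!: sum.cong)
   also have "\<dots> = (\<Sum>l\<in>{j}. k $$ (i, l) * vec_index v l)" using j i by (intro sum.mono_neutral_right) (auto simp: k_def)
   finally show "vec_index (k *\<^sub>v v) i = vec_index (vec_index v j \<cdot>\<^sub>v z) i" using i j z by (simp add: k_def)
  qed (use k z in auto)
  have "k * ?I \<tau> \<noteq> ?I \<tau> * k"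
  proof
   assume "k * ?I \<tau> = ?I \<tau> * k"
   then have e: "k *\<^sub>v (?I \<tau> *\<^sub>v y) = ?I \<tau> *\<^sub>v (k *\<^sub>v y)" using assoc_mult_mat_vec[OF I[of \<tau>] k y(1)] assoc_mult_mat_vec[OF k I[of \<tau>] y(1)] by metis
   have "?I \<tau> *\<^sub>v (k *\<^sub>v y) = vec_index y j \<cdot>\<^sub>v (\<tau> d \<cdot>\<^sub>v z)"
    unfolding ky[OF y(1)] using mult_mat_vec[OF I z(1)] Iy[OF cd(2) z] by simp
   moreover have "k *\<^sub>v (?I \<tau> *\<^sub>v y) = (\<tau> c * vec_index y j) \<cdot>\<^sub>v z" unfolding Iy[OF cd(1) y] using ky[of "\<tau> c \<cdot>\<^sub>v y"] y(1) j(1) by simp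
   ultimately have "vec_index ((\<tau> c * vec_index y j) \<cdot>\<^sub>v z) i = vec_index (vec_index y j \<cdot>\<^sub>v (\<tau> d \<cdot>\<^sub>v z)) i" using e by simp
   then show False using cd(3) i j z(1) by simp
  qed
  then show ?thesis using k by blast
 qed
 have "\<exists>k\<in>Mat n. \<forall>\<tau>\<in>T. k * ?I \<tau> \<noteq> ?I \<tau> * k" if "finite T" "\<And>\<tau>. \<tau> \<in> T ==> \<not> \<tau> constant_on ?\<gamma>" for T
  using that
 proof (induction T rule: finite_induct)
  case (insert \<sigma> T)
  obtain k where k: "k \<in> Mat n" "\<forall>\<tau>\<in>T. k * ?I \<tau> \<noteq> ?I \<tau> * k" using insert by blast
  obtain l where l: "l \<in> Mat n" "l * ?I \<sigma> \<noteq> ?I \<sigma> * l" using one[of \<sigma>] insert.prems by blast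
  have "finite {t. (k + t \<cdot>\<^sub>m l) * ?I \<tau> = ?I \<tau> * (k + t \<cdot>\<^sub>m l)}" if "\<tau> \<in> insert \<sigma> T" for \<tau>
   using that k(2) l(2) by (intro commuting_line[OF k(1) l(1) I]) blast
  then have "finite (\<Union>\<tau>\<in>insert \<sigma> T. {t. (k + t \<cdot>\<^sub>m l) * ?I \<tau> = ?I \<tau> * (k + t \<cdot>\<^sub>m l)})" using insert(1) by blast
  then obtain t where "t \<notin> (\<Union>\<tau>\<in>insert \<sigma> T. {t. (k + t \<cdot>\<^sub>m l) * ?I \<tau> = ?I \<tau> * (k + t \<cdot>\<^sub>m l)})"
   using ex_new_if_finite[OF infinite_UNIV_char_0[where 'a = complex]] by blast
  then show ?case using k(1) l(1) by (intro bexI[of _ "k + t \<cdot>\<^sub>m l"]) auto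
 qed auto
 note ex = this
 have "finite (signs ?\<gamma>)" unfolding signs_def using Gamma_facts(1)[OF G] by (intro finite_PiE) auto
 then have "\<exists>k\<in>Mat n. \<forall>\<tau>\<in>{\<tau> \<in> signs ?\<gamma>. \<not> \<tau> constant_on ?\<gamma>}. k * ?I \<tau> \<noteq> ?I \<tau> * k" by (intro ex) simp_all
 then obtain k where k: "k \<in> Mat n" "\<forall>\<tau>\<in>{\<tau> \<in> signs ?\<gamma>. \<not> \<tau> constant_on ?\<gamma>}. k * ?I \<tau> \<noteq> ?I \<tau> * k" by (elim bexE)
 have "nonc ?\<gamma> k x" unfolding nonc_def by (intro ballI impI) (rule bspec[OF k(2)], simp)
 then show ?thesis using k(1) by (rule bexI)
qed

end

section \<open>Generic points of S_o and the limits along generic directions\<close>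

context nc_symmetric
begin

abbreviation "Soo \<equiv> S_oo r q S"
abbreviation "xx w \<equiv> vv w * vv w"

lemma Soo_iff:
 "w \<in> Soo \<longleftrightarrow> w \<in> S \<and> (\<exists>\<gamma>\<in>Gamma. \<exists>\<tau>\<in>signs \<gamma>. spectrum (xx w) \<subseteq> Delta r \<gamma> \<and> S_fun r q \<gamma> \<tau> (xx w) = vv w \<and> nonc \<gamma> (uu w) (xx w))"
proof
 assume "w \<in> Soo"
 then obtain \<gamma> \<tau> p where *: "\<gamma> \<in> Gamma" "\<tau> \<in> signs \<gamma>" "p \<in> U_dom r \<gamma>" "w = omega r q \<gamma> \<tau> p" "w \<in> S" by (auto simp: S_oo_def)
 have pW: "p \<in> W_dom r \<gamma>" "nonc \<gamma> (p ! 0) (p ! 1)" using *(3) by (auto simp: U_dom_nonc)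
 obtain n where n: "p ! 0 \<in> Mat n" "p ! 1 \<in> Mat n" "spectrum (p ! 1) \<subseteq> Delta r \<gamma>" using W_domD[OF pW(1)] by auto
 note f = S_fun_facts[OF *(1,2) n(2,3)]
 have "uu w = p ! 0" "vv w = S_fun r q \<gamma> \<tau> (p ! 1)" using *(4) uu_vv_mkw[OF n(1) f(1)] by (auto simp: omega_mkw)
 then show "w \<in> S \<and> (\<exists>\<gamma>\<in>Gamma. \<exists>\<tau>\<in>signs \<gamma>. spectrum (xx w) \<subseteq> Delta r \<gamma> \<and> S_fun r q \<gamma> \<tau> (xx w) = vv w \<and> nonc \<gamma> (uu w) (xx w))"
  using *(1,2,5) f(2) n pW(2) by (intro conjI bexI[of _ \<gamma>] bexI[of _ \<tau>]) auto
next
 assume "w \<in> S \<and> (\<exists>\<gamma>\<in>Gamma. \<exists>\<tau>\<in>signs \<gamma>. spectrum (xx w) \<subseteq> Delta r \<gamma> \<and> S_fun r q \<gamma> \<tau> (xx w) = vv w \<and> nonc \<gamma> (uu w) (xx w))"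
 then obtain \<gamma> \<tau> where *: "w \<in> S" "\<gamma> \<in> Gamma" "\<tau> \<in> signs \<gamma>" "spectrum (xx w) \<subseteq> Delta r \<gamma>" "S_fun r q \<gamma> \<tau> (xx w) = vv w" "nonc \<gamma> (uu w) (xx w)" by blast
 obtain n where n: "w \<in> pts 2 n" "n \<ge> 1" using S_level *(1) by blast
 have "[uu w, xx w] \<in> U_dom r \<gamma>"
  using W_domI[OF uu_vv_carrier(1)[OF n(1)] mult_carrier_mat[OF uu_vv_carrier(2)[OF n(1)] uu_vv_carrier(2)[OF n(1)]] n(2) *(4)] *(6)
  by (simp add: U_dom_nonc)
 moreover have "omega r q \<gamma> \<tau> [uu w, xx w] = w" using *(5) mkw_uu_vv[OF n(1)] by (simp add: omega_mkw)
 ultimately have "w \<in> omega r q \<gamma> \<tau> ` U_dom r \<gamma> \<inter> S" using *(1) by (metis IntI image_eqI)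
 then show "w \<in> Soo" unfolding S_oo_def using *(2,3) by blast
qed

lemma xx_carrier: "w \<in> pts 2 n ==> xx w \<in> Mat n"
 using mult_carrier_mat[OF uu_vv_carrier(2) uu_vv_carrier(2)] .

lemma Soo_sub: "Soo \<subseteq> So"
proof
 fix w assume w: "w \<in> Soo"
 then obtain \<gamma> \<tau> where *: "w \<in> S" "\<gamma> \<in> Gamma" "\<tau> \<in> signs \<gamma>" "spectrum (xx w) \<subseteq> Delta r \<gamma>" "S_fun r q \<gamma> \<tau> (xx w) = vv w" unfolding Soo_iff by blast
 obtain n where n: "w \<in> pts 2 n" "n \<ge> 1" using S_level *(1) by blast
 have "sylv (vv w)" using S_fun_facts(3)[OF *(2,3) xx_carrier[OF n(1)] *(4)] *(5) by simp
 then show "w \<in> So" using *(1) by (simp add: So_iff)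
qed

lemma sim_closed_Soo: "sim_closed S Soo"
 unfolding sim_closed_def
proof (intro conjI ballI impI)
 show "Soo \<subseteq> S" using Soo_sub So_sub by blast
 fix w s assume w: "w \<in> Soo" and s: "s \<in> GL (mlevel w)" and c: "conj_point s w \<in> S"
 obtain \<gamma> \<tau> where *: "w \<in> S" "\<gamma> \<in> Gamma" "\<tau> \<in> signs \<gamma>" "spectrum (xx w) \<subseteq> Delta r \<gamma>" "S_fun r q \<gamma> \<tau> (xx w) = vv w" "nonc \<gamma> (uu w) (xx w)"
  using w unfolding Soo_iff by blast
 obtain n where n: "w \<in> pts 2 n" "n \<ge> 1" using S_level *(1) by blast
 have s: "s \<in> GL n" using s pts_mlevel[OF n(1)] by simp
 note v = uu_vv_carrier(2)[OF n(1)] and X = xx_carrier[OF n(1)]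
 have e: "xx (conj_point s w) = conj_mat s (xx w)" by (simp only: uu_vv_conj[OF n(1) s] conj_mat_mult[OF s v v])
 show "conj_point s w \<in> Soo" unfolding Soo_iff unfolding e unfolding uu_vv_conj[OF n(1) s]
  using c *(2,3,4) spectrum_conj[OF s X] S_fun_conj[OF *(2) X s *(4), of \<tau>] *(5) nonc_conj[OF *(2) X uu_vv_carrier(1)[OF n(1)] s *(4,6)]
  by (intro conjI bexI[of _ \<gamma>] bexI[of _ \<tau>]) simp_all
qed

lemma xx_flip: assumes "w \<in> pts 2 n" shows "xx (flip w) = xx w"
 unfolding uu_vv_flip[OF assms] by (rule mat_uminus_mult_uminus[OF uu_vv_carrier(2,2)[OF assms]])

lemma flip_Soo:
 assumes w: "w \<in> Soo" shows "flip w \<in> Soo"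
proof -
 obtain \<gamma> \<tau> where *: "w \<in> S" "\<gamma> \<in> Gamma" "\<tau> \<in> signs \<gamma>" "spectrum (xx w) \<subseteq> Delta r \<gamma>" "S_fun r q \<gamma> \<tau> (xx w) = vv w" "nonc \<gamma> (uu w) (xx w)"
  using w unfolding Soo_iff by blast
 obtain n where n: "w \<in> pts 2 n" "n \<ge> 1" using S_level *(1) by blast
 obtain \<tau>' where t': "\<tau>' \<in> signs \<gamma>" "S_fun r q \<gamma> \<tau>' (xx w) = - vv w" using S_fun_uminus[OF *(2,3) xx_carrier[OF n(1)] *(4)] *(5) by auto
 have "flip w \<in> S" using *(1) sym by (simp add: symmetric_set_def)
 then show ?thesis unfolding Soo_iff unfolding xx_flip[OF n(1)] unfolding uu_vv_flip[OF n(1)] using * t' by blast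
qed

text \<open>S_oo allows any \<open>\<gamma>\<close>. Taking the spectrum of v^2 gives a criterion
  that depends on the point alone and, on S_o, implies membership in S_oo.\<close>

definition generic :: "nc_point => bool" where "generic w \<longleftrightarrow> nonc (spectrum (xx w)) (uu w) (xx w)"

lemma So_Gamma: "w \<in> So ==> spectrum (xx w) \<in> Gamma"
 using S_level[of w] So_sub sylv_root(1)[OF uu_vv_carrier(2) _ refl, of w] So_iff by blast

lemma generic_Soo:
 assumes w: "w \<in> So" and f: "generic w" shows "w \<in> Soo"
proof -
 have wS: "w \<in> S" "sylv (vv w)" using w So_iff by auto
 obtain n where n: "w \<in> pts 2 n" "n \<ge> 1" using S_level wS by blast
 note G = So_Gamma[OF w]
 have "spectrum (xx w) \<subseteq> Delta r (spectrum (xx w))" using center_Delta[OF G] by blast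
 then show ?thesis unfolding Soo_iff using wS(1) G sylv_root(2)[OF uu_vv_carrier(2)[OF n(1)] wS(2) refl] f unfolding generic_def by blast
qed

text \<open>By the inclusion of spectra the spectrum at \<open>b\<close> serves as
  \<open>\<gamma>\<close> for both points and for their direct sum; one noncommuting block then
  suffices.\<close>

lemma generic_dsum:
 assumes a: "a \<in> pts 2 n" and b: "b \<in> pts 2 m" and ab: "point_dsum a b \<in> So" "point_dsum b a \<in> So"
  and sp: "spectrum (xx a) \<subseteq> spectrum (xx b)" and f: "generic b"
 shows "point_dsum a b \<in> Soo \<and> point_dsum b a \<in> Soo"
proof -
 note va = uu_vv_carrier[OF a] and vb = uu_vv_carrier[OF b] and xa = xx_carrier[OF a] and xb = xx_carrier[OF b]
 have xab: "xx (point_dsum a b) = mat_dsum (xx a) (xx b)" unfolding uu_vv_dsum[OF a b] by (rule mat_dsum_mult[OF va(2) vb(2) va(2) vb(2)])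
 have xba: "xx (point_dsum b a) = mat_dsum (xx b) (xx a)" unfolding uu_vv_dsum[OF b a] by (rule mat_dsum_mult[OF vb(2) va(2) vb(2) va(2)])
 have s1: "spectrum (xx (point_dsum a b)) = spectrum (xx b)" "spectrum (xx (point_dsum b a)) = spectrum (xx b)"
  unfolding xab xba spectrum_dsum[OF xa xb] spectrum_dsum[OF xb xa] using sp by auto
 have G: "spectrum (xx b) \<in> Gamma" using So_Gamma[OF ab(1)] s1(1) by simp
 have D: "spectrum (xx b) \<subseteq> Delta r (spectrum (xx b))" using center_Delta[OF G] by blast
 then have D': "spectrum (xx a) \<subseteq> Delta r (spectrum (xx b))" using sp by blast
 have "generic (point_dsum a b)" unfolding generic_def s1 unfolding xab unfolding uu_vv_dsum[OF a b]
  by (rule nonc_dsum[OF G xa va(1) xb vb(1) D' D]) (use f generic_def in blast)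
 moreover have "generic (point_dsum b a)" unfolding generic_def s1 unfolding xba unfolding uu_vv_dsum[OF b a]
  by (rule nonc_dsum[OF G xb vb(1) xa va(1) D D']) (use f generic_def in blast)
 ultimately show ?thesis using generic_Soo ab by blast
qed

definition shiftu :: "complex mat => complex => nc_point => nc_point" where
 "shiftu k t w = mkw (uu w + t \<cdot>\<^sub>m k) (vv w)"

definition dir :: "nc_point => complex mat => bool" where
 "dir w k \<longleftrightarrow> k \<in> carrier_mat (mlevel w) (mlevel w) \<and> nonc (spectrum (xx w)) k (xx w)"

lemma shiftu:
 assumes w: "w \<in> pts 2 n" and k: "k \<in> Mat n"
 shows "shiftu k t w \<in> pts 2 n" "uu (shiftu k t w) = uu w + t \<cdot>\<^sub>m k" "vv (shiftu k t w) = vv w"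
proof -
 have c: "uu w + t \<cdot>\<^sub>m k \<in> Mat n" using k by simp
 show "shiftu k t w \<in> pts 2 n" "uu (shiftu k t w) = uu w + t \<cdot>\<^sub>m k" "vv (shiftu k t w) = vv w"
  unfolding shiftu_def using mkw_pts[OF c uu_vv_carrier(2)[OF w]] uu_vv_mkw[OF c uu_vv_carrier(2)[OF w]] by auto
qed

lemma pdist_shiftu:
 assumes w: "w \<in> pts 2 n" and k: "k \<in> Mat n"
 shows "pdist (shiftu k t w) w = 2 * op_norm k * cmod t"
proof -
 have "w ! 0 = uu w + vv w" "w ! 1 = uu w - vv w"
  using arg_cong[OF mkw_uu_vv[OF w], of "\<lambda>x. x ! 0"] arg_cong[OF mkw_uu_vv[OF w], of "\<lambda>x. x ! 1"] by (simp_all add: mkw_def)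
 then have "shiftu k t w ! 0 - w ! 0 = t \<cdot>\<^sub>m k" "shiftu k t w ! 1 - w ! 1 = t \<cdot>\<^sub>m k"
  using uu_vv_carrier[OF w] k by (auto simp: shiftu_def mkw_def intro!: eq_matI)
 then show ?thesis unfolding pdist_pts2[OF shiftu(1)[OF w k] w] by (simp add: op_norm_smult[OF k])
qed

lemma pdist_shiftu_limit:
 assumes w: "w \<in> pts 2 n" and k: "k \<in> Mat n"
 shows "(\<lambda>m. pdist (shiftu k (tt m) w) w) \<longlonglongrightarrow> 0"
 unfolding pdist_shiftu[OF w k] using tendsto_mult[OF tendsto_const tt_limit, of "2 * op_norm k"] by simp

lemma dir_exists: "w \<in> So ==> \<exists>k. dir w k"
proof -
 assume w: "w \<in> So"
 obtain n where n: "w \<in> pts 2 n" "n \<ge> 1" using S_level w So_sub by blast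
 show ?thesis using nonc_exists[OF xx_carrier[OF n(1)] So_Gamma[OF w]] pts_mlevel[OF n(1)] unfolding dir_def by auto
qed

lemma dirD: "dir w k ==> w \<in> pts 2 n ==> k \<in> Mat n"
 using pts_mlevel[of w 2 n] by (simp add: dir_def)

lemma generic_shiftu:
 assumes w: "w \<in> So" "w \<in> pts 2 n" and k: "dir w k"
 shows "\<forall>\<^sub>F m in sequentially. generic (shiftu k (tt m) w)"
proof -
 have kc: "k \<in> Mat n" using dirD[OF k w(2)] .
 have "finite (spectrum (xx w))" using Gamma_facts(1)[OF So_Gamma[OF w(1)]] .
 moreover have "nonc (spectrum (xx w)) k (xx w)" using k by (simp add: dir_def)
 ultimately obtain \<delta> where d: "\<delta> > 0" "\<And>t. t \<noteq> 0 ==> cmod t < \<delta> ==> nonc (spectrum (xx w)) (uu w + t \<cdot>\<^sub>m k) (xx w)"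
  using nonc_perturb[OF xx_carrier[OF w(2)] uu_vv_carrier(1)[OF w(2)] kc] by blast
 show ?thesis using eventually_tt[OF d(1)]
 proof eventually_elim
  case (elim m)
  show ?case unfolding generic_def shiftu[OF w(2) kc] by (rule d(2)[OF tt(2) elim])
 qed
qed

text \<open>Perturbing \<open>u\<close> keeps \<open>v\<close> and hence stays in \<open>S_o\<close>.\<close>

lemma near_So:
 assumes w: "w \<in> So" "w \<in> pts 2 n" "n \<ge> 1"
 shows "\<exists>e>0. \<forall>a b. a \<in> pts 2 n --> b \<in> pts 2 n --> pdist a w < e --> pdist b w < e --> vv a = vv w --> vv b = vv w -->
  a \<in> So \<and> b \<in> So \<and> point_dsum a b \<in> So"
proof -
 have wS: "w \<in> S" "sylv (vv w)" using w So_iff by auto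
 obtain e where e1: "e > 0" and e2: "\<forall>a b. a \<in> pts 2 n --> b \<in> pts 2 n --> pdist a w < e --> pdist b w < e -->
   a \<in> S \<and> b \<in> S \<and> point_dsum a b \<in> S"
  using near_open[OF S_open zero_less_numeral wS(1) w(2,3)] by (elim exE conjE)
 show ?thesis
 proof (intro exI[of _ e] conjI[OF e1] allI impI)
  fix a b assume a: "a \<in> pts 2 n" and b: "b \<in> pts 2 n" and p: "pdist a w < e" "pdist b w < e" and v: "vv a = vv w" "vv b = vv w"
  have "sylv (vv (point_dsum a b))"
   unfolding uu_vv_dsum[OF a b] v sylv_def spectrum_dsum[OF uu_vv_carrier(2)[OF w(2)] uu_vv_carrier(2)[OF w(2)]]
   using wS(2) by (auto simp: sylv_def)
  then show "a \<in> So \<and> b \<in> So \<and> point_dsum a b \<in> So" using e2[rule_format, OF a b p] v wS(2) by (simp add: So_iff)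
 qed
qed

text \<open>Only one of the two directions has to be generic. With \<open>k' = 0\<close> this pairs
  \<open>w\<close> with its own perturbations; with another generic direction it makes limits along
  different directions comparable.\<close>

lemma shiftu_pair:
 assumes w: "w \<in> So" "w \<in> pts 2 n" "n \<ge> 1" and k: "dir w k" "k' \<in> Mat n"
 shows "\<exists>M. \<forall>m\<ge>M. \<forall>l\<ge>M. shiftu k (tt m) w \<in> Soo \<and> shiftu k' (tt l) w \<in> So \<and> point_dsum (shiftu k (tt m) w) (shiftu k' (tt l) w) \<in> Soo
  \<and> point_dsum (shiftu k' (tt l) w) (shiftu k (tt m) w) \<in> Soo"
proof -
 have kc: "k \<in> Mat n" using dirD[OF k(1) w(2)] .
 obtain e where e1: "e > 0" and e2: "\<forall>a b. a \<in> pts 2 n --> b \<in> pts 2 n --> pdist a w < e --> pdist b w < e --> vv a = vv w --> vv b = vv w -->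
  a \<in> So \<and> b \<in> So \<and> point_dsum a b \<in> So"
  using near_So[OF w] by (elim exE conjE)
 have "\<forall>\<^sub>F m in sequentially. pdist (shiftu k (tt m) w) w < e" "\<forall>\<^sub>F m in sequentially. pdist (shiftu k' (tt m) w) w < e"
  using order_tendstoD(2)[OF pdist_shiftu_limit[OF w(2) kc] e1] order_tendstoD(2)[OF pdist_shiftu_limit[OF w(2) k(2)] e1] by auto
 then have "\<forall>\<^sub>F m in sequentially. pdist (shiftu k (tt m) w) w < e \<and> pdist (shiftu k' (tt m) w) w < e \<and> generic (shiftu k (tt m) w)"
  using generic_shiftu[OF w(1,2) k(1)] by eventually_elim simp
 then obtain M where M: "\<And>m. m \<ge> M ==> pdist (shiftu k (tt m) w) w < e \<and> pdist (shiftu k' (tt m) w) w < e \<and> generic (shiftu k (tt m) w)"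
  by (auto simp: eventually_sequentially)
 show ?thesis
 proof (intro exI[of _ M] allI impI)
  fix m l assume ml: "m \<ge> M" "l \<ge> M"
  let ?a = "shiftu k (tt m) w" and ?b = "shiftu k' (tt l) w"
  note a = shiftu[OF w(2) kc, of "tt m"] and b = shiftu[OF w(2) k(2), of "tt l"]
  have p: "pdist ?a w < e" "pdist ?b w < e" and f: "generic ?a" using M[OF ml(1)] M[OF ml(2)] by auto
  have 1: "?a \<in> So" "?b \<in> So" "point_dsum ?a ?b \<in> So" using e2[rule_format, OF a(1) b(1) p a(3) b(3)] by auto
  have 2: "point_dsum ?b ?a \<in> So" using e2[rule_format, OF b(1) a(1) p(2,1) b(3) a(3)] by auto
  have "point_dsum ?b ?a \<in> Soo \<and> point_dsum ?a ?b \<in> Soo" using generic_dsum[OF b(1) a(1) 2 1(3) _ f] a(3) b(3) by simp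
  then show "?a \<in> Soo \<and> ?b \<in> So \<and> point_dsum ?a ?b \<in> Soo \<and> point_dsum ?b ?a \<in> Soo" using 1 generic_Soo f by blast
 qed
qed

lemma shiftu_zero_dir:
 assumes w: "w \<in> pts 2 n" shows "shiftu (0\<^sub>m n n) t w = w"
proof (rule pts2_uu_vv_eqI[OF shiftu(1)[OF w zero_carrier_mat] w])
 show "uu (shiftu (0\<^sub>m n n) t w) = uu w" unfolding shiftu(2)[OF w zero_carrier_mat] using uu_vv_carrier[OF w] by (intro eq_matI) auto
qed (rule shiftu(3)[OF w zero_carrier_mat])

definition ext2 :: "(nc_point => complex mat) => nc_point => complex mat" where
 "ext2 f w = (if w \<in> So then Matrix.mat (mlevel w) (mlevel w) (\<lambda>ij. lim (\<lambda>m. f (shiftu (SOME k. dir w k) (tt m) w) $$ ij)) else undefined)"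

context
 fixes f assumes f: "conditionally_nc 2 Soo f" and bdd: "freely_locally_bounded_on 2 S Soo f"
begin

lemma lipschitz_Soo: "w \<in> So ==> w \<in> pts 2 n ==> n \<ge> 1 ==> lipschitz_setting 2 S Soo f w n"
 using f bdd S_open sim_closed_Soo So_sub by unfold_locales auto

lemma appr_shiftu:
 assumes w: "w \<in> So" "w \<in> pts 2 n" "n \<ge> 1" and k: "dir w k"
 shows "lipschitz_setting.appr 2 Soo w n (\<lambda>m. shiftu k (tt m) w)"
proof -
 have kc: "k \<in> Mat n" using dirD[OF k w(2)] .
 obtain M where "\<forall>m\<ge>M. \<forall>l\<ge>M. shiftu k (tt m) w \<in> Soo \<and> shiftu k (tt l) w \<in> So \<and> point_dsum (shiftu k (tt m) w) (shiftu k (tt l) w) \<in> Soo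
  \<and> point_dsum (shiftu k (tt l) w) (shiftu k (tt m) w) \<in> Soo" using shiftu_pair[OF w k kc] by (elim exE)
 then have "\<forall>\<^sub>F m in sequentially. shiftu k (tt m) w \<in> Soo \<and> shiftu k (tt m) w \<in> pts 2 n"
  unfolding eventually_sequentially using shiftu(1)[OF w(2) kc] by (intro exI[of _ M]) auto
 then show ?thesis unfolding lipschitz_setting.appr_def[OF lipschitz_Soo[OF w]] using pdist_shiftu_limit[OF w(2) kc] by simp
qed

text \<open>The limit does not depend on the direction chosen in \<open>ext2\<close>, since
  perturbations along two directions form admissible pairs. This freedom is needed to let directions
  follow conjugations, flips and direct sums.\<close>

lemma ext2_conv:
 assumes w: "w \<in> So" "w \<in> pts 2 n" "n \<ge> 1" and k: "dir w k"
 shows "mconv n (\<lambda>m. f (shiftu k (tt m) w)) (ext2 f w)"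
proof -
 interpret L: lipschitz_setting 2 S Soo f w n by (rule lipschitz_Soo[OF w])
 define k0 where "k0 = (SOME k. dir w k)"
 have k0: "dir w k0" unfolding k0_def by (rule someI_ex[OF dir_exists[OF w(1)]])
 have kc: "k \<in> Mat n" "k0 \<in> Mat n" using dirD[OF k w(2)] dirD[OF k0 w(2)] .
 note a0 = appr_shiftu[OF w k0] and a = appr_shiftu[OF w k]
 obtain M where M: "\<forall>m\<ge>M. \<forall>l\<ge>M. shiftu k0 (tt m) w \<in> Soo \<and> shiftu k0 (tt l) w \<in> So \<and> point_dsum (shiftu k0 (tt m) w) (shiftu k0 (tt l) w) \<in> Soo
  \<and> point_dsum (shiftu k0 (tt l) w) (shiftu k0 (tt m) w) \<in> Soo" using shiftu_pair[OF w k0 kc(2)] by (elim exE)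
 have "\<exists>M. \<forall>m\<ge>M. \<forall>l\<ge>M. point_dsum (shiftu k0 (tt m) w) (shiftu k0 (tt l) w) \<in> Soo" using M by blast
 from L.seq_converges[OF a0 this] obtain X where X: "mconv n (\<lambda>m. f (shiftu k0 (tt m) w)) X" by auto
 have "ext2 f w = X"
 proof (rule eq_matI)
  have Xc: "X \<in> Mat n" using X by (simp add: mconv_def)
  have m: "mlevel w = n" using pts_mlevel[OF w(2)] by simp
  then show "dim_row (ext2 f w) = dim_row X" "dim_col (ext2 f w) = dim_col X" using Xc w(1) by (auto simp: ext2_def)
  fix i j assume "i < dim_row X" "j < dim_col X"
  then have ij: "i < n" "j < n" using Xc by auto
  then show "ext2 f w $$ (i, j) = X $$ (i, j)" using X m w(1) by (auto simp: ext2_def mconv_def k0_def[symmetric] intro: limI)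
 qed
 moreover obtain M' where M': "\<forall>m\<ge>M'. \<forall>l\<ge>M'. shiftu k0 (tt m) w \<in> Soo \<and> shiftu k (tt l) w \<in> So \<and> point_dsum (shiftu k0 (tt m) w) (shiftu k (tt l) w) \<in> Soo
  \<and> point_dsum (shiftu k (tt l) w) (shiftu k0 (tt m) w) \<in> Soo" using shiftu_pair[OF w k0 kc(1)] by (elim exE)
 have "\<forall>\<^sub>F m in sequentially. point_dsum (shiftu k0 (tt m) w) (shiftu k (tt m) w) \<in> Soo"
  unfolding eventually_sequentially using M' by blast
 ultimately show ?thesis using L.same_limit[OF a0 a _ X] by simp
qed

lemma eventually_Soo:
 assumes w: "w \<in> So" "w \<in> pts 2 n" "n \<ge> 1" and k: "dir w k"
 shows "\<forall>\<^sub>F m in sequentially. shiftu k (tt m) w \<in> Soo" "\<forall>\<^sub>F m in sequentially. f (shiftu k (tt m) w) \<in> Mat n"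
proof -
 show 1: "\<forall>\<^sub>F m in sequentially. shiftu k (tt m) w \<in> Soo"
  using appr_shiftu[OF w k] lipschitz_setting.appr_def[OF lipschitz_Soo[OF w]] by (auto elim: eventually_mono)
 show "\<forall>\<^sub>F m in sequentially. f (shiftu k (tt m) w) \<in> Mat n"
  using 1 by eventually_elim (rule conditionally_nc_graded[OF f _ shiftu(1)[OF w(2) dirD[OF k w(2)]]], auto)
qed

lemma ext2_carrier: "w \<in> So ==> w \<in> pts 2 n ==> n \<ge> 1 ==> ext2 f w \<in> Mat n"
 using ext2_conv[of w n] dir_exists[of w] by (auto simp: mconv_def)

lemma ext2_agrees:
 assumes w: "w \<in> Soo" shows "ext2 f w = f w"
proof -
 have wo: "w \<in> So" using w Soo_sub by blast
 obtain n where n: "w \<in> pts 2 n" "n \<ge> 1" using S_level wo So_sub by blast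
 obtain k where k: "dir w k" using dir_exists[OF wo] by blast
 interpret L: lipschitz_setting 2 S Soo f w n by (rule lipschitz_Soo[OF wo n])
 obtain M where M: "\<forall>m\<ge>M. \<forall>l\<ge>M. shiftu k (tt m) w \<in> Soo \<and> shiftu (0\<^sub>m n n) (tt l) w \<in> So \<and> point_dsum (shiftu k (tt m) w) (shiftu (0\<^sub>m n n) (tt l) w) \<in> Soo
  \<and> point_dsum (shiftu (0\<^sub>m n n) (tt l) w) (shiftu k (tt m) w) \<in> Soo" using shiftu_pair[OF wo n k zero_carrier_mat] by (elim exE)
 then have "\<forall>\<^sub>F m in sequentially. point_dsum w (shiftu k (tt m) w) \<in> Soo"
  unfolding eventually_sequentially shiftu_zero_dir[OF n(1)] by blast
 from L.constant_limit[OF appr_shiftu[OF wo n k] w this] show ?thesis using mconv_unique[OF ext2_conv[OF wo n k]] by metis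
qed

lemma ext2_conj:
 assumes x: "x \<in> So" "x \<in> pts 2 n" "n \<ge> 1" and s: "s \<in> GL n" and sx: "conj_point s x \<in> So"
 shows "ext2 f (conj_point s x) = conj_mat s (ext2 f x)"
proof -
 obtain k where k: "dir x k" using dir_exists[OF x(1)] by blast
 have kc: "k \<in> Mat n" using dirD[OF k x(2)] .
 let ?k = "conj_mat s k"
 have kc': "?k \<in> Mat n" using kc s by simp
 have e: "xx (conj_point s x) = conj_mat s (xx x)"
  by (simp only: uu_vv_conj[OF x(2) s] conj_mat_mult[OF s uu_vv_carrier(2)[OF x(2)] uu_vv_carrier(2)[OF x(2)]])
 have sp: "spectrum (conj_mat s (xx x)) = spectrum (xx x)" by (rule spectrum_conj[OF s xx_carrier[OF x(2)]])
 have D: "spectrum (xx x) \<subseteq> Delta r (spectrum (xx x))" using center_Delta[OF So_Gamma[OF x(1)]] by blast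
 have k': "dir (conj_point s x) ?k"
  unfolding dir_def e sp pts_mlevel[OF pts_conj[OF x(2) s] zero_less_numeral]
  using nonc_conj[OF So_Gamma[OF x(1)] xx_carrier[OF x(2)] kc s D] k kc' by (simp add: dir_def)
 have sh: "shiftu ?k t (conj_point s x) = conj_point s (shiftu k t x)" for t
 proof (rule pts2_uu_vv_eqI)
  note c = uu_vv_conj[OF _ s]
  show "uu (shiftu ?k t (conj_point s x)) = uu (conj_point s (shiftu k t x))"
   unfolding shiftu[OF pts_conj[OF x(2) s] kc'] c[OF x(2)] c[OF shiftu(1)[OF x(2) kc]] shiftu[OF x(2) kc]
   using conj_mat_add[OF s uu_vv_carrier(1)[OF x(2)], of "t \<cdot>\<^sub>m k"] conj_mat_smult[OF s kc, of t] kc by simp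
  show "vv (shiftu ?k t (conj_point s x)) = vv (conj_point s (shiftu k t x))"
   unfolding shiftu[OF pts_conj[OF x(2) s] kc'] c[OF x(2)] c[OF shiftu(1)[OF x(2) kc]] shiftu[OF x(2) kc] ..
 qed (use shiftu(1)[OF x(2) kc] shiftu(1)[OF pts_conj[OF x(2) s] kc'] s in auto)
 note ev = eventually_Soo[OF x k] and ev' = eventually_Soo(1)[OF sx pts_conj[OF x(2) s] x(3) k']
 have "mconv n (\<lambda>m. conj_mat s (f (shiftu k (tt m) x))) (conj_mat s (ext2 f x))" by (rule mconv_conj[OF ext2_conv[OF x k] s ev(2)])
 moreover have "\<forall>\<^sub>F m in sequentially. conj_mat s (f (shiftu k (tt m) x)) = f (shiftu ?k (tt m) (conj_point s x))"
  using ev(1) ev'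
 proof eventually_elim
  case (elim m)
  then show ?case using conditionally_nc_conj[OF f elim(1) shiftu(1)[OF x(2) kc] _ s] by (simp add: sh)
 qed
 ultimately have "mconv n (\<lambda>m. f (shiftu ?k (tt m) (conj_point s x))) (conj_mat s (ext2 f x))" by (rule mconv_cong)
 then show ?thesis using mconv_unique[OF ext2_conv[OF sx pts_conj[OF x(2) s] x(3) k']] by blast
qed

lemma ext2_flip:
 assumes sf: "\<And>w. w \<in> Soo ==> f (flip w) = f w" and w: "w \<in> So"
 shows "ext2 f (flip w) = ext2 f w"
proof -
 obtain n where n: "w \<in> pts 2 n" "n \<ge> 1" using S_level w So_sub by blast
 obtain k where k: "dir w k" using dir_exists[OF w] by blast
 have kc: "k \<in> Mat n" using dirD[OF k n(1)] .
 note fw = flip_So[OF w] and fp = flip_pts[OF n(1)]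
 have k': "dir (flip w) k" using k unfolding dir_def xx_flip[OF n(1)] pts_mlevel[OF fp zero_less_numeral] pts_mlevel[OF n(1) zero_less_numeral] .
 have sh: "shiftu k t (flip w) = flip (shiftu k t w)" for t
 proof (rule pts2_uu_vv_eqI)
  note s = shiftu[OF n(1) kc, of t] and s' = shiftu[OF fp kc, of t]
  show "uu (shiftu k t (flip w)) = uu (flip (shiftu k t w))" "vv (shiftu k t (flip w)) = vv (flip (shiftu k t w))"
   unfolding s'(2,3) uu_vv_flip[OF n(1)] uu_vv_flip[OF s(1)] s(2,3) by auto
 qed (use shiftu(1)[OF n(1) kc] shiftu(1)[OF fp kc] in auto)
 have "\<forall>\<^sub>F m in sequentially. f (shiftu k (tt m) w) = f (shiftu k (tt m) (flip w))"
  using eventually_Soo(1)[OF w n k] by eventually_elim (simp add: sh sf)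
 then have "mconv n (\<lambda>m. f (shiftu k (tt m) (flip w))) (ext2 f w)" by (rule mconv_cong[OF ext2_conv[OF w n k]])
 then show ?thesis using mconv_unique[OF ext2_conv[OF fw fp n(2) k']] by blast
qed

text \<open>The inclusion of spectra makes \<open>mat_dsum k l\<close> a generic direction at the
  direct sum. In general it is not: a sign function that is constant on each of two disjoint spectra
  but not on their union gives a matrix commuting with it.\<close>

lemma ext2_dsum_aux:
 assumes a: "a \<in> So" "a \<in> pts 2 n" "n \<ge> 1" and b: "b \<in> So" "b \<in> pts 2 m" "m \<ge> 1" and ab: "point_dsum a b \<in> So"
  and sp: "spectrum (xx a) \<subseteq> spectrum (xx b)"
 shows "ext2 f (point_dsum a b) = mat_dsum (ext2 f a) (ext2 f b)"
proof -
 obtain k where k: "dir a k" using dir_exists[OF a(1)] by blast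
 obtain l where l: "dir b l" using dir_exists[OF b(1)] by blast
 have kc: "k \<in> Mat n" and lc: "l \<in> Mat m" using dirD[OF k a(2)] dirD[OF l b(2)] .
 note pab = pts_dsum[OF a(2) b(2)]
 have nm: "n + m \<ge> 1" using a(3) by simp
 note va = uu_vv_carrier[OF a(2)] and vb = uu_vv_carrier[OF b(2)] and xa = xx_carrier[OF a(2)] and xb = xx_carrier[OF b(2)]
 have xab: "xx (point_dsum a b) = mat_dsum (xx a) (xx b)" unfolding uu_vv_dsum[OF a(2) b(2)] by (rule mat_dsum_mult[OF va(2) vb(2) va(2) vb(2)])
 have s1: "spectrum (mat_dsum (xx a) (xx b)) = spectrum (xx b)" unfolding spectrum_dsum[OF xa xb] using sp by auto
 have D: "spectrum (xx b) \<subseteq> Delta r (spectrum (xx b))" using center_Delta[OF So_Gamma[OF b(1)]] by blast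
 have D': "spectrum (xx a) \<subseteq> Delta r (spectrum (xx b))" using sp D by blast
 let ?k = "mat_dsum k l"
 have kl: "dir (point_dsum a b) ?k"
  unfolding dir_def xab s1 pts_mlevel[OF pab zero_less_numeral]
  using nonc_dsum[OF So_Gamma[OF b(1)] xa kc xb lc D' D] l kc lc by (simp add: dir_def)
 have sh: "shiftu ?k t (point_dsum a b) = point_dsum (shiftu k t a) (shiftu l t b)" for t
 proof (rule pts2_uu_vv_eqI)
  note sa = shiftu[OF a(2) kc, of t] and sb = shiftu[OF b(2) lc, of t] and sab = shiftu[OF pab dirD[OF kl pab], of t]
  show "shiftu ?k t (point_dsum a b) \<in> pts 2 (n + m)" by (rule sab(1))
  show "point_dsum (shiftu k t a) (shiftu l t b) \<in> pts 2 (n + m)" by (rule pts_dsum[OF sa(1) sb(1)])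
  show "vv (shiftu ?k t (point_dsum a b)) = vv (point_dsum (shiftu k t a) (shiftu l t b))"
   unfolding sab uu_vv_dsum[OF a(2) b(2)] uu_vv_dsum[OF sa(1) sb(1)] sa sb ..
  have kt: "t \<cdot>\<^sub>m k \<in> Mat n" "t \<cdot>\<^sub>m l \<in> Mat m" using kc lc by auto
  show "uu (shiftu ?k t (point_dsum a b)) = uu (point_dsum (shiftu k t a) (shiftu l t b))"
   unfolding sab uu_vv_dsum[OF a(2) b(2)] uu_vv_dsum[OF sa(1) sb(1)] sa sb mat_dsum_smult[OF kc lc] mat_dsum_add[OF va(1) vb(1) kt] ..
 qed
 note ea = eventually_Soo[OF a k] and eb = eventually_Soo[OF b l] and eab = eventually_Soo[OF ab pab nm kl]
 have "mconv (n + m) (\<lambda>j. mat_dsum (f (shiftu k (tt j) a)) (f (shiftu l (tt j) b))) (mat_dsum (ext2 f a) (ext2 f b))"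
  by (rule mconv_dsum[OF ext2_conv[OF a k] ext2_conv[OF b l] ea(2) eb(2)])
 moreover have "\<forall>\<^sub>F j in sequentially. mat_dsum (f (shiftu k (tt j) a)) (f (shiftu l (tt j) b)) = f (shiftu ?k (tt j) (point_dsum a b))"
  using ea(1) eb(1) eab(1)
 proof eventually_elim
  case (elim j)
  note sa = shiftu[OF a(2) kc, of "tt j"] and sb = shiftu[OF b(2) lc, of "tt j"]
  have d: "point_dsum (shiftu k (tt j) a) (shiftu l (tt j) b) \<in> Soo" using elim(3) by (simp add: sh)
  have "point_dsum (shiftu l (tt j) b) (shiftu k (tt j) a) \<in> Soo"
   by (rule sim_closed_swap[OF sim_closed_Soo S_open zero_less_numeral sa(1) sb(1) a(3) b(3) d])
  then show ?case using conditionally_nc_dsum[OF f _ elim(1,2) d] by (simp add: sh)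
 qed
 ultimately have "mconv (n + m) (\<lambda>j. f (shiftu ?k (tt j) (point_dsum a b))) (mat_dsum (ext2 f a) (ext2 f b))" by (rule mconv_cong)
 then show ?thesis using mconv_unique[OF ext2_conv[OF ab pab nm kl]] by blast
qed

text \<open>The value at \<open>x \<oplus> y\<close> commutes with \<open>1 \<oplus> (-1)\<close>, hence is block diagonal; its first block is read
 off from \<open>x \<oplus> (x \<oplus> y)\<close>, which is invariant under exchanging the two copies of \<open>x\<close>.\<close>

lemma ext2_dsum:
 assumes x: "x \<in> So" "x \<in> pts 2 n" "n \<ge> 1" and y: "y \<in> So" "y \<in> pts 2 m" "m \<ge> 1" and xy: "point_dsum x y \<in> So"
 shows "ext2 f (point_dsum x y) = mat_dsum (ext2 f x) (ext2 f y)"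
proof -
 have half: "\<exists>A\<in>Mat n. \<exists>B\<in>Mat m. ext2 f (point_dsum x y) = mat_dsum A B \<and> ext2 f x = A"
  if x: "x \<in> So" "x \<in> pts 2 n" "n \<ge> 1" and y: "y \<in> So" "y \<in> pts 2 m" "m \<ge> 1" and xy: "point_dsum x y \<in> So" for x y n m
 proof -
  let ?b = "point_dsum x y"
  note bp = pts_dsum[OF x(2) y(2)]
  have nm: "n + m \<ge> 1" using x(3) by simp
  note vx = uu_vv_carrier[OF x(2)] and vy = uu_vv_carrier[OF y(2)] and cb = ext2_carrier[OF xy bp nm] and cx = ext2_carrier[OF x]
  note nb = nth_dsum[OF ptsD(1)[OF x(2)] ptsD(1)[OF y(2)]]
  have "?b \<in> S" using xy So_sub by blast
  then obtain F where F: "valid_polys 2 F" "?b \<in> fnb 2 F" "fnb 2 F \<subseteq> S" by (rule open_base[OF S_open])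
  \<comment> \<open>A basic neighbourhood of \<open>?b\<close> contains the summand \<open>x\<close>
    and therefore also the direct sum of \<open>x\<close> with \<open>?b\<close>.\<close>
  have "point_dsum x ?b \<in> S"
   using fnb_dsum[OF F(1) pts_nc_space[OF x(2,3)] pts_nc_space[OF y(2,3)]] fnb_dsum[OF F(1) pts_nc_space[OF x(2,3)] pts_nc_space[OF bp nm]] F(2,3) by auto
  moreover have spv: "spectrum (vv ?b) = spectrum (vv x) \<union> spectrum (vv y)"
   unfolding uu_vv_dsum[OF x(2) y(2)] by (rule spectrum_dsum[OF vx(2) vy(2)])
  moreover have "spectrum (vv (point_dsum x ?b)) = spectrum (vv ?b)"
   unfolding uu_vv_dsum(2)[OF x(2) bp] spectrum_dsum[OF vx(2) uu_vv_carrier(2)[OF bp]] using spv by auto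
  ultimately have xb: "point_dsum x ?b \<in> So" using xy unfolding So_iff sylv_def by auto
  have spx: "spectrum (xx x) \<subseteq> spectrum (xx ?b)" unfolding spectrum_square[OF vx(2)] spectrum_square[OF uu_vv_carrier(2)[OF bp]] spv by auto
  let ?s = "mat_dsum (1\<^sub>m n) (- 1\<^sub>m m) :: complex mat"
  have sc: "?s \<in> carrier_mat (n + m) (n + m)" by simp
  have ss: "?s * ?s = 1\<^sub>m (n + m)" by (simp add: mat_dsum_mult[of _ n _ m] mat_dsum_one)
  have s: "?s \<in> GL (n + m)" "mat_inv ?s = ?s" using GL_I[OF sc sc ss ss] mat_inv_eqI[OF sc sc ss ss] by auto
  have sconj: "conj_mat ?s (mat_dsum A B) = mat_dsum A B" if "A \<in> Mat n" "B \<in> Mat m" for A B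
   using that unfolding conj_mat_def s(2) by (simp add: mat_dsum_mult[of _ n _ m])
  have "conj_point ?s ?b = ?b"
   by (rule point_eqI[OF pts_conj[OF bp s(1)] bp]) (simp add: nth_conj[OF ptsD(1)[OF bp]] nb sconj[OF ptsD(2)[OF x(2)] ptsD(2)[OF y(2)]])
  then have inv: "conj_mat ?s (ext2 f ?b) = ext2 f ?b" using ext2_conj[OF xy bp nm s(1)] xy by simp
  obtain A B C D where e: "ext2 f ?b = four_block_mat A B C D"
   and c: "A \<in> Mat n" "B \<in> carrier_mat n m" "C \<in> carrier_mat m n" "D \<in> Mat m"
   using split_block(5)[OF _ carrier_matD(1)[OF cb] carrier_matD(2)[OF cb]] split_block(1-4)[OF _ carrier_matD(1)[OF cb] carrier_matD(2)[OF cb]]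
   by (metis prod_cases4)
  have "conj_mat ?s (four_block_mat A B C D) = four_block_mat A (- B) (- C) D"
   using c unfolding conj_mat_def s(2)
   by (simp add: mat_dsum_eq[of _ n _ m] mult_four_block_mat[of _ n n _ m _ m _ _ n _ m])
  then have "four_block_mat A (- B) (- C) D = four_block_mat A B C D" using inv e by simp
  then have "- B = B" "- C = C" using four_block_inj[of A "- B" "- C" D A B C D n n m m] c by auto
  then have "B = 0\<^sub>m n m" "C = 0\<^sub>m m n" using c(2,3) by (auto simp: mat_eq_iff)
  then have eb: "ext2 f ?b = mat_dsum A D" using e c by (simp add: mat_dsum_eq[of _ n _ m])
  let ?t = "mat_dsum (block_swap n n) (1\<^sub>m m)"
  note t = GL_dsum(1)[OF block_swap_GL(1)[of n n] GL_one(1)[of m]]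
  have tconj: "conj_mat ?t (mat_dsum A (mat_dsum B D)) = mat_dsum B (mat_dsum A D)"
   if "A \<in> Mat n" "B \<in> Mat n" "D \<in> Mat m" for A B D
   unfolding mat_dsum_assoc[symmetric] using conj_dsum[OF block_swap_GL(1)[of n n] GL_one(1)[of m] mat_dsum_carrier[OF that(1,2)] that(3)]
    conj_block_swap[OF that(1,2)] conj_mat_by_one[OF that(3)] by simp
  have xbp: "point_dsum x ?b \<in> pts 2 (n + n + m)" using pts_dsum[OF x(2) bp] by (simp add: add.assoc)
  have "conj_point ?t (point_dsum x ?b) = point_dsum x ?b"
   by (rule point_eqI[OF pts_conj[OF xbp t] xbp])
    (simp add: nth_conj[OF ptsD(1)[OF xbp]] nth_dsum[OF ptsD(1)[OF x(2)] ptsD(1)[OF bp]] nb tconj[OF ptsD(2)[OF x(2)] ptsD(2)[OF x(2)] ptsD(2)[OF y(2)]])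
  then have "conj_mat ?t (ext2 f (point_dsum x ?b)) = ext2 f (point_dsum x ?b)" using ext2_conj[OF xb xbp _ t] xb x(3) by simp
  \<comment> \<open>\<open>ext2_dsum_aux\<close> applies to \<open>x\<close> and \<open>?b\<close>,
    because the spectrum at the first is contained in that at the second.\<close>
  then have "mat_dsum A (mat_dsum (ext2 f x) D) = mat_dsum (ext2 f x) (mat_dsum A D)"
   unfolding ext2_dsum_aux[OF x xy bp nm xb spx] eb tconj[OF cx c(1,4)] .
  then have "ext2 f x = A" using mat_dsum_inj(1)[OF _ c(1) mat_dsum_carrier[OF cx c(4)] cx mat_dsum_carrier[OF c(1,4)]] by simp
  then show ?thesis using eb c by blast
 qed
 obtain A B where A: "A \<in> Mat n" "B \<in> Mat m" "ext2 f (point_dsum x y) = mat_dsum A B" "ext2 f x = A" using half[OF x y xy] by blast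
 have yx: "point_dsum y x \<in> So" "point_dsum y x = conj_point (block_swap n m) (point_dsum x y)"
  using sim_closed_swap[OF sim_closed_So S_open zero_less_numeral x(2) y(2) x(3) y(3) xy] conj_block_swap_point[OF x(2) y(2)] by auto
 \<comment> \<open>\<open>half\<close> identifies only the block of the first summand. The second
   one is obtained from the sum in the other order and carried over by the exchange of
   summands.\<close>
 obtain B' A' where B: "B' \<in> Mat m" "A' \<in> Mat n" "ext2 f (point_dsum y x) = mat_dsum B' A'" "ext2 f y = B'" using half[OF y x yx(1)] by blast
 have "ext2 f (point_dsum y x) = conj_mat (block_swap n m) (mat_dsum A B)"
  unfolding yx(2) A(3)[symmetric] by (rule ext2_conj[OF xy pts_dsum[OF x(2) y(2)] _ block_swap_GL(1)]) (use x(3) yx in simp_all)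
 then have "mat_dsum B' A' = mat_dsum B A" unfolding B(3) conj_block_swap[OF A(1,2)] .
 then have "B' = B" using mat_dsum_inj(1)[OF _ B(1,2) A(2,1)] by simp
 then show ?thesis using A B by simp
qed

lemma ext2_conditionally_nc: "conditionally_nc 2 So (ext2 f)"
proof (rule conditionally_nc_I)
 show "So \<subseteq> nc_space 2" using So_sub S_sub by blast
 show "graded So (ext2 f)" unfolding graded_def
 proof
  fix w assume w: "w \<in> So"
  obtain n where n: "w \<in> pts 2 n" "n \<ge> 1" using S_level w So_sub by blast
  show "ext2 f w \<in> carrier_mat (mlevel w) (mlevel w)" using ext2_carrier[OF w n] pts_mlevel[OF n(1)] by simp
 qed
 show "preserves_similarity So (ext2 f)" unfolding preserves_similarity_def
 proof (intro ballI impI)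
  fix w s assume w: "w \<in> So" and s: "s \<in> GL (mlevel w)" and c: "conj_point s w \<in> So"
  obtain n where n: "w \<in> pts 2 n" "n \<ge> 1" using S_level w So_sub by blast
  show "ext2 f (conj_point s w) = conj_mat s (ext2 f w)" using ext2_conj[OF w n _ c] s pts_mlevel[OF n(1)] by simp
 qed
 fix x y assume x: "x \<in> So" and y: "y \<in> nc_space 2" and xy: "point_dsum x y \<in> So"
 have yS: "y \<in> So" using So_summands[OF _ y xy] x So_sub S_sub by blast
 obtain n where n: "x \<in> pts 2 n" "n \<ge> 1" using S_level x So_sub by blast
 obtain m where m: "y \<in> pts 2 m" "m \<ge> 1" using S_level yS So_sub by blast
 show "y \<in> So \<and> ext2 f (point_dsum x y) = mat_dsum (ext2 f x) (ext2 f y)" using yS ext2_dsum[OF x n yS m xy] by simp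
qed

lemma ext2_bounded: "freely_locally_bounded_on 2 S So (ext2 f)"
 unfolding freely_locally_bounded_on_def
proof
 fix w assume w: "w \<in> S"
 obtain V C0 where V: "openin (free_topology 2) V" "w \<in> V" and C0: "\<forall>x\<in>V \<inter> Soo. op_norm (f x) \<le> C0"
  using bdd w unfolding freely_locally_bounded_on_def bounded_values_on_def by blast
 have "op_norm (ext2 f x) \<le> max 0 C0" if x: "x \<in> V" "x \<in> So" for x
 proof -
  obtain n where n: "x \<in> pts 2 n" "n \<ge> 1" using S_level x(2) So_sub by blast
  obtain k where k: "dir x k" using dir_exists[OF x(2)] by blast
  have kc: "k \<in> Mat n" using dirD[OF k n(1)] .
  interpret L: lipschitz_setting 2 S Soo f x n by (rule lipschitz_Soo[OF x(2) n])
  show ?thesis by (rule L.limit_bounded[OF appr_shiftu[OF x(2) n k] ext2_conv[OF x(2) n k] V(1) x(1) C0])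
 qed
 then have "bounded_values_on (V \<inter> So) (ext2 f)" unfolding bounded_values_on_def by blast
 then show "\<exists>V. openin (free_topology 2) V \<and> w \<in> V \<and> bounded_values_on (V \<inter> So) (ext2 f)" using V by blast
qed

end

lemma determined_by_Soo:
 assumes f: "conditionally_nc 2 So f" "freely_locally_bounded_on 2 S So f"
  and g: "conditionally_nc 2 So g" "freely_locally_bounded_on 2 S So g"
  and eq: "\<And>w. w \<in> Soo ==> f w = g w" and w: "w \<in> So"
 shows "f w = g w"
proof -
 have r: "conditionally_nc 2 Soo h" "freely_locally_bounded_on 2 S Soo h" if "conditionally_nc 2 So h" "freely_locally_bounded_on 2 S So h" for h
 proof -
  show "conditionally_nc 2 Soo h" by (rule conditionally_nc_subset[OF that(1) Soo_sub])
  show "freely_locally_bounded_on 2 S Soo h" by (rule freely_locally_bounded_on_cong[OF that(2) Soo_sub refl])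
 qed
 obtain n where n: "w \<in> pts 2 n" "n \<ge> 1" using S_level w So_sub by blast
 obtain k where k: "dir w k" using dir_exists[OF w] by blast
 have kc: "k \<in> Mat n" using dirD[OF k n(1)] .
 have lim: "mconv n (\<lambda>m. h (shiftu k (tt m) w)) (h w)" if h: "conditionally_nc 2 So h" "freely_locally_bounded_on 2 S So h" for h
 proof -
  interpret L: lipschitz_setting 2 S So h w n using h S_open sim_closed_So So_sub w n by unfold_locales auto
  obtain M where M: "\<forall>m\<ge>M. \<forall>l\<ge>M. shiftu k (tt m) w \<in> Soo \<and> shiftu (0\<^sub>m n n) (tt l) w \<in> So \<and> point_dsum (shiftu k (tt m) w) (shiftu (0\<^sub>m n n) (tt l) w) \<in> Soo
   \<and> point_dsum (shiftu (0\<^sub>m n n) (tt l) w) (shiftu k (tt m) w) \<in> Soo" using shiftu_pair[OF w n k zero_carrier_mat] by (elim exE)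
  have p: "\<forall>\<^sub>F m in sequentially. point_dsum w (shiftu k (tt m) w) \<in> So"
   using M Soo_sub unfolding eventually_sequentially shiftu_zero_dir[OF n(1)] by blast
  have "\<forall>\<^sub>F m in sequentially. shiftu k (tt m) w \<in> So \<and> shiftu k (tt m) w \<in> pts 2 n"
   using M Soo_sub shiftu(1)[OF n(1) kc] unfolding eventually_sequentially by blast
  then have a: "L.appr (\<lambda>m. shiftu k (tt m) w)" unfolding L.appr_def using pdist_shiftu_limit[OF n(1) kc] by simp
  show ?thesis by (rule L.constant_limit[OF a w p])
 qed
 have "\<forall>\<^sub>F m in sequentially. f (shiftu k (tt m) w) = g (shiftu k (tt m) w)"
  using eventually_Soo(1)[OF r[OF f] w n k] by eventually_elim (rule eq)
 then have "mconv n (\<lambda>m. g (shiftu k (tt m) w)) (f w)" by (rule mconv_cong[OF lim[OF f]])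
 then show ?thesis using mconv_unique[OF lim[OF g]] by metis
qed

end

section \<open>Zariski-free holomorphy\<close>

lemma topspace_free: "d > 0 ==> topspace (free_topology d) = nc_space d"
 using openin_subset[OF openin_nc_space] openin_free_subset[OF openin_topspace] by blast

lemma pf_tuple_pts:
 assumes "\<And>i. i < d ==> pf e (\<psi> i)" "e > 0" "x \<in> pts e n" "n \<ge> 1"
 shows "map (\<lambda>i. \<psi> i x) [0..<d] \<in> pts d n"
 using pf_carrier[OF assms(1) assms(3,2,4)] by (intro ptsI) auto

text \<open>Continuity of polynomial maps: substitution turns the polynomials that define a basic
  set into polynomials of the new variables.\<close>

lemma openin_pf_preimage:
 assumes \<psi>: "\<And>i. i < d ==> pf e (\<psi> i)" and de: "d > 0" "e > 0" and V: "openin (free_topology d) V"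
 shows "openin (free_topology e) {x \<in> nc_space e. map (\<lambda>i. \<psi> i x) [0..<d] \<in> V}"
proof -
 let ?\<psi> = "\<lambda>x. map (\<lambda>i. \<psi> i x) [0..<d]"
 have lv: "?\<psi> x \<in> nc_space d \<and> mlevel (?\<psi> x) = mlevel x" if "x \<in> nc_space e" for x
 proof -
  have x: "x \<in> pts e (mlevel x)" "mlevel x \<ge> 1" using that de by (auto simp: nc_space_iff)
  have "?\<psi> x \<in> pts d (mlevel x)" by (rule pf_tuple_pts[OF \<psi> de(2) x])
  then show ?thesis using pts_nc_space[OF _ x(2)] pts_mlevel[OF _ de(1)] by blast
 qed
 have "continuous_map (free_topology e) (free_topology d) ?\<psi>" unfolding free_topology_def[of d]
 proof (rule continuous_on_generated_topo)
  fix U assume "U \<in> basic_free_set d ` {\<delta>. \<forall>p\<in>elements_mat \<delta>. free_poly_in d p}"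
  then obtain \<delta> where \<delta>: "U = basic_free_set d \<delta>" "valid_polys d {\<delta>}" by (auto simp: valid_polys_def)
  have "?\<psi> -` U \<inter> topspace (free_topology e) =
   {x \<in> nc_space e. op_norm (blockmat (dim_row \<delta>) (dim_col \<delta>) (mlevel x) (\<lambda>k l. eval_poly (\<delta> $$ (k, l)) (?\<psi> x))) < 1}"
   unfolding topspace_free[OF de(2)] \<delta>(1) basic_free_set_def eval_poly_mat_blockmat using lv by auto
  moreover have "pf e (\<lambda>x. eval_poly (\<delta> $$ (k, l)) (?\<psi> x))" if "k < dim_row \<delta>" "l < dim_col \<delta>" for k l
   by (rule pf_comp[OF pf_eval_poly[OF de(1)] de \<psi>]) (rule valid_polysD[OF \<delta>(2) singletonI that])
  ultimately show "openin (free_topology e) (?\<psi> -` U \<inter> topspace (free_topology e))"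
   using openin_blockmat[of "dim_row \<delta>" "dim_col \<delta>" e "\<lambda>k l x. eval_poly (\<delta> $$ (k, l)) (?\<psi> x)" 1] de by simp
 next
  have "\<Union> (basic_free_set d ` {\<delta>. \<forall>p\<in>elements_mat \<delta>. free_poly_in d p}) = nc_space d"
   using topspace_free[OF de(1)] unfolding free_topology_def by (simp only: topology_generated_by_topspace)
  then show "?\<psi> ` topspace (free_topology e) \<subseteq> \<Union> (basic_free_set d ` {\<delta>. \<forall>p\<in>elements_mat \<delta>. free_poly_in d p})"
   unfolding topspace_free[OF de(2)] using lv by auto
 qed
 from openin_continuous_map_preimage[OF this V] show ?thesis unfolding topspace_free[OF de(2)] .
qed

text \<open>Each inequation removes the free variety of a single function, and there are finitely
  many of them.\<close>

lemma zariski_openI: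
 assumes N: "openin (free_topology d) N" and G: "finite G" "\<And>g. g \<in> G ==> freely_holomorphic d N g"
 shows "openin (zariski_free_topology d) {x \<in> N. \<forall>g\<in>G. g x \<noteq> 0\<^sub>m (mlevel x) (mlevel x)}"
proof -
 let ?T = "\<lambda>g. {x \<in> N. \<forall>h\<in>{g}. h x = 0\<^sub>m (mlevel x) (mlevel x)}"
 have e: "{x \<in> N. \<forall>g\<in>G. g x \<noteq> 0\<^sub>m (mlevel x) (mlevel x)} = N - \<Union> (?T ` G)" by auto
 have "free_variety d N (?T g)" if "g \<in> G" for g
  unfolding free_variety_def using G(2)[OF that] by (intro exI[of _ "{g}"]) simp
 then have "\<forall>T\<in>?T ` G. free_variety d N T" unfolding ball_simps by (intro ballI)
 moreover have "finite (?T ` G)" using G(1) by (rule finite_imageI)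
 ultimately have "\<exists>D \<T>. N - \<Union> (?T ` G) = D - \<Union>\<T> \<and> free_domain d D \<and> finite \<T> \<and> (\<forall>T\<in>\<T>. free_variety d D T)"
  using N unfolding free_domain_def by (intro exI[of _ N] exI[of _ "?T ` G"] conjI refl)
 then show ?thesis unfolding e zariski_free_topology_def by (intro topology_generated_by_Basis CollectI)
qed

text \<open>Isolates what is used of the data \<open>U\<close> and \<open>X\<close> in the
  noncommutation condition, so that \<open>uu\<close> and the square of \<open>vv\<close> on S_oo,
  and the two coordinates in a chart, can be treated alike.\<close>

definition natural_map :: "(nc_point => complex mat) => bool" where
 "natural_map U \<longleftrightarrow> pf 2 U \<and>
  (\<forall>n m. \<forall>x\<in>pts 2 n. \<forall>y\<in>pts 2 m. U (point_dsum x y) = mat_dsum (U x) (U y)) \<and>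
  (\<forall>n. \<forall>x\<in>pts 2 n. \<forall>s\<in>GL n. U (conj_point s x) = conj_mat s (U x))"

lemma natural_mapD:
 assumes "natural_map U" shows "pf 2 U" "x \<in> pts 2 n ==> y \<in> pts 2 m ==> U (point_dsum x y) = mat_dsum (U x) (U y)"
  "x \<in> pts 2 n ==> s \<in> GL n ==> U (conj_point s x) = conj_mat s (U x)" "x \<in> pts 2 n ==> n \<ge> 1 ==> U x \<in> Mat n"
 using assms pf_carrier[of 2 U x n] unfolding natural_map_def by auto

lemma pf_uu_vv: "pf 2 uu" "pf 2 vv"
proof -
 have v: "pf 2 (\<lambda>x. x ! 0)" "pf 2 (\<lambda>x. x ! 1)" by (rule pf_var, simp)+
 show "pf 2 uu" using pf_scale[OF pf.add[OF v], of "1/2"] by (simp add: uu_def[abs_def])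
 show "pf 2 vv" using pf_scale[OF pf_minus[OF v], of "1/2"] by (simp add: vv_def[abs_def])
qed

lemma natural_uu: "natural_map uu"
 unfolding natural_map_def by (intro conjI allI ballI pf_uu_vv uu_vv_dsum uu_vv_conj)

lemma natural_xx: "natural_map (\<lambda>w. vv w * vv w)"
 unfolding natural_map_def
proof (intro conjI allI ballI)
 show "pf 2 (\<lambda>w. vv w * vv w)" by (rule pf_mult[OF pf_uu_vv(2) pf_uu_vv(2)]) simp
 fix n m x y assume x: "x \<in> pts 2 n" and y: "y \<in> pts 2 m"
 show "vv (point_dsum x y) * vv (point_dsum x y) = mat_dsum (vv x * vv x) (vv y * vv y)"
  unfolding uu_vv_dsum[OF x y] by (rule mat_dsum_mult[OF uu_vv_carrier(2)[OF x] uu_vv_carrier(2)[OF y] uu_vv_carrier(2)[OF x] uu_vv_carrier(2)[OF y]])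
next
 fix n x s assume x: "x \<in> pts 2 n" and s: "s \<in> GL n"
 show "vv (conj_point s x) * vv (conj_point s x) = conj_mat s (vv x * vv x)"
  unfolding uu_vv_conj[OF x s] by (rule conj_mat_mult[OF s uu_vv_carrier(2)[OF x] uu_vv_carrier(2)[OF x], symmetric])
qed

lemma natural_coordinate: "i < 2 ==> natural_map (\<lambda>p. p ! i)"
 unfolding natural_map_def
 by (intro conjI allI ballI pf_var) (auto simp: nth_dsum[OF ptsD(1) ptsD(1)] nth_conj[OF ptsD(1)])

context sqrt_branches
begin

text \<open>A freely open nc-set on which the calculus of \<open>X\<close> is defined and, for each
  holomorphic \<open>h\<close>, bounded over all levels. The set is chosen before \<open>h\<close>,
  so it serves all sign functions at once.\<close>

definition chart_nb :: "complex set => (nc_point => complex mat) => (nc_point => complex mat) => nc_point set => bool" where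
 "chart_nb \<gamma> U X N \<longleftrightarrow> openin (free_topology 2) N \<and> nc_set 2 N \<and> (\<forall>w\<in>N. spectrum (X w) \<subseteq> Delta r \<gamma>) \<and>
  (\<exists>K\<ge>0. \<forall>w\<in>N. op_norm (U w) \<le> K) \<and>
  (\<forall>h. h holomorphic_on Delta r \<gamma> --> (\<exists>K\<ge>0. \<forall>w\<in>N. op_norm (hol_calculus h (X w)) \<le> K))"

text \<open>The conditions in \<open>calculus_bound\<close> are strict bounds on norms of
  polynomials in the point, hence freely open. Passing to a basic neighbourhood makes the set closed
  under direct sums.\<close>

lemma chart_nb_exists:
 assumes g: "\<gamma> \<in> Gamma" and U: "natural_map U" and X: "natural_map X" and V: "openin (free_topology 2) V" "w \<in> V"
  and sp: "spectrum (X w) \<subseteq> Delta r \<gamma>"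
 obtains N where "chart_nb \<gamma> U X N" "w \<in> N" "N \<subseteq> V"
proof -
 interpret discs \<gamma> "r \<gamma>" by (rule discs_Gamma[OF g])
 have D: "Delta r \<gamma> = \<Delta>" by (rule Delta_discs[OF g])
 have wn: "w \<in> nc_space 2" using openin_free_subset[OF V(1)] V(2) by blast
 then obtain n where w: "w \<in> pts 2 n" "n \<ge> 1" by (auto simp: nc_space_pts)
 obtain p M where M: "M > 0" "pm p (X w) = 0\<^sub>m n n" "op_norm (X w) < M"
  and p: "\<And>m y. y \<in> Mat m ==> op_norm (pm p y) < 1 ==> spectrum y \<subseteq> \<Delta>"
  and K: "\<And>h. h holomorphic_on \<Delta> ==> \<exists>K\<ge>0. \<forall>m y. y \<in> Mat m --> op_norm (pm p y) < 1 --> op_norm y < M -->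
   op_norm (hol_calculus h y) \<le> K"
  using calculus_bound[OF natural_mapD(4)[OF X w] sp[unfolded D]] by metis
 define C where "C = op_norm (U w) + 1"
 have C: "C > 0" "op_norm (U w) < C" using op_norm_nonneg[OF natural_mapD(4)[OF U w]] by (auto simp: C_def)
 have d: "(2::nat) > 0" by simp
 define V' where "V' = V \<inter> {x \<in> nc_space 2. op_norm (pm p (X x)) < 1} \<inter> {x \<in> nc_space 2. op_norm (X x) < M} \<inter> {x \<in> nc_space 2. op_norm (U x) < C}"
 have "openin (free_topology 2) V'" unfolding V'_def
  by (intro openin_Int V(1) openin_pf d M(1) C(1) zero_less_one pf_pm natural_mapD(1)[OF X] natural_mapD(1)[OF U]) simp_all
 moreover have "w \<in> V'" using V(2) wn M C by (simp add: V'_def)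
 ultimately obtain F where F: "valid_polys 2 F" "w \<in> fnb 2 F" "fnb 2 F \<subseteq> V'" by (rule open_base)
 have N: "fnb 2 F \<subseteq> nc_space 2" by (auto simp: fnb_def)
 have B: "\<exists>m. X y \<in> Mat m \<and> op_norm (pm p (X y)) < 1 \<and> op_norm (X y) < M \<and> op_norm (U y) < C" if yF: "y \<in> fnb 2 F" for y
 proof -
  have "y \<in> V'" using F(3) yF by blast
  moreover obtain m where m: "y \<in> pts 2 m" "m \<ge> 1" using subsetD[OF N yF] by (auto simp: nc_space_pts)
  ultimately show ?thesis using natural_mapD(4)[OF X m] by (auto simp: V'_def)
 qed
 have "chart_nb \<gamma> U X (fnb 2 F)" unfolding chart_nb_def D
 proof (intro conjI ballI allI impI)
  show "openin (free_topology 2) (fnb 2 F)" by (rule fnb_open[OF F(1) d])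
  show "nc_set 2 (fnb 2 F)" unfolding nc_set_def using N fnb_dsum[OF F(1) _ _ d] by blast
  show "spectrum (X y) \<subseteq> \<Delta>" if "y \<in> fnb 2 F" for y using B[OF that] p by blast
  show "\<exists>K\<ge>0. \<forall>w\<in>fnb 2 F. op_norm (U w) \<le> K" using B C(1) by (intro exI[of _ C]) (auto intro: less_imp_le)
  fix h assume "h holomorphic_on \<Delta>"
  then obtain K0 where "K0 \<ge> 0" "\<forall>m y. y \<in> Mat m --> op_norm (pm p y) < 1 --> op_norm y < M --> op_norm (hol_calculus h y) \<le> K0"
   using K by blast
  then show "\<exists>K\<ge>0. \<forall>w\<in>fnb 2 F. op_norm (hol_calculus h (X w)) \<le> K" using B by (intro exI[of _ K0]) blast
 qed
 then show thesis using that F(2,3) unfolding V'_def by blast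
qed

text \<open>The points of \<open>N\<close> at which \<open>nonc\<close> fails form a finite union of
  zero sets of these commutators, so the remaining points form a basic Zariski-free set.\<close>

lemma commutator_freely_holomorphic:
 assumes g: "\<gamma> \<in> Gamma" and U: "natural_map U" and X: "natural_map X" and N: "chart_nb \<gamma> U X N"
 shows "freely_holomorphic 2 N (\<lambda>w. U w * I_fun r \<gamma> \<tau> (X w) - I_fun r \<gamma> \<tau> (X w) * U w)"
proof -
 let ?I = "\<lambda>w. I_fun r \<gamma> \<tau> (X w)" and ?g = "\<lambda>w. U w * I_fun r \<gamma> \<tau> (X w) - I_fun r \<gamma> \<tau> (X w) * U w"
 have oN: "openin (free_topology 2) N" and ncN: "nc_set 2 N" and sp: "\<And>w. w \<in> N ==> spectrum (X w) \<subseteq> Delta r \<gamma>"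
  using N unfolding chart_nb_def by auto
 obtain K1 where K1: "K1 \<ge> 0" "\<forall>w\<in>N. op_norm (U w) \<le> K1" using N unfolding chart_nb_def by auto
 obtain K2 where K2: "K2 \<ge> 0" "\<forall>w\<in>N. op_norm (?I w) \<le> K2"
  using N iota_holomorphic[OF g, of \<tau>] unfolding chart_nb_def I_fun_def by blast
 have lv: "\<exists>n\<ge>1. w \<in> pts 2 n" if "w \<in> N" for w using ncN that unfolding nc_set_def by (auto simp: nc_space_pts)
 have c: "U w \<in> Mat n" "?I w \<in> Mat n" "U w * ?I w \<in> Mat n" "?I w * U w \<in> Mat n"
  if "w \<in> pts 2 n" "n \<ge> 1" for w n
  using natural_mapD(4)[OF U that] I_fun_carrier[OF natural_mapD(4)[OF X that], of \<gamma> \<tau>] by auto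
 have gr: "graded N ?g" unfolding graded_def
 proof
  fix w assume "w \<in> N"
  then obtain n where n: "w \<in> pts 2 n" "n \<ge> 1" using lv by blast
  show "?g w \<in> carrier_mat (mlevel w) (mlevel w)" unfolding pts_mlevel[OF n(1) zero_less_numeral] using c[OF n] by simp
 qed
 have ds: "?g (point_dsum x y) = mat_dsum (?g x) (?g y)" if xy: "x \<in> N" "y \<in> N" for x y
 proof -
  obtain n m where n: "x \<in> pts 2 n" "n \<ge> 1" and m: "y \<in> pts 2 m" "m \<ge> 1" using lv xy by blast
  note cx = c[OF n] and cy = c[OF m]
  have "?I (point_dsum x y) = mat_dsum (?I x) (?I y)" unfolding natural_mapD(2)[OF X n(1) m(1)]
   by (rule I_fun_dsum[OF g natural_mapD(4)[OF X n] natural_mapD(4)[OF X m] sp[OF xy(1)] sp[OF xy(2)]])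
  then show ?thesis unfolding natural_mapD(2)[OF U n(1) m(1)]
   by (simp only: mat_dsum_mult[OF cx(1) cy(1) cx(2) cy(2)] mat_dsum_mult[OF cx(2) cy(2) cx(1) cy(1)] mat_dsum_minus[OF cx(3) cy(3) cx(4) cy(4)])
 qed
 have ps: "preserves_similarity N ?g" unfolding preserves_similarity_def
 proof (intro ballI impI)
  fix x s assume x: "x \<in> N" and s: "s \<in> GL (mlevel x)" and "conj_point s x \<in> N"
  obtain n where n: "x \<in> pts 2 n" "n \<ge> 1" using lv x by blast
  have s: "s \<in> GL n" using s pts_mlevel[OF n(1)] by simp
  note cx = c[OF n]
  have "?I (conj_point s x) = conj_mat s (?I x)" unfolding natural_mapD(3)[OF X n(1) s]
   by (rule I_fun_conj[OF g natural_mapD(4)[OF X n] s sp[OF x]])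
  then show "?g (conj_point s x) = conj_mat s (?g x)" unfolding natural_mapD(3)[OF U n(1) s]
   by (simp only: conj_mat_mult[OF s cx(1,2)] conj_mat_mult[OF s cx(2,1)] conj_mat_minus[OF s cx(3,4)])
 qed
 have "op_norm (?g w) \<le> K1 * K2 + K2 * K1" if w: "w \<in> N" for w
 proof -
  obtain n where n: "w \<in> pts 2 n" "n \<ge> 1" using lv w by blast
  note cw = c[OF n] and nn = op_norm_nonneg[OF c(1)[OF n]] op_norm_nonneg[OF c(2)[OF n]]
  have "op_norm (U w) * op_norm (?I w) \<le> K1 * K2" "op_norm (?I w) * op_norm (U w) \<le> K2 * K1"
   using K1 K2 w nn by (auto intro!: mult_mono)
  then show ?thesis
   using op_norm_minus[OF cw(3,4)] op_norm_mult[OF cw(1,2)] op_norm_mult[OF cw(2,1)] by linarith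
 qed
 then have bd: "bounded_values_on N ?g" unfolding bounded_values_on_def by blast
 have nf: "nc_function 2 N ?g" unfolding nc_function_def by (intro conjI ballI ncN gr ps ds)
 show ?thesis unfolding freely_holomorphic_def tau_holomorphic_def
 proof (intro conjI ballI oN gr)
  fix x assume x: "x \<in> N"
  show "\<exists>U. openin (free_topology 2) U \<and> x \<in> U \<and> U \<subseteq> N \<and> nc_function 2 U ?g"
   by (rule exI[of _ N]) (intro conjI oN x order_refl nf)
  show "\<exists>U. openin (free_topology 2) U \<and> x \<in> U \<and> U \<subseteq> N \<and> bounded_values_on U ?g"
   by (rule exI[of _ N]) (intro conjI oN x order_refl bd)
 qed
qed

lemma nonc_zariski_open:
 assumes g: "\<gamma> \<in> Gamma" and U: "natural_map U" and X: "natural_map X" and N: "chart_nb \<gamma> U X N"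
 shows "openin (zariski_free_topology 2) {w \<in> N. nonc \<gamma> (U w) (X w)}" "nc_set 2 {w \<in> N. nonc \<gamma> (U w) (X w)}"
proof -
 let ?g = "\<lambda>\<tau> w. U w * I_fun r \<gamma> \<tau> (X w) - I_fun r \<gamma> \<tau> (X w) * U w"
 let ?T = "{\<tau> \<in> signs \<gamma>. \<not> \<tau> constant_on \<gamma>}"
 have oN: "openin (free_topology 2) N" and ncN: "nc_set 2 N" and sp: "\<And>w. w \<in> N ==> spectrum (X w) \<subseteq> Delta r \<gamma>"
  using N unfolding chart_nb_def by auto
 have lv: "\<exists>n\<ge>1. w \<in> pts 2 n" if "w \<in> N" for w using ncN that unfolding nc_set_def by (auto simp: nc_space_pts)
 have "finite (signs \<gamma>)" unfolding signs_def using Gamma_facts(1)[OF g] by (intro finite_PiE) auto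
 then have fin: "finite (?g ` ?T)" by simp
 have "(\<forall>h\<in>?g ` ?T. h w \<noteq> 0\<^sub>m (mlevel w) (mlevel w)) \<longleftrightarrow> nonc \<gamma> (U w) (X w)" if w: "w \<in> N" for w
 proof -
  obtain n where n: "w \<in> pts 2 n" "n \<ge> 1" using lv w by blast
  have "?g \<tau> w = 0\<^sub>m n n \<longleftrightarrow> U w * I_fun r \<gamma> \<tau> (X w) = I_fun r \<gamma> \<tau> (X w) * U w" for \<tau>
  proof -
   have c: "U w * I_fun r \<gamma> \<tau> (X w) \<in> Mat n" "I_fun r \<gamma> \<tau> (X w) * U w \<in> Mat n"
    using natural_mapD(4)[OF U n] I_fun_carrier[OF natural_mapD(4)[OF X n], of \<gamma> \<tau>] by auto
   have "A - B = 0\<^sub>m n n \<longleftrightarrow> A = B" if "A \<in> Mat n" "B \<in> Mat n" for A B :: "complex mat"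
    using that by (auto simp: mat_eq_iff)
   then show ?thesis using c by blast
  qed
  then show ?thesis unfolding nonc_def pts_mlevel[OF n(1) zero_less_numeral] by auto
 qed
 then have e: "{w \<in> N. \<forall>h\<in>?g ` ?T. h w \<noteq> 0\<^sub>m (mlevel w) (mlevel w)} = {w \<in> N. nonc \<gamma> (U w) (X w)}"
  by (intro Collect_cong conj_cong refl)
 show "openin (zariski_free_topology 2) {w \<in> N. nonc \<gamma> (U w) (X w)}"
  unfolding e[symmetric] using commutator_freely_holomorphic[OF g U X N] by (intro zariski_openI oN fin) auto
 show "nc_set 2 {w \<in> N. nonc \<gamma> (U w) (X w)}" unfolding nc_set_def
 proof (intro conjI ballI)
  show "{w \<in> N. nonc \<gamma> (U w) (X w)} \<subseteq> nc_space 2" using ncN unfolding nc_set_def by auto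
  fix x y assume "x \<in> {w \<in> N. nonc \<gamma> (U w) (X w)}" "y \<in> {w \<in> N. nonc \<gamma> (U w) (X w)}"
  then have x: "x \<in> N" "nonc \<gamma> (U x) (X x)" and y: "y \<in> N" by auto
  obtain n m where n: "x \<in> pts 2 n" "n \<ge> 1" and m: "y \<in> pts 2 m" "m \<ge> 1" using lv x y by blast
  have "nonc \<gamma> (U (point_dsum x y)) (X (point_dsum x y))"
   unfolding natural_mapD(2)[OF U n(1) m(1)] natural_mapD(2)[OF X n(1) m(1)]
   by (rule nonc_dsum[OF g natural_mapD(4)[OF X n] natural_mapD(4)[OF U n] natural_mapD(4)[OF X m] natural_mapD(4)[OF U m] sp[OF x(1)] sp[OF y] disjI1[OF x(2)]])
  then show "point_dsum x y \<in> {w \<in> N. nonc \<gamma> (U w) (X w)}" using ncN x(1) y unfolding nc_set_def by blast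
 qed
qed

text \<open>The noncommuting part of a \<open>chart_nb\<close> is Zariski-freely open and an nc-set.
  Neighbourhoods of this kind yield at once the openness of \<open>D\<close>, the local nc property
  and the local bound.\<close>

lemma zariski_holomorphicI:
 assumes gr: "graded D h"
  and loc: "\<And>w. w \<in> D ==> \<exists>\<gamma>\<in>Gamma. \<exists>U X N. natural_map U \<and> natural_map X \<and> chart_nb \<gamma> U X N \<and> w \<in> {w \<in> N. nonc \<gamma> (U w) (X w)} \<and>
   {w \<in> N. nonc \<gamma> (U w) (X w)} \<subseteq> D \<and> bounded_values_on {w \<in> N. nonc \<gamma> (U w) (X w)} h"
  and ds: "\<And>x y. x \<in> D ==> y \<in> D ==> point_dsum x y \<in> D ==> point_dsum y x \<in> D ==> h (point_dsum x y) = mat_dsum (h x) (h y)"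
  and ps: "preserves_similarity D h"
 shows "zariski_freely_holomorphic 2 D h"
proof -
 have Z: "\<exists>Z. openin (zariski_free_topology 2) Z \<and> w \<in> Z \<and> Z \<subseteq> D \<and> nc_function 2 Z h \<and> bounded_values_on Z h" if w: "w \<in> D" for w
 proof -
  obtain \<gamma> U X N where *: "\<gamma> \<in> Gamma" "natural_map U" "natural_map X" "chart_nb \<gamma> U X N" and
   Z: "w \<in> {w \<in> N. nonc \<gamma> (U w) (X w)}" "{w \<in> N. nonc \<gamma> (U w) (X w)} \<subseteq> D" "bounded_values_on {w \<in> N. nonc \<gamma> (U w) (X w)} h"
   using loc[OF w] by (elim bexE exE conjE)
  define A where "A = {w \<in> N. nonc \<gamma> (U w) (X w)}"
  note A = nonc_zariski_open[OF *, folded A_def] and Z = Z[folded A_def]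
  have "nc_function 2 A h" unfolding nc_function_def
  proof (intro conjI ballI A(2))
   show "graded A h" using gr Z(2) unfolding graded_def by blast
   show "preserves_similarity A h" using ps Z(2) unfolding preserves_similarity_def by blast
   fix x y assume "x \<in> A" "y \<in> A"
   moreover from this have "point_dsum x y \<in> A" "point_dsum y x \<in> A" using A(2) unfolding nc_set_def by blast+
   ultimately show "h (point_dsum x y) = mat_dsum (h x) (h y)" by (intro ds subsetD[OF Z(2)])
  qed
  then show ?thesis using A(1) Z by (intro exI[of _ A] conjI)
 qed
 then have "openin (zariski_free_topology 2) D" by (subst openin_subopen) blast
 then show ?thesis unfolding zariski_freely_holomorphic_def tau_holomorphic_def using Z gr by blast
qed

end

context nc_symmetric
begin

context
 fixes f assumes f: "conditionally_nc 2 S f" and bdd: "freely_locally_bounded_on 2 S S f"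
begin

text \<open>The pair of \<open>\<gamma>\<close> and \<open>\<tau>\<close> that works at a point
  keeps working nearby: the spectrum of v stays in the open set
  \<open>branch \<gamma> \<tau>\<close>, which is enforced by the norm of a polynomial in v, and
  then v is recovered from its square by the same root function.\<close>

lemma Soo_zariski_holomorphic: "zariski_freely_holomorphic 2 Soo f"
proof (rule zariski_holomorphicI)
 have SS: "Soo \<subseteq> S" using Soo_sub So_sub by blast
 show "graded Soo f" "preserves_similarity Soo f"
  using conditionally_nc_subset[OF f SS] unfolding conditionally_nc_def by auto
 show "f (point_dsum x y) = mat_dsum (f x) (f y)" if "x \<in> Soo" "y \<in> Soo" "point_dsum x y \<in> Soo" "point_dsum y x \<in> Soo" for x y
  by (rule conditionally_nc_dsum[OF f zero_less_numeral]) (use that SS in blast)+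
 fix w assume "w \<in> Soo"
 then obtain \<gamma> \<tau> where w: "w \<in> S" and g: "\<gamma> \<in> Gamma" and t: "\<tau> \<in> signs \<gamma>" and sp: "spectrum (xx w) \<subseteq> Delta r \<gamma>"
  and v: "S_fun r q \<gamma> \<tau> (xx w) = vv w" and nc: "nonc \<gamma> (uu w) (xx w)"
  unfolding Soo_iff by (elim conjE bexE)
 obtain n where n: "w \<in> pts 2 n" "n \<ge> 1" using S_level w by blast
 have wn: "w \<in> nc_space 2" by (rule pts_nc_space[OF n])
 have "spectrum (vv w) \<subseteq> branch \<gamma> \<tau>" using spectrum_S_fun_branch[OF g t xx_carrier[OF n(1)] sp] unfolding v .
 then obtain p where p: "pm p (vv w) = 0\<^sub>m n n" "\<And>z. z \<notin> branch \<gamma> \<tau> ==> cmod (poly p z) \<ge> 2"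
  using annihilating_poly_large_off[OF uu_vv_carrier(2)[OF n(1)] open_branch[OF g]] by metis
 obtain V0 C where V0: "openin (free_topology 2) V0" "w \<in> V0" and C: "\<forall>x\<in>V0 \<inter> S. op_norm (f x) \<le> C"
  using bdd w unfolding freely_locally_bounded_on_def bounded_values_on_def by blast
 define V where "V = V0 \<inter> S \<inter> {x \<in> nc_space 2. op_norm (pm p (vv x)) < 1}"
 have V: "openin (free_topology 2) V" unfolding V_def
  by (intro openin_Int V0(1) S_open openin_pf pf_pm pf_uu_vv) simp_all
 have wV: "w \<in> V" using V0(2) w wn p(1) by (simp add: V_def)
 obtain N where N: "chart_nb \<gamma> uu (\<lambda>w. vv w * vv w) N" "w \<in> N" "N \<subseteq> V"
  by (rule chart_nb_exists[OF g natural_uu natural_xx V wV sp])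
 have sub: "{w \<in> N. nonc \<gamma> (uu w) (xx w)} \<subseteq> Soo"
 proof
  fix y assume "y \<in> {w \<in> N. nonc \<gamma> (uu w) (xx w)}"
  then have y: "y \<in> V" "nonc \<gamma> (uu y) (xx y)" using N(3) by auto
  then have yS: "y \<in> S" and yp: "op_norm (pm p (vv y)) < 1" by (auto simp: V_def)
  obtain m where m: "y \<in> pts 2 m" "m \<ge> 1" using S_level yS by blast
  have "spectrum (vv y) \<subseteq> branch \<gamma> \<tau>"
  proof
   fix z assume "z \<in> spectrum (vv y)"
   from poly_spectrum_le[OF uu_vv_carrier(2)[OF m(1)] this, of p] have "cmod (poly p z) < 2" using yp by simp
   then show "z \<in> branch \<gamma> \<tau>" using p(2)[of z] by (meson not_le)
  qed
  from S_fun_branch[OF g t uu_vv_carrier(2)[OF m(1)] this] show "y \<in> Soo" unfolding Soo_iff using yS g t y(2) by blast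
 qed
 have "bounded_values_on {w \<in> N. nonc \<gamma> (uu w) (xx w)} f" unfolding bounded_values_on_def
 proof (intro exI[of _ C] ballI)
  fix y assume "y \<in> {w \<in> N. nonc \<gamma> (uu w) (xx w)}"
  then have "y \<in> V0 \<inter> S" using N(3) by (auto simp: V_def)
  then show "op_norm (f y) \<le> C" using C by blast
 qed
 moreover have "w \<in> {w \<in> N. nonc \<gamma> (uu w) (xx w)}" using N(2) nc by simp
 ultimately show "\<exists>\<gamma>\<in>Gamma. \<exists>U X N. natural_map U \<and> natural_map X \<and> chart_nb \<gamma> U X N \<and> w \<in> {w \<in> N. nonc \<gamma> (U w) (X w)} \<and>
   {w \<in> N. nonc \<gamma> (U w) (X w)} \<subseteq> Soo \<and> bounded_values_on {w \<in> N. nonc \<gamma> (U w) (X w)} f"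
  by - (rule bexI[OF _ g], rule exI[of _ uu], rule exI[of _ "\<lambda>w. vv w * vv w"], rule exI[of _ N], intro conjI natural_uu natural_xx N(1) sub)
qed

end

abbreviation "om \<equiv> omega r q"

lemma omega_facts:
 assumes g: "\<gamma> \<in> Gamma" and t: "\<tau> \<in> signs \<gamma>" and p: "p \<in> pts 2 n" "n \<ge> 1" "spectrum (p ! 1) \<subseteq> Delta r \<gamma>"
 shows "om \<gamma> \<tau> p \<in> pts 2 n" "uu (om \<gamma> \<tau> p) = p ! 0" "vv (om \<gamma> \<tau> p) = S_fun r q \<gamma> \<tau> (p ! 1)" "xx (om \<gamma> \<tau> p) = p ! 1"
  "Phi r q \<gamma> \<tau> p = pi_map (om \<gamma> \<tau> p)" "p \<in> W_dom r \<gamma>"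
proof -
 have c: "p ! 0 \<in> Mat n" "p ! 1 \<in> Mat n" using ptsD(2)[OF p(1)] by auto
 note s = S_fun_facts[OF g t c(2) p(3)]
 show 1: "om \<gamma> \<tau> p \<in> pts 2 n" unfolding omega_mkw using c s(1) by simp
 show 2: "uu (om \<gamma> \<tau> p) = p ! 0" "vv (om \<gamma> \<tau> p) = S_fun r q \<gamma> \<tau> (p ! 1)" unfolding omega_mkw using uu_vv_mkw[OF c(1) s(1)] by auto
 then show "xx (om \<gamma> \<tau> p) = p ! 1" using s(2) by simp
 show "Phi r q \<gamma> \<tau> p = pi_map (om \<gamma> \<tau> p)" unfolding pi_map_uu_vv[OF 1] 2 s(2) Phi_def Let_def ..
 show "p \<in> W_dom r \<gamma>" using pts_nc_space[OF p(1,2)] c p(2,3) by (auto simp: W_dom_def D_dom_def)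
qed

abbreviation "Ud \<equiv> U_chart r q S"

lemma U_chart_iff:
 assumes "p \<in> pts 2 n" "n \<ge> 1" "\<gamma> \<in> Gamma" "\<tau> \<in> signs \<gamma>"
 shows "p \<in> Ud \<gamma> \<tau> \<longleftrightarrow> spectrum (p ! 1) \<subseteq> Delta r \<gamma> \<and> nonc \<gamma> (p ! 0) (p ! 1) \<and> om \<gamma> \<tau> p \<in> S"
 using omega_facts(6)[OF assms(3,4,1,2)] W_domD[of p \<gamma>] by (auto simp: U_chart_def U_dom_nonc)

lemma U_chart_level: "p \<in> Ud \<gamma> \<tau> ==> \<exists>n\<ge>1. p \<in> pts 2 n"
 using W_domD[of p \<gamma>] by (auto simp: U_chart_def U_dom_nonc)

lemma omega_Soo:
 assumes g: "\<gamma> \<in> Gamma" and t: "\<tau> \<in> signs \<gamma>" and p: "p \<in> Ud \<gamma> \<tau>"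
 shows "om \<gamma> \<tau> p \<in> Soo"
 using g t p unfolding S_oo_def U_chart_def by blast

lemma omega_dsum:
 assumes g: "\<gamma> \<in> Gamma" and t: "\<tau> \<in> signs \<gamma>" and x: "x \<in> pts 2 n" "n \<ge> 1" "spectrum (x ! 1) \<subseteq> Delta r \<gamma>"
  and y: "y \<in> pts 2 m" "m \<ge> 1" "spectrum (y ! 1) \<subseteq> Delta r \<gamma>"
 shows "om \<gamma> \<tau> (point_dsum x y) = point_dsum (om \<gamma> \<tau> x) (om \<gamma> \<tau> y)"
proof (rule pts2_uu_vv_eqI)
 have c: "x ! 1 \<in> Mat n" "y ! 1 \<in> Mat m" using ptsD(2)[OF x(1), of 1] ptsD(2)[OF y(1), of 1] by auto
 have nd: "point_dsum x y ! 0 = mat_dsum (x ! 0) (y ! 0)" "point_dsum x y ! 1 = mat_dsum (x ! 1) (y ! 1)"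
  using nth_dsum[OF ptsD(1)[OF x(1)] ptsD(1)[OF y(1)]] by auto
 have sp: "spectrum (point_dsum x y ! 1) \<subseteq> Delta r \<gamma>" unfolding nd spectrum_dsum[OF c] using x(3) y(3) by simp
 have nm: "n + m \<ge> 1" using x(2) by simp
 note o = omega_facts[OF g t x] and o' = omega_facts[OF g t y] and o2 = omega_facts[OF g t pts_dsum[OF x(1) y(1)] nm sp]
 show "om \<gamma> \<tau> (point_dsum x y) \<in> pts 2 (n + m)" by (rule o2(1))
 show "point_dsum (om \<gamma> \<tau> x) (om \<gamma> \<tau> y) \<in> pts 2 (n + m)" using o(1) o'(1) by simp
 show "uu (om \<gamma> \<tau> (point_dsum x y)) = uu (point_dsum (om \<gamma> \<tau> x) (om \<gamma> \<tau> y))"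
  unfolding uu_vv_dsum[OF o(1) o'(1)] o2(2) o(2) o'(2) nd ..
 show "vv (om \<gamma> \<tau> (point_dsum x y)) = vv (point_dsum (om \<gamma> \<tau> x) (om \<gamma> \<tau> y))"
  unfolding uu_vv_dsum[OF o(1) o'(1)] o2(3) o(3) o'(3) nd by (rule S_fun_dsum[OF g c x(3) y(3)])
qed

lemma omega_conj:
 assumes g: "\<gamma> \<in> Gamma" and t: "\<tau> \<in> signs \<gamma>" and x: "x \<in> pts 2 n" "n \<ge> 1" "spectrum (x ! 1) \<subseteq> Delta r \<gamma>" and s: "s \<in> GL n"
 shows "om \<gamma> \<tau> (conj_point s x) = conj_point s (om \<gamma> \<tau> x)"
proof (rule pts2_uu_vv_eqI)
 have c: "x ! 1 \<in> Mat n" using ptsD(2)[OF x(1), of 1] by auto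
 have nd: "conj_point s x ! 0 = conj_mat s (x ! 0)" "conj_point s x ! 1 = conj_mat s (x ! 1)"
  using nth_conj[OF ptsD(1)[OF x(1)]] by auto
 have sp: "spectrum (conj_point s x ! 1) \<subseteq> Delta r \<gamma>" unfolding nd spectrum_conj[OF s c] using x(3) .
 note o = omega_facts[OF g t x] and o2 = omega_facts[OF g t pts_conj[OF x(1) s] x(2) sp]
 show "om \<gamma> \<tau> (conj_point s x) \<in> pts 2 n" by (rule o2(1))
 show "conj_point s (om \<gamma> \<tau> x) \<in> pts 2 n" using o(1) s by simp
 show "uu (om \<gamma> \<tau> (conj_point s x)) = uu (conj_point s (om \<gamma> \<tau> x))" unfolding uu_vv_conj[OF o(1) s] o2(2) o(2) nd ..
 show "vv (om \<gamma> \<tau> (conj_point s x)) = vv (conj_point s (om \<gamma> \<tau> x))"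
  unfolding uu_vv_conj[OF o(1) s] o2(3) o(3) nd by (rule S_fun_conj[OF g c s x(3)])
qed

text \<open>Near a point, \<open>S\<^sub>\<gamma>\<^sub>\<tau>(x)\<close> is uniformly close to a polynomial in \<open>x\<close>, namely to the interpolation
 polynomial of the square root at the eigenvalues of the point.\<close>

lemma omega_neighbourhood:
 assumes g: "\<gamma> \<in> Gamma" and t: "\<tau> \<in> signs \<gamma>" and p: "p \<in> pts 2 n" "n \<ge> 1" "spectrum (p ! 1) \<subseteq> Delta r \<gamma>"
  and V: "openin (free_topology 2) V" "om \<gamma> \<tau> p \<in> V"
 obtains N where "openin (free_topology 2) N" "p \<in> N" "\<And>y. y \<in> N ==> spectrum (y ! 1) \<subseteq> Delta r \<gamma> ==> om \<gamma> \<tau> y \<in> V"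
proof -
 have d: "(2::nat) > 0" by simp
 have c: "p ! 0 \<in> Mat n" "p ! 1 \<in> Mat n" using ptsD(2)[OF p(1)] by auto
 have pn: "p \<in> nc_space 2" by (rule pts_nc_space[OF p(1,2)])
 obtain N1 \<eta> where N1: "openin (free_topology 2) N1" "om \<gamma> \<tau> p \<in> N1" and \<eta>: "\<eta> > 0"
  and near: "\<And>m y z. m \<ge> 1 ==> y \<in> N1 ==> y \<in> pts 2 m ==> z \<in> pts 2 m ==> pdist z y < \<eta> ==> z \<in> V"
  by (rule uniform_interior[OF V omega_facts(1)[OF g t p] d]) blast
 interpret P: hc_setting "p ! 1" n "Delta r \<gamma>" using c(2) open_Delta[OF g] p(3) by unfold_locales
 obtain P h where h: "h holomorphic_on Delta r \<gamma>" and eq: "\<And>z. z \<in> Delta r \<gamma> ==> root \<gamma> \<tau> z = poly P z + poly (char_poly (p ! 1)) z * h z"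
  using P.char_poly_division[OF root_holomorphic[OF g]] by blast
 define Q where "Q = char_poly (p ! 1)"
 have nat: "natural_map (\<lambda>x. x ! 0)" "natural_map (\<lambda>x. x ! 1)" by (rule natural_coordinate, simp)+
 obtain N0 where N0: "chart_nb \<gamma> (\<lambda>x. x ! 0) (\<lambda>x. x ! 1) N0" "p \<in> N0"
  using chart_nb_exists[OF g nat openin_nc_space[OF d] pn p(3)] by metis
 obtain K where K: "K \<ge> 0" "\<forall>w\<in>N0. op_norm (hol_calculus h (w ! 1)) \<le> K" using N0(1) h unfolding chart_nb_def by blast
 \<comment> \<open>The map \<open>om\<close> and its polynomial approximation will differ in both
   coordinates by an error of norm at most \<open>\<epsilon> * K\<close>, hence by less than
   \<open>\<eta>\<close> in total.\<close>
 define \<epsilon> where "\<epsilon> = \<eta> / (2 * (K + 1))"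
 have \<epsilon>: "\<epsilon> > 0" "2 * (\<epsilon> * K) < \<eta>" using \<eta> K(1) by (auto simp: \<epsilon>_def field_simps)
 define \<psi> where "\<psi> i x = (if i = 0 then x ! 0 + pm P (x ! 1) else x ! 0 - pm P (x ! 1))" for i :: nat and x :: nc_point
 have v: "pf 2 (\<lambda>x. x ! 0)" "pf 2 (\<lambda>x. x ! 1)" by (rule pf_var, simp)+
 have \<psi>: "pf 2 (\<psi> i)" for i
  using pf.add[OF v(1) pf_pm[OF v(2) d, of P]] pf_minus[OF v(1) pf_pm[OF v(2) d, of P] d] by (cases "i = 0") (auto simp: \<psi>_def[abs_def])
 let ?\<psi> = "\<lambda>x. map (\<lambda>i. \<psi> i x) [0..<2]"
 have \<psi>e: "?\<psi> x = mkw (x ! 0) (pm P (x ! 1))" for x by (simp add: \<psi>_def mkw_def upt_rec)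
 \<comment> \<open>\<open>pm Q x\<close> vanishes at the given point and, as a polynomial, is small
   on a free neighbourhood of it, while the other factor of the error is bounded on
   \<open>N0\<close>.\<close>
 have S: "S_fun r q \<gamma> \<tau> x = pm P x + pm Q x * hol_calculus h x" if x: "x \<in> Mat m" "spectrum x \<subseteq> Delta r \<gamma>" for x m
 proof -
  interpret X: hc_setting x m "Delta r \<gamma>" using x open_Delta[OF g] by unfold_locales
  have "hol_calculus (root \<gamma> \<tau>) x = hol_calculus (\<lambda>z. poly P z + poly Q z * h z) x" by (rule X.hc_cong) (simp add: eq Q_def)
  also have "\<dots> = pm P x + pm Q x * hol_calculus h x"
   using h by (subst X.hc_add) (auto intro!: holomorphic_intros simp: X.hc_poly X.hc_poly_mult)
  finally show ?thesis unfolding S_fun_def .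
 qed
 define N where "N = N0 \<inter> {x \<in> nc_space 2. ?\<psi> x \<in> N1} \<inter> {x \<in> nc_space 2. op_norm (pm Q (x ! 1)) < \<epsilon>}"
 have oN: "openin (free_topology 2) N" unfolding N_def
  using N0(1) openin_pf_preimage[OF \<psi> d d N1(1)] openin_pf[OF pf_pm[OF v(2) d] d \<epsilon>(1)] unfolding chart_nb_def by (intro openin_Int) auto
 have Q0: "pm Q (p ! 1) = 0\<^sub>m n n" unfolding Q_def by (rule P.cayley_hamilton_pm)
 have "?\<psi> p = om \<gamma> \<tau> p" unfolding \<psi>e omega_mkw S[OF c(2) p(3)] Q0
   left_mult_zero_mat[OF hc_carrier[OF c(2)]] right_add_zero_mat[OF pm_carrier[OF c(2)]] ..
 then have pN: "p \<in> N" using N0(2) N1(2) pn Q0 \<epsilon>(1) by (simp add: N_def)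
 have "om \<gamma> \<tau> y \<in> V" if y: "y \<in> N" and sp: "spectrum (y ! 1) \<subseteq> Delta r \<gamma>" for y
 proof -
  have y': "y \<in> N0" "y \<in> nc_space 2" "?\<psi> y \<in> N1" "op_norm (pm Q (y ! 1)) < \<epsilon>" using y by (auto simp: N_def)
  obtain m where m: "y \<in> pts 2 m" "m \<ge> 1" using y'(2) by (auto simp: nc_space_pts)
  have cy: "y ! 0 \<in> Mat m" "y ! 1 \<in> Mat m" using ptsD(2)[OF m(1)] by auto
  let ?E = "pm Q (y ! 1) * hol_calculus h (y ! 1)"
  have E: "?E \<in> Mat m" "pm P (y ! 1) \<in> Mat m" using cy(2) by auto
  have nE: "op_norm ?E \<le> \<epsilon> * K"
  proof -
   have "op_norm ?E \<le> op_norm (pm Q (y ! 1)) * op_norm (hol_calculus h (y ! 1))"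
    by (rule op_norm_mult[OF pm_carrier[OF cy(2)] hc_carrier[OF cy(2)]])
   also have "\<dots> \<le> \<epsilon> * K" using y'(1,4) K \<epsilon>(1) op_norm_nonneg[OF hc_carrier[OF cy(2)]] by (intro mult_mono) auto
   finally show ?thesis .
  qed
  have py: "?\<psi> y \<in> pts 2 m" unfolding \<psi>e using cy(1) E(2) by simp
  have oy: "om \<gamma> \<tau> y \<in> pts 2 m" by (rule omega_facts(1)[OF g t m sp])
  have "om \<gamma> \<tau> y ! 0 - ?\<psi> y ! 0 = ?E" "om \<gamma> \<tau> y ! 1 - ?\<psi> y ! 1 = (-1) \<cdot>\<^sub>m ?E"
   unfolding \<psi>e omega_mkw S[OF cy(2) sp] mkw_def using cy(1) carrier_matD[OF cy(1)] carrier_matD[OF E(1)] carrier_matD[OF E(2)]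
   by (auto intro!: eq_matI simp del: index_mult_mat)
  then have "pdist (om \<gamma> \<tau> y) (?\<psi> y) = 2 * op_norm ?E" unfolding pdist_pts2[OF oy py] by (simp only: op_norm_smult[OF E(1)]) simp
  then have "pdist (om \<gamma> \<tau> y) (?\<psi> y) < \<eta>" using nE \<epsilon>(2) by simp
  then show ?thesis by (rule near[OF m(2) y'(3) py oy])
 qed
 then show thesis using that oN pN by blast
qed

text \<open>\<open>om\<close> respects direct sums and similarities, so these properties carry over
  from \<open>f\<close>. The local bound carries over because \<open>om\<close> maps the points of a
  free neighbourhood with admissible spectrum into a given free neighbourhood of the image.\<close>

lemma chart_zariski_holomorphic:
 assumes f: "conditionally_nc 2 S f" and bdd: "freely_locally_bounded_on 2 S S f" and g: "\<gamma> \<in> Gamma" and t: "\<tau> \<in> signs \<gamma>"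
  and h: "\<And>p. p \<in> Ud \<gamma> \<tau> ==> h p = f (om \<gamma> \<tau> p)"
 shows "zariski_freely_holomorphic 2 (Ud \<gamma> \<tau>) h"
proof (rule zariski_holomorphicI)
 note iff = U_chart_iff[OF _ _ g t]
 have D: "spectrum (p ! 1) \<subseteq> Delta r \<gamma>" "om \<gamma> \<tau> p \<in> S" "nonc \<gamma> (p ! 0) (p ! 1)" if "p \<in> Ud \<gamma> \<tau>" for p
  using U_chart_level[OF that] iff that by blast+
 show "graded (Ud \<gamma> \<tau>) h" unfolding graded_def
 proof
  fix p assume p: "p \<in> Ud \<gamma> \<tau>"
  obtain n where n: "p \<in> pts 2 n" "n \<ge> 1" using U_chart_level[OF p] by blast
  show "h p \<in> carrier_mat (mlevel p) (mlevel p)" unfolding h[OF p] pts_mlevel[OF n(1) zero_less_numeral]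
   by (rule conditionally_nc_graded[OF f D(2)[OF p] omega_facts(1)[OF g t n D(1)[OF p]] zero_less_numeral])
 qed
 show "preserves_similarity (Ud \<gamma> \<tau>) h" unfolding preserves_similarity_def
 proof (intro ballI impI)
  fix p s assume p: "p \<in> Ud \<gamma> \<tau>" and s: "s \<in> GL (mlevel p)" and ps: "conj_point s p \<in> Ud \<gamma> \<tau>"
  obtain n where n: "p \<in> pts 2 n" "n \<ge> 1" using U_chart_level[OF p] by blast
  have s: "s \<in> GL n" using s pts_mlevel[OF n(1)] by simp
  note oc = omega_conj[OF g t n D(1)[OF p] s]
  show "h (conj_point s p) = conj_mat s (h p)" unfolding h[OF p] h[OF ps] oc
   by (rule conditionally_nc_conj[OF f D(2)[OF p] omega_facts(1)[OF g t n D(1)[OF p]] zero_less_numeral s]) (use D(2)[OF ps] oc in simp)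
 qed
 show "h (point_dsum x y) = mat_dsum (h x) (h y)"
  if x: "x \<in> Ud \<gamma> \<tau>" and y: "y \<in> Ud \<gamma> \<tau>" and xy: "point_dsum x y \<in> Ud \<gamma> \<tau>" "point_dsum y x \<in> Ud \<gamma> \<tau>" for x y
 proof -
  obtain n m where n: "x \<in> pts 2 n" "n \<ge> 1" and m: "y \<in> pts 2 m" "m \<ge> 1" using U_chart_level[OF x] U_chart_level[OF y] by blast
  note o = omega_dsum[OF g t n D(1)[OF x] m D(1)[OF y]] and o' = omega_dsum[OF g t m D(1)[OF y] n D(1)[OF x]]
  show ?thesis unfolding h[OF x] h[OF y] h[OF xy(1)] o
   by (rule conditionally_nc_dsum[OF f zero_less_numeral D(2)[OF x] D(2)[OF y] D(2)[OF xy(1), unfolded o] D(2)[OF xy(2), unfolded o']])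
 qed
 fix p assume p: "p \<in> Ud \<gamma> \<tau>"
 obtain n where n: "p \<in> pts 2 n" "n \<ge> 1" using U_chart_level[OF p] by blast
 obtain V0 C where V0: "openin (free_topology 2) V0" "om \<gamma> \<tau> p \<in> V0" and C: "\<forall>x\<in>V0 \<inter> S. op_norm (f x) \<le> C"
  using bdd D(2)[OF p] unfolding freely_locally_bounded_on_def bounded_values_on_def by blast
 have V: "openin (free_topology 2) (V0 \<inter> S)" "om \<gamma> \<tau> p \<in> V0 \<inter> S" using openin_Int[OF V0(1) S_open] V0(2) D(2)[OF p] by auto
 obtain N0 where N0: "openin (free_topology 2) N0" "p \<in> N0" "\<And>y. y \<in> N0 ==> spectrum (y ! 1) \<subseteq> Delta r \<gamma> ==> om \<gamma> \<tau> y \<in> V0 \<inter> S"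
  by (rule omega_neighbourhood[OF g t n D(1)[OF p] V]) blast
 have nat: "natural_map (\<lambda>x. x ! 0)" "natural_map (\<lambda>x. x ! 1)" by (rule natural_coordinate, simp)+
 obtain N where N: "chart_nb \<gamma> (\<lambda>x. x ! 0) (\<lambda>x. x ! 1) N" "p \<in> N" "N \<subseteq> N0"
  by (rule chart_nb_exists[OF g nat N0(1,2) D(1)[OF p]])
 have *: "y \<in> Ud \<gamma> \<tau> \<and> op_norm (h y) \<le> C" if y: "y \<in> {w \<in> N. nonc \<gamma> (w ! 0) (w ! 1)}" for y
 proof -
  have yN: "y \<in> N" "nonc \<gamma> (y ! 0) (y ! 1)" using y by auto
  have sp: "spectrum (y ! 1) \<subseteq> Delta r \<gamma>" using N(1) yN(1) unfolding chart_nb_def by blast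
  have o: "om \<gamma> \<tau> y \<in> V0 \<inter> S" by (rule N0(3)[OF subsetD[OF N(3) yN(1)] sp])
  have "y \<in> nc_space 2" using N(1) yN(1) unfolding chart_nb_def nc_set_def by blast
  then obtain m where m: "y \<in> pts 2 m" "m \<ge> 1" by (auto simp: nc_space_pts)
  have yU: "y \<in> Ud \<gamma> \<tau>" using iff[OF m] sp yN(2) o by simp
  then show ?thesis using h[OF yU] C o by simp
 qed
 have "bounded_values_on {w \<in> N. nonc \<gamma> (w ! 0) (w ! 1)} h" unfolding bounded_values_on_def using * by blast
 moreover have "{w \<in> N. nonc \<gamma> (w ! 0) (w ! 1)} \<subseteq> Ud \<gamma> \<tau>" using * by blast
 moreover have "p \<in> {w \<in> N. nonc \<gamma> (w ! 0) (w ! 1)}" using N(2) D(3)[OF p] by simp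
 ultimately show "\<exists>\<gamma>'\<in>Gamma. \<exists>U X N. natural_map U \<and> natural_map X \<and> chart_nb \<gamma>' U X N \<and> p \<in> {w \<in> N. nonc \<gamma>' (U w) (X w)} \<and>
   {w \<in> N. nonc \<gamma>' (U w) (X w)} \<subseteq> Ud \<gamma> \<tau> \<and> bounded_values_on {w \<in> N. nonc \<gamma>' (U w) (X w)} h"
  by - (rule bexI[OF _ g], rule exI[of _ "\<lambda>x. x ! 0"], rule exI[of _ "\<lambda>x. x ! 1"], rule exI[of _ N], intro conjI nat N(1))
qed

end

section \<open>The five sets of functions\<close>

lemma bounded_along_pi_cong:
 assumes "bounded_along_pi S G F" "G' \<subseteq> G" "\<And>X. X \<in> G' ==> F' X = F X"
 shows "bounded_along_pi S G' F'"
 unfolding bounded_along_pi_def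
proof
 fix w assume "w \<in> S"
 then obtain U C where U: "openin (free_topology 2) U" "w \<in> U" and C: "\<forall>X\<in>pi_map ` U \<inter> G. op_norm (F X) \<le> C"
  using assms(1) unfolding bounded_along_pi_def bounded_values_on_def by blast
 have "op_norm (F' X) \<le> C" if X: "X \<in> pi_map ` U \<inter> G'" for X
 proof -
  have "X \<in> pi_map ` U \<inter> G" using X assms(2) by auto
  then show ?thesis using C assms(3)[of X] X by simp
 qed
 then have "bounded_values_on (pi_map ` U \<inter> G') F'" unfolding bounded_values_on_def by blast
 then show "\<exists>U. openin (free_topology 2) U \<and> w \<in> U \<and> bounded_values_on (pi_map ` U \<inter> G') F'" using U by (intro exI[of _ U] conjI)
qed

lemma tau_holomorphic_cong:
 assumes h: "tau_holomorphic T d D f" and eq: "\<And>w. w \<in> D ==> f' w = f w"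
 shows "tau_holomorphic T d D f'"
proof -
 have "nc_function d U f'" if U: "nc_function d U f" "U \<subseteq> D" for U
  using U(1) subsetD[OF U(2)] eq unfolding nc_function_def nc_set_def graded_def preserves_similarity_def by simp
 moreover have "bounded_values_on U f'" if U: "bounded_values_on U f" "U \<subseteq> D" for U
  using U(1) subsetD[OF U(2)] eq unfolding bounded_values_on_def by simp
 moreover have "graded D f'" using h eq unfolding tau_holomorphic_def graded_def by simp
 ultimately show ?thesis using h unfolding tau_holomorphic_def by meson
qed

context nc_symmetric
begin

abbreviation "Goo \<equiv> G_oo r q S"

text \<open>\<open>Phi\<close> is \<open>\<pi>\<close> after \<open>om\<close>, and
  \<open>om\<close> maps the chart domains onto S_oo.\<close>

lemma Goo_image: "Goo = pi_map ` Soo"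
proof (intro Set.set_eqI iffI)
 fix X assume "X \<in> Goo"
 then obtain \<gamma> \<tau> p where g: "\<gamma> \<in> Gamma" "\<tau> \<in> signs \<gamma>" and p: "p \<in> Ud \<gamma> \<tau>" "X = Phi r q \<gamma> \<tau> p" unfolding G_oo_def by blast
 obtain n where n: "p \<in> pts 2 n" "n \<ge> 1" using U_chart_level[OF p(1)] by blast
 have "X = pi_map (om \<gamma> \<tau> p)" unfolding p(2) by (rule omega_facts(5)[OF g n]) (use U_chart_iff[OF n g] p(1) in blast)
 then show "X \<in> pi_map ` Soo" using omega_Soo[OF g p(1)] by blast
next
 fix X assume "X \<in> pi_map ` Soo"
 then obtain \<gamma> \<tau> p where g: "\<gamma> \<in> Gamma" "\<tau> \<in> signs \<gamma>" and p: "p \<in> U_dom r \<gamma>" "om \<gamma> \<tau> p \<in> S" "X = pi_map (om \<gamma> \<tau> p)"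
  unfolding S_oo_def by blast
 have pU: "p \<in> Ud \<gamma> \<tau>" using p(1,2) by (simp add: U_chart_def)
 obtain n where n: "p \<in> pts 2 n" "n \<ge> 1" using U_chart_level[OF pU] by blast
 have "X = Phi r q \<gamma> \<tau> p" unfolding p(3) by (rule omega_facts(5)[OF g n, symmetric]) (use U_chart_iff[OF n g] pU in blast)
 then show "X \<in> Goo" unfolding G_oo_def using g pU by blast
qed

lemma Goo_sub: "Goo \<subseteq> Go" unfolding Goo_image Go_image using Soo_sub by blast

lemma sym_functionsD:
 assumes "f \<in> sym_functions_S S"
 shows "f \<in> extensional S" "conditionally_nc 2 S f" "\<And>w. w \<in> S ==> f (flip w) = f w" "freely_locally_bounded_on 2 S S f"
 using assms freely_holomorphic_bounded[of 2 S f] unfolding sym_functions_S_def symmetric_fun_def by auto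

lemma symmetric_So: "symmetric_set So" using flip_So by (simp add: symmetric_set_def)
lemma symmetric_Soo: "symmetric_set Soo" using flip_Soo by (simp add: symmetric_set_def)
lemma Soo_S: "Soo \<subseteq> S" using Soo_sub So_sub by blast

text \<open>Agreement on S_oo determines the functions on S_o and thereby on \<open>S\<close>. The
  injectivity of all four maps rests on this.\<close>

lemma sym_functions_eqI:
 assumes f: "f \<in> sym_functions_S S" and g: "g \<in> sym_functions_S S" and eq: "\<And>w. w \<in> Soo ==> f w = g w"
 shows "f = g"
proof (rule extensionalityI[OF sym_functionsD(1)[OF f] sym_functionsD(1)[OF g]])
 note F = sym_functionsD[OF f] and G = sym_functionsD[OF g]
 fix w assume w: "w \<in> S"
 have "f y = g y" if "y \<in> So" for y
  by (rule determined_by_Soo[OF conditionally_nc_subset[OF F(2) So_sub] freely_locally_bounded_on_cong[OF F(4) So_sub refl]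
   conditionally_nc_subset[OF G(2) So_sub] freely_locally_bounded_on_cong[OF G(4) So_sub refl] eq that])
 then show "f w = g w" by (rule determined_by_So[OF F(2,4) G(2,4) _ w])
qed

lemma restrict_inj:
 assumes f: "f \<in> sym_functions_S S" and g: "g \<in> sym_functions_S S" and A: "Soo \<subseteq> A"
 shows "(restrict f A = restrict g A) = (f = g)"
proof
 assume e: "restrict f A = restrict g A"
 show "f = g" by (rule sym_functions_eqI[OF f g]) (use e A in \<open>metis restrict_apply' subsetD\<close>)
qed simp

lemma extends_So:
 assumes g: "conditionally_nc 2 So g" "freely_locally_bounded_on 2 S So g" "\<And>w. w \<in> So ==> g (flip w) = g w"
 shows "\<exists>f\<in>sym_functions_S S. \<forall>w\<in>So. f w = g w"
proof (rule bexI[of _ "restrict (ext g) S"], rule ballI)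
 show "restrict (ext g) S w = g w" if w: "w \<in> So" for w
  using ext_agrees[OF g(1,2) w] subsetD[OF So_sub w] by simp
 have "tau_holomorphic (free_topology 2) 2 S (restrict (ext g) S)"
  by (rule tau_holomorphic_cong[OF ext_freely_holomorphic[OF g(1,2), unfolded freely_holomorphic_def]]) simp
 moreover have "conditionally_nc 2 S (restrict (ext g) S)"
  by (rule conditionally_nc_cong[OF ext_conditionally_nc[OF g(1,2)]]) simp
 moreover have "symmetric_fun S (restrict (ext g) S)"
  unfolding symmetric_fun_def using sym ext_flip[OF g] by (simp add: symmetric_set_def)
 ultimately show "restrict (ext g) S \<in> sym_functions_S S" unfolding sym_functions_S_def freely_holomorphic_def by simp
qed

lemma extends_Soo:
 assumes g: "conditionally_nc 2 Soo g" "freely_locally_bounded_on 2 S Soo g" "\<And>w. w \<in> Soo ==> g (flip w) = g w"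
 shows "\<exists>f\<in>sym_functions_S S. \<forall>w\<in>Soo. f w = g w"
proof -
 obtain f where f: "f \<in> sym_functions_S S" "\<forall>w\<in>So. f w = ext2 g w"
  using extends_So[OF ext2_conditionally_nc[OF g(1,2)] ext2_bounded[OF g(1,2)] ext2_flip[OF g]] by blast
 have "f w = g w" if "w \<in> Soo" for w using f(2) ext2_agrees[OF g(1,2) that] subsetD[OF Soo_sub that] by simp
 then show ?thesis using f(1) by blast
qed

lemma pi_map_flip_S: "w \<in> S ==> pi_map (flip w) = pi_map w"
 using S_level[of w] pi_map_flip by blast

lemma bij_So: "bij_betw (\<lambda>f. restrict f So) (sym_functions_S S) (sym_functions_S_o r q S)"
proof (rule bij_betwI')
 show "(restrict f So = restrict g So) = (f = g)" if "f \<in> sym_functions_S S" "g \<in> sym_functions_S S" for f g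
  by (rule restrict_inj[OF that Soo_sub])
next
 fix f assume "f \<in> sym_functions_S S"
 note F = sym_functionsD[OF this]
 have "conditionally_nc 2 So (restrict f So)" by (rule conditionally_nc_cong[OF conditionally_nc_subset[OF F(2) So_sub]]) simp
 moreover have "freely_locally_bounded_on 2 S So (restrict f So)" by (rule freely_locally_bounded_on_cong[OF F(4) So_sub]) simp
 moreover have "symmetric_fun So (restrict f So)" unfolding symmetric_fun_def
  using symmetric_So flip_So F(3) subsetD[OF So_sub] by simp
 ultimately show "restrict f So \<in> sym_functions_S_o r q S" unfolding sym_functions_S_o_def by simp
next
 fix g assume "g \<in> sym_functions_S_o r q S"
 then have g: "g \<in> extensional So" "symmetric_fun So g" "conditionally_nc 2 So g" "freely_locally_bounded_on 2 S So g"
  unfolding sym_functions_S_o_def by auto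
 obtain f where f: "f \<in> sym_functions_S S" "\<forall>w\<in>So. f w = g w"
  using extends_So[OF g(3,4)] g(2) unfolding symmetric_fun_def by blast
 have "g = restrict f So" by (rule extensionalityI[OF g(1)]) (use f(2) in auto)
 then show "\<exists>f\<in>sym_functions_S S. g = restrict f So" using f(1) by blast
qed

lemma bij_Soo: "bij_betw (\<lambda>f. restrict f Soo) (sym_functions_S S) (sym_functions_S_oo r q S)"
proof (rule bij_betwI')
 show "(restrict f Soo = restrict g Soo) = (f = g)" if "f \<in> sym_functions_S S" "g \<in> sym_functions_S S" for f g
  by (rule restrict_inj[OF that order_refl])
next
 fix f assume "f \<in> sym_functions_S S"
 note F = sym_functionsD[OF this]
 have "conditionally_nc 2 Soo (restrict f Soo)" by (rule conditionally_nc_cong[OF conditionally_nc_subset[OF F(2) Soo_S]]) simp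
 moreover have "freely_locally_bounded_on 2 S Soo (restrict f Soo)" by (rule freely_locally_bounded_on_cong[OF F(4) Soo_S]) simp
 moreover have "symmetric_fun Soo (restrict f Soo)" unfolding symmetric_fun_def
  using symmetric_Soo flip_Soo F(3) subsetD[OF Soo_S] by simp
 moreover have "zariski_freely_holomorphic 2 Soo (restrict f Soo)" unfolding zariski_freely_holomorphic_def
  by (rule tau_holomorphic_cong[OF Soo_zariski_holomorphic[OF F(2,4), unfolded zariski_freely_holomorphic_def]]) simp
 ultimately show "restrict f Soo \<in> sym_functions_S_oo r q S" unfolding sym_functions_S_oo_def by simp
next
 fix g assume "g \<in> sym_functions_S_oo r q S"
 then have g: "g \<in> extensional Soo" "symmetric_fun Soo g" "conditionally_nc 2 Soo g" "freely_locally_bounded_on 2 S Soo g"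
  unfolding sym_functions_S_oo_def by auto
 obtain f where f: "f \<in> sym_functions_S S" "\<forall>w\<in>Soo. f w = g w"
  using extends_Soo[OF g(3,4)] g(2) unfolding symmetric_fun_def by blast
 have "g = restrict f Soo" by (rule extensionalityI[OF g(1)]) (use f(2) in auto)
 then show "\<exists>f\<in>sym_functions_S S. g = restrict f Soo" using f(1) by blast
qed

lemma push_sym: "f \<in> sym_functions_S S ==> w \<in> So ==> push f (pi_map w) = f w"
 using push_So[OF sym_functionsD(2,3)] .

lemma restrict_push_inj:
 assumes f: "f \<in> sym_functions_S S" and g: "g \<in> sym_functions_S S" and A: "Goo \<subseteq> A"
 shows "(restrict (push f) A = restrict (push g) A) = (f = g)"
proof
 assume e: "restrict (push f) A = restrict (push g) A"
 show "f = g"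
 proof (rule sym_functions_eqI[OF f g])
  fix w assume w: "w \<in> Soo"
  then have "pi_map w \<in> A" using A unfolding Goo_image by blast
  then show "f w = g w" using fun_cong[OF e, of "pi_map w"] push_sym[OF f] push_sym[OF g] subsetD[OF Soo_sub w] by simp
 qed
qed simp

text \<open>Surjectivity passes through \<open>S\<close>: the pullback of \<open>F\<close> along
  \<open>\<pi>\<close> is symmetric on S_oo and extends to \<open>S\<close>, and the descent of the
  extension agrees with \<open>F\<close> because every point of G_oo comes from S_oo.\<close>

lemma bij_Goo: "bij_betw (\<lambda>f. restrict (push f) Goo) (sym_functions_S S) (functions_G_oo r q S)"
proof (rule bij_betwI')
 show "(restrict (push f) Goo = restrict (push g) Goo) = (f = g)" if "f \<in> sym_functions_S S" "g \<in> sym_functions_S S" for f g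
  by (rule restrict_push_inj[OF that order_refl])
next
 fix f assume fS: "f \<in> sym_functions_S S"
 note F = sym_functionsD[OF fS]
 have "conditionally_nc 3 Goo (restrict (push f) Goo)"
  by (rule conditionally_nc_cong[OF conditionally_nc_subset[OF push_conditionally_nc[OF F(2,3)] Goo_sub]]) simp_all
 moreover have "bounded_along_pi S Goo (restrict (push f) Goo)"
  by (rule bounded_along_pi_cong[OF push_bounded[OF F(2,3,4)] Goo_sub]) simp_all
 moreover have "holomorphic_on_G_oo r q S (restrict (push f) Goo)" unfolding holomorphic_on_G_oo_def
 proof (intro ballI)
  fix \<gamma> \<tau> assume g: "\<gamma> \<in> Gamma" and t: "\<tau> \<in> signs \<gamma>"
  show "zariski_freely_holomorphic 2 (Ud \<gamma> \<tau>) (restrict (push f) Goo \<circ> Phi r q \<gamma> \<tau>)"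
  proof (rule chart_zariski_holomorphic[OF F(2,4) g t])
   fix p assume p: "p \<in> Ud \<gamma> \<tau>"
   obtain n where n: "p \<in> pts 2 n" "n \<ge> 1" using U_chart_level[OF p] by blast
   have e: "Phi r q \<gamma> \<tau> p = pi_map (om \<gamma> \<tau> p)" by (rule omega_facts(5)[OF g t n]) (use U_chart_iff[OF n g t] p in blast)
   have o: "om \<gamma> \<tau> p \<in> Soo" by (rule omega_Soo[OF g t p])
   then have "pi_map (om \<gamma> \<tau> p) \<in> Goo" unfolding Goo_image by blast
   then show "(restrict (push f) Goo \<circ> Phi r q \<gamma> \<tau>) p = f (om \<gamma> \<tau> p)"
    using push_sym[OF fS subsetD[OF Soo_sub o]] by (simp add: e)
  qed
 qed
 ultimately show "restrict (push f) Goo \<in> functions_G_oo r q S" unfolding functions_G_oo_def by simp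
next
 fix F assume "F \<in> functions_G_oo r q S"
 then have F: "F \<in> extensional Goo" "conditionally_nc 3 (pi_map ` Soo) F" "bounded_along_pi S (pi_map ` Soo) F"
  unfolding functions_G_oo_def Goo_image by auto
 have "Soo \<subseteq> nc_space 2" using Soo_S S_sub by blast
 note cn = conditionally_nc_pullback[OF F(2) this]
 obtain f where f: "f \<in> sym_functions_S S" "\<forall>w\<in>Soo. f w = F (pi_map w)"
  using extends_Soo[OF cn locally_bounded_pullback[OF F(3)]] pi_map_flip_S subsetD[OF Soo_S] by auto
 have "F = restrict (push f) Goo"
 proof (rule extensionalityI[OF F(1)])
  fix X assume X: "X \<in> Goo"
  then obtain w where w: "w \<in> Soo" "X = pi_map w" unfolding Goo_image by blast
  then show "F X = restrict (push f) Goo X" using X push_sym[OF f(1) subsetD[OF Soo_sub w(1)]] f(2) by simp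
 qed simp
 then show "\<exists>f\<in>sym_functions_S S. F = restrict (push f) Goo" using f(1) by blast
qed

lemma bij_Go: "bij_betw (\<lambda>f. restrict (push f) Go) (sym_functions_S S) (functions_G_o r q S)"
proof (rule bij_betwI')
 show "(restrict (push f) Go = restrict (push g) Go) = (f = g)" if "f \<in> sym_functions_S S" "g \<in> sym_functions_S S" for f g
  by (rule restrict_push_inj[OF that Goo_sub])
next
 fix f assume fS: "f \<in> sym_functions_S S"
 note F = sym_functionsD[OF fS]
 have "conditionally_nc 3 Go (restrict (push f) Go)" by (rule conditionally_nc_cong[OF push_conditionally_nc[OF F(2,3)]]) simp_all
 moreover have "bounded_along_pi S Go (restrict (push f) Go)" by (rule bounded_along_pi_cong[OF push_bounded[OF F(2,3,4)] order_refl]) simp_all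
 ultimately show "restrict (push f) Go \<in> functions_G_o r q S" unfolding functions_G_o_def by simp
next
 fix F assume "F \<in> functions_G_o r q S"
 then have F: "F \<in> extensional Go" "conditionally_nc 3 (pi_map ` So) F" "bounded_along_pi S (pi_map ` So) F"
  unfolding functions_G_o_def Go_image by auto
 have "So \<subseteq> nc_space 2" using So_sub S_sub by blast
 note cn = conditionally_nc_pullback[OF F(2) this]
 obtain f where f: "f \<in> sym_functions_S S" "\<forall>w\<in>So. f w = F (pi_map w)"
  using extends_So[OF cn locally_bounded_pullback[OF F(3)]] pi_map_flip_S subsetD[OF So_sub] by auto
 have "F = restrict (push f) Go"
 proof (rule extensionalityI[OF F(1)])
  fix X assume X: "X \<in> Go"
  then obtain w where w: "w \<in> So" "X = pi_map w" unfolding Go_image by blast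
  then show "F X = restrict (push f) Go X" using X push_sym[OF f(1) w(1)] f(2) by simp
 qed simp
 then show "\<exists>f\<in>sym_functions_S S. F = restrict (push f) Go" using f(1) by blast
qed

end

theorem theorem10p11:
  fixes S :: "nc_point set"
    and r :: "complex set \<Rightarrow> real"
    and q :: "complex set \<Rightarrow> complex \<Rightarrow> complex"
  assumes choice: "sqrt_choice r q"
    and dom: "free_domain 2 S"
    and sym: "symmetric_set S"
    and closed: "\<And>w1 w2. w1 \<in> S \<Longrightarrow> w2 \<in> S \<Longrightarrow>
        similar_points (pi_map w1) (pi_map w2) \<Longrightarrow> point_dsum w1 w2 \<in> S"
  shows "\<exists>to_o to_oo to_Goo to_Go.
      bij_betw to_o (sym_functions_S S) (sym_functions_S_o r q S) \<and>
      bij_betw to_oo (sym_functions_S S) (sym_functions_S_oo r q S) \<and>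
      bij_betw to_Goo (sym_functions_S S) (functions_G_oo r q S) \<and>
      bij_betw to_Go (sym_functions_S S) (functions_G_o r q S) \<and>
      (\<forall>f \<in> sym_functions_S S.
         to_o f = restrict f (S_o r q S) \<and>
         to_oo f = restrict (to_o f) (S_oo r q S) \<and>
         to_Goo f = restrict (to_Go f) (G_oo r q S) \<and>
         (\<forall>w \<in> S_o r q S. to_o f w = to_Go f (pi_map w)) \<and>
         (\<forall>w \<in> S_oo r q S. to_oo f w = to_Goo f (pi_map w)))"
proof -
 interpret nc_symmetric r q S using assms by unfold_locales
 have e: "restrict h Soo = restrict (restrict h So) Soo" for h :: "nc_point => complex mat"
  using Soo_sub by (intro ext) auto
 have e': "restrict h Goo = restrict (restrict h Go) Goo" for h :: "nc_point => complex mat"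
  using Goo_sub by (intro ext) auto
 have p: "restrict f So w = restrict (push f) Go (pi_map w)" if "f \<in> sym_functions_S S" "w \<in> So" for f w
  using push_sym[OF that] that(2) by (simp add: Go_image)
 have p': "restrict f Soo w = restrict (push f) Goo (pi_map w)" if "f \<in> sym_functions_S S" "w \<in> Soo" for f w
  using push_sym[OF that(1) subsetD[OF Soo_sub that(2)]] that(2) by (simp add: Goo_image)
 \<comment> \<open>All bijections issue from the functions on \<open>S\<close>. Each target function
   is a restriction of \<open>f\<close> or of its descent \<open>push f\<close>, so the
   compatibilities reduce to restricting in two steps and to \<open>push_sym\<close>.\<close>
 show ?thesis
  by (rule exI[of _ "\<lambda>f. restrict f So"], rule exI[of _ "\<lambda>f. restrict f Soo"],
    rule exI[of _ "\<lambda>f. restrict (push f) Goo"], rule exI[of _ "\<lambda>f. restrict (push f) Go"])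
   (intro conjI ballI refl bij_So bij_Soo bij_Goo bij_Go e e' p p')
qed

end
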